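(* The satisfiability problem for $L([1],[\omega],\mathtt u,\mathtt U)$-formulas (given a formula $\phi$, decide whether there exist a model $\xi$ and a time instant $\mathbf t$ with $\xi\models_{\mathbf t}\phi$) is PSPACE-complete.
   Context: Fix $Var=\{p_n : n\in\omega\}$. The formulas of $L([1],[\omega],\mathtt u,\mathtt U)$ form the smallest set containing $Var$ and closed under $\neg\phi$, $[1]\phi$, $[\omega]\phi$, $(\phi\wedge\psi)$, $(\phi\,\mathtt u\,\psi)$, $(\phi\,\mathtt U\,\psi)$; the input size is the number of symbols of $\phi$. Time instants are pairs $\mathbf t=\langle t_1,t_2\rangle\in\omega\times\omega$ ordered lexicographically. A model is a function $\xi:\omega\times\omega\times Var\to\{0,1\}$. Satisfaction: $\xi\models_{\mathbf r}p$ iff $\xi(r_1,r_2,p)=1$; $\neg,\wedge$ classical; $\xi\models_{\mathbf r}[1]\phi$ iff $\xi\models_{\langle r_1,r_2+1\rangle}\phi$; $\xi\models_{\mathbf r}[\omega]\phi$ iff $\xi\models_{\langle r_1+1,0\rangle}\phi$; $\xi\models_{\mathbf r}\phi\,\mathtt u\,\psi$ iff there is $k\in\omega$ with $\xi\models_{\langle r_1,r_2+k\rangle}\psi$ and $\xi\models_{\langle r_1,r_2+i\rangle}\phi$ for all $0\le i<k$; $\xi\models_{\mathbf r}\phi\,\mathtt U\,\psi$ iff there is $\mathbf s\ge\mathbf r$ with $\xi\models_{\mathbf s}\psi$ and $\xi\models_{\mathbf t}\phi$ for all $\mathbf r\le\mathbf t<\mathbf s$. *)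

theory Defs
  imports Main
begin

datatype fml =
    Var nat
  | Neg fml
  | Next1 fml
  | NextW fml
  | Conj fml fml
  | Until_u fml fml
  | Until_U fml fml

text \<open>A model xi : omega x omega x Var -> {0,1}; instants are pairs of naturals.\<close>
type_synonym model = "nat \<Rightarrow> nat \<Rightarrow> nat \<Rightarrow> bool"

definition lex_le :: "nat \<times> nat \<Rightarrow> nat \<times> nat \<Rightarrow> bool" where
  "lex_le r s \<longleftrightarrow> fst r < fst s \<or> (fst r = fst s \<and> snd r \<le> snd s)"

definition lex_less :: "nat \<times> nat \<Rightarrow> nat \<times> nat \<Rightarrow> bool" where
  "lex_less r s \<longleftrightarrow> lex_le r s \<and> r \<noteq> s"

fun sat :: "model \<Rightarrow> nat \<times> nat \<Rightarrow> fml \<Rightarrow> bool" where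
  "sat \<xi> r (Var n) = \<xi> (fst r) (snd r) n"
| "sat \<xi> r (Neg \<phi>) = (\<not> sat \<xi> r \<phi>)"
| "sat \<xi> r (Next1 \<phi>) = sat \<xi> (fst r, Suc (snd r)) \<phi>"
| "sat \<xi> r (NextW \<phi>) = sat \<xi> (Suc (fst r), 0) \<phi>"
| "sat \<xi> r (Conj \<phi> \<psi>) = (sat \<xi> r \<phi> \<and> sat \<xi> r \<psi>)"
| "sat \<xi> r (Until_u \<phi> \<psi>) =
     (\<exists>k. sat \<xi> (fst r, snd r + k) \<psi> \<and> (\<forall>i<k. sat \<xi> (fst r, snd r + i) \<phi>))"
| "sat \<xi> r (Until_U \<phi> \<psi>) =
     (\<exists>s. lex_le r s \<and> sat \<xi> s \<psi> \<and> (\<forall>t. lex_le r t \<and> lex_less t s \<longrightarrow> sat \<xi> t \<phi>))"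

definition satisfiable :: "fml \<Rightarrow> bool" where
  "satisfiable \<phi> \<longleftrightarrow> (\<exists>\<xi> t. sat \<xi> t \<phi>)"

text \<open>Polish (prefix) notation over the alphabet {1..9}; the index of a variable
  is written in binary (least significant bit first, symbols 8/9).\<close>
fun bin :: "nat \<Rightarrow> nat list" where
  "bin n = (if n < 2 then [8 + n] else (8 + n mod 2) # bin (n div 2))"

fun enc :: "fml \<Rightarrow> nat list" where
  "enc (Var n) = 7 # bin n"
| "enc (Neg \<phi>) = 1 # enc \<phi>"
| "enc (Next1 \<phi>) = 2 # enc \<phi>"
| "enc (NextW \<phi>) = 3 # enc \<phi>"
| "enc (Conj \<phi> \<psi>) = 4 # enc \<phi> @ enc \<psi>"
| "enc (Until_u \<phi> \<psi>) = 5 # enc \<phi> @ enc \<psi>"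
| "enc (Until_U \<phi> \<psi>) = 6 # enc \<phi> @ enc \<psi>"

definition fml_alphabet :: "nat set" where
  "fml_alphabet = {1..9}"

definition SAT_lang :: "nat list set" where
  "SAT_lang = {enc \<phi> | \<phi>. satisfiable \<phi>}"

datatype move = Left | Right | Stay

record tm =
  tm_nstates :: nat
  tm_nsyms :: nat          (* tape symbols are 0..<nsyms, 0 is the blank *)
  tm_start :: nat
  tm_accept :: nat
  tm_reject :: nat
  tm_delta :: "nat \<Rightarrow> nat \<Rightarrow> nat \<times> nat \<times> move"

type_synonym config = "nat \<times> (int \<Rightarrow> nat) \<times> int"   (* state, tape, head position *)

definition wf_tm :: "tm \<Rightarrow> bool" where
  "wf_tm M \<longleftrightarrow> 0 < tm_nsyms M \<and>
     tm_start M < tm_nstates M \<and> tm_accept M < tm_nstates M \<and> tm_reject M < tm_nstates M \<and>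
     tm_accept M \<noteq> tm_reject M \<and>
     (\<forall>q < tm_nstates M. \<forall>a < tm_nsyms M.
        fst (tm_delta M q a) < tm_nstates M \<and> fst (snd (tm_delta M q a)) < tm_nsyms M)"

definition move_off :: "move \<Rightarrow> int" where
  "move_off d = (case d of Left \<Rightarrow> -1 | Right \<Rightarrow> 1 | Stay \<Rightarrow> 0)"

definition halted :: "tm \<Rightarrow> config \<Rightarrow> bool" where
  "halted M c \<longleftrightarrow> fst c = tm_accept M \<or> fst c = tm_reject M"

definition step :: "tm \<Rightarrow> config \<Rightarrow> config" where
  "step M c = (if halted M c then c else
     (case c of (q, T, h) \<Rightarrow>
       (case tm_delta M q (T h) of (q', a, d) \<Rightarrow> (q', T(h := a), h + move_off d))))"

definition init_config :: "tm \<Rightarrow> nat list \<Rightarrow> config" where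
  "init_config M w = (tm_start M, (\<lambda>i. if 0 \<le> i \<and> i < int (length w) then w ! nat i else 0), 0)"

definition run :: "tm \<Rightarrow> nat list \<Rightarrow> nat \<Rightarrow> config" where
  "run M w t = (step M ^^ t) (init_config M w)"

definition head_pos :: "config \<Rightarrow> int" where
  "head_pos c = snd (snd c)"

definition tape_of :: "config \<Rightarrow> int \<Rightarrow> nat" where
  "tape_of c = fst (snd c)"

definition alphabet :: "nat set \<Rightarrow> bool" where
  "alphabet \<Sigma> \<longleftrightarrow> finite \<Sigma> \<and> 0 \<notin> \<Sigma>"

definition decides_in_space :: "tm \<Rightarrow> nat set \<Rightarrow> nat list set \<Rightarrow> (nat \<Rightarrow> nat) \<Rightarrow> bool" where
  "decides_in_space M \<Sigma> L s \<longleftrightarrow>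
     (\<forall>w \<in> lists \<Sigma>. \<exists>t. halted M (run M w t) \<and>
        (fst (run M w t) = tm_accept M \<longleftrightarrow> w \<in> L) \<and>
        (\<forall>i. \<bar>head_pos (run M w i)\<bar> \<le> int (s (length w))))"

definition PSPACE :: "nat set \<Rightarrow> nat list set \<Rightarrow> bool" where
  "PSPACE \<Sigma> L \<longleftrightarrow> alphabet \<Sigma> \<and> L \<subseteq> lists \<Sigma> \<and>
     (\<exists>M k. wf_tm M \<and> \<Sigma> \<subseteq> {..<tm_nsyms M} \<and>
        decides_in_space M \<Sigma> L (\<lambda>n. k * (n + 1) ^ k))"

definition computes_in_poly_time :: "tm \<Rightarrow> nat set \<Rightarrow> (nat list \<Rightarrow> nat list) \<Rightarrow> nat \<Rightarrow> bool" where
  "computes_in_poly_time M \<Sigma> f k \<longleftrightarrow>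
     (\<forall>w \<in> lists \<Sigma>. \<exists>t \<le> k * (length w + 1) ^ k.
        fst (run M w t) = tm_accept M \<and>
        (\<forall>i < length (f w). tape_of (run M w t) (int i) = f w ! i) \<and>
        tape_of (run M w t) (int (length (f w))) = 0)"

definition poly_reduces :: "nat set \<Rightarrow> nat list set \<Rightarrow> nat set \<Rightarrow> nat list set \<Rightarrow> bool" where
  "poly_reduces \<Sigma>1 L1 \<Sigma>2 L2 \<longleftrightarrow>
     (\<exists>f M k. wf_tm M \<and> \<Sigma>1 \<subseteq> {..<tm_nsyms M} \<and> computes_in_poly_time M \<Sigma>1 f k \<and>
        (\<forall>w \<in> lists \<Sigma>1. f w \<in> lists \<Sigma>2 \<and> (w \<in> L1 \<longleftrightarrow> f w \<in> L2)))"

definition PSPACE_hard :: "nat set \<Rightarrow> nat list set \<Rightarrow> bool" where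
  "PSPACE_hard \<Sigma> L \<longleftrightarrow> (\<forall>\<Sigma>' L'. PSPACE \<Sigma>' L' \<longrightarrow> poly_reduces \<Sigma>' L' \<Sigma> L)"

definition PSPACE_complete :: "nat set \<Rightarrow> nat list set \<Rightarrow> bool" where
  "PSPACE_complete \<Sigma> L \<longleftrightarrow> PSPACE \<Sigma> L \<and> PSPACE_hard \<Sigma> L"

end

theory Submission
  imports Defs "HOL-Library.Nat_Bijection"
begin

text \<open>
  Hardness: the computation of a machine in space \<open>s\<close> is written into a single row of \<open>\<omega> \<times> \<omega>\<close>, one instant per
  tape cell. The cell that is \<open>s\<close> instants further on is determined by three neighbouring cells, so polynomially long
  formulas built from \<open>[1]\<close> and \<open>u\<close> describe an accepting computation.

  Membership: label every instant with the set of subformulas that hold there. Within a row the labels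
  obey local fixpoint equations, in which the next row enters only through the label of its first instant, and
  eventualities are Buechi conditions within each row and across rows. Such labellings exist iff they exist in
  doubly ultimately periodic form, that is, iff a sink is reachable in a graph of exponential size whose nodes
  are words as long as the formula. Savitch's midpoint recursion turns reachability into a polynomially long
  quantifier prefix over a scan of the input, and an odometer evaluates it. Machines are obtained by compiling
  structured programs on finitely many stacks.
\<close>

section \<open>Stack programs\<close>

text \<open>The statement demands concrete one-tape machines, so programs see only the tops of their
  stacks: then the residual programs and the readings are finite in number and can serve as machine
  states. The graph is shaped to suit such a control. Most of an edge is a condition on one
  occurrence and its immediate operands; what a finite control cannot absorb is that equal variables
  at distant offsets must agree. A universally quantified block therefore guesses one variable name
  per scan, and that scan compares only the occurrences of this name. \<open>U\<close> escapes local
  equations at the end of a row, because the first instant of the next row is the successor of no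
  instant; its label is kept as a constant of the row, and the missing equation becomes a choice
  between two fixpoints. The midpoint recursion speaks of paths of length exactly
  \<open>2 ^ L\<close>: the source has a loop, so shorter paths can be padded, and
  \<open>L = 2 * nbit * n\<close> since there are \<open>2 ^ (2 * nbit * n)\<close> pairs of words
  of length \<open>n\<close> over \<open>2 ^ nbit\<close> symbols.\<close>

type_synonym regs = "nat \<Rightarrow> nat list"

datatype act = Push nat nat | Pop nat | Repl nat nat

definition hd0 :: "nat list \<Rightarrow> nat" where
  "hd0 xs = (case xs of [] \<Rightarrow> 0 | x # _ \<Rightarrow> x)"

lemma hd0_simps [simp]: "hd0 [] = 0" "hd0 (x # xs) = x"
  by (simp_all add: hd0_def)

definition tops :: "regs \<Rightarrow> nat \<Rightarrow> nat" where
  "tops s r = hd0 (s r)"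

fun do_act :: "act \<Rightarrow> regs \<Rightarrow> regs" where
  "do_act (Push r a) s = s(r := a # s r)"
| "do_act (Pop r) s = s(r := tl (s r))"
| "do_act (Repl r a) s = s(r := (if s r = [] then [] else a # tl (s r)))"

abbreviation do_acts :: "act list \<Rightarrow> regs \<Rightarrow> regs" where
  "do_acts as s \<equiv> fold do_act as s"

text \<open>Actions and tests receive the readings of all stacks, with 0 for an empty one, and
  nothing else. One step is thus determined by a program and a finite reading.\<close>

datatype com =
    SKIP
  | Do "(nat \<Rightarrow> nat) \<Rightarrow> act list"
  | Seq com com
  | IF "(nat \<Rightarrow> nat) \<Rightarrow> bool" com com
  | WHILE "(nat \<Rightarrow> nat) \<Rightarrow> bool" com

primrec sstep :: "com \<Rightarrow> (nat \<Rightarrow> nat) \<Rightarrow> com \<times> act list" where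
  "sstep SKIP m = (SKIP, [])"
| "sstep (Do F) m = (SKIP, F m)"
| "sstep (Seq a b) m =
     (if a = SKIP then (b, []) else (Seq (fst (sstep a m)) b, snd (sstep a m)))"
| "sstep (IF p a b) m = (if p m then a else b, [])"
| "sstep (WHILE p c) m = (if p m then Seq c (WHILE p c) else SKIP, [])"

text \<open>The predicate \<open>P\<close> has to hold in every intermediate state; it carries the space bound.\<close>

inductive exec :: "(regs \<Rightarrow> bool) \<Rightarrow> com \<Rightarrow> regs \<Rightarrow> nat \<Rightarrow> regs \<Rightarrow> bool" for P where
  exec_done: "P s \<Longrightarrow> exec P SKIP s 0 s"
| exec_step: "c \<noteq> SKIP \<Longrightarrow> P s \<Longrightarrow>
    exec P (fst (sstep c (tops s))) (do_acts (snd (sstep c (tops s))) s) n s' \<Longrightarrow>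
    exec P c s (Suc n) s'"

definition bounded :: "nat \<Rightarrow> regs \<Rightarrow> bool" where
  "bounded H s \<longleftrightarrow> (\<forall>r. length (s r) \<le> H)"

definition init_regs :: "nat list \<Rightarrow> regs" where
  "init_regs w = (\<lambda>_. [])(0 := rev w)"

text \<open>The programs that can remain during a run, comparable to the partial derivatives of a
  regular expression. A loop body is always followed by the same loop, so the set stays
  finite.\<close>

primrec residuals :: "com \<Rightarrow> com set" where
  "residuals SKIP = {SKIP}"
| "residuals (Do F) = {Do F, SKIP}"
| "residuals (Seq a b) = (\<lambda>x. Seq x b) ` residuals a \<union> residuals b"
| "residuals (IF p a b) = {IF p a b} \<union> residuals a \<union> residuals b"
| "residuals (WHILE p c) = {WHILE p c, SKIP} \<union> (\<lambda>x. Seq x (WHILE p c)) ` residuals c"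

lemma finite_residuals: "finite (residuals c)"
  by (induction c) auto

lemma self_residuals: "c \<in> residuals c"
  by (induction c) auto

lemma sstep_residuals: "x \<in> residuals c \<Longrightarrow> fst (sstep x m) \<in> residuals c"
proof (induction c arbitrary: x)
  case (Seq a b)
  then show ?case using self_residuals[of b] by (auto split: if_splits)
next
  case (IF p a b)
  then show ?case using self_residuals[of a] self_residuals[of b] by auto
next
  case (WHILE p c)
  then show ?case using self_residuals[of c] by (auto split: if_splits)
qed auto

definition mems :: "nat \<Rightarrow> nat \<Rightarrow> (nat \<Rightarrow> nat) set" where
  "mems K B = {m. (\<forall>r<K. m r < B) \<and> (\<forall>r\<ge>K. m r = 0)}"

lemma finite_mems: "finite (mems K B)"
proof -
  have "mems K B = {m. \<forall>r. (r \<in> {..<K} \<longrightarrow> m r \<in> {..<B}) \<and> (r \<notin> {..<K} \<longrightarrow> m r = 0)}"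
    unfolding mems_def by (rule Collect_cong) (simp add: not_less all_conj_distrib)
  then show ?thesis by (simp only: finite_set_of_finite_funs finite_lessThan)
qed

text \<open>Pushed symbols are positive: 0 is reserved for the reading of an empty stack and for
  blank cells of a track.\<close>

fun ok_act :: "nat \<Rightarrow> nat \<Rightarrow> act \<Rightarrow> bool" where
  "ok_act K B (Push r a) = (r < K \<and> 0 < a \<and> a < B)"
| "ok_act K B (Pop r) = (r < K)"
| "ok_act K B (Repl r a) = (r < K \<and> 0 < a \<and> a < B)"

primrec wf_com :: "nat \<Rightarrow> nat \<Rightarrow> com \<Rightarrow> bool" where
  "wf_com K B SKIP = True"
| "wf_com K B (Do F) = (\<forall>m \<in> mems K B. \<forall>a \<in> set (F m). ok_act K B a)"
| "wf_com K B (Seq a b) = (wf_com K B a \<and> wf_com K B b)"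
| "wf_com K B (IF p a b) = (wf_com K B a \<and> wf_com K B b)"
| "wf_com K B (WHILE p c) = wf_com K B c"

lemma wf_com_residuals: "x \<in> residuals c \<Longrightarrow> wf_com K B c \<Longrightarrow> wf_com K B x"
  by (induction c arbitrary: x) auto

lemma wf_com_acts:
  "wf_com K B c \<Longrightarrow> m \<in> mems K B \<Longrightarrow> a \<in> set (snd (sstep c m)) \<Longrightarrow> ok_act K B a"
  by (induction c) (auto split: if_splits)

section \<open>Simulation of stack programs by Turing machines\<close>

text \<open>One program step is a series of round trips from the left-end marker.
  \<open>Sweep\<close> runs right and collects the tops, \<open>Back\<close> returns and consults
  the program; for each pending action \<open>Home\<close> returns to the marker,
  \<open>Find\<close> runs to the first blank of the track, and \<open>Edit\<close> changes the cell
  before it, while a push fills the blank itself.\<close>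

datatype cst =
    Ini0
  | Ini1
  | Sweep com "nat \<Rightarrow> nat"
  | Back com "nat \<Rightarrow> nat"
  | Home com "act list"
  | Find com act "act list"
  | Edit com nat nat "act list"
  | Acc
  | Rej

text \<open>A stack lies on its track with the bottom at cell 0, so pushing and popping leave all
  other cells in place.\<close>

definition dig :: "nat list \<Rightarrow> nat \<Rightarrow> nat" where
  "dig xs i = (if i < length xs then rev xs ! i else 0)"

lemma dig_Nil [simp]: "dig [] i = 0"
  by (simp add: dig_def)

lemma dig_Cons: "dig (a # xs) = (dig xs)(length xs := a)"
  by (auto simp: dig_def fun_eq_iff nth_append)

lemma dig_length [simp]: "dig xs (length xs) = 0"
  by (simp add: dig_def)

lemma dig_ge: "length xs \<le> i \<Longrightarrow> dig xs i = 0"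
  by (simp add: dig_def)

lemma dig_pos: "\<forall>a\<in>set xs. 0 < a \<Longrightarrow> i < length xs \<Longrightarrow> 0 < dig xs i"
proof -
  assume a: "\<forall>a\<in>set xs. 0 < a" and i: "i < length xs"
  then have "rev xs ! i \<in> set xs" by (metis length_rev nth_mem set_rev)
  then show ?thesis using a i by (simp add: dig_def)
qed

lemma dig_zero_iff: "\<forall>a\<in>set xs. 0 < a \<Longrightarrow> dig xs i = 0 \<longleftrightarrow> length xs \<le> i"
  using dig_pos[of xs i] dig_ge[of xs i] by (cases "i < length xs") auto

locale stack_prog =
  fixes c0 :: com and ans :: "(nat \<Rightarrow> nat) \<Rightarrow> bool" and K B :: nat
  assumes wf0: "wf_com K B c0" and K0: "0 < K" and B2: "2 \<le> B"
begin

text \<open>Tape symbols are functions from tracks to symbols, and track \<open>K\<close> carries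
  only the marker at cell -1. During a sweep the last nonzero symbol of a track is the top of its
  stack. If \<open>Edit\<close> finds itself on the marker the stack was empty, and nothing is
  written, in accordance with \<open>tl [] = []\<close>.\<close>

fun atm :: "cst \<Rightarrow> (nat \<Rightarrow> nat) \<Rightarrow> cst \<times> (nat \<Rightarrow> nat) \<times> move" where
  "atm Ini0 f = (Ini1, f, Left)"
| "atm Ini1 f = (Home c0 [], f(K := 1), Stay)"
| "atm (Sweep q m) f =
     (if \<forall>r<K. f r = 0 then (Back q m, f, Left)
      else (Sweep q (\<lambda>r. if r < K \<and> f r \<noteq> 0 then f r else m r), f, Right))"
| "atm (Back q m) f =
     (if f K = 0 then (Back q m, f, Left)
      else if q = SKIP then (if ans m then Acc else Rej, f, Stay)
      else (Home (fst (sstep q m)) (snd (sstep q m)), f, Stay))"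
| "atm (Home q as) f =
     (if f K = 0 then (Home q as, f, Left)
      else (case as of [] \<Rightarrow> (Sweep q (\<lambda>_. 0), f, Right) | a # as' \<Rightarrow> (Find q a as', f, Right)))"
| "atm (Find q (Push r a) as) f =
     (if f r = 0 then (Home q as, f(r := a), Left) else (Find q (Push r a) as, f, Right))"
| "atm (Find q (Pop r) as) f =
     (if f r = 0 then (Edit q r 0 as, f, Left) else (Find q (Pop r) as, f, Right))"
| "atm (Find q (Repl r a) as) f =
     (if f r = 0 then (Edit q r a as, f, Left) else (Find q (Repl r a) as, f, Right))"
| "atm (Edit q r a as) f = (Home q as, if f K = 0 then f(r := a) else f, Stay)"
| "atm Acc f = (Acc, f, Stay)"
| "atm Rej f = (Rej, f, Stay)"

definition syms :: "(nat \<Rightarrow> nat) set" where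
  "syms = mems (Suc K) B"

text \<open>Suffixes of the action lists of single steps: the pending actions that a state has to
  remember. Restricting states to them keeps the state set finite.\<close>

definition act_lists :: "act list set" where
  "act_lists = (\<Union>q\<in>residuals c0. \<Union>m\<in>mems K B. \<Union>i\<le>length (snd (sstep q m)). {drop i (snd (sstep q m))})"

definition acts :: "act set" where
  "acts = \<Union> (set ` act_lists)"

definition states :: "cst set" where
  "states = {Ini0, Ini1, Acc, Rej}
     \<union> (\<lambda>(q, m). Sweep q m) ` (residuals c0 \<times> mems K B)
     \<union> (\<lambda>(q, m). Back q m) ` (residuals c0 \<times> mems K B)
     \<union> (\<lambda>(q, as). Home q as) ` (residuals c0 \<times> (insert [] act_lists))
     \<union> (\<lambda>(q, a, as). Find q a as) ` (residuals c0 \<times> acts \<times> act_lists)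
     \<union> (\<lambda>(q, r, a, as). Edit q r a as) ` (residuals c0 \<times> {..<K} \<times> {..<B} \<times> act_lists)"

lemma finite_act_lists: "finite act_lists"
  unfolding act_lists_def using finite_residuals finite_mems by auto

lemma finite_states: "finite states"
  unfolding states_def using finite_act_lists finite_residuals finite_mems[of K B]
  by (auto simp: acts_def)

lemma finite_syms: "finite syms"
  by (simp add: syms_def finite_mems)

lemma act_lists_tl: "a # as \<in> act_lists \<Longrightarrow> as \<in> act_lists"
proof -
  assume "a # as \<in> act_lists"
  then obtain q m i where q: "q \<in> residuals c0" "m \<in> mems K B" and i: "i \<le> length (snd (sstep q m))"
    "a # as = drop i (snd (sstep q m))" by (auto simp: act_lists_def)
  have "Suc i \<le> length (snd (sstep q m))"
    using i(2) by (metis drop_eq_Nil list.distinct(1) not_less_eq_eq)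
  moreover have "as = drop (Suc i) (snd (sstep q m))"
    using i(2) by (metis drop_Suc list.sel(3) tl_drop)
  ultimately show ?thesis using q unfolding act_lists_def by blast
qed

lemma act_lists_hd: "a # as \<in> act_lists \<Longrightarrow> a \<in> acts"
  unfolding acts_def by (metis UN_I list.set_intros(1))

lemma sstep_act_lists: "q \<in> residuals c0 \<Longrightarrow> m \<in> mems K B \<Longrightarrow> snd (sstep q m) \<in> act_lists"
  unfolding act_lists_def by (rule UN_I, assumption, rule UN_I, assumption, rule UN_I[of 0]) auto

lemma acts_ok: "a \<in> acts \<Longrightarrow> ok_act K B a"
  unfolding acts_def act_lists_def
  by (auto dest!: in_set_dropD intro: wf_com_acts wf_com_residuals[OF _ wf0])

lemma zero_mems [simp]: "(\<lambda>_. 0) \<in> mems K B"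
  using B2 by (simp add: mems_def)

lemma states_simps [simp]:
  "Ini0 \<in> states" "Ini1 \<in> states" "Acc \<in> states" "Rej \<in> states"
  "Sweep q m \<in> states \<longleftrightarrow> q \<in> residuals c0 \<and> m \<in> mems K B"
  "Back q m \<in> states \<longleftrightarrow> q \<in> residuals c0 \<and> m \<in> mems K B"
  "Home q as \<in> states \<longleftrightarrow> q \<in> residuals c0 \<and> (as = [] \<or> as \<in> act_lists)"
  "Find q a as \<in> states \<longleftrightarrow> q \<in> residuals c0 \<and> a \<in> acts \<and> as \<in> act_lists"
  "Edit q r b as \<in> states \<longleftrightarrow> q \<in> residuals c0 \<and> r < K \<and> b < B \<and> as \<in> act_lists"
  unfolding states_def image_def by auto

lemma syms_upd: "f \<in> syms \<Longrightarrow> r \<le> K \<Longrightarrow> a < B \<Longrightarrow> f(r := a) \<in> syms"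
  by (auto simp: syms_def mems_def)

lemma atm_closed:
  assumes q: "q \<in> states" and f: "f \<in> syms"
  shows "fst (atm q f) \<in> states \<and> fst (snd (atm q f)) \<in> syms"
proof (cases q)
  case Ini1 then show ?thesis using f self_residuals B2 by (simp add: syms_upd)
next
  case (Sweep c m)
  then have "c \<in> residuals c0" "m \<in> mems K B" using q by auto
  moreover from this have "(\<lambda>r. if r < K \<and> f r \<noteq> 0 then f r else m r) \<in> mems K B"
    using f by (auto simp: mems_def syms_def)
  ultimately show ?thesis using Sweep f by simp
next
  case (Back c m)
  then show ?thesis using q f sstep_act_lists[of c m] sstep_residuals[of c c0 m] by simp
next
  case (Home c as)
  then show ?thesis using q f act_lists_tl act_lists_hd by (auto split: list.split)
next
  case (Find c a as)
  then have "ok_act K B a" using acts_ok q by simp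
  then show ?thesis using Find f q B2 by (cases a) (auto simp: syms_upd)
next
  case (Edit c r a as)
  then show ?thesis using f q by (simp add: syms_upd)
qed (use f in simp_all)

definition input_sym :: "nat \<Rightarrow> nat \<Rightarrow> nat" where
  "input_sym a = (\<lambda>_. 0)(0 := a)"

lemma input_sym_syms: "a < B \<Longrightarrow> input_sym a \<in> syms"
  using K0 by (auto simp: input_sym_def syms_def mems_def)

text \<open>Inputs arrive and outputs are expected as plain numbers, so the coding of tape symbols
  must send the symbol with \<open>a\<close> on track 0 alone to \<open>a\<close> itself; in
  particular the all-zero symbol becomes the blank. An injection on these symbols is extended to a
  bijection.\<close>

lemma sym_coding_exists:
  "\<exists>h. bij_betw h syms {..<card syms} \<and> (\<forall>a<B. h (input_sym a) = a)"
proof -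
  let ?I = "input_sym ` {..<B}"
  have inj: "inj_on input_sym {..<B}"
    by (rule inj_onI) (metis fun_upd_same input_sym_def)
  have sub: "?I \<subseteq> syms" using input_sym_syms by auto
  have cI: "card ?I = B" using card_image[OF inj] by simp
  have le: "B \<le> card syms" using card_mono[OF finite_syms sub] cI by simp
  have "card (syms - ?I) = card {B..<card syms}"
    using card_Diff_subset[of ?I syms] sub cI by simp
  then obtain g where g: "bij_betw g (syms - ?I) {B..<card syms}"
    using finite_same_card_bij[of "syms - ?I" "{B..<card syms}"] finite_syms by auto
  define h where "h f = (if f \<in> ?I then f 0 else g f)" for f
  have h1: "bij_betw h ?I {..<B}"
  proof (rule bij_betw_imageI)
    show "inj_on h ?I" by (rule inj_onI) (auto simp: h_def input_sym_def)
    show "h ` ?I = {..<B}" by (auto simp: h_def input_sym_def image_image)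
  qed
  have h2: "bij_betw h (syms - ?I) {B..<card syms}"
    using g by (rule bij_betw_cong[THEN iffD1, rotated]) (auto simp: h_def)
  have "bij_betw h (?I \<union> (syms - ?I)) ({..<B} \<union> {B..<card syms})"
    using h1 h2 by (rule bij_betw_combine) auto
  moreover have "?I \<union> (syms - ?I) = syms" using sub by auto
  moreover have "{..<B} \<union> {B..<card syms} = {..<card syms}" using le by auto
  moreover have "\<forall>a<B. h (input_sym a) = a" by (auto simp: h_def input_sym_def)
  ultimately show ?thesis by auto
qed

lemma state_coding_exists: "\<exists>h. bij_betw h states {..<card states}"
  using ex_bij_betw_finite_nat[OF finite_states] by (auto simp: lessThan_atLeast0)

definition sym_code :: "(nat \<Rightarrow> nat) \<Rightarrow> nat" where
  "sym_code = (SOME h. bij_betw h syms {..<card syms} \<and> (\<forall>a<B. h (input_sym a) = a))"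

definition state_code :: "cst \<Rightarrow> nat" where
  "state_code = (SOME h. bij_betw h states {..<card states})"

lemma sym_code: "bij_betw sym_code syms {..<card syms}" "a < B \<Longrightarrow> sym_code (input_sym a) = a"
  using someI_ex[OF sym_coding_exists] by (auto simp: sym_code_def)

lemma state_code: "bij_betw state_code states {..<card states}"
  using someI_ex[OF state_coding_exists] by (auto simp: state_code_def)

definition mach :: tm where
  "mach = \<lparr> tm_nstates = card states, tm_nsyms = card syms, tm_start = state_code Ini0,
     tm_accept = state_code Acc, tm_reject = state_code Rej,
     tm_delta = (\<lambda>q a. case atm (inv_into states state_code q) (inv_into syms sym_code a) of
        (q', f, d) \<Rightarrow> (state_code q', sym_code f, d)) \<rparr>"

lemma state_code_less: "q \<in> states \<Longrightarrow> state_code q < card states"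
  using state_code by (auto simp: bij_betw_def)

lemma sym_code_less: "f \<in> syms \<Longrightarrow> sym_code f < card syms"
  using sym_code(1) by (auto simp: bij_betw_def)

lemma state_code_eq: "q \<in> states \<Longrightarrow> q' \<in> states \<Longrightarrow> state_code q = state_code q' \<longleftrightarrow> q = q'"
  using state_code by (auto simp: bij_betw_def inj_on_def)

lemma B_le_syms: "B \<le> card syms"
proof -
  have "{..<B} \<subseteq> sym_code ` syms"
    using sym_code(2) input_sym_syms by (metis image_eqI lessThan_iff subsetI)
  then have "{..<B} \<subseteq> {..<card syms}" using sym_code(1) by (simp add: bij_betw_def)
  then show ?thesis by simp
qed

lemma wf_mach: "wf_tm mach"
proof -
  have *: "state_code q' < card states \<and> sym_code f < card syms"
    if "i < card states" "a < card syms"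
      "atm (inv_into states state_code i) (inv_into syms sym_code a) = (q', f, d)" for i a q' f d
  proof -
    have "inv_into states state_code i \<in> states"
      using that(1) state_code by (metis bij_betw_def inv_into_into lessThan_iff)
    moreover have "inv_into syms sym_code a \<in> syms"
      using that(2) sym_code(1) by (metis bij_betw_def inv_into_into lessThan_iff)
    ultimately show ?thesis using atm_closed that(3) state_code_less sym_code_less by (metis fst_conv snd_conv)
  qed
  have "state_code Acc \<noteq> state_code Rej" using state_code_eq by simp
  moreover have "0 < card syms" using B_le_syms B2 by simp
  ultimately show ?thesis using state_code_less
    by (auto simp: wf_tm_def mach_def split: prod.split dest: *)
qed

type_synonym acfg = "cst \<times> (int \<Rightarrow> nat \<Rightarrow> nat) \<times> int"

definition astep :: "acfg \<Rightarrow> acfg" where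
  "astep c = (case c of (q, T, h) \<Rightarrow>
     (case atm q (T h) of (q', f, d) \<Rightarrow> (q', T(h := f), h + move_off d)))"

definition code :: "acfg \<Rightarrow> config" where
  "code c = (case c of (q, T, h) \<Rightarrow> (state_code q, (\<lambda>i. sym_code (T i)), h))"

definition good :: "acfg \<Rightarrow> bool" where
  "good c \<longleftrightarrow> fst c \<in> states \<and> (\<forall>i. fst (snd c) i \<in> syms)"

lemma good_astep: "good c \<Longrightarrow> good (astep c)"
proof -
  assume g: "good c"
  obtain q T h where c: "c = (q, T, h)" by (cases c)
  obtain q' f d where a: "atm q (T h) = (q', f, d)" by (cases "atm q (T h)")
  have "q' \<in> states" "f \<in> syms" using atm_closed[of q "T h"] g a by (auto simp: good_def c)
  then show ?thesis using g a by (auto simp: good_def astep_def c)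
qed

lemma step_code:
  assumes "good c"
  shows "step mach (code c) = code (astep c)"
proof -
  obtain q T h where c: "c = (q, T, h)" by (cases c)
  have q: "q \<in> states" and T: "T h \<in> syms" using assms by (auto simp: good_def c)
  have "inv_into states state_code (state_code q) = q"
    using state_code q by (metis bij_betw_def inv_into_f_f)
  moreover have "inv_into syms sym_code (sym_code (T h)) = T h"
    using sym_code(1) T by (metis bij_betw_def inv_into_f_f)
  ultimately have d: "tm_delta mach (state_code q) (sym_code (T h)) =
    (case atm q (T h) of (q', f, d) \<Rightarrow> (state_code q', sym_code f, d))"
    by (simp add: mach_def)
  have hal: "halted mach (code c) \<longleftrightarrow> q = Acc \<or> q = Rej"
    using q state_code_eq by (simp add: halted_def c code_def mach_def)
  show ?thesis
  proof (cases "q = Acc \<or> q = Rej")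
    case True
    then have "astep c = c" by (auto simp: c astep_def move_off_def)
    then show ?thesis using True hal by (simp add: step_def)
  next
    case False
    then have "step mach (code c) = (case tm_delta mach (state_code q) (sym_code (T h)) of
        (q', a, d) \<Rightarrow> (q', (\<lambda>i. sym_code (T i))(h := a), h + move_off d))"
      using hal by (simp add: step_def c code_def)
    also have "\<dots> = code (astep c)"
    proof -
      obtain q' f d' where "atm q (T h) = (q', f, d')" by (cases "atm q (T h)")
      moreover have "(\<lambda>i. sym_code (T i))(h := sym_code f) = (\<lambda>i. sym_code ((T(h := f)) i))" by auto
      ultimately show ?thesis unfolding d by (simp add: c astep_def code_def)
    qed
    finally show ?thesis .
  qed
qed

lemma good_astep_pow: "good c \<Longrightarrow> good ((astep ^^ n) c)"
  by (induction n) (auto simp: good_astep)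

lemma steps_code: "good c \<Longrightarrow> (step mach ^^ n) (code c) = code ((astep ^^ n) c)"
  by (induction n) (auto simp: step_code good_astep_pow)

text \<open>Time and head position are bounded together: the decision procedure needs the second,
  the reduction the first.\<close>

definition reach :: "nat \<Rightarrow> nat \<Rightarrow> acfg \<Rightarrow> acfg \<Rightarrow> bool" where
  "reach L N x y \<longleftrightarrow> (\<exists>n\<le>N. (astep ^^ n) x = y \<and> (\<forall>i\<le>n. \<bar>snd (snd ((astep ^^ i) x))\<bar> \<le> int L))"

lemma reach_trans:
  assumes "reach L N1 x y" "reach L N2 y z" shows "reach L (N1 + N2) x z"
proof -
  obtain n1 where n1: "n1 \<le> N1" "(astep ^^ n1) x = y" "\<forall>i\<le>n1. \<bar>snd (snd ((astep ^^ i) x))\<bar> \<le> int L"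
    using assms(1) by (auto simp: reach_def)
  obtain n2 where n2: "n2 \<le> N2" "(astep ^^ n2) y = z" "\<forall>i\<le>n2. \<bar>snd (snd ((astep ^^ i) y))\<bar> \<le> int L"
    using assms(2) by (auto simp: reach_def)
  have e: "(astep ^^ (n1 + j)) x = (astep ^^ j) y" for j
    using n1(2) by (simp add: add.commute funpow_add)
  have "\<bar>snd (snd ((astep ^^ i) x))\<bar> \<le> int L" if "i \<le> n1 + n2" for i
  proof (cases "i \<le> n1")
    case False
    then show ?thesis using e[of "i - n1"] n2(3) that by simp
  qed (use n1(3) in simp)
  moreover have "(astep ^^ (n1 + n2)) x = z" using e n2(2) by simp
  ultimately show ?thesis unfolding reach_def using n1(1) n2(1) by (metis add_mono)
qed

lemma reach_mono: "reach L N x y \<Longrightarrow> N \<le> N' \<Longrightarrow> L \<le> L' \<Longrightarrow> reach L' N' x y"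
proof -
  assume a: "reach L N x y" "N \<le> N'" "L \<le> L'"
  then obtain n where n: "n \<le> N" "(astep ^^ n) x = y" "\<forall>i\<le>n. \<bar>snd (snd ((astep ^^ i) x))\<bar> \<le> int L"
    by (auto simp: reach_def)
  have "\<bar>snd (snd ((astep ^^ i) x))\<bar> \<le> int L'" if "i \<le> n" for i
    using n(3) that a(3) by (meson of_nat_mono order_trans)
  then show ?thesis unfolding reach_def using n a(2) by (intro exI[of _ n]) auto
qed

lemma reach_refl: "\<bar>h\<bar> \<le> int L \<Longrightarrow> reach L N (q, T, h) (q, T, h)"
  unfolding reach_def by (rule exI[of _ 0]) auto

lemma reach_step:
  assumes "atm q (T h) = (q', f, d)" "\<bar>h\<bar> \<le> int L" "\<bar>h + move_off d\<bar> \<le> int L"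
  shows "reach L 1 (q, T, h) (q', T(h := f), h + move_off d)"
  unfolding reach_def
proof (intro exI[of _ 1] conjI allI impI)
  fix i :: nat assume "i \<le> 1"
  then have "i = 0 \<or> i = 1" by auto
  then show "\<bar>snd (snd ((astep ^^ i) (q, T, h)))\<bar> \<le> int L" using assms by (auto simp: astep_def)
qed (use assms in \<open>auto simp: astep_def\<close>)

lemma reach_right:
  assumes "\<forall>i<n. atm q (T (h + int i)) = (q, T (h + int i), Right)"
    "\<bar>h\<bar> \<le> int L" "\<bar>h + int n\<bar> \<le> int L"
  shows "reach L n (q, T, h) (q, T, h + int n)"
  using assms
proof (induction n)
  case 0 then show ?case by (auto intro: reach_refl)
next
  case (Suc n)
  have "reach L n (q, T, h) (q, T, h + int n)" using Suc by auto
  moreover have "reach L 1 (q, T, h + int n) (q, T, h + int (Suc n))"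
    using reach_step[of q T "h + int n" q "T (h + int n)" Right L] Suc.prems
    by (auto simp: move_off_def algebra_simps)
  ultimately show ?case using reach_trans[of L n _ _ 1] by simp
qed

lemma reach_left:
  assumes "\<forall>i<n. atm q (T (h - int i)) = (q, T (h - int i), Left)"
    "\<bar>h\<bar> \<le> int L" "\<bar>h - int n\<bar> \<le> int L"
  shows "reach L n (q, T, h) (q, T, h - int n)"
  using assms
proof (induction n)
  case 0 then show ?case by (auto intro: reach_refl)
next
  case (Suc n)
  have "reach L n (q, T, h) (q, T, h - int n)" using Suc by auto
  moreover have "reach L 1 (q, T, h - int n) (q, T, h - int (Suc n))"
    using reach_step[of q T "h - int n" q "T (h - int n)" Left L] Suc.prems
    by (auto simp: move_off_def algebra_simps)
  ultimately show ?case using reach_trans[of L n _ _ 1] by simp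
qed

definition tape :: "regs \<Rightarrow> int \<Rightarrow> nat \<Rightarrow> nat" where
  "tape s i = (if i = -1 then (\<lambda>_. 0)(K := 1) else if i < 0 then (\<lambda>_. 0)
     else (\<lambda>r. dig (s r) (nat i)))"

definition valid :: "regs \<Rightarrow> bool" where
  "valid s \<longleftrightarrow> (\<forall>r\<ge>K. s r = []) \<and> (\<forall>r. \<forall>a\<in>set (s r). 0 < a \<and> a < B)"

lemma tape_nonneg: "0 \<le> i \<Longrightarrow> tape s i r = dig (s r) (nat i)"
  by (simp add: tape_def)

lemma tape_marker: "tape s (-1) K = 1" "r < K \<Longrightarrow> tape s (-1) r = 0"
  by (simp_all add: tape_def)

lemma tape_no_marker: "valid s \<Longrightarrow> 0 \<le> i \<Longrightarrow> tape s i K = 0"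
  by (simp add: tape_def valid_def)

lemma tape_zero_iff: "valid s \<Longrightarrow> tape s (int i) r = 0 \<longleftrightarrow> length (s r) \<le> i"
  using dig_zero_iff[of "s r" i] by (simp add: tape_nonneg valid_def)

lemma tape_upd:
  assumes "dig xs = (dig (s r))(i := a)"
  shows "(tape s)(int i := (tape s (int i))(r := a)) = tape (s(r := xs))"
proof (rule ext)
  fix j
  show "((tape s)(int i := (tape s (int i))(r := a))) j = tape (s(r := xs)) j"
    using assms by (cases "0 \<le> j") (auto simp: tape_def fun_eq_iff)
qed

lemma set_tl_subset: "x \<in> set (tl xs) \<Longrightarrow> x \<in> set xs"
  by (cases xs) auto

lemma valid_do_act: "valid s \<Longrightarrow> ok_act K B a \<Longrightarrow> valid (do_act a s)"
  by (cases a) (auto simp: valid_def dest: set_tl_subset)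

lemma valid_tops: "valid s \<Longrightarrow> tops s \<in> mems K B"
proof -
  assume v: "valid s"
  have "hd0 (s r) < B" for r
  proof (cases "s r")
    case (Cons x xs)
    then have "x \<in> set (s r)" by simp
    then have "x < B" using v unfolding valid_def by blast
    then show ?thesis using Cons by simp
  qed (use B2 in simp)
  then show ?thesis using v by (simp add: valid_def tops_def mems_def)
qed

lemma reach_home:
  assumes "valid s" "n \<le> L" "1 \<le> L"
  shows "reach L n (Home q as, tape s, int n - 1) (Home q as, tape s, -1)"
  using reach_left[of n "Home q as" "tape s" "int n - 1" L] assms
  by (auto simp: tape_no_marker)

lemma reach_find:
  assumes "valid s" "length (s r) \<le> L" "a = Push r b \<or> a = Pop r \<or> a = Repl r b"
  shows "reach L (length (s r)) (Find q a as, tape s, 0) (Find q a as, tape s, int (length (s r)))"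
proof -
  have "atm (Find q a as) (tape s (0 + int i)) = (Find q a as, tape s (0 + int i), Right)"
    if "i < length (s r)" for i
    using assms(3) that tape_zero_iff[OF assms(1), of i r] by auto
  then show ?thesis using reach_right[of "length (s r)" "Find q a as" "tape s" 0 L] assms(2) by simp
qed

lemma dig_replace_top:
  assumes "xs \<noteq> []"
  shows "dig (tl xs) = (dig xs)(length xs - 1 := 0)" "dig (a # tl xs) = (dig xs)(length xs - 1 := a)"
proof -
  obtain x ys where xs: "xs = x # ys" using assms by (cases xs) auto
  have "dig ys (length ys) = 0" by simp
  then show "dig (tl xs) = (dig xs)(length xs - 1 := 0)"
    unfolding xs by (auto simp: dig_Cons fun_eq_iff)
  show "dig (a # tl xs) = (dig xs)(length xs - 1 := a)"
    unfolding xs by (auto simp: dig_Cons fun_eq_iff)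
qed

text \<open>Serves \<open>Pop\<close> and \<open>Repl\<close> alike, since overwriting the top
  symbol by 0 pops it.\<close>

lemma reach_edit:
  assumes s: "valid s" "length (s r) \<le> L" "1 \<le> L" and r: "r < K"
    and e: "s' = s(r := (if s r = [] then [] else if b = 0 then tl (s r) else b # tl (s r)))"
    and v: "valid s'"
  shows "reach L (1 + length (s r)) (Edit q r b as, tape s, int (length (s r)) - 1) (Home q as, tape s', -1)"
proof -
  let ?n = "length (s r)"
  have "reach L 1 (Edit q r b as, tape s, int ?n - 1) (Home q as, tape s', int ?n - 1)"
  proof (cases "s r = []")
    case True
    then have "s' = s" using e by auto
    then show ?thesis using True reach_step[of "Edit q r b as" "tape s" "-1" "Home q as" "tape s (-1)" Stay L] s
      by (simp add: tape_marker move_off_def)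
  next
    case False
    then have p: "int ?n - 1 = int (?n - 1)" by (cases "s r") auto
    have "s' = s(r := (if b = 0 then tl (s r) else b # tl (s r)))" using e False by simp
    moreover have "dig (if b = 0 then tl (s r) else b # tl (s r)) = (dig (s r))(?n - 1 := b)"
      using dig_replace_top[OF False] by simp
    ultimately have "(tape s)(int (?n - 1) := (tape s (int (?n - 1)))(r := b)) = tape s'"
      using tape_upd by metis
    then show ?thesis
      using reach_step[of "Edit q r b as" "tape s" "int (?n - 1)" "Home q as" "(tape s (int (?n - 1)))(r := b)" Stay L] s
      unfolding p by (simp add: tape_no_marker move_off_def)
  qed
  moreover have "reach L ?n (Home q as, tape s', int ?n - 1) (Home q as, tape s', -1)"
    using reach_home[OF v] s by simp
  ultimately show ?thesis by (rule reach_trans)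
qed

lemma reach_act:
  assumes v: "valid s" and a: "ok_act K B a" and b: "\<forall>r. length (s r) \<le> H" and L: "H + 1 \<le> L"
  shows "reach L (2 * H + 5) (Home q (a # as), tape s, -1) (Home q as, tape (do_act a s), -1)"
proof -
  have v': "valid (do_act a s)" using valid_do_act v a by simp
  have 1: "reach L 1 (Home q (a # as), tape s, -1) (Find q a as, tape s, 0)"
    using reach_step[of "Home q (a # as)" "tape s" "-1" "Find q a as" "tape s (-1)" Right L] L
    by (simp add: tape_marker move_off_def)
  obtain r y where r: "a = Push r y \<or> a = Pop r \<or> a = Repl r y" by (cases a) auto
  then have rK: "r < K" using a by auto
  let ?n = "length (s r)"
  have nH: "?n \<le> H" using b by simp
  have 2: "reach L ?n (Find q a as, tape s, 0) (Find q a as, tape s, int ?n)"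
    using reach_find[OF v _ r] nH L by simp
  have z: "tape s (int ?n) r = 0" using tape_zero_iff[OF v] by simp
  have 3: "reach L (2 + ?n) (Find q a as, tape s, int ?n) (Home q as, tape (do_act a s), -1)"
  proof (cases a)
    case (Push r' y')
    then have [simp]: "r' = r" using r by auto
    have "(tape s)(int ?n := (tape s (int ?n))(r := y')) = tape (do_act a s)"
      using tape_upd[of "y' # s r" s r ?n y'] by (simp add: Push dig_Cons)
    then have "reach L 1 (Find q a as, tape s, int ?n) (Home q as, tape (do_act a s), int ?n - 1)"
      using reach_step[of "Find q a as" "tape s" "int ?n" "Home q as" "(tape s (int ?n))(r := y')" Left L] z L nH
      by (simp add: Push move_off_def)
    moreover have "reach L ?n (Home q as, tape (do_act a s), int ?n - 1) (Home q as, tape (do_act a s), -1)"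
      using reach_home[OF v'] nH L by simp
    ultimately have "reach L (1 + ?n) (Find q a as, tape s, int ?n) (Home q as, tape (do_act a s), -1)"
      by (rule reach_trans)
    then show ?thesis by (rule reach_mono) auto
  next
    case (Pop r')
    then have [simp]: "r' = r" using r by auto
    have "reach L 1 (Find q a as, tape s, int ?n) (Edit q r 0 as, tape s, int ?n - 1)"
      using reach_step[of "Find q a as" "tape s" "int ?n" "Edit q r 0 as" "tape s (int ?n)" Left L] z L nH
      by (simp add: Pop move_off_def)
    moreover have "reach L (1 + ?n) (Edit q r 0 as, tape s, int ?n - 1) (Home q as, tape (do_act a s), -1)"
      by (rule reach_edit[OF v _ _ rK _ v']) (use nH L in \<open>auto simp: Pop\<close>)
    ultimately have "reach L (1 + (1 + ?n)) (Find q a as, tape s, int ?n) (Home q as, tape (do_act a s), -1)"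
      by (rule reach_trans)
    then show ?thesis by simp
  next
    case (Repl r' y')
    then have [simp]: "r' = r" using r by auto
    have y: "0 < y'" using a by (simp add: Repl)
    have "reach L 1 (Find q a as, tape s, int ?n) (Edit q r y' as, tape s, int ?n - 1)"
      using reach_step[of "Find q a as" "tape s" "int ?n" "Edit q r y' as" "tape s (int ?n)" Left L] z L nH
      by (simp add: Repl move_off_def)
    moreover have "reach L (1 + ?n) (Edit q r y' as, tape s, int ?n - 1) (Home q as, tape (do_act a s), -1)"
      by (rule reach_edit[OF v _ _ rK _ v']) (use nH L y in \<open>auto simp: Repl\<close>)
    ultimately have "reach L (1 + (1 + ?n)) (Find q a as, tape s, int ?n) (Home q as, tape (do_act a s), -1)"
      by (rule reach_trans)
    then show ?thesis by simp
  qed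
  have "reach L ((1 + ?n) + (2 + ?n)) (Home q (a # as), tape s, -1) (Home q as, tape (do_act a s), -1)"
    using reach_trans[OF reach_trans[OF 1 2] 3] .
  then show ?thesis by (rule reach_mono) (use nH in auto)
qed

lemma length_do_act: "\<forall>r. length (s r) \<le> H \<Longrightarrow> length (do_act a s r) \<le> Suc H"
proof -
  assume *: "\<forall>r. length (s r) \<le> H"
  have "length (s x) - Suc 0 \<le> H" for x using * by (meson diff_le_self le_trans)
  then show ?thesis using * by (cases a) (simp_all add: le_SucI)
qed

lemma reach_acts:
  assumes "valid s" "\<forall>a\<in>set as. ok_act K B a" "\<forall>r. length (s r) \<le> H" "H + length as \<le> H'" "H' + 1 \<le> L"
  shows "reach L (length as * (2 * H' + 5)) (Home q as, tape s, -1) (Home q [], tape (do_acts as s), -1)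
    \<and> valid (do_acts as s)"
  using assms
proof (induction as arbitrary: s H)
  case Nil then show ?case by (auto intro: reach_refl)
next
  case (Cons a as)
  have "reach L (2 * H' + 5) (Home q (a # as), tape s, -1) (Home q as, tape (do_act a s), -1)"
    by (rule reach_mono[OF reach_act[of s a H L]]) (use Cons.prems in auto)
  moreover have "reach L (length as * (2 * H' + 5)) (Home q as, tape (do_act a s), -1)
      (Home q [], tape (do_acts as (do_act a s)), -1) \<and> valid (do_acts as (do_act a s))"
    using Cons.prems valid_do_act length_do_act by (intro Cons.IH[of _ "Suc H"]) auto
  ultimately show ?case using reach_trans[of L "2 * H' + 5"] by simp
qed

lemma reach_sweep:
  assumes v: "valid s" and b: "\<forall>r. length (s r) \<le> H" and L: "H + 1 \<le> L"
  shows "reach L (2 * H + 2) (Home q [], tape s, -1) (Back q (tops s), tape s, -1)"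
proof -
  \<comment> \<open>The memory after \<open>j\<close> cells: for every stack, the topmost of its
    lowest \<open>j\<close> symbols.\<close>
  define mm where "mm j = (\<lambda>r. hd0 (drop (length (s r) - j) (s r)))" for j
  \<comment> \<open>The sweep ends at the first cell that is blank on all tracks, hence at the
    height of the tallest stack.\<close>
  define n where "n = Max ((\<lambda>r. length (s r)) ` {..<K})"
  have n_ge: "length (s r) \<le> n" for r
  proof (cases "r < K")
    case False then show ?thesis using v by (simp add: valid_def)
  qed (simp add: n_def)
  have "n \<in> (\<lambda>r. length (s r)) ` {..<K}" unfolding n_def by (rule Max_in) (use K0 in auto)
  then obtain r0 where r0: "r0 < K" "length (s r0) = n" by auto
  have nH: "n \<le> H" using b r0 by auto
  have 1: "reach L 1 (Home q [], tape s, -1) (Sweep q (mm 0), tape s, 0)"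
    using reach_step[of "Home q []" "tape s" "-1" "Sweep q (mm 0)" "tape s (-1)" Right L] L
    by (simp add: tape_marker move_off_def mm_def)
  have mm_Suc: "(\<lambda>r. if r < K \<and> tape s (int j) r \<noteq> 0 then tape s (int j) r else mm j r) = mm (Suc j)" for j
  proof (rule ext)
    fix r
    show "(if r < K \<and> tape s (int j) r \<noteq> 0 then tape s (int j) r else mm j r) = mm (Suc j) r"
    proof (cases "j < length (s r)")
      case True
      then have "r < K" using v by (metis list.size(3) not_le not_less_zero valid_def)
      have "drop (length (s r) - Suc j) (s r) = s r ! (length (s r) - Suc j) # drop (length (s r) - j) (s r)"
        using True by (metis Cons_nth_drop_Suc Suc_diff_Suc diff_less zero_less_Suc gr_implies_not0 length_greater_0_conv list.size(3))
      then have "mm (Suc j) r = rev (s r) ! j" using True by (simp add: mm_def rev_nth)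
      then show ?thesis using True \<open>r < K\<close> tape_zero_iff[OF v, of j r] by (simp add: tape_nonneg dig_def)
    next
      case False
      then show ?thesis using tape_zero_iff[OF v, of j r] by (simp add: mm_def)
    qed
  qed
  have 2: "reach L j (Sweep q (mm 0), tape s, 0) (Sweep q (mm j), tape s, int j)" if "j \<le> n" for j
    using that
  proof (induction j)
    case 0 then show ?case using L by (auto intro: reach_refl)
  next
    case (Suc j)
    have "tape s (int j) r0 \<noteq> 0" using tape_zero_iff[OF v, of j r0] r0 Suc.prems by simp
    then have "\<not> (\<forall>r<K. tape s (int j) r = 0)" using r0 by auto
    then have "atm (Sweep q (mm j)) (tape s (int j)) = (Sweep q (mm (Suc j)), tape s (int j), Right)"
      using mm_Suc[of j] by (simp only: atm.simps if_False)
    then have "reach L 1 (Sweep q (mm j), tape s, int j) (Sweep q (mm (Suc j)), tape s, int (Suc j))"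
      using reach_step[of "Sweep q (mm j)" "tape s" "int j" "Sweep q (mm (Suc j))" "tape s (int j)" Right L] Suc.prems L nH
      by (simp add: move_off_def algebra_simps)
    then show ?case using Suc reach_trans[of L j _ _ 1] by simp
  qed
  have z: "\<forall>r<K. tape s (int n) r = 0" using tape_zero_iff[OF v] n_ge by simp
  have mt: "mm n = tops s" using n_ge by (simp add: mm_def tops_def fun_eq_iff)
  have 3: "reach L 1 (Sweep q (mm n), tape s, int n) (Back q (tops s), tape s, int n - 1)"
    using reach_step[of "Sweep q (mm n)" "tape s" "int n" "Back q (tops s)" "tape s (int n)" Left L] z L nH
    by (simp add: move_off_def mt)
  have 4: "reach L n (Back q (tops s), tape s, int n - 1) (Back q (tops s), tape s, -1)"
    using reach_left[of n "Back q (tops s)" "tape s" "int n - 1" L] v L nH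
    by (auto simp: tape_no_marker)
  have "reach L (1 + n + 1 + n) (Home q [], tape s, -1) (Back q (tops s), tape s, -1)"
    using reach_trans[OF reach_trans[OF reach_trans[OF 1 2] 3] 4] by simp
  then show ?thesis by (rule reach_mono) (use nH in auto)
qed

definition act_max :: nat where
  "act_max = Max (length ` act_lists)"

definition step_cost :: nat where
  "step_cost = 7 + act_max * (2 * act_max + 7)"

lemma length_act_max: "as \<in> act_lists \<Longrightarrow> length as \<le> act_max"
  unfolding act_max_def using finite_act_lists by simp

lemma reach_small_step:
  assumes v: "valid s" and b: "\<forall>r. length (s r) \<le> H" and L: "L = H + act_max + 1"
    and q: "q \<in> residuals c0" "q \<noteq> SKIP"
  shows "reach L (step_cost * (H + 1)) (Home q [], tape s, -1)
      (Home (fst (sstep q (tops s))) [], tape (do_acts (snd (sstep q (tops s))) s), -1)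
    \<and> valid (do_acts (snd (sstep q (tops s))) s)"
proof -
  let ?as = "snd (sstep q (tops s))" and ?q = "fst (sstep q (tops s))"
  have al: "?as \<in> act_lists" using sstep_act_lists q valid_tops[OF v] by simp
  have ok: "\<forall>a\<in>set ?as. ok_act K B a"
    using wf_com_acts[OF _ valid_tops[OF v]] wf_com_residuals[OF q(1) wf0] by blast
  have 1: "reach L (2 * H + 2) (Home q [], tape s, -1) (Back q (tops s), tape s, -1)"
    using reach_sweep v b L by simp
  have 2: "reach L 1 (Back q (tops s), tape s, -1) (Home ?q ?as, tape s, -1)"
    using reach_step[of "Back q (tops s)" "tape s" "-1" "Home ?q ?as" "tape s (-1)" Stay L] L q
    by (simp add: tape_marker move_off_def)
  have 3: "reach L (length ?as * (2 * (H + act_max) + 5)) (Home ?q ?as, tape s, -1) (Home ?q [], tape (do_acts ?as s), -1)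
    \<and> valid (do_acts ?as s)"
    by (rule reach_acts[OF v ok b]) (use length_act_max[OF al] L in auto)
  have "length ?as * (2 * (H + act_max) + 5) \<le> act_max * (2 * (H + act_max) + 5)"
    using length_act_max[OF al] by (rule mult_le_mono1)
  also have "\<dots> \<le> act_max * ((2 * act_max + 7) * (H + 1))"
    by (rule mult_le_mono2) (simp add: algebra_simps)
  finally have "2 * H + 2 + 1 + length ?as * (2 * (H + act_max) + 5) \<le> step_cost * (H + 1)"
    by (simp add: step_cost_def algebra_simps)
  then show ?thesis using reach_mono[OF reach_trans[OF reach_trans[OF 1 2] conjunct1[OF 3]]] 3 by simp
qed

lemma reach_exec:
  assumes "exec (bounded H) c s n s'" "c \<in> residuals c0" "valid s"
  shows "reach (H + act_max + 1) (n * (step_cost * (H + 1))) (Home c [], tape s, -1) (Home SKIP [], tape s', -1)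
     \<and> valid s' \<and> bounded H s'"
  using assms
proof (induction rule: exec.induct)
  case (exec_done s)
  then show ?case by (auto intro: reach_refl)
next
  case (exec_step c s n s')
  let ?L = "H + act_max + 1"
  have 1: "reach ?L (step_cost * (H + 1)) (Home c [], tape s, -1)
      (Home (fst (sstep c (tops s))) [], tape (do_acts (snd (sstep c (tops s))) s), -1)
    \<and> valid (do_acts (snd (sstep c (tops s))) s)"
    using reach_small_step[OF exec_step.prems(2) _ refl exec_step.prems(1) exec_step.hyps(1)] exec_step.hyps(2)
    by (auto simp: bounded_def)
  moreover have "fst (sstep c (tops s)) \<in> residuals c0" using sstep_residuals exec_step.prems by simp
  ultimately have 2: "reach ?L (n * (step_cost * (H + 1)))
      (Home (fst (sstep c (tops s))) [], tape (do_acts (snd (sstep c (tops s))) s), -1) (Home SKIP [], tape s', -1)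
      \<and> valid s' \<and> bounded H s'"
    using exec_step.IH by simp
  show ?case using reach_trans[OF conjunct1[OF 1] conjunct1[OF 2]] 2 by simp
qed

text \<open>The last conjunct asks for empty stacks besides stack 0, because a cell has the code of
  a plain symbol only if its other tracks are blank.\<close>

theorem mach_simulates:
  assumes w: "w \<in> lists {0<..<B}" and e: "exec (bounded H) c0 (init_regs w) n s'"
  shows "\<exists>T \<le> (step_cost + 10) * (n + 1) * (H + 1). halted mach (run mach w T) \<and>
     (fst (run mach w T) = tm_accept mach \<longleftrightarrow> ans (tops s')) \<and>
     (\<forall>i. \<bar>head_pos (run mach w i)\<bar> \<le> int (H + act_max + 1)) \<and>
     ((\<forall>r>0. s' r = []) \<longrightarrow> (\<forall>i. tape_of (run mach w T) (int i) = dig (s' 0) i))"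
proof -
  let ?s = "init_regs w" and ?L = "H + act_max + 1"
  define T0 :: "int \<Rightarrow> nat \<Rightarrow> nat" where
    "T0 = (\<lambda>i. input_sym (if 0 \<le> i \<and> i < int (length w) then w ! nat i else 0))"
  have wB: "0 < w ! i" "w ! i < B" if "i < length w" for i
    using w that by (auto simp: in_lists_conv_set)
  have T0B: "(if 0 \<le> i \<and> i < int (length w) then w ! nat i else 0) < B" for i
    using wB(2)[of "nat i"] B2 by auto
  have cod: "code (Ini0, T0, 0) = init_config mach w"
    using sym_code(2)[OF T0B] by (simp add: code_def init_config_def T0_def mach_def)
  have good0: "good (Ini0, T0, 0)"
    using input_sym_syms[OF T0B] by (simp add: good_def T0_def)
  have v: "valid ?s" using w K0 by (auto simp: valid_def init_regs_def in_lists_conv_set)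
  \<comment> \<open>The input, first letter at cell 0, already has the layout of the stack
    \<open>rev w\<close>; only the marker is missing.\<close>
  have tape0: "T0(-1 := (T0 (-1))(K := 1)) = tape ?s"
    by (auto simp: fun_eq_iff T0_def tape_def input_sym_def init_regs_def dig_def)
  have 1: "reach ?L 1 (Ini0, T0, 0) (Ini1, T0, -1)"
    using reach_step[of Ini0 T0 0 Ini1 "T0 0" Left ?L] by (simp add: move_off_def)
  have 2: "reach ?L 1 (Ini1, T0, -1) (Home c0 [], tape ?s, -1)"
    using reach_step[of Ini1 T0 "-1" "Home c0 []" "(T0 (-1))(K := 1)" Stay ?L]
    unfolding tape0 by (simp add: move_off_def)
  have 3: "reach ?L (n * (step_cost * (H + 1))) (Home c0 [], tape ?s, -1) (Home SKIP [], tape s', -1)"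
    and v': "valid s'" and b': "bounded H s'"
    using reach_exec[OF e self_residuals v] by auto
  have 4: "reach ?L (2 * H + 2) (Home SKIP [], tape s', -1) (Back SKIP (tops s'), tape s', -1)"
    using reach_sweep[OF v'] b' by (simp add: bounded_def)
  define qf where "qf = (if ans (tops s') then Acc else Rej)"
  have 5: "reach ?L 1 (Back SKIP (tops s'), tape s', -1) (qf, tape s', -1)"
    using reach_step[of "Back SKIP (tops s')" "tape s'" "-1" qf "tape s' (-1)" Stay ?L]
    by (simp add: tape_marker move_off_def qf_def)
  have "reach ?L (1 + 1 + n * (step_cost * (H + 1)) + (2 * H + 2) + 1) (Ini0, T0, 0) (qf, tape s', -1)"
    using reach_trans[OF reach_trans[OF reach_trans[OF reach_trans[OF 1 2] 3] 4] 5] .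
  then obtain T where T: "T \<le> 1 + 1 + n * (step_cost * (H + 1)) + (2 * H + 2) + 1"
    "(astep ^^ T) (Ini0, T0, 0) = (qf, tape s', -1)"
    "\<forall>i\<le>T. \<bar>snd (snd ((astep ^^ i) (Ini0, T0, 0)))\<bar> \<le> int ?L"
    unfolding reach_def by auto
  have run: "run mach w i = code ((astep ^^ i) (Ini0, T0, 0))" for i
    using steps_code[OF good0] by (simp add: run_def cod)
  \<comment> \<open>Halting states repeat without moving, which extends the head bound from the
    first \<open>T\<close> steps to all times.\<close>
  have fix1: "(astep ^^ j) (qf, tape s', -1) = (qf, tape s', -1)" for j
    by (induction j) (auto simp: qf_def astep_def move_off_def)
  have head: "\<bar>head_pos (run mach w i)\<bar> \<le> int ?L" for i
  proof (cases "i \<le> T")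
    case True
    then show ?thesis using T(3) by (auto simp: run head_pos_def code_def split: prod.splits)
  next
    case False
    have "(astep ^^ (i - T + T)) (Ini0, T0, 0) = (qf, tape s', -1)"
      unfolding funpow_add using T(2) fix1 by simp
    then show ?thesis using False by (simp add: run head_pos_def code_def)
  qed
  have rT: "run mach w T = (state_code qf, (\<lambda>i. sym_code (tape s' i)), -1)"
    using T(2) by (simp add: run code_def)
  have "state_code Rej \<noteq> state_code Acc" by (simp add: state_code_eq)
  then have ac: "fst (run mach w T) = tm_accept mach \<longleftrightarrow> ans (tops s')"
    unfolding rT by (simp add: mach_def qf_def)
  have hal: "halted mach (run mach w T)" unfolding rT by (simp add: halted_def mach_def qf_def)
  have tp: "tape_of (run mach w T) (int i) = dig (s' 0) i" if "\<forall>r>0. s' r = []" for i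
  proof -
    have "tape s' (int i) = input_sym (dig (s' 0) i)"
      using that by (auto simp: tape_def input_sym_def fun_eq_iff)
    moreover have "dig (s' 0) i < B"
    proof (cases "i < length (s' 0)")
      case True
      then have "rev (s' 0) ! i \<in> set (s' 0)" by (metis length_rev nth_mem set_rev)
      then show ?thesis using True v' by (simp add: dig_def valid_def)
    qed (use B2 in \<open>simp add: dig_def\<close>)
    ultimately show ?thesis by (simp add: rT tape_of_def sym_code(2))
  qed
  have "1 + 1 + n * (step_cost * (H + 1)) + (2 * H + 2) + 1 \<le> (step_cost + 10) * (n + 1) * (H + 1)"
    by (simp add: algebra_simps)
  then show ?thesis using T(1) head ac hal tp by (intro exI[of _ T]) auto
qed

end

section \<open>Execution rules with space bounds (\<open>runs\<close>) and with time bounds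
  (\<open>runt\<close>)\<close>

lemma exec_P: "exec P c s n s' \<Longrightarrow> P s \<and> P s'"
  by (induction rule: exec.induct) auto

lemma exec_Do: "P s \<Longrightarrow> P (do_acts (F (tops s)) s) \<Longrightarrow> exec P (Do F) s 1 (do_acts (F (tops s)) s)"
  using exec_step[of "Do F" P s 0] exec_done by simp

lemma exec_Seq:
  assumes "exec P a s n s1" "exec P b s1 m s2" shows "exec P (Seq a b) s (n + Suc m) s2"
  using assms
proof (induction rule: exec.induct)
  case (exec_done s)
  then show ?case using exec_step[of "Seq SKIP b" P s m s2] by simp
next
  case (exec_step c s n s')
  then show ?case using exec.exec_step[of "Seq c b" P s "n + Suc m" s2] by simp
qed

lemma exec_IF:
  "P s \<Longrightarrow> exec P (if p (tops s) then a else b) s n s' \<Longrightarrow> exec P (IF p a b) s (Suc n) s'"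
  using exec_step[of "IF p a b" P s n s'] by simp

lemma exec_WHILE_False: "P s \<Longrightarrow> \<not> p (tops s) \<Longrightarrow> exec P (WHILE p c) s 1 s"
  using exec_step[of "WHILE p c" P s 0 s] exec_done by simp

lemma exec_WHILE_True:
  assumes "p (tops s)" "exec P c s n s1" "exec P (WHILE p c) s1 m s2"
  shows "exec P (WHILE p c) s (n + m + 2) s2"
  using exec_step[of "WHILE p c" P s "n + Suc m" s2] exec_Seq[OF assms(2,3)] assms(1) exec_P[OF assms(2)]
  by simp

definition runs :: "(regs \<Rightarrow> bool) \<Rightarrow> com \<Rightarrow> regs \<Rightarrow> regs \<Rightarrow> bool" where
  "runs P c s s' \<longleftrightarrow> (\<exists>n. exec P c s n s')"

lemma runs_post: "runs P c s s' \<Longrightarrow> P s'"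
  unfolding runs_def using exec_P by blast

lemma runs_Do: "P s \<Longrightarrow> P s' \<Longrightarrow> s' = do_acts (F (tops s)) s \<Longrightarrow> runs P (Do F) s s'"
  unfolding runs_def using exec_Do by blast

lemma runs_SKIP: "P s \<Longrightarrow> runs P SKIP s s"
  unfolding runs_def using exec_done by blast

lemma runs_Seq: "runs P a s s1 \<Longrightarrow> runs P b s1 s2 \<Longrightarrow> runs P (Seq a b) s s2"
  unfolding runs_def using exec_Seq by blast

lemma runs_IF: "runs P (if p (tops s) then a else b) s s' \<Longrightarrow> runs P (IF p a b) s s'"
  unfolding runs_def using exec_IF exec_P by metis

lemma runs_WHILE_False: "P s \<Longrightarrow> \<not> p (tops s) \<Longrightarrow> runs P (WHILE p c) s s"
  unfolding runs_def using exec_WHILE_False by blast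

lemma runs_WHILE_True:
  "p (tops s) \<Longrightarrow> runs P c s s1 \<Longrightarrow> runs P (WHILE p c) s1 s2 \<Longrightarrow> runs P (WHILE p c) s s2"
  unfolding runs_def using exec_WHILE_True by blast

lemma runs_WHILE_star:
  assumes "(\<lambda>s s'. p (tops s) \<and> runs P c s s')\<^sup>*\<^sup>* s s'" "\<not> p (tops s')" "P s'"
  shows "runs P (WHILE p c) s s'"
  using assms
  by (induction rule: converse_rtranclp_induct) (auto intro: runs_WHILE_False runs_WHILE_True)

lemma runs_WHILE_iter:
  assumes "\<And>i. i < n \<Longrightarrow> p (tops (f i)) \<and> runs P c (f i) (f (Suc i))" "\<not> p (tops (f n))" "P (f n)"
    "s = f 0" "s' = f n"
  shows "runs P (WHILE p c) s s'"
proof -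
  have "j \<le> n \<Longrightarrow> runs P (WHILE p c) (f (n - j)) (f n)" for j
  proof (induction j)
    case 0 then show ?case using assms by (auto intro: runs_WHILE_False)
  next
    case (Suc j)
    have "Suc (n - Suc j) = n - j" "n - Suc j < n" using Suc.prems by auto
    then show ?case using Suc assms(1)[of "n - Suc j"] runs_WHILE_True[of p "f (n - Suc j)"] by auto
  qed
  from this[of n] show ?thesis using assms by simp
qed

text \<open>The state predicate is trivial here; stack heights are recovered from the running time
  by \<open>exec_bounded_by_time\<close>.\<close>

definition runt :: "com \<Rightarrow> nat \<Rightarrow> regs \<Rightarrow> regs \<Rightarrow> bool" where
  "runt c N s s' \<longleftrightarrow> (\<exists>n\<le>N. exec (\<lambda>_. True) c s n s')"

lemma runt_mono: "runt c N s s' \<Longrightarrow> N \<le> N' \<Longrightarrow> runt c N' s s'"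
  unfolding runt_def using le_trans by blast

lemma runt_Do: "s' = do_acts (F (tops s)) s \<Longrightarrow> runt (Do F) 1 s s'"
  unfolding runt_def using exec_Do[of "\<lambda>_. True"] by auto

lemma runt_SKIP: "runt SKIP 0 s s"
  unfolding runt_def using exec_done[of "\<lambda>_. True"] by blast

lemma runt_Seq: "runt a N s s1 \<Longrightarrow> runt b M s1 s2 \<Longrightarrow> runt (Seq a b) (N + M + 1) s s2"
proof -
  assume "runt a N s s1" "runt b M s1 s2"
  then obtain n m where "n \<le> N" "m \<le> M" "exec (\<lambda>_. True) a s n s1" "exec (\<lambda>_. True) b s1 m s2"
    by (auto simp: runt_def)
  then show ?thesis unfolding runt_def using exec_Seq[of "\<lambda>_. True" a s n s1 b m s2]
    by (intro exI[of _ "n + Suc m"]) auto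
qed

lemma runt_WHILE_iter:
  assumes "\<And>i. i < n \<Longrightarrow> p (tops (f i)) \<and> runt c N (f i) (f (Suc i))" "\<not> p (tops (f n))"
    "s = f 0" "s' = f n"
  shows "runt (WHILE p c) (n * (N + 2) + 1) s s'"
proof -
  have "j \<le> n \<Longrightarrow> runt (WHILE p c) (j * (N + 2) + 1) (f (n - j)) (f n)" for j
  proof (induction j)
    case 0 then show ?case unfolding runt_def using assms exec_WHILE_False[of "\<lambda>_. True"] by auto
  next
    case (Suc j)
    have e: "Suc (n - Suc j) = n - j" "n - Suc j < n" using Suc.prems by auto
    then obtain k where k: "k \<le> N" "exec (\<lambda>_. True) c (f (n - Suc j)) k (f (n - j))"
      using assms(1)[of "n - Suc j"] by (auto simp: runt_def)
    obtain k' where k': "k' \<le> j * (N + 2) + 1" "exec (\<lambda>_. True) (WHILE p c) (f (n - j)) k' (f n)"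
      using Suc by (auto simp: runt_def)
    have "exec (\<lambda>_. True) (WHILE p c) (f (n - Suc j)) (k + k' + 2) (f n)"
      using exec_WHILE_True[OF _ k(2) k'(2)] assms(1)[of "n - Suc j"] e by simp
    then show ?case unfolding runt_def using k(1) k'(1) by (intro exI[of _ "k + k' + 2"]) auto
  qed
  from this[of n] show ?thesis using assms by simp
qed

section \<open>Polynomial bounds and machines obtained from programs\<close>

definition polyb :: "(nat \<Rightarrow> nat) \<Rightarrow> bool" where
  "polyb f \<longleftrightarrow> (\<exists>k. \<forall>n. f n \<le> k * (n + 1) ^ k)"

lemma poly_term_mono: "k \<le> k' \<Longrightarrow> e \<le> e' \<Longrightarrow> k * (n + 1) ^ e \<le> k' * (n + 1 :: nat) ^ e'"
  by (intro mult_le_mono power_increasing) auto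

lemma polyb_const [intro]: "polyb (\<lambda>_. c)"
proof -
  have "c \<le> c * (n + 1) ^ c" for n by simp
  then show ?thesis unfolding polyb_def by blast
qed

lemma polyb_id [intro]: "polyb (\<lambda>n. n)"
  unfolding polyb_def by (rule exI[of _ 1]) simp

lemma polyb_add [intro]:
  assumes "polyb f" "polyb g" shows "polyb (\<lambda>n. f n + g n)"
proof -
  obtain k l where kl: "\<And>n. f n \<le> k * (n + 1) ^ k" "\<And>n. g n \<le> l * (n + 1) ^ l"
    using assms unfolding polyb_def by blast
  have "f n + g n \<le> (k + l) * (n + 1) ^ (k + l)" for n
    using kl[of n] poly_term_mono[of k k k "k + l" n] poly_term_mono[of l l l "k + l" n]
    unfolding add_mult_distrib by linarith
  then show ?thesis unfolding polyb_def by blast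
qed

lemma polyb_mult [intro]:
  assumes "polyb f" "polyb g" shows "polyb (\<lambda>n. f n * g n)"
proof -
  obtain k l where kl: "\<And>n. f n \<le> k * (n + 1) ^ k" "\<And>n. g n \<le> l * (n + 1) ^ l"
    using assms unfolding polyb_def by blast
  have "f n * g n \<le> (k * l + k + l) * (n + 1) ^ (k * l + k + l)" for n
  proof -
    have "f n * g n \<le> (k * (n + 1) ^ k) * (l * (n + 1) ^ l)" using kl by (rule mult_le_mono)
    also have "\<dots> = (k * l) * (n + 1) ^ (k + l)" by (simp add: power_add)
    also have "\<dots> \<le> (k * l + k + l) * (n + 1) ^ (k * l + k + l)" by (rule poly_term_mono) auto
    finally show ?thesis .
  qed
  then show ?thesis unfolding polyb_def by blast
qed

lemma polyb_power [intro]: "polyb f \<Longrightarrow> polyb (\<lambda>n. f n ^ e)"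
  by (induction e) auto

context stack_prog
begin

text \<open>A step raises a stack by at most \<open>act_max\<close>. For the program of the
  reduction it is therefore enough to count steps.\<close>

lemma exec_bounded_by_time:
  assumes "exec (\<lambda>_. True) c s n s'" "c \<in> residuals c0" "valid s" "bounded h s"
  shows "exec (bounded (h + n * act_max)) c s n s'"
  using assms
proof (induction arbitrary: h rule: exec.induct)
  case (exec_done s)
  then show ?case by (auto intro: exec.exec_done)
next
  case (exec_step c s n s')
  let ?as = "snd (sstep c (tops s))" and ?c = "fst (sstep c (tops s))"
  have al: "?as \<in> act_lists" using sstep_act_lists exec_step.prems valid_tops by simp
  have ok: "\<forall>a\<in>set ?as. ok_act K B a"
    using wf_com_acts[OF _ valid_tops] wf_com_residuals[OF _ wf0] exec_step.prems by blast
  have b: "valid (do_acts as t) \<and> bounded (h + length as) (do_acts as t)"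
    if "\<forall>a\<in>set as. ok_act K B a" "valid t" "bounded h t" for as t h
    using that
  proof (induction as arbitrary: t h)
    case (Cons a as)
    have "bounded (Suc h) (do_act a t)" using Cons.prems(3) length_do_act by (simp add: bounded_def)
    then show ?case using Cons.IH[of "do_act a t" "Suc h"] Cons.prems valid_do_act by simp
  qed simp
  have "valid (do_acts ?as s) \<and> bounded (h + length ?as) (do_acts ?as s)"
    using b ok exec_step.prems by simp
  then have "valid (do_acts ?as s)" "bounded (h + act_max) (do_acts ?as s)"
    using length_act_max[OF al] unfolding bounded_def by (auto intro: le_trans)
  then have "exec (bounded (h + act_max + n * act_max)) ?c (do_acts ?as s) n s'"
    using exec_step.IH sstep_residuals exec_step.prems by simp
  moreover have "bounded (h + act_max + n * act_max) s"
    using exec_step.prems(3) unfolding bounded_def by (meson le_add1 le_trans)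
  ultimately show ?case using exec.exec_step[OF exec_step.hyps(1)] by (simp add: add.assoc)
qed

end

theorem PSPACE_by_program:
  assumes wf: "wf_com K B c" "0 < K" "2 \<le> B" and S: "alphabet S" "S \<subseteq> {0<..<B}" "L \<subseteq> lists S"
    and h: "polyb h"
    and c: "\<And>w. w \<in> lists S \<Longrightarrow> \<exists>s'. runs (bounded (h (length w))) c (init_regs w) s' \<and> (ans (tops s') \<longleftrightarrow> w \<in> L)"
  shows "PSPACE S L"
proof -
  interpret stack_prog c ans K B using wf by unfold_locales
  have "polyb (\<lambda>n. h n + (act_max + 1))" using h by (intro polyb_add polyb_const)
  then obtain k where k: "\<And>n. h n + act_max + 1 \<le> k * (n + 1) ^ k" unfolding polyb_def by (auto simp: add.assoc)
  have "decides_in_space mach S L (\<lambda>n. k * (n + 1) ^ k)"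
    unfolding decides_in_space_def
  proof
    fix w assume w: "w \<in> lists S"
    then have wB: "w \<in> lists {0<..<B}" using S(2) by (meson lists_mono in_mono)
    obtain s' n where s': "exec (bounded (h (length w))) c (init_regs w) n s'" "ans (tops s') \<longleftrightarrow> w \<in> L"
      using c[OF w] unfolding runs_def by blast
    have "int (h (length w) + act_max + 1) \<le> int (k * (length w + 1) ^ k)" using k by (metis of_nat_mono)
    then show "\<exists>t. halted mach (run mach w t) \<and> (fst (run mach w t) = tm_accept mach \<longleftrightarrow> w \<in> L) \<and>
        (\<forall>i. \<bar>head_pos (run mach w i)\<bar> \<le> int (k * (length w + 1) ^ k))"
      using mach_simulates[OF wB s'(1)] s'(2) by (meson order_trans)
  qed
  moreover have "S \<subseteq> {..<tm_nsyms mach}"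
  proof
    fix x assume "x \<in> S"
    then have "x < B" using S(2) by auto
    then show "x \<in> {..<tm_nsyms mach}" using B_le_syms by (simp add: mach_def)
  qed
  ultimately show ?thesis unfolding PSPACE_def using wf_mach S by blast
qed

text \<open>The output is read from the bottom of stack 0 upwards, hence the \<open>rev\<close>; the
  other stacks are emptied so that the output cells carry nothing else.\<close>

theorem poly_time_by_program:
  assumes wf: "wf_com K B c" "0 < K" "2 \<le> B" and S: "S \<subseteq> {0<..<B}"
    and h: "polyb h"
    and c: "\<And>w. w \<in> lists S \<Longrightarrow> \<exists>s'. runt c (h (length w)) (init_regs w) s' \<and> s' 0 = rev (f w) \<and> (\<forall>r>0. s' r = [])"
  shows "\<exists>M k. wf_tm M \<and> S \<subseteq> {..<tm_nsyms M} \<and> computes_in_poly_time M S f k"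
proof -
  interpret stack_prog c "\<lambda>_. True" K B using wf by unfold_locales
  have "polyb (\<lambda>n. (step_cost + 10) * (h n + 1) * (n + h n * act_max + 1))"
    using h by (intro polyb_add polyb_const polyb_mult polyb_id)
  then obtain k where k: "\<And>n. (step_cost + 10) * (h n + 1) * (n + h n * act_max + 1) \<le> k * (n + 1) ^ k"
    unfolding polyb_def by blast
  have "computes_in_poly_time mach S f k"
    unfolding computes_in_poly_time_def
  proof
    fix w assume w: "w \<in> lists S"
    then have wB: "w \<in> lists {0<..<B}" using S by (meson lists_mono in_mono)
    obtain s' n where s': "n \<le> h (length w)" "exec (\<lambda>_. True) c (init_regs w) n s'" "s' 0 = rev (f w)" "\<forall>r>0. s' r = []"
      using c[OF w] unfolding runt_def by blast
    have v: "valid (init_regs w)" using wB K0 by (auto simp: valid_def init_regs_def in_lists_conv_set)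
    have "bounded (length w) (init_regs w)" by (simp add: bounded_def init_regs_def)
    then have "exec (bounded (length w + n * act_max)) c (init_regs w) n s'"
      using exec_bounded_by_time[OF s'(2) self_residuals v] by simp
    from mach_simulates[OF wB this] obtain T where
      T: "T \<le> (step_cost + 10) * (n + 1) * (length w + n * act_max + 1)"
      "fst (run mach w T) = tm_accept mach" "\<forall>i. tape_of (run mach w T) (int i) = dig (s' 0) i"
      using s'(4) by blast
    have "(step_cost + 10) * (n + 1) * (length w + n * act_max + 1)
       \<le> (step_cost + 10) * (h (length w) + 1) * (length w + h (length w) * act_max + 1)"
      using s'(1) by (intro mult_le_mono add_le_mono) auto
    then have "T \<le> k * (length w + 1) ^ k" using T(1) k[of "length w"] by linarith
    then show "\<exists>t\<le>k * (length w + 1) ^ k. fst (run mach w t) = tm_accept mach \<and>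
        (\<forall>i<length (f w). tape_of (run mach w t) (int i) = f w ! i) \<and>
        tape_of (run mach w t) (int (length (f w))) = 0"
      using T s'(3) by (intro exI[of _ T]) (auto simp: dig_def)
  qed
  moreover have "S \<subseteq> {..<tm_nsyms mach}"
  proof
    fix x assume "x \<in> S"
    then have "x < B" using S by auto
    then show "x \<in> {..<tm_nsyms mach}" using B_le_syms by (simp add: mach_def)
  qed
  ultimately show ?thesis using wf_mach by blast
qed

section \<open>PSPACE-hardness\<close>

definition TT :: fml where "TT = Neg (Conj (Var 0) (Neg (Var 0)))"
definition Imp :: "fml \<Rightarrow> fml \<Rightarrow> fml" where "Imp a b = Neg (Conj a (Neg b))"
definition Ev :: "fml \<Rightarrow> fml" where "Ev a = Until_u TT a"
definition Alw :: "fml \<Rightarrow> fml" where "Alw a = Neg (Until_u TT (Neg a))"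
definition AndL :: "fml list \<Rightarrow> fml" where "AndL xs = foldr Conj xs TT"
definition OrL :: "fml list \<Rightarrow> fml" where "OrL xs = Neg (AndL (map Neg xs))"

lemma sat_TT [simp]: "sat \<xi> r TT" by (simp add: TT_def)
lemma sat_Imp [simp]: "sat \<xi> r (Imp a b) \<longleftrightarrow> (sat \<xi> r a \<longrightarrow> sat \<xi> r b)" by (simp add: Imp_def)
lemma sat_Ev [simp]: "sat \<xi> (i, j) (Ev a) \<longleftrightarrow> (\<exists>k. sat \<xi> (i, j + k) a)" by (simp add: Ev_def)
lemma sat_Alw [simp]: "sat \<xi> (i, j) (Alw a) \<longleftrightarrow> (\<forall>k. sat \<xi> (i, j + k) a)" by (simp add: Alw_def)
lemma sat_AndL [simp]: "sat \<xi> r (AndL xs) \<longleftrightarrow> (\<forall>x\<in>set xs. sat \<xi> r x)"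
  by (induction xs) (auto simp: AndL_def)
lemma sat_OrL [simp]: "sat \<xi> r (OrL xs) \<longleftrightarrow> (\<exists>x\<in>set xs. sat \<xi> r x)" by (auto simp: OrL_def)
lemma sat_Next1_pow [simp]: "sat \<xi> (i, j) ((Next1 ^^ k) a) \<longleftrightarrow> sat \<xi> (i, j + k) a"
  by (induction k arbitrary: j) auto

lemma enc_AndL: "enc (AndL xs) = concat (map (\<lambda>x. 4 # enc x) xs) @ enc TT"
  by (induction xs) (auto simp: AndL_def)

lemma enc_Next1_pow: "enc ((Next1 ^^ k) a) = replicate k 2 @ enc a"
  by (induction k) auto

declare bin.simps [simp del]

lemma bin_alphabet: "set (bin n) \<subseteq> {8, 9}"
proof (induction n rule: bin.induct)
  case (1 n)
  show ?case
  proof (cases "n < 2")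
    case True
    then have "n = 0 \<or> n = 1" by auto
    then show ?thesis by (subst bin.simps) auto
  next
    case False
    have "set (bin (n div 2)) \<subseteq> {8, 9}" using 1 False by simp
    moreover have "8 + n mod 2 \<in> {8, 9}" by auto
    ultimately show ?thesis using False by (subst bin.simps) simp
  qed
qed

lemma enc_alphabet: "set (enc \<phi>) \<subseteq> {1..9}"
proof (induction \<phi>)
  case (Var n)
  then show ?case using bin_alphabet[of n] by auto
qed auto

lemma enc_pos: "a \<in> set (enc \<phi>) \<Longrightarrow> 0 < a \<and> a < 10"
  using enc_alphabet[of \<phi>] by fastforce

text \<open>Numerals do not announce their end. Unique decoding rests on what follows them: a token
  below 8, or the end of the word.\<close>

lemma bin_inj_prefix:
  "bin m @ xs = bin n @ ys \<Longrightarrow> (xs = [] \<or> hd xs < 8) \<Longrightarrow> (ys = [] \<or> hd ys < 8) \<Longrightarrow> m = n \<and> xs = ys"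
proof (induction m arbitrary: n rule: less_induct)
  case (less m)
  have hd8: "bin k @ zs \<noteq> []" "8 \<le> hd (bin k @ zs)" for k zs by (subst bin.simps, simp)+
  have m: "bin m = (if m < 2 then [8 + m] else (8 + m mod 2) # bin (m div 2))" by (rule bin.simps)
  have n: "bin n = (if n < 2 then [8 + n] else (8 + n mod 2) # bin (n div 2))" by (rule bin.simps)
  show ?case
  proof (cases "m < 2")
    case True
    show ?thesis
    proof (cases "n < 2")
      case False
      then have "xs = bin (n div 2) @ ys" using less.prems(1) m n True by simp
      then show ?thesis using hd8[of "n div 2" ys] less.prems(2) by auto
    qed (use True less.prems m n in auto)
  next
    case F: False
    show ?thesis
    proof (cases "n < 2")
      case True
      then have "ys = bin (m div 2) @ xs" using less.prems(1) m n F by simp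
      then show ?thesis using hd8[of "m div 2" xs] less.prems(3) by auto
    next
      case False
      then have "m mod 2 = n mod 2" "bin (m div 2) @ xs = bin (n div 2) @ ys" using less.prems(1) m n F by auto
      then have "m div 2 = n div 2 \<and> xs = ys" using less.IH[of "m div 2" "n div 2"] less.prems F by simp
      then show ?thesis using \<open>m mod 2 = n mod 2\<close> by (metis div_mult_mod_eq)
    qed
  qed
qed

lemma hd_enc: "enc \<phi> \<noteq> []" "hd (enc \<phi> @ xs) < 8"
  by (cases \<phi>; simp)+

lemma enc_inj_prefix:
  "enc \<phi> @ xs = enc \<psi> @ ys \<Longrightarrow> (xs = [] \<or> hd xs < 8) \<Longrightarrow> (ys = [] \<or> hd ys < 8) \<Longrightarrow> \<phi> = \<psi> \<and> xs = ys"
proof (induction \<phi> arbitrary: \<psi> xs ys)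
  case (Var m)
  obtain n where \<psi>: "\<psi> = Var n" using Var.prems(1) by (cases \<psi>) simp_all
  then show ?case using bin_inj_prefix[of m xs n ys] Var.prems by simp
next
  case (Neg \<phi>)
  obtain c where \<psi>: "\<psi> = Neg c" using Neg.prems(1) by (cases \<psi>) simp_all
  then show ?case using Neg.IH[of xs c ys] Neg.prems by simp
next
  case (Next1 \<phi>)
  obtain c where \<psi>: "\<psi> = Next1 c" using Next1.prems(1) by (cases \<psi>) simp_all
  then show ?case using Next1.IH[of xs c ys] Next1.prems by simp
next
  case (NextW \<phi>)
  obtain c where \<psi>: "\<psi> = NextW c" using NextW.prems(1) by (cases \<psi>) simp_all
  then show ?case using NextW.IH[of xs c ys] NextW.prems by simp
next
  case (Conj a b)
  obtain c d where \<psi>: "\<psi> = Conj c d" using Conj.prems(1) by (cases \<psi>) simp_all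
  have "a = c \<and> enc b @ xs = enc d @ ys" by (rule Conj.IH(1)) (use Conj.prems \<psi> hd_enc in simp_all)
  then show ?case using Conj.IH(2)[of xs d ys] Conj.prems \<psi> by simp
next
  case (Until_u a b)
  obtain c d where \<psi>: "\<psi> = Until_u c d" using Until_u.prems(1) by (cases \<psi>) simp_all
  have "a = c \<and> enc b @ xs = enc d @ ys" by (rule Until_u.IH(1)) (use Until_u.prems \<psi> hd_enc in simp_all)
  then show ?case using Until_u.IH(2)[of xs d ys] Until_u.prems \<psi> by simp
next
  case (Until_U a b)
  obtain c d where \<psi>: "\<psi> = Until_U c d" using Until_U.prems(1) by (cases \<psi>) simp_all
  have "a = c \<and> enc b @ xs = enc d @ ys" by (rule Until_U.IH(1)) (use Until_U.prems \<psi> hd_enc in simp_all)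
  then show ?case using Until_U.IH(2)[of xs d ys] Until_U.prems \<psi> by simp
qed

lemma enc_inj: "enc \<phi> = enc \<psi> \<longleftrightarrow> \<phi> = \<psi>"
  using enc_inj_prefix[of \<phi> "[]" \<psi> "[]"] by auto

section \<open>Computation histories of a space-bounded machine\<close>

type_synonym cell = "nat \<times> nat option"

definition cell_var :: "cell \<Rightarrow> fml" where
  "cell_var c = Var (prod_encode (fst c, case snd c of None \<Rightarrow> 0 | Some q \<Rightarrow> Suc q))"

definition cell_model :: "(nat \<Rightarrow> cell) \<Rightarrow> model" where
  "cell_model X i j v \<longleftrightarrow> Var v = cell_var (X j)"

lemma cell_var_inj: "cell_var c = cell_var d \<longleftrightarrow> c = d"
  by (cases c; cases d) (auto simp: cell_var_def split: option.splits)

lemma sat_cell_model: "sat (cell_model X) (i, j) (cell_var c) \<longleftrightarrow> X j = c"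
proof -
  have "cell_var c = Var (prod_encode (fst c, case snd c of None \<Rightarrow> 0 | Some q \<Rightarrow> Suc q))"
    by (simp add: cell_var_def)
  then have "sat (cell_model X) (i, j) (cell_var c) \<longleftrightarrow> cell_var c = cell_var (X j)"
    by (simp add: cell_model_def)
  then show ?thesis using cell_var_inj by auto
qed

definition cell_at :: "config \<Rightarrow> int \<Rightarrow> cell" where
  "cell_at c i = (fst (snd c) i, if snd (snd c) = i then Some (fst c) else None)"

locale space_machine =
  fixes M :: tm and k :: nat and S :: "nat set" and L :: "nat list set"
  assumes wfM: "wf_tm M" and SM: "S \<subseteq> {..<tm_nsyms M}" and alphS: "alphabet S"
    and dec: "decides_in_space M S L (\<lambda>n. k * (n + 1) ^ k)"
begin

definition moves :: "move \<Rightarrow> cell \<Rightarrow> nat option" where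
  "moves d x = (case snd x of None \<Rightarrow> None | Some q \<Rightarrow>
     if q \<noteq> tm_accept M \<and> q \<noteq> tm_reject M \<and> snd (snd (tm_delta M q (fst x))) = d
     then Some (fst (tm_delta M q (fst x))) else None)"

text \<open>The classical window rule: a head reaches the middle cell only from a neighbour. The
  outer cells enter only through their heads, so a wrong but headless neighbour does no harm; this
  is what happens at the ends of configurations.\<close>

definition next_cell :: "cell \<Rightarrow> cell \<Rightarrow> cell \<Rightarrow> cell" where
  "next_cell x y z = (case snd y of
     Some q \<Rightarrow> if q = tm_accept M \<or> q = tm_reject M then y
       else (fst (snd (tm_delta M q (fst y))), moves Stay y)
   | None \<Rightarrow> (fst y, case moves Right x of Some q \<Rightarrow> Some q | None \<Rightarrow> moves Left z))"

lemma next_cell_step: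
  "next_cell (cell_at c (i - 1)) (cell_at c i) (cell_at c (i + 1)) = cell_at (step M c) i"
proof -
  obtain q T h where c: "c = (q, T, h)" by (cases c)
  obtain q' a d where d: "tm_delta M q (T h) = (q', a, d)" by (cases "tm_delta M q (T h)")
  show ?thesis
  proof (cases "halted M c")
    case True
    then show ?thesis unfolding c by (auto simp: step_def halted_def next_cell_def cell_at_def moves_def)
  next
    case False
    then have q: "q \<noteq> tm_accept M" "q \<noteq> tm_reject M" by (auto simp: c halted_def)
    have st: "step M (q, T, h) = (q', T(h := a), h + move_off d)" using False d by (simp add: step_def c)
    consider "i = h" | "i = h + 1" | "i = h - 1" | "i \<noteq> h" "i \<noteq> h + 1" "i \<noteq> h - 1" by blast
    then show ?thesis
    proof cases
      case 1
      then show ?thesis using q d unfolding c by (cases d) (auto simp: st next_cell_def cell_at_def moves_def move_off_def)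
    next
      case 2
      then show ?thesis using q d unfolding c by (cases d) (auto simp: st next_cell_def cell_at_def moves_def move_off_def)
    next
      case 3
      then show ?thesis using q d unfolding c by (cases d) (auto simp: st next_cell_def cell_at_def moves_def move_off_def)
    next
      case 4
      then show ?thesis unfolding c by (cases d) (auto simp: st next_cell_def cell_at_def moves_def move_off_def)
    qed
  qed
qed

lemma next_cell_no_head_left: "snd x = None \<Longrightarrow> snd x' = None \<Longrightarrow> next_cell x y z = next_cell x' y z"
  by (cases "snd y") (auto simp: next_cell_def moves_def)

lemma next_cell_no_head_right: "snd z = None \<Longrightarrow> snd z' = None \<Longrightarrow> next_cell x y z = next_cell x y z'"
  by (cases "snd y") (auto simp: next_cell_def moves_def split: option.split)

definition cells :: "cell list" where
  "cells = List.product [0..<tm_nsyms M] (None # map Some [0..<tm_nstates M])"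

lemma cells_iff: "(a, q) \<in> set cells \<longleftrightarrow> a < tm_nsyms M \<and> (\<forall>p. q = Some p \<longrightarrow> p < tm_nstates M)"
  by (cases q) (auto simp: cells_def)

text \<open>One more than the space bound, so that the outermost cells of a configuration never
  carry the head.\<close>

definition margin :: "nat \<Rightarrow> nat" where
  "margin n = k * (n + 1) ^ k + 1"

text \<open>The empty input still yields one cell, a blank under the head.\<close>

definition input_cells :: "nat list \<Rightarrow> cell list" where
  "input_cells w = (hd0 w, Some (tm_start M)) # map (\<lambda>a. (a, None)) (tl w)"

text \<open>The first configuration followed by the first cell of the second one. A window
  determines the cell below its middle, \<open>width + 1\<close> instants after its start, so this
  many cells have to be given.\<close>

definition start_cells :: "nat list \<Rightarrow> cell list" where
  "start_cells w = replicate (margin (length w)) (0, None) @ input_cells w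
     @ replicate (margin (length w)) (0, None) @ [(0, None)]"

definition init_fml :: "cell list \<Rightarrow> fml" where
  "init_fml cs = foldr (\<lambda>c f. Conj (cell_var c) (Next1 f)) cs TT"

text \<open>The other conjuncts only force variables to be true. This one prevents a model from
  making an accepting cell true in addition to the cell of the history.\<close>

definition unique_fml :: fml where
  "unique_fml = AndL (map (\<lambda>(c, d). Imp (cell_var c) (Neg (cell_var d)))
     (filter (\<lambda>(c, d). c \<noteq> d) (List.product cells cells)))"

definition accept_fml :: fml where
  "accept_fml = OrL (map (\<lambda>a. cell_var (a, Some (tm_accept M))) [0..<tm_nsyms M])"

definition triples :: "(cell \<times> cell \<times> cell) list" where
  "triples = List.product cells (List.product cells cells)"

definition window :: "cell \<times> cell \<times> cell \<Rightarrow> fml" where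
  "window t = (case t of (x, y, z) \<Rightarrow>
     Conj (cell_var x) (Conj (Next1 (cell_var y)) (Next1 (Next1 (cell_var z)))))"

definition trans_fml :: "nat \<Rightarrow> fml" where
  "trans_fml N = AndL (map (\<lambda>t. Imp (window t)
     ((Next1 ^^ N) (cell_var (case t of (x, y, z) \<Rightarrow> next_cell x y z)))) triples)"

definition red_fml :: "nat list \<Rightarrow> fml" where
  "red_fml w = Conj (init_fml (start_cells w)) (Conj (Alw unique_fml) (Conj (Ev accept_fml)
     (Alw (trans_fml (length (start_cells w))))))"

lemma sat_init_fml: "sat \<xi> (i, j) (init_fml cs) \<longleftrightarrow> (\<forall>l<length cs. sat \<xi> (i, j + l) (cell_var (cs ! l)))"
proof (induction cs arbitrary: j)
  case (Cons c cs)
  then show ?case by (auto simp: init_fml_def nth_Cons less_Suc_eq_0_disj split: nat.split)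
qed (simp add: init_fml_def)

lemma sat_unique_fml:
  "sat \<xi> r unique_fml \<longleftrightarrow> (\<forall>c\<in>set cells. \<forall>d\<in>set cells. c \<noteq> d \<longrightarrow> sat \<xi> r (cell_var c) \<longrightarrow> \<not> sat \<xi> r (cell_var d))"
  by (auto simp: unique_fml_def)

lemma sat_trans_fml:
  "sat \<xi> (i, j) (trans_fml N) \<longleftrightarrow> (\<forall>x\<in>set cells. \<forall>y\<in>set cells. \<forall>z\<in>set cells.
     sat \<xi> (i, j) (cell_var x) \<longrightarrow> sat \<xi> (i, Suc j) (cell_var y) \<longrightarrow> sat \<xi> (i, Suc (Suc j)) (cell_var z) \<longrightarrow>
     sat \<xi> (i, j + N) (cell_var (next_cell x y z)))"
  by (auto simp: trans_fml_def triples_def window_def)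

definition width :: "nat list \<Rightarrow> nat" where
  "width w = 2 * margin (length w) + length (input_cells w)"

definition history :: "nat list \<Rightarrow> nat \<Rightarrow> cell" where
  "history w t = cell_at (run M w (t div width w)) (int (t mod width w) - int (margin (length w)))"

lemma length_start_cells: "length (start_cells w) = Suc (width w)"
  by (simp add: start_cells_def width_def)

lemma width_pos: "0 < width w" by (simp add: width_def margin_def)

lemma run_Suc: "run M w (Suc t) = step M (run M w t)"
  by (simp add: run_def)

lemma head_bound: "w \<in> lists S \<Longrightarrow> \<bar>head_pos (run M w t)\<bar> < int (margin (length w))"
proof -
  assume "w \<in> lists S"
  then have "\<bar>head_pos (run M w t)\<bar> \<le> int (k * (length w + 1) ^ k)"
    using dec unfolding decides_in_space_def by blast
  then show ?thesis by (simp add: margin_def)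
qed

lemma no_head_outside:
  assumes "w \<in> lists S" "int (margin (length w)) \<le> \<bar>i\<bar>"
  shows "snd (cell_at (run M w t) i) = None"
  using head_bound[OF assms(1), of t] assms(2) by (auto simp: cell_at_def head_pos_def)

lemma run_ok: "w \<in> lists S \<Longrightarrow> fst (run M w t) < tm_nstates M \<and> (\<forall>i. tape_of (run M w t) i < tm_nsyms M)"
proof (induction t)
  case 0
  have "w ! i < tm_nsyms M" if "i < length w" for i using 0 that SM by (auto simp: in_lists_conv_set)
  then show ?case using wfM by (auto simp: run_def init_config_def tape_of_def wf_tm_def)
next
  case (Suc t)
  obtain q T h where c: "run M w t = (q, T, h)" by (cases "run M w t")
  have q: "q < tm_nstates M" "\<forall>i. T i < tm_nsyms M" using Suc c by (auto simp: tape_of_def)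
  obtain q' a d where d: "tm_delta M q (T h) = (q', a, d)" by (cases "tm_delta M q (T h)")
  have "q' < tm_nstates M" "a < tm_nsyms M" using wfM q d unfolding wf_tm_def by (metis fst_conv snd_conv)+
  then show ?case unfolding run_Suc c using q d by (auto simp: step_def tape_of_def)
qed

lemma history_cells: "w \<in> lists S \<Longrightarrow> history w t \<in> set cells"
  using run_ok by (auto simp: history_def cell_at_def cells_iff tape_of_def)

text \<open>The window starting at \<open>t\<close> has its middle at \<open>t + 1\<close>, and the
  same cell of the next configuration is \<open>width\<close> later. At the first or last cell of a
  configuration the window reaches into the adjacent one; both the cell read there and the cell that
  ought to be read are headless, so the rule gives the same result.\<close>

lemma history_rec:
  assumes w: "w \<in> lists S"
  shows "history w (t + Suc (width w)) = next_cell (history w t) (history w (Suc t)) (history w (Suc (Suc t)))"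
proof -
  let ?N = "width w" and ?P = "int (margin (length w))"
  define j m where "j = Suc t div ?N" and "m = Suc t mod ?N"
  let ?c = "run M w j" and ?i = "int m - ?P"
  have N: "0 < ?N" "2 * margin (length w) + 1 \<le> ?N" by (auto simp: width_def margin_def input_cells_def)
  have mN: "m < ?N" using N by (simp add: m_def)
  have St: "Suc t = j * ?N + m" by (simp add: j_def m_def)
  have "(t + Suc ?N) div ?N = Suc j" "(t + Suc ?N) mod ?N = m"
    using N div_add_self2[of ?N "Suc t"] mod_add_self2[of "Suc t" ?N] by (simp_all add: j_def m_def)
  then have a: "history w (t + Suc ?N) = cell_at (step M ?c) ?i" by (simp add: history_def run_Suc)
  have b: "history w (Suc t) = cell_at ?c ?i" by (simp add: history_def j_def m_def)
  have l: "next_cell (history w t) y z = next_cell (cell_at ?c (?i - 1)) y z" for y z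
  proof (cases m)
    case 0
    then obtain j' where j': "j = Suc j'" using St by (cases j) auto
    have "t = (?N - 1) + j' * ?N" using St 0 N unfolding j' by simp
    then have "t mod ?N = (?N - 1) mod ?N" by (simp only: mod_mult_self1)
    then have "t mod ?N = ?N - 1" using N by simp
    then have "snd (history w t) = None" unfolding history_def using no_head_outside[OF w] N by simp
    moreover have "snd (cell_at ?c (?i - 1)) = None" using no_head_outside[OF w] 0 by simp
    ultimately show ?thesis by (rule next_cell_no_head_left)
  next
    case (Suc m')
    then have "t = j * ?N + m'" using St by simp
    then have "t div ?N = j" "t mod ?N = m'" using mN Suc by auto
    then show ?thesis using Suc by (simp add: history_def)
  qed
  have r: "next_cell x y (history w (Suc (Suc t))) = next_cell x y (cell_at ?c (?i + 1))" for x y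
  proof (cases "Suc m = ?N")
    case True
    then have "Suc (Suc t) = Suc j * ?N" using St by simp
    then have "Suc (Suc t) mod ?N = 0" by (simp only: mod_mult_self2_is_0)
    then have "snd (history w (Suc (Suc t))) = None" unfolding history_def using no_head_outside[OF w] by simp
    moreover have "snd (cell_at ?c (?i + 1)) = None" using no_head_outside[OF w] True N by simp
    ultimately show ?thesis by (rule next_cell_no_head_right)
  next
    case False
    then have "Suc (Suc t) = Suc m + j * ?N" "Suc m < ?N" using St mN by auto
    then have "Suc (Suc t) div ?N = j" "Suc (Suc t) mod ?N = Suc m"
      by (simp_all only: div_mult_self1 mod_mult_self1) (simp_all add: div_mult_self1)
    then show ?thesis by (simp add: history_def algebra_simps)
  qed
  show ?thesis unfolding a l b r next_cell_step ..
qed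

lemma history_start:
  assumes w: "w \<in> lists S" and l: "l < length (start_cells w)"
  shows "history w l = start_cells w ! l"
proof -
  let ?N = "width w" and ?P = "margin (length w)"
  have P0: "0 < ?P" by (simp add: margin_def)
  show ?thesis
  proof (cases "l = ?N")
    \<comment> \<open>The one given cell of the second configuration: the first step writes at cell
      0 only and the margin is positive, so it is still blank.\<close>
    case True
    have "history w l = cell_at (step M (init_config M w)) (- int ?P)"
      using True width_pos[of w] by (simp add: history_def run_def)
    also have "\<dots> = (0, None)"
    proof -
      have "fst (snd (step M (init_config M w))) (- int ?P) = 0"
        using P0 by (auto simp: step_def init_config_def split: prod.split)
      moreover have "snd (cell_at (step M (init_config M w)) (- int ?P)) = None"
        using no_head_outside[OF w, of "- int ?P" 1] by (simp add: run_def)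
      ultimately show ?thesis by (simp add: cell_at_def)
    qed
    finally show ?thesis using True by (simp add: start_cells_def width_def nth_append)
  next
    case False
    then have lN: "l < ?N" using l by (simp add: length_start_cells)
    then have h: "history w l = cell_at (init_config M w) (int l - int ?P)"
      by (simp add: history_def run_def)
    consider "l < ?P" | "?P \<le> l" "l < ?P + length (input_cells w)" | "?P + length (input_cells w) \<le> l" by linarith
    then show ?thesis
    proof cases
      case 1
      then show ?thesis unfolding h by (simp add: cell_at_def init_config_def start_cells_def nth_append)
    next
      case 2
      then obtain m where m: "l = ?P + m" using le_Suc_ex by blast
      have "m < length (input_cells w)" using 2 m by simp
      then have "start_cells w ! l = input_cells w ! m" unfolding m by (simp add: start_cells_def nth_append)
      moreover have "cell_at (init_config M w) (int m) = input_cells w ! m"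
        using \<open>m < length (input_cells w)\<close>
        by (cases w; cases m) (auto simp: input_cells_def cell_at_def init_config_def nat_add_distrib)
      ultimately show ?thesis unfolding h using m by simp
    next
      case 3
      then obtain m where m: "l = ?P + length (input_cells w) + m" using le_Suc_ex by blast
      have "m < ?P" using lN m by (simp add: width_def)
      then have "start_cells w ! l = (0, None)" unfolding m by (simp add: start_cells_def nth_append)
      moreover have "cell_at (init_config M w) (int (length (input_cells w) + m)) = (0, None)"
        by (cases w) (auto simp: input_cells_def cell_at_def init_config_def)
      ultimately show ?thesis unfolding h using m by simp
    qed
  qed
qed

lemma accepts_iff:
  assumes w: "w \<in> lists S"
  shows "w \<in> L \<longleftrightarrow> (\<exists>t. fst (run M w t) = tm_accept M)"
proof -
  obtain t where t: "halted M (run M w t)" "fst (run M w t) = tm_accept M \<longleftrightarrow> w \<in> L"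
    using dec w unfolding decides_in_space_def by blast
  have stay: "run M w (u + d) = run M w u" if "halted M (run M w u)" for u d
    using that by (induction d) (auto simp: run_Suc step_def)
  have "fst (run M w t) = tm_accept M" if a: "fst (run M w u) = tm_accept M" for u
  proof -
    have "halted M (run M w u)" using a by (simp add: halted_def)
    then have "run M w (u + t) = run M w u" "run M w (t + u) = run M w t" using stay t(1) by blast+
    then show ?thesis using a by (simp add: add.commute)
  qed
  then show ?thesis using t(2) by blast
qed

lemma accept_lt: "tm_accept M < tm_nstates M" using wfM by (simp add: wf_tm_def)

text \<open>In any model the variables of the history hold along the row, by induction over windows,
  and uniqueness identifies the accepting cell with a cell of the history. Conversely the history
  itself is a model. The formula contains only \<open>[1]\<close> and \<open>u\<close>, so it never
  leaves the row in which it is evaluated.\<close>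

theorem red_fml_correct:
  assumes w: "w \<in> lists S"
  shows "satisfiable (red_fml w) \<longleftrightarrow> w \<in> L"
proof
  assume "satisfiable (red_fml w)"
  then obtain \<xi> i j where s: "sat \<xi> (i, j) (red_fml w)" unfolding satisfiable_def by (metis surj_pair)
  let ?h = "history w" and ?N = "length (start_cells w)"
  have ini: "\<forall>l<?N. sat \<xi> (i, j + l) (cell_var (?h l))"
    using s history_start[OF w] by (simp add: red_fml_def sat_init_fml)
  have tr: "\<forall>t. sat \<xi> (i, j + t) (trans_fml ?N)" using s by (simp add: red_fml_def)
  have all: "sat \<xi> (i, j + t) (cell_var (?h t))" for t
  proof (induction t rule: less_induct)
    case (less t)
    show ?case
    proof (cases "t < ?N")
      case False
      then obtain u where u: "t = u + ?N" by (metis add.commute le_Suc_ex not_less)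
      have N2: "2 < ?N" by (simp add: start_cells_def margin_def input_cells_def)
      have "sat \<xi> (i, j + u) (cell_var (?h u))" "sat \<xi> (i, Suc (j + u)) (cell_var (?h (Suc u)))"
        "sat \<xi> (i, Suc (Suc (j + u))) (cell_var (?h (Suc (Suc u))))"
      proof -
        have "u < t" "Suc u < t" "Suc (Suc u) < t" using u N2 by linarith+
        from less[OF this(1)] less[OF this(2)] less[OF this(3)] show
          "sat \<xi> (i, j + u) (cell_var (?h u))" "sat \<xi> (i, Suc (j + u)) (cell_var (?h (Suc u)))"
          "sat \<xi> (i, Suc (Suc (j + u))) (cell_var (?h (Suc (Suc u))))" by (simp_all only: add_Suc_right)
      qed
      then have "sat \<xi> (i, j + u + ?N) (cell_var (next_cell (?h u) (?h (Suc u)) (?h (Suc (Suc u)))))"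
        using tr[rule_format, of u] history_cells[OF w] unfolding sat_trans_fml by blast
      then show ?thesis using history_rec[OF w, of u] u by (simp add: length_start_cells add.assoc)
    qed (use ini in simp)
  qed
  obtain t a where t: "a < tm_nsyms M" "sat \<xi> (i, j + t) (cell_var (a, Some (tm_accept M)))"
    using s by (auto simp: red_fml_def accept_fml_def)
  have "\<forall>c\<in>set cells. \<forall>d\<in>set cells. c \<noteq> d \<longrightarrow> sat \<xi> (i, j + t) (cell_var c) \<longrightarrow> \<not> sat \<xi> (i, j + t) (cell_var d)"
    using s by (simp add: red_fml_def sat_unique_fml)
  moreover have "(a, Some (tm_accept M)) \<in> set cells" using t(1) accept_lt by (simp add: cells_iff)
  ultimately have "?h t = (a, Some (tm_accept M))" using all[of t] t(2) history_cells[OF w, of t] by blast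
  then have "fst (run M w (t div width w)) = tm_accept M"
    by (auto simp: history_def cell_at_def split: if_splits)
  then show "w \<in> L" using accepts_iff[OF w] by blast
next
  assume "w \<in> L"
  then obtain t where t: "fst (run M w t) = tm_accept M" using accepts_iff[OF w] by blast
  let ?h = "history w" and ?N = "length (start_cells w)" and ?P = "margin (length w)"
  let ?\<xi> = "cell_model ?h"
  define m where "m = nat (head_pos (run M w t) + int ?P)"
  have m: "int m - int ?P = head_pos (run M w t)" "m < width w"
    using head_bound[OF w, of t] by (auto simp: m_def width_def)
  have "?h (t * width w + m) = (tape_of (run M w t) (head_pos (run M w t)), Some (tm_accept M))"
    using m t by (simp add: history_def cell_at_def tape_of_def head_pos_def)
  then have acc: "sat ?\<xi> (0, 0) (Ev accept_fml)"
    using run_ok[OF w, of t]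
    by (auto simp: accept_fml_def sat_cell_model intro!: exI[of _ "t * width w + m"])
  have "sat ?\<xi> (0, 0) (init_fml (start_cells w))"
    using history_start[OF w] by (simp add: sat_init_fml sat_cell_model)
  moreover have "sat ?\<xi> (0, 0) (Alw unique_fml)" by (simp add: sat_unique_fml sat_cell_model)
  moreover have "sat ?\<xi> (0, 0) (Alw (trans_fml ?N))"
    using history_rec[OF w] by (simp add: sat_trans_fml sat_cell_model length_start_cells)
  ultimately have "sat ?\<xi> (0, 0) (red_fml w)" using acc by (simp add: red_fml_def)
  then show "satisfiable (red_fml w)" unfolding satisfiable_def by blast
qed

end

section \<open>A polynomial-time program that writes the formula\<close>

definition copy_act :: "nat \<Rightarrow> nat \<Rightarrow> act list" where
  "copy_act r a = (if a = 0 then [] else [Push r a])"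

definition move_reg :: "nat \<Rightarrow> nat \<Rightarrow> com" where
  "move_reg r r' = WHILE (\<lambda>t. t r \<noteq> 0) (Do (\<lambda>t. copy_act r' (t r) @ [Pop r]))"

definition emit :: "nat list \<Rightarrow> act list" where
  "emit xs = map (Push 0) xs"

lemma do_acts_emit [simp]: "do_acts (emit xs) s = s(0 := rev xs @ s 0)"
  by (induction xs arbitrary: s) (auto simp: emit_def)

lemma set_emit: "a \<in> set (emit xs) \<longleftrightarrow> (\<exists>x\<in>set xs. a = Push 0 x)"
  by (auto simp: emit_def)

lemma tops_drop: "s r = drop i xs \<Longrightarrow> i < length xs \<Longrightarrow> tops s r = xs ! i"
  by (simp add: tops_def Cons_nth_drop_Suc[symmetric])

lemma runt_drain:
  assumes "\<And>i. i < length xs \<Longrightarrow> runt c N (f i) (f (Suc i))"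
    and "\<And>i. i \<le> length xs \<Longrightarrow> f i r = drop i xs" and "\<forall>a\<in>set xs. 0 < a"
    and "s = f 0" "s' = f (length xs)"
  shows "runt (WHILE (\<lambda>t. t r \<noteq> 0) c) (length xs * (N + 2) + 1) s s'"
proof (rule runt_WHILE_iter[where f = f])
  fix i assume i: "i < length xs"
  then have "tops (f i) r = xs ! i" using tops_drop[of "f i" r i xs] assms(2) by simp
  moreover have "0 < xs ! i" using assms(3) i by simp
  ultimately show "tops (f i) r \<noteq> 0 \<and> runt c N (f i) (f (Suc i))" using assms(1) i by simp
qed (use assms in \<open>auto simp: tops_def\<close>)

lemma runt_move_reg:
  assumes "r \<noteq> r'" "\<forall>a\<in>set (s r). 0 < a" "s' = s(r := [], r' := rev (s r) @ s r')"
  shows "runt (move_reg r r') (length (s r) * 3 + 1) s s'"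
proof -
  define f where "f i = s(r := drop i (s r), r' := rev (take i (s r)) @ s r')" for i
  have "runt (Do (\<lambda>t. copy_act r' (t r) @ [Pop r])) 1 (f i) (f (Suc i))" if i: "i < length (s r)" for i
  proof (rule runt_Do)
    have "tops (f i) r = s r ! i" using tops_drop[of "f i" r i "s r"] i assms(1) by (simp add: f_def)
    moreover have "s r ! i \<noteq> 0" using assms(2) i by auto
    ultimately show "f (Suc i) = do_acts (copy_act r' (tops (f i) r) @ [Pop r]) (f i)"
      using assms(1) i by (auto simp: f_def copy_act_def take_Suc_conv_app_nth drop_Suc tl_drop fun_eq_iff)
  qed
  then have "runt (move_reg r r') (length (s r) * (1 + 2) + 1) s s'"
    unfolding move_reg_def using assms
    by (intro runt_drain[where f = f]) (auto simp: f_def)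
  then show ?thesis by (rule runt_mono) simp
qed

definition una :: "nat \<Rightarrow> nat list" where
  "una n = replicate n 2"

lemma una_simps [simp]: "length (una n) = n" "tl (una n) = una (n - 1)" "drop i (una n) = una (n - i)"
  "2 # una n = una (Suc n)" "rev (una n) = una n" "una 0 = []" "una m @ una n = una (m + n)"
  "\<forall>a\<in>set (una n). 0 < a"
  by (auto simp: una_def replicate_add)

text \<open>Register 1 stays unused: the simplifier would rewrite the index 1 to \<open>Suc 0\<close>.\<close>

definition st :: "nat list \<Rightarrow> nat list \<Rightarrow> nat list \<Rightarrow> nat list \<Rightarrow> nat list \<Rightarrow> nat list \<Rightarrow> nat list \<Rightarrow> regs" where
  "st a b c d e f g = (\<lambda>_. [])(0 := a, 2 := b, 3 := c, 4 := d, 5 := e, 6 := f, 7 := g)"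

lemma st_read [simp]:
  "st a b c d e f g 0 = a" "st a b c d e f g 2 = b" "st a b c d e f g 3 = c" "st a b c d e f g 4 = d"
  "st a b c d e f g 5 = e" "st a b c d e f g 6 = f" "st a b c d e f g 7 = g"
  by (simp_all add: st_def)

lemma st_upd [simp]:
  "(st a b c d e f g)(0 := x) = st x b c d e f g"
  "(st a b c d e f g)(2 := x) = st a x c d e f g"
  "(st a b c d e f g)(3 := x) = st a b x d e f g"
  "(st a b c d e f g)(4 := x) = st a b c x e f g"
  "(st a b c d e f g)(5 := x) = st a b c d x f g"
  "(st a b c d e f g)(6 := x) = st a b c d e x g"
  "(st a b c d e f g)(7 := x) = st a b c d e f x"
  by (auto simp: st_def fun_eq_iff)

lemma tops_st [simp]:
  "tops (st a b c d e f g) 0 = hd0 a" "tops (st a b c d e f g) 2 = hd0 b" "tops (st a b c d e f g) 3 = hd0 c"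
  "tops (st a b c d e f g) 4 = hd0 d" "tops (st a b c d e f g) 5 = hd0 e" "tops (st a b c d e f g) 6 = hd0 f"
  "tops (st a b c d e f g) 7 = hd0 g"
  by (simp_all add: tops_def)

lemma hd0_drop: "i < length xs \<Longrightarrow> hd0 (drop i xs) = xs ! i"
  by (simp add: Cons_nth_drop_Suc[symmetric])

text \<open>One factor \<open>n + 1\<close> of the space bound: the unary number on stack 4 is
  multiplied by it, each unit contributing one plus a pass over the word, which travels to stack 3
  and back.\<close>

definition mul_prog :: com where
  "mul_prog = Seq (WHILE (\<lambda>t. t 4 \<noteq> 0) (Seq (Do (\<lambda>_. [Pop 4, Push 5 2]))
      (Seq (WHILE (\<lambda>t. t 2 \<noteq> 0) (Do (\<lambda>t. copy_act 3 (t 2) @ [Pop 2, Push 5 2]))) (move_reg 3 2))))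
    (move_reg 5 4)"

lemma runt_mul_prog:
  assumes w: "\<forall>a\<in>set w. 0 < a"
  shows "runt mul_prog (x * (9 * length w + 12) + 3) (st a w [] (una x) [] f g) (st a w [] (una (x * (length w + 1))) [] f g)"
proof -
  let ?n = "length w"
  define F where "F i = st a w [] (una (x - i)) (una (i * (?n + 1))) f g" for i
  have body: "runt (Seq (Do (\<lambda>_. [Pop 4, Push 5 2]))
      (Seq (WHILE (\<lambda>t. t 2 \<noteq> 0) (Do (\<lambda>t. copy_act 3 (t 2) @ [Pop 2, Push 5 2]))) (move_reg 3 2)))
      (6 * ?n + 5) (F i) (F (Suc i))" if i: "i < x" for i
  proof -
    define G where "G j = st a (drop j w) (rev (take j w)) (una (x - Suc i)) (una (i * (?n + 1) + 1 + j)) f g" for j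
    have 1: "runt (Do (\<lambda>_. [Pop 4, Push 5 2])) 1 (F i) (G 0)"
      by (rule runt_Do) (simp add: F_def G_def)
    have "runt (Do (\<lambda>t. copy_act 3 (t 2) @ [Pop 2, Push 5 2])) 1 (G j) (G (Suc j))" if j: "j < ?n" for j
    proof (rule runt_Do)
      have "w ! j \<noteq> 0" using w j by auto
      then show "G (Suc j) = do_acts (copy_act 3 (tops (G j) 2) @ [Pop 2, Push 5 2]) (G j)"
        using j by (simp add: G_def hd0_drop copy_act_def take_Suc_conv_app_nth drop_Suc tl_drop)
    qed
    then have 2: "runt (WHILE (\<lambda>t. t 2 \<noteq> 0) (Do (\<lambda>t. copy_act 3 (t 2) @ [Pop 2, Push 5 2]))) (?n * (1 + 2) + 1) (G 0) (G ?n)"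
      using w by (intro runt_drain[where f = G]) (auto simp: G_def)
    have 3: "runt (move_reg 3 2) (?n * 3 + 1) (G ?n) (F (Suc i))"
    proof -
      have "G ?n = st a [] (rev w) (una (x - Suc i)) (una (Suc i * (?n + 1))) f g" by (simp add: G_def algebra_simps)
      then show ?thesis using runt_move_reg[of 3 2 "G ?n" "F (Suc i)"] w by (simp only: F_def) simp
    qed
    show ?thesis by (rule runt_mono[OF runt_Seq[OF 1 runt_Seq[OF 2 3]]]) simp
  qed
  have A: "runt (WHILE (\<lambda>t. t 4 \<noteq> 0) (Seq (Do (\<lambda>_. [Pop 4, Push 5 2]))
      (Seq (WHILE (\<lambda>t. t 2 \<noteq> 0) (Do (\<lambda>t. copy_act 3 (t 2) @ [Pop 2, Push 5 2]))) (move_reg 3 2))))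
      (length (una x) * (6 * ?n + 5 + 2) + 1) (st a w [] (una x) [] f g) (F x)"
    by (rule runt_drain[where f = F and xs = "una x"]) (use body in \<open>auto simp: F_def\<close>)
  have B: "runt (move_reg 5 4) (x * (?n + 1) * 3 + 1) (F x) (st a w [] (una (x * (?n + 1))) [] f g)"
    using runt_move_reg[of 5 4 "F x"] by (simp add: F_def)
  show ?thesis unfolding mul_prog_def
    by (rule runt_mono[OF runt_Seq[OF A B]]) (simp add: algebra_simps)
qed

primrec pow_prog :: "nat \<Rightarrow> com" where
  "pow_prog 0 = SKIP"
| "pow_prog (Suc j) = Seq (pow_prog j) mul_prog"

primrec pow_time :: "nat \<Rightarrow> nat \<Rightarrow> nat \<Rightarrow> nat" where
  "pow_time x 0 n = 0"
| "pow_time x (Suc j) n = pow_time x j n + (x * (n + 1) ^ j * (9 * n + 12) + 3) + 1"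

lemma runt_pow_prog:
  assumes w: "\<forall>a\<in>set w. 0 < a"
  shows "runt (pow_prog j) (pow_time x j (length w)) (st a w [] (una x) [] f g)
    (st a w [] (una (x * (length w + 1) ^ j)) [] f g)"
proof (induction j)
  case 0 then show ?case using runt_SKIP by simp
next
  case (Suc j)
  have "x * (length w + 1) ^ j * (length w + 1) = x * (length w + 1) ^ Suc j"
    by (simp only: power_Suc2 mult.assoc)
  then show ?case using runt_Seq[OF Suc runt_mul_prog[OF w]] by (simp only: pow_prog.simps pow_time.simps)
qed

lemma polyb_pow_time: "polyb (pow_time x j)"
proof (induction j)
  case (Suc j)
  have "polyb (\<lambda>n. pow_time x j n + (x * (n + 1) ^ j * (9 * n + 12) + 3) + 1)"
    using Suc by (intro polyb_add polyb_mult polyb_const polyb_power polyb_id) auto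
  then show ?case by simp
qed (simp add: polyb_const)

lemma concat_replicate_snoc: "concat (replicate (Suc n) xs) = concat (replicate n xs) @ xs"
  by (induction n) auto

context space_machine
begin

definition cell_str :: "cell \<Rightarrow> nat list" where
  "cell_str c = 4 # enc (cell_var c) @ [2]"

definition const_str :: "nat list" where
  "const_str = enc TT @ 4 # enc (Alw unique_fml) @ 4 # enc (Ev accept_fml) @ [1, 5] @ enc TT @ [1]"

definition items :: "(nat list \<times> nat list) list" where
  "items = map (\<lambda>t. (4 # 1 # 4 # enc (window t) @ [1],
     enc (cell_var (case t of (x, y, z) \<Rightarrow> next_cell x y z)))) triples"

definition items_str :: "nat \<Rightarrow> (nat list \<times> nat list) list \<Rightarrow> nat list" where
  "items_str N xs = concat (map (\<lambda>(p, q). p @ replicate N 2 @ q) xs)"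

text \<open>The formula cut in the order of writing. \<open>const_str\<close> begins with the
  \<open>TT\<close> that closes the initial conjunction and stops inside the last
  \<open>Alw\<close>; only the cells before it and the shifts in the items after it depend on the
  input.\<close>

lemma enc_red_fml: "enc (red_fml w) = 4 # concat (map cell_str (start_cells w)) @ const_str
    @ items_str (length (start_cells w)) items @ enc TT"
proof -
  have i: "enc (init_fml cs) = concat (map cell_str cs) @ enc TT" for cs
    by (induction cs) (auto simp: init_fml_def cell_str_def)
  have t: "enc (trans_fml N) = items_str N items @ enc TT" for N
    unfolding trans_fml_def enc_AndL items_str_def items_def map_map
    by (simp add: comp_def Imp_def enc_Next1_pow)
  show ?thesis by (simp add: red_fml_def i t const_str_def Alw_def)
qed

text \<open>Every unit of the counter becomes a token 2, that is one \<open>Next1\<close>; stack 7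
  saves the counter for the next item.\<close>

definition rep_prog :: com where
  "rep_prog = Seq (WHILE (\<lambda>t. t 6 \<noteq> 0) (Do (\<lambda>_. [Push 0 2, Push 7 2, Pop 6]))) (move_reg 7 6)"

fun items_prog :: "(nat list \<times> nat list) list \<Rightarrow> com" where
  "items_prog [] = SKIP"
| "items_prog ((p, q) # xs) = Seq (Do (\<lambda>_. emit p)) (Seq rep_prog (Seq (Do (\<lambda>_. emit q)) (items_prog xs)))"

lemma runt_rep_prog:
  "runt rep_prog (6 * N + 3) (st a [] [] [] [] (una N) []) (st (replicate N 2 @ a) [] [] [] [] (una N) [])"
proof -
  define F where "F i = st (replicate i 2 @ a) [] [] [] [] (una (N - i)) (una i)" for i
  have F: "runt (Do (\<lambda>_. [Push 0 2, Push 7 2, Pop 6])) 1 (F i) (F (Suc i))" for i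
    by (rule runt_Do) (simp add: F_def)
  have 1: "runt (WHILE (\<lambda>t. t 6 \<noteq> 0) (Do (\<lambda>_. [Push 0 2, Push 7 2, Pop 6]))) (length (una N) * (1 + 2) + 1)
      (st a [] [] [] [] (una N) []) (F N)"
    by (rule runt_drain[where f = F and xs = "una N"]) (rule F, simp_all add: F_def)
  have 2: "runt (move_reg 7 6) (N * 3 + 1) (F N) (st (replicate N 2 @ a) [] [] [] [] (una N) [])"
    using runt_move_reg[of 7 6 "F N"] by (simp add: F_def)
  show ?thesis unfolding rep_prog_def by (rule runt_mono[OF runt_Seq[OF 1 2]]) simp
qed

lemma runt_items_prog:
  "runt (items_prog xs) (length xs * (6 * N + 8)) (st a [] [] [] [] (una N) [])
     (st (rev (items_str N xs) @ a) [] [] [] [] (una N) [])"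
proof (induction xs arbitrary: a)
  case Nil then show ?case using runt_SKIP by (simp add: items_str_def)
next
  case (Cons x xs)
  obtain p q where x: "x = (p, q)" by (cases x)
  have 1: "runt (Do (\<lambda>_. emit p)) 1 (st a [] [] [] [] (una N) []) (st (rev p @ a) [] [] [] [] (una N) [])"
    by (rule runt_Do) simp
  have 2: "runt (Do (\<lambda>_. emit q)) 1 (st (replicate N 2 @ rev p @ a) [] [] [] [] (una N) [])
    (st (rev q @ replicate N 2 @ rev p @ a) [] [] [] [] (una N) [])"
    by (rule runt_Do) simp
  have e: "rev (items_str N xs) @ rev q @ replicate N 2 @ rev p @ a = rev (items_str N (x # xs)) @ a"
    by (simp add: items_str_def x)
  have "runt (items_prog (x # xs)) (1 + (6 * N + 3 + (1 + length xs * (6 * N + 8) + 1) + 1) + 1) (st a [] [] [] [] (una N) [])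
     (st (rev (items_str N xs) @ rev q @ replicate N 2 @ rev p @ a) [] [] [] [] (una N) [])"
    unfolding x items_prog.simps
    by (rule runt_Seq[OF 1 runt_Seq[OF runt_rep_prog runt_Seq[OF 2 Cons]]])
  then show ?case unfolding e by (rule runt_mono) simp
qed

text \<open>Stack 4 counts down the left margin, stack 5 keeps a copy for the right margin, and
  stack 6 counts all cells written, which is the shift of the transition formulas. Pushing symbols
  in reading order leaves the reversed word, as required of the output.\<close>

definition red_prog :: com where
  "red_prog =
    Seq (move_reg 0 2)
   (Seq (Do (\<lambda>_. replicate k (Push 4 2)))
   (Seq (pow_prog k)
   (Seq (Do (\<lambda>_. Push 4 2 # emit [4]))
   (Seq (WHILE (\<lambda>t. t 4 \<noteq> 0) (Do (\<lambda>_. emit (cell_str (0, None)) @ [Push 6 2, Push 5 2, Pop 4])))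
   (Seq (Do (\<lambda>t. emit (cell_str (t 2, Some (tm_start M))) @ [Push 6 2, Pop 2]))
   (Seq (WHILE (\<lambda>t. t 2 \<noteq> 0) (Do (\<lambda>t. emit (cell_str (t 2, None)) @ [Push 6 2, Pop 2])))
   (Seq (WHILE (\<lambda>t. t 5 \<noteq> 0) (Do (\<lambda>_. emit (cell_str (0, None)) @ [Push 6 2, Pop 5])))
   (Seq (Do (\<lambda>_. emit (cell_str (0, None)) @ Push 6 2 # emit const_str))
   (Seq (items_prog items)
   (Seq (Do (\<lambda>_. emit (enc TT)))
   (WHILE (\<lambda>t. t 6 \<noteq> 0) (Do (\<lambda>_. [Pop 6])))))))))))))"

definition red_time :: "nat \<Rightarrow> nat" where
  "red_time n = 100 + 6 * n + pow_time k k n + 6 * margin n + (length items + 1) * (6 * (2 * margin n + n + 2) + 8)"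

lemma do_acts_replicate_Push: "do_acts (replicate n (Push r a)) s = s(r := replicate n a @ s r)"
  by (induction n arbitrary: s) (auto simp: replicate_app_Cons_same)

lemma runt_red_prog:
  assumes w: "\<forall>a\<in>set w. 0 < a"
  shows "runt red_prog (red_time (length w)) (init_regs w) (st (rev (enc (red_fml w))) [] [] [] [] [] [])"
proof -
  let ?n = "length w" and ?P = "margin (length w)" and ?b = "cell_str (0, None)"
  let ?N = "length (start_cells w)"
  have i: "init_regs w = st (rev w) [] [] [] [] [] []" by (auto simp: init_regs_def st_def fun_eq_iff)
  have 1: "runt (move_reg 0 2) (?n * 3 + 1) (init_regs w) (st [] w [] [] [] [] [])"
    unfolding i using runt_move_reg[of 0 2 "st (rev w) [] [] [] [] [] []"] w by simp
  have 2: "runt (Do (\<lambda>_. replicate k (Push 4 2))) 1 (st [] w [] [] [] [] []) (st [] w [] (una k) [] [] [])"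
    by (rule runt_Do) (simp only: do_acts_replicate_Push, simp add: una_def)
  have 3: "runt (pow_prog k) (pow_time k k ?n) (st [] w [] (una k) [] [] []) (st [] w [] (una (k * (?n + 1) ^ k)) [] [] [])"
    using runt_pow_prog[OF w] .
  have 4: "runt (Do (\<lambda>_. Push 4 2 # emit [4])) 1 (st [] w [] (una (k * (?n + 1) ^ k)) [] [] []) (st [4] w [] (una ?P) [] [] [])"
    by (rule runt_Do) (simp add: margin_def)
  define F where "F j = st (rev (concat (replicate j ?b)) @ [4]) w [] (una (?P - j)) (una j) (una j) []" for j
  have "runt (Do (\<lambda>_. emit ?b @ [Push 6 2, Push 5 2, Pop 4])) 1 (F j) (F (Suc j))" for j
    by (rule runt_Do) (simp add: F_def concat_replicate_snoc del: replicate_Suc)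
  then have 5: "runt (WHILE (\<lambda>t. t 4 \<noteq> 0) (Do (\<lambda>_. emit ?b @ [Push 6 2, Push 5 2, Pop 4]))) (length (una ?P) * (1 + 2) + 1)
     (st [4] w [] (una ?P) [] [] []) (F ?P)"
    by (intro runt_drain[where f = F]) (auto simp: F_def)
  let ?o = "rev (concat (replicate ?P ?b)) @ [4]"
  let ?s = "cell_str (hd0 w, Some (tm_start M))"
  define G where "G j = st (rev (concat (map (\<lambda>a. cell_str (a, None)) (take j (tl w)))) @ rev ?s @ ?o) (drop j (tl w)) [] [] (una ?P) (una (?P + 1 + j)) []" for j
  have 6: "runt (Do (\<lambda>t. emit (cell_str (t 2, Some (tm_start M))) @ [Push 6 2, Pop 2])) 1 (F ?P) (G 0)"
    by (rule runt_Do) (simp add: F_def G_def)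
  have "runt (Do (\<lambda>t. emit (cell_str (t 2, None)) @ [Push 6 2, Pop 2])) 1 (G j) (G (Suc j))" if "j < length (tl w)" for j
    by (rule runt_Do) (use that in \<open>simp add: G_def hd0_drop take_Suc_conv_app_nth drop_Suc tl_drop\<close>)
  moreover have "\<forall>a\<in>set (tl w). 0 < a" using w by (cases w) auto
  ultimately have 7: "runt (WHILE (\<lambda>t. t 2 \<noteq> 0) (Do (\<lambda>t. emit (cell_str (t 2, None)) @ [Push 6 2, Pop 2])))
      (length (tl w) * (1 + 2) + 1) (G 0) (G (length (tl w)))"
    by (intro runt_drain[where f = G]) (auto simp: G_def)
  let ?o2 = "rev (concat (map (\<lambda>a. cell_str (a, None)) (tl w))) @ rev ?s @ ?o"
  define H where "H j = st (rev (concat (replicate j ?b)) @ ?o2) [] [] [] (una (?P - j)) (una (?P + 1 + length (tl w) + j)) []" for j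
  have "runt (Do (\<lambda>_. emit ?b @ [Push 6 2, Pop 5])) 1 (H j) (H (Suc j))" for j
    by (rule runt_Do) (simp add: H_def concat_replicate_snoc del: replicate_Suc)
  then have 8: "runt (WHILE (\<lambda>t. t 5 \<noteq> 0) (Do (\<lambda>_. emit ?b @ [Push 6 2, Pop 5]))) (length (una ?P) * (1 + 2) + 1)
     (G (length (tl w))) (H ?P)"
    by (intro runt_drain[where f = H]) (auto simp: H_def G_def)
  let ?o3 = "rev const_str @ rev ?b @ rev (concat (replicate ?P ?b)) @ ?o2"
  have N: "?N = Suc (?P + 1 + length (tl w) + ?P)" by (simp add: start_cells_def input_cells_def)
  have 9: "runt (Do (\<lambda>_. emit ?b @ Push 6 2 # emit const_str)) 1 (H ?P) (st ?o3 [] [] [] [] (una ?N) [])"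
    by (rule runt_Do) (simp add: H_def N)
  have 10: "runt (items_prog items) (length items * (6 * ?N + 8)) (st ?o3 [] [] [] [] (una ?N) [])
     (st (rev (items_str ?N items) @ ?o3) [] [] [] [] (una ?N) [])"
    by (rule runt_items_prog)
  let ?o4 = "rev (enc TT) @ rev (items_str ?N items) @ ?o3"
  have 11: "runt (Do (\<lambda>_. emit (enc TT))) 1 (st (rev (items_str ?N items) @ ?o3) [] [] [] [] (una ?N) []) (st ?o4 [] [] [] [] (una ?N) [])"
    by (rule runt_Do) simp
  have "runt (Do (\<lambda>_. [Pop 6])) 1 (st ?o4 [] [] [] [] (una (?N - j)) []) (st ?o4 [] [] [] [] (una (?N - Suc j)) [])" for j
    by (rule runt_Do) simp
  then have 12: "runt (WHILE (\<lambda>t. t 6 \<noteq> 0) (Do (\<lambda>_. [Pop 6]))) (length (una ?N) * (1 + 2) + 1) (st ?o4 [] [] [] [] (una ?N) []) (st ?o4 [] [] [] [] [] [])"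
    by (intro runt_drain[where f = "\<lambda>j. st ?o4 [] [] [] [] (una (?N - j)) []"]) auto
  have o4: "?o4 = rev (enc (red_fml w))"
    unfolding enc_red_fml start_cells_def by (simp add: input_cells_def comp_def)
  have tm: "length (tl w) \<le> ?n" by simp
  have NN: "?N \<le> 2 * ?P + ?n + 2" using N tm by linarith
  have "length items * (6 * ?N + 8) + ?N * 3 \<le> (length items + 1) * (6 * (2 * ?P + ?n + 2) + 8)"
  proof -
    have "length items * (6 * ?N + 8) \<le> length items * (6 * (2 * ?P + ?n + 2) + 8)"
      using NN by (intro mult_le_mono) auto
    moreover have "?N * 3 \<le> 6 * (2 * ?P + ?n + 2) + 8"
      using mult_le_mono1[OF NN, of 3] unfolding add_mult_distrib2 add_mult_distrib by presburger
    ultimately have "length items * (6 * ?N + 8) + ?N * 3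
      \<le> length items * (6 * (2 * ?P + ?n + 2) + 8) + (6 * (2 * ?P + ?n + 2) + 8)" by (rule add_mono)
    then show ?thesis by (simp only: add_mult_distrib mult_1)
  qed
  then show ?thesis unfolding red_prog_def o4[symmetric]
    by (intro runt_mono[OF runt_Seq[OF 1 runt_Seq[OF 2 runt_Seq[OF 3 runt_Seq[OF 4 runt_Seq[OF 5 runt_Seq[OF 6
      runt_Seq[OF 7 runt_Seq[OF 8 runt_Seq[OF 9 runt_Seq[OF 10 runt_Seq[OF 11 12]]]]]]]]]]]])
      (use tm in \<open>simp add: red_time_def del: length_tl\<close>)
qed

lemma polyb_red_time: "polyb red_time"
proof -
  have "polyb (\<lambda>n. 100 + 6 * n + pow_time k k n + 6 * (k * (n + 1) ^ k + 1)
     + (length items + 1) * (6 * (2 * (k * (n + 1) ^ k + 1) + n + 2) + 8))"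
    by (intro polyb_add polyb_mult polyb_const polyb_power polyb_id polyb_pow_time)
  then show ?thesis by (simp add: red_time_def[abs_def] margin_def)
qed

lemma wf_red_prog: "wf_com 9 (tm_nsyms M + 10) red_prog"
proof -
  let ?B = "tm_nsyms M + 10"
  have e: "ok_act 9 ?B a" if "\<forall>x\<in>set xs. 0 < x \<and> x < 10" "a \<in> set (emit xs)" for a xs
    using that by (auto simp: set_emit)
  have c: "\<forall>x\<in>set (cell_str y). 0 < x \<and> x < 10" for y
    using enc_pos by (auto simp: cell_str_def)
  have cs: "\<forall>x\<in>set const_str. 0 < x \<and> x < 10"
    using enc_pos by (auto simp: const_str_def)
  have cp: "ok_act 9 ?B a" if "r < 9" "m \<in> mems 9 ?B" "a \<in> set (copy_act r (m r'))" for a r r' m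
    using that by (cases "r' < 9") (auto simp: copy_act_def mems_def split: if_splits)
  have mv: "wf_com 9 ?B (move_reg r r')" if "r < 9" "r' < 9" for r r'
    using that cp by (auto simp: move_reg_def)
  have mul: "wf_com 9 ?B mul_prog" using mv cp[of 3 _ _ 2] by (auto simp: mul_prog_def)
  then have pw: "wf_com 9 ?B (pow_prog j)" for j by (induction j) auto
  have rep: "wf_com 9 ?B rep_prog" using mv by (auto simp: rep_prog_def)
  have it: "wf_com 9 ?B (items_prog xs)" if "\<forall>(p, q)\<in>set xs. \<forall>x\<in>set p \<union> set q. 0 < x \<and> x < 10" for xs
    using that
  proof (induction xs rule: items_prog.induct)
    case (2 p q xs)
    have "\<forall>x\<in>set p. 0 < x \<and> x < 10" "\<forall>x\<in>set q. 0 < x \<and> x < 10" using 2(2) by auto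
    then show ?case using 2 e[of p] e[of q] rep by simp
  qed simp
  have "\<forall>(p, q)\<in>set items. \<forall>x\<in>set p \<union> set q. 0 < x \<and> x < 10"
    using enc_pos by (auto simp: items_def)
  then have "wf_com 9 ?B (items_prog items)" by (rule it)
  moreover have "\<forall>x\<in>set (enc TT). 0 < x \<and> x < 10" using enc_pos by blast
  ultimately show ?thesis unfolding red_prog_def
    using mv pw e[OF c] e[OF cs] e[of "enc TT"] by (auto simp: set_emit)
qed

theorem reduction: "poly_reduces S L fml_alphabet SAT_lang"
proof -
  have S: "S \<subseteq> {0<..<tm_nsyms M + 10}"
  proof
    fix x assume x: "x \<in> S"
    have "x \<noteq> 0" using x alphS unfolding alphabet_def by metis
    moreover have "x < tm_nsyms M" using x SM by auto
    ultimately show "x \<in> {0<..<tm_nsyms M + 10}" by simp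
  qed
  have "\<exists>M' k'. wf_tm M' \<and> S \<subseteq> {..<tm_nsyms M'} \<and> computes_in_poly_time M' S (\<lambda>w. enc (red_fml w)) k'"
  proof (rule poly_time_by_program[OF wf_red_prog _ _ S polyb_red_time])
    fix w assume "w \<in> lists S"
    then have "\<forall>a\<in>set w. 0 < a" using S by (auto simp: in_lists_conv_set)
    then show "\<exists>s'. runt red_prog (red_time (length w)) (init_regs w) s' \<and> s' 0 = rev (enc (red_fml w)) \<and> (\<forall>r>0. s' r = [])"
      by (intro exI[of _ "st (rev (enc (red_fml w))) [] [] [] [] [] []"] conjI runt_red_prog)
         (auto simp: st_def)
  qed auto
  then obtain M' k' where M': "wf_tm M'" "S \<subseteq> {..<tm_nsyms M'}" "computes_in_poly_time M' S (\<lambda>w. enc (red_fml w)) k'"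
    by blast
  moreover have "enc (red_fml w) \<in> lists fml_alphabet" for w
    using enc_alphabet by (auto simp: fml_alphabet_def)
  moreover have "w \<in> L \<longleftrightarrow> enc (red_fml w) \<in> SAT_lang" if "w \<in> lists S" for w
    using red_fml_correct[OF that] enc_inj by (auto simp: SAT_lang_def)
  ultimately show ?thesis unfolding poly_reduces_def by blast
qed

end

section \<open>Labellings of \<open>\<omega> \<times> \<omega>\<close> by sets of subformula occurrences\<close>

text \<open>An occurrence is addressed by its offset in the prefix encoding.\<close>

fun occs :: "nat \<Rightarrow> fml \<Rightarrow> (nat \<times> fml) set" where
  "occs z (Var n) = {(z, Var n)}"
| "occs z (Neg a) = insert (z, Neg a) (occs (z + 1) a)"
| "occs z (Next1 a) = insert (z, Next1 a) (occs (z + 1) a)"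
| "occs z (NextW a) = insert (z, NextW a) (occs (z + 1) a)"
| "occs z (Conj a b) = insert (z, Conj a b) (occs (z + 1) a \<union> occs (z + 1 + length (enc a)) b)"
| "occs z (Until_u a b) = insert (z, Until_u a b) (occs (z + 1) a \<union> occs (z + 1 + length (enc a)) b)"
| "occs z (Until_U a b) = insert (z, Until_U a b) (occs (z + 1) a \<union> occs (z + 1 + length (enc a)) b)"

lemma occs_self: "(z, \<phi>) \<in> occs z \<phi>"
  by (cases \<phi>) auto

lemma finite_occs: "finite (occs z \<phi>)"
  by (induction \<phi> arbitrary: z) auto

lemma occs_range: "(p, \<psi>) \<in> occs z \<phi> \<Longrightarrow> z \<le> p \<and> p < z + length (enc \<phi>)"
  by (induction \<phi> arbitrary: z) fastforce+

lemma occs_trans: "(p, \<psi>) \<in> occs z \<phi> \<Longrightarrow> occs p \<psi> \<subseteq> occs z \<phi>"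
  by (induction \<phi> arbitrary: z) (auto simp del: add_Suc_right)

lemma occs_unique: "(p, \<psi>) \<in> occs z \<phi> \<Longrightarrow> (p, \<psi>') \<in> occs z \<phi> \<Longrightarrow> \<psi> = \<psi>'"
proof (induction \<phi> arbitrary: z)
  case (Conj a b)
  then show ?case using occs_range[of p \<psi> "z + 1" a] occs_range[of p \<psi>' "z + 1" a]
    occs_range[of p \<psi> "z + 1 + length (enc a)" b] occs_range[of p \<psi>' "z + 1 + length (enc a)" b] by auto
next
  case (Until_u a b)
  then show ?case using occs_range[of p \<psi> "z + 1" a] occs_range[of p \<psi>' "z + 1" a]
    occs_range[of p \<psi> "z + 1 + length (enc a)" b] occs_range[of p \<psi>' "z + 1 + length (enc a)" b] by auto
next
  case (Until_U a b)
  then show ?case using occs_range[of p \<psi> "z + 1" a] occs_range[of p \<psi>' "z + 1" a]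
    occs_range[of p \<psi> "z + 1 + length (enc a)" b] occs_range[of p \<psi>' "z + 1 + length (enc a)" b] by auto
next
  case (Neg a)
  then show ?case using occs_range[of p \<psi> "z + 1" a] occs_range[of p \<psi>' "z + 1" a] by auto
next
  case (Next1 a)
  then show ?case using occs_range[of p \<psi> "z + 1" a] occs_range[of p \<psi>' "z + 1" a] by auto
next
  case (NextW a)
  then show ?case using occs_range[of p \<psi> "z + 1" a] occs_range[of p \<psi>' "z + 1" a] by auto
qed auto

section \<open>Unfolding of the until operators and shifting of instants\<close>

lemma sat_u_unfold:
  "sat \<xi> (i, j) (Until_u a b) \<longleftrightarrow> sat \<xi> (i, j) b \<or> (sat \<xi> (i, j) a \<and> sat \<xi> (i, Suc j) (Until_u a b))"
proof
  assume "sat \<xi> (i, j) (Until_u a b)"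
  then obtain k where k: "sat \<xi> (i, j + k) b" "\<forall>l<k. sat \<xi> (i, j + l) a" by auto
  show "sat \<xi> (i, j) b \<or> (sat \<xi> (i, j) a \<and> sat \<xi> (i, Suc j) (Until_u a b))"
  proof (cases k)
    case (Suc k')
    have "sat \<xi> (i, Suc j + k') b" using k(1) Suc by simp
    moreover have "\<forall>l<k'. sat \<xi> (i, Suc j + l) a" using k(2) Suc by auto
    ultimately show ?thesis using k(2) Suc by auto
  qed (use k in simp)
next
  assume "sat \<xi> (i, j) b \<or> (sat \<xi> (i, j) a \<and> sat \<xi> (i, Suc j) (Until_u a b))"
  then show "sat \<xi> (i, j) (Until_u a b)"
  proof
    assume "sat \<xi> (i, j) b"
    then show ?thesis by (auto intro!: exI[of _ 0])
  next
    assume *: "sat \<xi> (i, j) a \<and> sat \<xi> (i, Suc j) (Until_u a b)"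
    then obtain k where k: "sat \<xi> (i, Suc j + k) b" "\<forall>l<k. sat \<xi> (i, Suc j + l) a" by auto
    have "\<forall>l<Suc k. sat \<xi> (i, j + l) a"
    proof (intro allI impI)
      fix l assume "l < Suc k"
      then show "sat \<xi> (i, j + l) a" using * k(2) by (cases l) auto
    qed
    then show ?thesis using k(1) by (auto intro!: exI[of _ "Suc k"])
  qed
qed

lemma sat_U_iff: "sat \<xi> (i, j) (Until_U a b) \<longleftrightarrow>
  (\<exists>i' j'. lex_le (i, j) (i', j') \<and> sat \<xi> (i', j') b \<and>
    (\<forall>m l. lex_le (i, j) (m, l) \<and> (m < i' \<or> m = i' \<and> l < j') \<longrightarrow> sat \<xi> (m, l) a))"
proof -
  have "lex_less (m, l) (i', j') \<longleftrightarrow> m < i' \<or> m = i' \<and> l < j'" for m l i' j'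
    by (auto simp: lex_less_def lex_le_def)
  then show ?thesis by simp
qed

lemma sat_U_unfold:
  "sat \<xi> (i, j) (Until_U a b) \<longleftrightarrow> sat \<xi> (i, j) b \<or> (sat \<xi> (i, j) a \<and> sat \<xi> (i, Suc j) (Until_U a b))"
proof
  assume "sat \<xi> (i, j) (Until_U a b)"
  then obtain i' j' where s: "lex_le (i, j) (i', j')" "sat \<xi> (i', j') b"
    "\<And>m l. lex_le (i, j) (m, l) \<Longrightarrow> m < i' \<or> m = i' \<and> l < j' \<Longrightarrow> sat \<xi> (m, l) a"
    unfolding sat_U_iff by blast
  show "sat \<xi> (i, j) b \<or> (sat \<xi> (i, j) a \<and> sat \<xi> (i, Suc j) (Until_U a b))"
  proof (cases "i' = i \<and> j' = j")
    case False
    then have "lex_le (i, Suc j) (i', j')" "i < i' \<or> i = i' \<and> j < j'" using s(1) by (auto simp: lex_le_def)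
    moreover have "lex_le (i, j) (m, l)" if "lex_le (i, Suc j) (m, l)" for m l
      using that by (auto simp: lex_le_def)
    ultimately have "sat \<xi> (i, Suc j) (Until_U a b)" unfolding sat_U_iff using s(2,3) by blast
    moreover have "sat \<xi> (i, j) a" using s(3)[of i j] \<open>i < i' \<or> _\<close> by (simp add: lex_le_def)
    ultimately show ?thesis by simp
  qed (use s in simp)
next
  assume "sat \<xi> (i, j) b \<or> (sat \<xi> (i, j) a \<and> sat \<xi> (i, Suc j) (Until_U a b))"
  then show "sat \<xi> (i, j) (Until_U a b)"
  proof
    assume "sat \<xi> (i, j) b"
    then show ?thesis unfolding sat_U_iff by (intro exI[of _ i] exI[of _ j]) (auto simp: lex_le_def)
  next
    assume *: "sat \<xi> (i, j) a \<and> sat \<xi> (i, Suc j) (Until_U a b)"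
    then obtain i' j' where s: "lex_le (i, Suc j) (i', j')" "sat \<xi> (i', j') b"
      "\<And>m l. lex_le (i, Suc j) (m, l) \<Longrightarrow> m < i' \<or> m = i' \<and> l < j' \<Longrightarrow> sat \<xi> (m, l) a"
      unfolding sat_U_iff by blast
    have "sat \<xi> (m, l) a" if "lex_le (i, j) (m, l)" "m < i' \<or> m = i' \<and> l < j'" for m l
    proof (cases "m = i \<and> l = j")
      case False
      then have "lex_le (i, Suc j) (m, l)" using that(1) by (auto simp: lex_le_def)
      then show ?thesis using s(3) that(2) by blast
    qed (use * in simp)
    moreover have "lex_le (i, j) (i', j')" using s(1) by (auto simp: lex_le_def)
    ultimately show ?thesis unfolding sat_U_iff using s(2) by blast
  qed
qed

text \<open>With \<open>sat_U_limit_elim\<close> this governs \<open>U\<close> at the end of a row,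
  which no finite number of one-step unfoldings reaches.\<close>

lemma sat_U_limit_intro:
  assumes "\<And>l. j \<le> l \<Longrightarrow> sat \<xi> (i, l) a" "sat \<xi> (Suc i, 0) (Until_U a b)"
  shows "sat \<xi> (i, j) (Until_U a b)"
proof -
  obtain i' j' where s: "lex_le (Suc i, 0) (i', j')" "sat \<xi> (i', j') b"
    "\<And>m l. lex_le (Suc i, 0) (m, l) \<Longrightarrow> m < i' \<or> m = i' \<and> l < j' \<Longrightarrow> sat \<xi> (m, l) a"
    using assms(2) unfolding sat_U_iff by blast
  have "sat \<xi> (m, l) a" if "lex_le (i, j) (m, l)" "m < i' \<or> m = i' \<and> l < j'" for m l
  proof (cases "m = i")
    case True then show ?thesis using assms(1) that by (auto simp: lex_le_def)
  next
    case False
    then have "lex_le (Suc i, 0) (m, l)" using that(1) by (auto simp: lex_le_def)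
    then show ?thesis using s(3) that(2) by blast
  qed
  moreover have "lex_le (i, j) (i', j')" using s(1) by (auto simp: lex_le_def)
  ultimately show ?thesis unfolding sat_U_iff using s(2) by blast
qed

lemma sat_U_limit_elim:
  assumes "\<And>l. j \<le> l \<Longrightarrow> \<not> sat \<xi> (i, l) b" "sat \<xi> (i, j) (Until_U a b)"
  shows "sat \<xi> (Suc i, 0) (Until_U a b)"
proof -
  obtain i' j' where s: "lex_le (i, j) (i', j')" "sat \<xi> (i', j') b"
    "\<And>m l. lex_le (i, j) (m, l) \<Longrightarrow> m < i' \<or> m = i' \<and> l < j' \<Longrightarrow> sat \<xi> (m, l) a"
    using assms(2) unfolding sat_U_iff by blast
  have "i' \<noteq> i" using s(1,2) assms(1) by (auto simp: lex_le_def)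
  then have "lex_le (Suc i, 0) (i', j')" using s(1) by (auto simp: lex_le_def)
  moreover have "lex_le (i, j) (m, l)" if "lex_le (Suc i, 0) (m, l)" for m l
    using that by (auto simp: lex_le_def)
  ultimately show ?thesis unfolding sat_U_iff using s(2,3) by blast
qed

text \<open>The instants from \<open>(r1, r2)\<close> on form an isomorphic copy of all instants:
  row \<open>r1\<close> loses its first \<open>r2\<close> instants, later rows stay whole.\<close>

lemma sat_shift:
  "sat (\<lambda>i j. \<xi> (r1 + i) (if i = 0 then r2 + j else j)) (i, j) \<phi> \<longleftrightarrow> sat \<xi> (r1 + i, if i = 0 then r2 + j else j) \<phi>"
proof (induction \<phi> arbitrary: i j)
  case (Until_u a b)
  then show ?case by (auto simp: add.assoc)
next
  case (Until_U a b)
  let ?m = "\<lambda>i j. (r1 + i, if i = 0 then r2 + j else j)"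
  have le: "lex_le (?m i j) (?m i' j') \<longleftrightarrow> lex_le (i, j) (i', j')" for i j i' j' by (auto simp: lex_le_def)
  have ls: "(fst (?m m l) < fst (?m i' j') \<or> fst (?m m l) = fst (?m i' j') \<and> snd (?m m l) < snd (?m i' j'))
    \<longleftrightarrow> (m < i' \<or> m = i' \<and> l < j')" for m l i' j' by auto
  have sur: "\<exists>i' j'. (a', b') = ?m i' j'" if "lex_le (?m i j) (a', b')" for a' b'
  proof (cases "a' = r1")
    case True
    then have "i = 0" "r2 + j \<le> b'" using that by (auto simp: lex_le_def split: if_splits)
    then show ?thesis using True by (intro exI[of _ 0] exI[of _ "b' - r2"]) auto
  next
    case False
    then show ?thesis using that by (intro exI[of _ "a' - r1"] exI[of _ b']) (auto simp: lex_le_def)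
  qed
  show ?case (is "?L \<longleftrightarrow> ?R")
  proof
    assume ?L
    then obtain i' j' where s: "lex_le (i, j) (i', j')" "sat \<xi> (?m i' j') b"
      "\<And>m l. lex_le (i, j) (m, l) \<Longrightarrow> m < i' \<or> m = i' \<and> l < j' \<Longrightarrow> sat \<xi> (?m m l) a"
      unfolding sat_U_iff Until_U.IH by blast
    have "sat \<xi> (m, l) a" if t: "lex_le (?m i j) (m, l)" "m < fst (?m i' j') \<or> m = fst (?m i' j') \<and> l < snd (?m i' j')" for m l
    proof -
      obtain m' l' where e: "(m, l) = ?m m' l'" using sur[OF t(1)] by blast
      then have "lex_le (i, j) (m', l')" using t(1) le by metis
      moreover have "m' < i' \<or> m' = i' \<and> l' < j'" using t(2) ls[of m' l' i' j'] e by (metis fst_conv snd_conv)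
      ultimately show ?thesis using s(3) e by metis
    qed
    then show ?R unfolding sat_U_iff using s(1,2) le
      by (intro exI[of _ "fst (?m i' j')"] exI[of _ "snd (?m i' j')"]) auto
  next
    assume ?R
    then obtain x y where s: "lex_le (?m i j) (x, y)" "sat \<xi> (x, y) b"
      "\<And>m l. lex_le (?m i j) (m, l) \<Longrightarrow> m < x \<or> m = x \<and> l < y \<Longrightarrow> sat \<xi> (m, l) a"
      unfolding sat_U_iff by blast
    obtain i' j' where e: "(x, y) = ?m i' j'" using sur[OF s(1)] by blast
    have "sat \<xi> (?m m l) a" if "lex_le (i, j) (m, l)" "m < i' \<or> m = i' \<and> l < j'" for m l
      using s(3)[of "fst (?m m l)" "snd (?m m l)"] that le ls[of m l i' j'] e by (metis fst_conv snd_conv)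
    moreover have "lex_le (i, j) (i', j')" using s(1) e le by metis
    moreover have "sat \<xi> (?m i' j') b" using s(2) e by metis
    ultimately show ?L unfolding sat_U_iff Until_U.IH by blast
  qed
next
  case (NextW \<phi>)
  then show ?case using NextW[of "Suc i" 0] by auto
qed auto

lemma satisfiable_at_origin: "satisfiable \<phi> \<longleftrightarrow> (\<exists>\<xi>. sat \<xi> (0, 0) \<phi>)"
proof
  assume "satisfiable \<phi>"
  then obtain \<xi> r1 r2 where "sat \<xi> (r1, r2) \<phi>" unfolding satisfiable_def by (metis surj_pair)
  then have "sat (\<lambda>i j. \<xi> (r1 + i) (if i = 0 then r2 + j else j)) (0, 0) \<phi>" using sat_shift[of \<xi> r1 r2 0 0] by simp
  then show "\<exists>\<xi>. sat \<xi> (0, 0) \<phi>" by blast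
qed (auto simp: satisfiable_def)

section \<open>Labellings and their equivalence with models\<close>

locale formula =
  fixes \<phi> :: fml
begin

abbreviation Occ :: "(nat \<times> fml) set" where "Occ \<equiv> occs 0 \<phi>"

lemma children:
  "(p, Neg a) \<in> Occ \<Longrightarrow> (Suc p, a) \<in> Occ" "(p, Next1 a) \<in> Occ \<Longrightarrow> (Suc p, a) \<in> Occ" "(p, NextW a) \<in> Occ \<Longrightarrow> (Suc p, a) \<in> Occ"
  "(p, Conj a b) \<in> Occ \<Longrightarrow> (Suc p, a) \<in> Occ \<and> (Suc (p + length (enc a)), b) \<in> Occ"
  "(p, Until_u a b) \<in> Occ \<Longrightarrow> (Suc p, a) \<in> Occ \<and> (Suc (p + length (enc a)), b) \<in> Occ"
  "(p, Until_U a b) \<in> Occ \<Longrightarrow> (Suc p, a) \<in> Occ \<and> (Suc (p + length (enc a)), b) \<in> Occ"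
  using occs_trans occs_self by fastforce+

text \<open>\<open>B\<close> stands for the label at the start of the next row. Occurrences of one
  variable have different offsets and so need an explicit agreement.\<close>

definition static :: "nat set \<Rightarrow> nat set \<Rightarrow> bool" where
  "static B T \<longleftrightarrow> (\<forall>(p, \<psi>)\<in>Occ. case \<psi> of
      Neg a \<Rightarrow> p \<in> T \<longleftrightarrow> Suc p \<notin> T
    | Conj a b \<Rightarrow> p \<in> T \<longleftrightarrow> Suc p \<in> T \<and> Suc (p + length (enc a)) \<in> T
    | NextW a \<Rightarrow> p \<in> T \<longleftrightarrow> Suc p \<in> B
    | _ \<Rightarrow> True) \<and> (\<forall>p q n. (p, Var n) \<in> Occ \<longrightarrow> (q, Var n) \<in> Occ \<longrightarrow> (p \<in> T \<longleftrightarrow> q \<in> T))"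

lemma staticD:
  assumes "static B T"
  shows "(p, Neg a) \<in> Occ \<Longrightarrow> p \<in> T \<longleftrightarrow> Suc p \<notin> T"
    "(p, Conj a b) \<in> Occ \<Longrightarrow> p \<in> T \<longleftrightarrow> Suc p \<in> T \<and> Suc (p + length (enc a)) \<in> T"
    "(p, NextW a) \<in> Occ \<Longrightarrow> p \<in> T \<longleftrightarrow> Suc p \<in> B"
    "(p, Var n) \<in> Occ \<Longrightarrow> (q, Var n) \<in> Occ \<Longrightarrow> p \<in> T \<longleftrightarrow> q \<in> T"
proof -
  note * = assms[unfolded static_def]
  show "(p, Neg a) \<in> Occ \<Longrightarrow> p \<in> T \<longleftrightarrow> Suc p \<notin> T" by (drule bspec[OF conjunct1[OF *]]) simp
  show "(p, Conj a b) \<in> Occ \<Longrightarrow> p \<in> T \<longleftrightarrow> Suc p \<in> T \<and> Suc (p + length (enc a)) \<in> T"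
    by (drule bspec[OF conjunct1[OF *]]) simp
  show "(p, NextW a) \<in> Occ \<Longrightarrow> p \<in> T \<longleftrightarrow> Suc p \<in> B" by (drule bspec[OF conjunct1[OF *]]) simp
  show "(p, Var n) \<in> Occ \<Longrightarrow> (q, Var n) \<in> Occ \<Longrightarrow> p \<in> T \<longleftrightarrow> q \<in> T"
    using conjunct2[OF *] by blast
qed

definition succ :: "nat set \<Rightarrow> nat set \<Rightarrow> bool" where
  "succ T T' \<longleftrightarrow> (\<forall>(p, \<psi>)\<in>Occ. case \<psi> of
      Next1 a \<Rightarrow> p \<in> T \<longleftrightarrow> Suc p \<in> T'
    | Until_u a b \<Rightarrow> p \<in> T \<longleftrightarrow> Suc (p + length (enc a)) \<in> T \<or> (Suc p \<in> T \<and> p \<in> T')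
    | Until_U a b \<Rightarrow> p \<in> T \<longleftrightarrow> Suc (p + length (enc a)) \<in> T \<or> (Suc p \<in> T \<and> p \<in> T')
    | _ \<Rightarrow> True)"

lemma succD:
  assumes "succ T T'"
  shows "(p, Next1 a) \<in> Occ \<Longrightarrow> p \<in> T \<longleftrightarrow> Suc p \<in> T'"
    "(p, Until_u a b) \<in> Occ \<Longrightarrow> p \<in> T \<longleftrightarrow> Suc (p + length (enc a)) \<in> T \<or> (Suc p \<in> T \<and> p \<in> T')"
    "(p, Until_U a b) \<in> Occ \<Longrightarrow> p \<in> T \<longleftrightarrow> Suc (p + length (enc a)) \<in> T \<or> (Suc p \<in> T \<and> p \<in> T')"
  by (drule bspec[OF assms[unfolded succ_def]], simp)+

text \<open>\<open>ful\<close> has to hold infinitely often in every row, \<open>gful\<close> in infinitely many rows. For \<open>Until_U\<close>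
  the row-local fixpoint is the greatest one if the next row starts with the formula, and the least one otherwise.\<close>

definition ful :: "nat set \<Rightarrow> nat set \<Rightarrow> nat \<times> fml \<Rightarrow> bool" where
  "ful B T x = (case x of (p, \<psi>) \<Rightarrow> (case \<psi> of
      Until_u a b \<Rightarrow> p \<notin> T \<or> Suc (p + length (enc a)) \<in> T
    | Until_U a b \<Rightarrow> if p \<in> B then p \<in> T \<or> Suc p \<notin> T else p \<notin> T \<or> Suc (p + length (enc a)) \<in> T
    | _ \<Rightarrow> True))"

definition gful :: "nat set \<Rightarrow> nat \<times> fml \<Rightarrow> bool" where
  "gful T x = (case x of (p, \<psi>) \<Rightarrow> (case \<psi> of
      Until_U a b \<Rightarrow> p \<notin> T \<or> Suc (p + length (enc a)) \<in> T | _ \<Rightarrow> True))"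

text \<open>For \<open>gful\<close> a single instant in each of infinitely many rows suffices: a
  \<open>U\<close> postponed forever would be in the label, and its second argument outside, at
  every later instant, so \<open>gful\<close> would fail throughout all later rows.\<close>

definition labelling :: "(nat \<Rightarrow> nat \<Rightarrow> nat set) \<Rightarrow> bool" where
  "labelling T \<longleftrightarrow> (\<forall>i j. static (T (Suc i) 0) (T i j) \<and> succ (T i j) (T i (Suc j))) \<and>
     (\<forall>x\<in>Occ. \<forall>i N. \<exists>j\<ge>N. ful (T (Suc i) 0) (T i j) x) \<and> (\<forall>x\<in>Occ. \<forall>N. \<exists>i\<ge>N. \<exists>j. gful (T i j) x)"

lemma model_labelling:
  assumes "sat \<xi> (0, 0) \<phi>"
  shows "\<exists>T. labelling T \<and> 0 \<in> T 0 0 \<and> (\<forall>i j. T i j \<subseteq> fst ` Occ)"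
proof -
  define T where "T i j = {p. \<exists>\<psi>. (p, \<psi>) \<in> Occ \<and> sat \<xi> (i, j) \<psi>}" for i j
  have T: "p \<in> T i j \<longleftrightarrow> sat \<xi> (i, j) \<psi>" if "(p, \<psi>) \<in> Occ" for p \<psi> i j
    using that occs_unique[OF that] unfolding T_def by blast
  have "static (T (Suc i) 0) (T i j)" for i j
  proof -
    have "case \<psi> of Neg a \<Rightarrow> p \<in> T i j \<longleftrightarrow> Suc p \<notin> T i j
      | Conj a b \<Rightarrow> p \<in> T i j \<longleftrightarrow> Suc p \<in> T i j \<and> Suc (p + length (enc a)) \<in> T i j
      | NextW a \<Rightarrow> p \<in> T i j \<longleftrightarrow> Suc p \<in> T (Suc i) 0 | _ \<Rightarrow> True" if x: "(p, \<psi>) \<in> Occ" for p \<psi>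
    proof (cases \<psi>)
      case (Neg a)
      then show ?thesis using x T[OF x] T[of "Suc p" a] children(1) by simp
    next
      case (NextW a)
      then show ?thesis using x T[OF x] T[of "Suc p" a] children(3) by simp
    next
      case (Conj a b)
      then show ?thesis using x T[OF x] T[of "Suc p" a] T[of "Suc (p + length (enc a))" b] children(4) by simp
    qed auto
    moreover have "p \<in> T i j \<longleftrightarrow> q \<in> T i j" if "(p, Var n) \<in> Occ" "(q, Var n) \<in> Occ" for p q n
      using that T by blast
    ultimately show ?thesis unfolding static_def by blast
  qed
  moreover have "succ (T i j) (T i (Suc j))" for i j
  proof -
    have "case \<psi> of Next1 a \<Rightarrow> p \<in> T i j \<longleftrightarrow> Suc p \<in> T i (Suc j)
      | Until_u a b \<Rightarrow> p \<in> T i j \<longleftrightarrow> Suc (p + length (enc a)) \<in> T i j \<or> (Suc p \<in> T i j \<and> p \<in> T i (Suc j))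
      | Until_U a b \<Rightarrow> p \<in> T i j \<longleftrightarrow> Suc (p + length (enc a)) \<in> T i j \<or> (Suc p \<in> T i j \<and> p \<in> T i (Suc j))
      | _ \<Rightarrow> True" if x: "(p, \<psi>) \<in> Occ" for p \<psi>
    proof (cases \<psi>)
      case (Next1 a)
      then show ?thesis using x T[OF x] T[of "Suc p" a] children(2) by simp
    next
      case (Until_u a b)
      then show ?thesis
        using x T[OF x] T[of "Suc p" a] T[of "Suc (p + length (enc a))" b] children(5) sat_u_unfold[of \<xi> i j a b]
        by (simp del: sat.simps)
    next
      case (Until_U a b)
      then show ?thesis
        using x T[OF x] T[of "Suc p" a] T[of "Suc (p + length (enc a))" b] children(6) sat_U_unfold[of \<xi> i j a b]
        by (simp del: sat.simps)
    qed auto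
    then show ?thesis unfolding succ_def by blast
  qed
  moreover have "\<exists>j\<ge>N. ful (T (Suc i) 0) (T i j) x" if x: "x \<in> Occ" for x i N
  proof -
    obtain p \<psi> where xp: "x = (p, \<psi>)" by (cases x)
    show ?thesis
    proof (cases \<psi>)
      case (Until_u a b)
      then have Occ: "(p, Until_u a b) \<in> Occ" using x xp by simp
      show ?thesis
      proof (cases "sat \<xi> (i, N) (Until_u a b)")
        case True
        then obtain k where "sat \<xi> (i, N + k) b" by auto
        then show ?thesis using T[of _ b] children(5)[OF Occ]
          by (intro exI[of _ "N + k"]) (auto simp: ful_def xp Until_u)
      next
        case False
        then show ?thesis using T[OF Occ] by (intro exI[of _ N]) (auto simp: ful_def xp Until_u simp del: sat.simps)
      qed
    next
      case (Until_U a b)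
      then have Occ: "(p, Until_U a b) \<in> Occ" using x xp by simp
      note c = children(6)[OF Occ]
      show ?thesis
      proof (rule ccontr)
        \<comment> \<open>If \<open>ful\<close> failed from column \<open>N\<close> on, the tail of
          the row would be constant, and the two limit lemmas contradict this in the two cases for
          the next row.\<close>
        assume "\<not> ?thesis"
        then have n: "\<not> ful (T (Suc i) 0) (T i l) x" if "N \<le> l" for l using that by blast
        show False
        proof (cases "sat \<xi> (Suc i, 0) (Until_U a b)")
          case True
          then have "p \<in> T (Suc i) 0" using T[OF Occ] by blast
          then have "sat \<xi> (i, l) a \<and> \<not> sat \<xi> (i, l) (Until_U a b)" if "N \<le> l" for l
            using n[OF that] T[OF Occ] T[of "Suc p" a] c by (auto simp: ful_def xp Until_U simp del: sat.simps)
          then show False using sat_U_limit_intro[of N \<xi> i a b] True by blast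
        next
          case False
          then have "p \<notin> T (Suc i) 0" using T[OF Occ] by blast
          then have "\<not> sat \<xi> (i, l) b \<and> sat \<xi> (i, l) (Until_U a b)" if "N \<le> l" for l
            using n[OF that] T[OF Occ] T[of "Suc (p + length (enc a))" b] c by (auto simp: ful_def xp Until_U simp del: sat.simps)
          then show False using sat_U_limit_elim[of N \<xi> i b a] False by blast
        qed
      qed
    qed (auto simp: ful_def xp)
  qed
  moreover have "\<exists>i\<ge>N. \<exists>j. gful (T i j) x" if x: "x \<in> Occ" for x N
  proof -
    obtain p \<psi> where xp: "x = (p, \<psi>)" by (cases x)
    show ?thesis
    proof (cases \<psi>)
      case (Until_U a b)
      then have Occ: "(p, Until_U a b) \<in> Occ" using x xp by simp
      show ?thesis
      proof (cases "sat \<xi> (N, 0) (Until_U a b)")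
        case True
        then obtain i' j' where "lex_le (N, 0) (i', j')" "sat \<xi> (i', j') b" unfolding sat_U_iff by blast
        then show ?thesis using T[of _ b] children(6)[OF Occ]
          by (intro exI[of _ i']) (auto simp: gful_def xp Until_U lex_le_def)
      next
        case False
        then have "p \<notin> T N 0" using T[OF Occ] by blast
        then show ?thesis by (intro exI[of _ N]) (auto simp: gful_def xp Until_U)
      qed
    qed (auto simp: gful_def xp)
  qed
  ultimately have "labelling T" unfolding labelling_def by blast
  moreover have "0 \<in> T 0 0" using T[OF occs_self] assms by blast
  moreover have "T i j \<subseteq> fst ` Occ" for i j by (force simp: T_def)
  ultimately show ?thesis by blast
qed

lemma down_closed:
  assumes "\<And>l. j \<le> l \<Longrightarrow> l < m \<Longrightarrow> q \<in> T l" "p \<in> T m" "j \<le> m"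
    and "\<And>l. q \<in> T l \<Longrightarrow> p \<in> T (Suc l) \<Longrightarrow> p \<in> T l"
  shows "p \<in> (T :: nat \<Rightarrow> nat set) j"
  using assms(3,1,2)
proof (induction rule: inc_induct)
  case (step n)
  then show ?case using assms(4)[of n] by simp
qed simp

text \<open>Truth lemma by induction over occurrences, for all instants at once. Variables take
  their value from any of their occurrences, which agree by \<open>static\<close>.\<close>

lemma labelling_model:
  assumes lab: "labelling T" and root: "0 \<in> T 0 0"
  shows "satisfiable \<phi>"
proof -
  define \<xi> where "\<xi> i j n \<longleftrightarrow> (\<exists>p. (p, Var n) \<in> Occ \<and> p \<in> T i j)" for i j n
  have st: "static (T (Suc i) 0) (T i j)" and su: "succ (T i j) (T i (Suc j))" for i j
    using lab unfolding labelling_def by blast+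
  have fu': "\<forall>x\<in>Occ. \<forall>i N. \<exists>j\<ge>N. ful (T (Suc i) 0) (T i j) x"
    and gf': "\<forall>x\<in>Occ. \<forall>N. \<exists>i\<ge>N. \<exists>j. gful (T i j) x"
    by (rule conjunct1[OF conjunct2[OF lab[unfolded labelling_def]]],
        rule conjunct2[OF conjunct2[OF lab[unfolded labelling_def]]])
  have fu: "\<exists>j\<ge>N. ful (T (Suc i) 0) (T i j) x" if "x \<in> Occ" for x i N
    by (rule bspec[OF fu' that, THEN spec, THEN spec])
  have gf: "\<exists>i\<ge>N. \<exists>j. gful (T i j) x" if "x \<in> Occ" for x N
    using bspec[OF gf' that] by (rule spec)
  have truth: "(p, \<psi>) \<in> Occ \<Longrightarrow> sat \<xi> (i, j) \<psi> \<longleftrightarrow> p \<in> T i j" for p \<psi> i j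
  proof (induction \<psi> arbitrary: p i j)
    case (Var n)
    have "(\<exists>p. (p, Var n) \<in> Occ \<and> p \<in> T i j) \<longleftrightarrow> p \<in> T i j"
      using staticD(4)[OF st[of i j] Var.prems] Var.prems by blast
    then show ?case by (simp add: \<xi>_def)
  next
    case (Neg a)
    then show ?case using staticD(1)[OF st[of i j] Neg.prems] Neg.IH[OF children(1)[OF Neg.prems]] by simp
  next
    case (Next1 a)
    then show ?case using succD(1)[OF su[of i j] Next1.prems] Next1.IH[OF children(2)[OF Next1.prems]] by simp
  next
    case (NextW a)
    then show ?case using staticD(3)[OF st[of i j] NextW.prems] NextW.IH[OF children(3)[OF NextW.prems]] by simp
  next
    case (Conj a b)
    note c = children(4)[OF Conj.prems]
    show ?case using staticD(2)[OF st[of i j] Conj.prems] Conj.IH(1)[OF conjunct1[OF c]] Conj.IH(2)[OF conjunct2[OF c]]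
      by simp
  next
    case (Until_u a b)
    let ?q = "Suc (p + length (enc a))"
    have A: "sat \<xi> (i, l) a \<longleftrightarrow> Suc p \<in> T i l" and B: "sat \<xi> (i, l) b \<longleftrightarrow> ?q \<in> T i l" for l
      using Until_u.IH children(5)[OF Until_u.prems] by blast+
    have S: "p \<in> T i l \<longleftrightarrow> ?q \<in> T i l \<or> (Suc p \<in> T i l \<and> p \<in> T i (Suc l))" for l
      using succD(2)[OF su[of i l] Until_u.prems] .
    show ?case
    proof
      assume "sat \<xi> (i, j) (Until_u a b)"
      then obtain k where k: "?q \<in> T i (j + k)" "\<And>l. l < k \<Longrightarrow> Suc p \<in> T i (j + l)" using A B by auto
      have 1: "p \<in> T i (j + k)" using k(1) S by blast
      have 2: "Suc p \<in> T i l" if "j \<le> l" "l < j + k" for l using k(2)[of "l - j"] that by auto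
      have 3: "Suc p \<in> T i l \<Longrightarrow> p \<in> T i (Suc l) \<Longrightarrow> p \<in> T i l" for l using S by blast
      show "p \<in> T i j" using down_closed[where T = "T i", OF 2 1 le_add1 3] .
    next
      assume p: "p \<in> T i j"
      have "\<exists>l\<ge>j. p \<notin> T i l \<or> ?q \<in> T i l" using fu[OF Until_u.prems, of j i] by (auto simp: ful_def)
      then have ex: "\<exists>k. p \<notin> T i (j + k) \<or> ?q \<in> T i (j + k)" by (metis le_Suc_ex)
      define k where "k = (LEAST k. p \<notin> T i (j + k) \<or> ?q \<in> T i (j + k))"
      have k: "p \<notin> T i (j + k) \<or> ?q \<in> T i (j + k)" unfolding k_def by (rule LeastI_ex[OF ex])
      have lt: "p \<in> T i (j + l) \<and> ?q \<notin> T i (j + l)" if "l < k" for l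
        using not_less_Least[of l] that unfolding k_def by blast
      have "p \<in> T i (j + k)"
      proof (cases k)
        case (Suc k')
        then have "p \<in> T i (j + k')" "?q \<notin> T i (j + k')" using lt[of k'] by auto
        then have "p \<in> T i (Suc (j + k'))" using S by blast
        then show ?thesis using Suc by simp
      qed (use p in simp)
      then have "?q \<in> T i (j + k)" using k by blast
      moreover have "Suc p \<in> T i (j + l)" if "l < k" for l using lt[OF that] S[of "j + l"] by blast
      ultimately show "sat \<xi> (i, j) (Until_u a b)" using A B by auto
    qed
  next
    case (Until_U a b)
    let ?q = "Suc (p + length (enc a))"
    have A: "sat \<xi> (i, l) a \<longleftrightarrow> Suc p \<in> T i l" and B: "sat \<xi> (i, l) b \<longleftrightarrow> ?q \<in> T i l" for i l
      using Until_U.IH children(6)[OF Until_U.prems] by blast+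
    have S: "p \<in> T i l \<longleftrightarrow> ?q \<in> T i l \<or> (Suc p \<in> T i l \<and> p \<in> T i (Suc l))" for i l
      using succD(3)[OF su[of i l] Until_U.prems] .
    show ?case
    proof
      assume "sat \<xi> (i, j) (Until_U a b)"
      then obtain i' j' where s: "lex_le (i, j) (i', j')" "?q \<in> T i' j'"
        "\<And>m l. lex_le (i, j) (m, l) \<Longrightarrow> m < i' \<or> m = i' \<and> l < j' \<Longrightarrow> Suc p \<in> T m l"
        unfolding sat_U_iff A B by blast
      have down: "Suc p \<in> T m l \<Longrightarrow> p \<in> T m (Suc l) \<Longrightarrow> p \<in> T m l" for m l using S by blast
      have ii: "i \<le> i'" using s(1) by (auto simp: lex_le_def)
      \<comment> \<open>The interval starting at \<open>(i, j)\<close> enters its first row in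
        column \<open>j\<close> and every later row in column 0.\<close>
      define st0 where "st0 m = (if m = i then j else 0)" for m
      have "p \<in> T i (st0 i)"
        using ii
      proof (induction rule: inc_induct)
        case base
        have 1: "st0 i' \<le> j'" using s(1) by (auto simp: st0_def lex_le_def)
        have 2: "p \<in> T i' j'" using S s(2) by blast
        have 3: "Suc p \<in> T i' l" if "st0 i' \<le> l" "l < j'" for l
          using s(3)[of i' l] that ii by (auto simp: lex_le_def st0_def split: if_splits)
        show ?case by (rule down_closed[where T = "T i'", OF 3 2 1 down])
      next
        \<comment> \<open>The witness lies in a later row, so the first argument holds along the
          rest of row \<open>m\<close>, and row \<open>m + 1\<close> starts with the until formula.
          The greatest-fixpoint case of \<open>ful\<close> then puts \<open>p\<close> somewhere into
          this tail, from where it is carried back.\<close>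
        case (step m)
        have nx: "p \<in> T (Suc m) 0" using step.IH step.hyps by (auto simp: st0_def)
        have al: "Suc p \<in> T m l" if "st0 m \<le> l" for l
          using s(3)[of m l] that step.hyps by (auto simp: lex_le_def st0_def split: if_splits)
        obtain l where l: "st0 m \<le> l" "p \<in> T m l"
          using fu[OF Until_U.prems, of "st0 m" m] nx al by (auto simp: ful_def)
        show ?case by (rule down_closed[where T = "T m", OF al l(2,1) down])
      qed
      then show "p \<in> T i j" by (simp add: st0_def)
    next
      assume p: "p \<in> T i j"
      \<comment> \<open>The instants that end the waiting; the lexicographically first of them turns
        out to be the witness.\<close>
      define bad where "bad m l \<longleftrightarrow> lex_le (i, j) (m, l) \<and> (p \<notin> T m l \<or> ?q \<in> T m l)" for m l
      \<comment> \<open>In a row after \<open>i\<close> every column lies beyond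
        \<open>(i, j)\<close>.\<close>
      obtain m0 l0 where "Suc i \<le> m0" "p \<notin> T m0 l0 \<or> ?q \<in> T m0 l0"
        using gf[OF Until_U.prems, of "Suc i"] by (auto simp: gful_def)
      then have ex: "\<exists>m l. bad m l" unfolding bad_def by (intro exI[of _ m0] exI[of _ l0]) (auto simp: lex_le_def)
      define m where "m = (LEAST m. \<exists>l. bad m l)"
      have ex2: "\<exists>l. bad m l" unfolding m_def by (rule LeastI_ex[OF ex])
      define l where "l = (LEAST l. bad m l)"
      have bad: "bad m l" unfolding l_def by (rule LeastI_ex[OF ex2])
      have nb1: "\<not> bad m' l'" if "m' < m" for m' l' using not_less_Least[of m' "\<lambda>m. \<exists>l. bad m l"] that unfolding m_def by blast
      have nb2: "\<not> bad m l'" if "l' < l" for l' using not_less_Least[of l' "bad m"] that unfolding l_def by blast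
      have good: "p \<in> T m' l' \<and> ?q \<notin> T m' l'" if "lex_le (i, j) (m', l')" "m' < m \<or> m' = m \<and> l' < l" for m' l'
        using nb1[of m' l'] nb2[of l'] that unfolding bad_def by blast
      have le: "lex_le (i, j) (m, l)" using bad by (simp add: bad_def)
      have "p \<in> T m l"
      proof (cases "m = i \<and> l = j")
        case False
        show ?thesis
        proof (cases l)
          case (Suc l')
          then have "lex_le (i, j) (m, l')" using le False by (auto simp: lex_le_def)
          then have "p \<in> T m l'" "?q \<notin> T m l'" using good[of m l'] Suc by auto
          then have "p \<in> T m (Suc l')" using S by blast
          then show ?thesis using Suc by simp
        next
          \<comment> \<open>The first bad instant opens a row. On the tail of the preceding row
            \<open>p\<close> holds and the second argument fails, which the least-fixpoint case of
            \<open>ful\<close> forbids; hence \<open>p\<close> belongs to the label that opens this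
            row.\<close>
          case 0
          then have im: "i < m" using le False by (auto simp: lex_le_def)
          then obtain m' where m': "m = Suc m'" by (cases m) auto
          define N where "N = (if m' = i then j else 0)"
          have g: "p \<in> T m' l' \<and> ?q \<notin> T m' l'" if "N \<le> l'" for l'
            using good[of m' l'] that im m' by (auto simp: N_def lex_le_def split: if_splits)
          obtain l' where l': "N \<le> l'" "ful (T (Suc m') 0) (T m' l') (p, Until_U a b)"
            using fu[OF Until_U.prems] by blast
          then show ?thesis using g[of l'] by (auto simp: ful_def m' 0 split: if_splits)
        qed
      qed (use p in simp)
      then have q: "?q \<in> T m l" using bad by (auto simp: bad_def)
      have "Suc p \<in> T m' l'" if "lex_le (i, j) (m', l')" "m' < m \<or> m' = m \<and> l' < l" for m' l'
        using good[OF that] S[of m' l'] by blast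
      then show "sat \<xi> (i, j) (Until_U a b)" unfolding sat_U_iff A B using le q by blast
    qed
  qed
  have "sat \<xi> (0, 0) \<phi>" using truth[OF occs_self] root by blast
  then show ?thesis unfolding satisfiable_def by blast
qed

end

section \<open>Satisfiability as reachability\<close>

text \<open>A node of the graph describes an instant of a labelling that is being traversed along an outer and an
  inner lasso, one set of fields per offset: \<open>fT\<close> the current label, \<open>fB\<close> the label at the start of the next row;
  \<open>fS\<close>, \<open>fF\<close>, \<open>fIM\<close> the label at the start of the inner loop, the obligations met since then, and whether the
  inner loop was entered; \<open>fO\<close>, \<open>fG\<close>, \<open>fOM\<close> the same for the outer loop. The remaining fields select the kind
  of the outgoing edge: enter the inner loop (\<open>fMK\<close>), close it and go to the next row (\<open>fRW\<close>), which in
  addition enters the outer loop (\<open>fOK\<close>), close both loops (\<open>fFN\<close>); \<open>fST\<close> and \<open>fDN\<close> mark source and sink.\<close>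

datatype fld = fT | fB | fS | fF | fO | fG | fIM | fOM | fMK | fRW | fOK | fFN | fST | fDN

lemma finite_fld: "finite (UNIV :: fld set)"
proof -
  have "UNIV = {fT, fB, fS, fF, fO, fG, fIM, fOM, fMK, fRW, fOK, fFN, fST, fDN}"
    using fld.exhaust by blast
  then show ?thesis by (metis finite.emptyI finite.insertI)
qed

text \<open>Here and below \<open>k\<close> is the token of an occurrence in \<open>enc\<close>,
  \<open>x\<close> its fields, \<open>x1\<close> and \<open>x2\<close> the fields of its operands,
  and \<open>y\<close>, \<open>y1\<close> the fields at the same offsets in the next node.\<close>

definition tyok :: "nat \<Rightarrow> fld set \<Rightarrow> fld set \<Rightarrow> fld set \<Rightarrow> bool" where
  "tyok k x x1 x2 \<longleftrightarrow> (k = 1 \<longrightarrow> (fT \<in> x \<longleftrightarrow> fT \<notin> x1)) \<and> (k = 4 \<longrightarrow> (fT \<in> x \<longleftrightarrow> fT \<in> x1 \<and> fT \<in> x2))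
     \<and> (k = 3 \<longrightarrow> (fT \<in> x \<longleftrightarrow> fB \<in> x1))"

text \<open>The promised label \<open>fB\<close> becomes the current one, while the new
  \<open>fB\<close> is unconstrained and thereby guessed. Entering the outer loop stores the new
  label and resets the obligations.\<close>

definition rowend :: "fld set \<Rightarrow> fld set \<Rightarrow> bool" where
  "rowend x y \<longleftrightarrow> fIM \<in> x \<and> (fT \<in> x \<longleftrightarrow> fS \<in> x) \<and> fF \<in> x \<and> (fT \<in> y \<longleftrightarrow> fB \<in> x) \<and> fIM \<notin> y \<and>
     (if fOK \<in> x then (fO \<in> y \<longleftrightarrow> fB \<in> x) \<and> fOM \<in> y \<and> fG \<notin> y
      else (fO \<in> y \<longleftrightarrow> fO \<in> x) \<and> (fOM \<in> y \<longleftrightarrow> fOM \<in> x) \<and> (fG \<in> y \<longrightarrow> fG \<in> x))"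

definition gfk :: "nat \<Rightarrow> fld set \<Rightarrow> fld set \<Rightarrow> bool" where
  "gfk k x x2 \<longleftrightarrow> (k = 6 \<longrightarrow> fT \<notin> x \<or> fT \<in> x2)"

definition ffk :: "nat \<Rightarrow> fld set \<Rightarrow> fld set \<Rightarrow> fld set \<Rightarrow> bool" where
  "ffk k x x1 x2 \<longleftrightarrow> (k = 5 \<longrightarrow> fT \<notin> x \<or> fT \<in> x2) \<and>
     (k = 6 \<longrightarrow> (if fB \<in> x then fT \<in> x \<or> fT \<notin> x1 else fT \<notin> x \<or> fT \<in> x2))"

text \<open>\<open>fF\<close> and \<open>fG\<close> are bound by implications only: an obligation
  may be claimed once it has been met. Forgetting a claim is harmless, since closing a loop requires
  it.\<close>

definition stepok :: "nat \<Rightarrow> fld set \<Rightarrow> fld set \<Rightarrow> fld set \<Rightarrow> fld set \<Rightarrow> fld set \<Rightarrow> bool" where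
  "stepok k x y x1 y1 x2 \<longleftrightarrow> (k = 2 \<longrightarrow> (fT \<in> x \<longleftrightarrow> fT \<in> y1)) \<and>
     (k = 5 \<or> k = 6 \<longrightarrow> (fT \<in> x \<longleftrightarrow> fT \<in> x2 \<or> (fT \<in> x1 \<and> fT \<in> y))) \<and>
     (fB \<in> y \<longleftrightarrow> fB \<in> x) \<and> (fO \<in> y \<longleftrightarrow> fO \<in> x) \<and> (fOM \<in> y \<longleftrightarrow> fOM \<in> x) \<and>
     (fG \<in> y \<longrightarrow> fG \<in> x \<or> gfk k x x2) \<and>
     (if fMK \<in> x then (fS \<in> y \<longleftrightarrow> fT \<in> y) \<and> fIM \<in> y \<and> fF \<notin> y
      else (fS \<in> y \<longleftrightarrow> fS \<in> x) \<and> (fIM \<in> y \<longleftrightarrow> fIM \<in> x) \<and> (fF \<in> y \<longrightarrow> fF \<in> x \<or> ffk k x x1 x2))"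

text \<open>Both lassos close at once: the label repeats the start of the inner loop, and the next
  row would start with the label stored at the entry of the outer loop.\<close>

definition finok :: "fld set \<Rightarrow> bool" where
  "finok x \<longleftrightarrow> fIM \<in> x \<and> fOM \<in> x \<and> (fT \<in> x \<longleftrightarrow> fS \<in> x) \<and> fF \<in> x \<and> (fB \<in> x \<longleftrightarrow> fO \<in> x) \<and> fG \<in> x"

text \<open>A source may be followed by a source again, which allows paths to be padded; leaving it
  leads to a node outside both loops.\<close>

definition lok :: "nat \<Rightarrow> fld set \<Rightarrow> fld set \<Rightarrow> fld set \<Rightarrow> fld set \<Rightarrow> fld set \<Rightarrow> bool" where
  "lok k x y x1 y1 x2 \<longleftrightarrow>
    (if fST \<in> x then fST \<in> y \<or> (fIM \<notin> y \<and> fOM \<notin> y \<and> fDN \<notin> y)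
     else fDN \<notin> x \<and> tyok k x x1 x2 \<and>
       (if fFN \<in> x then finok x \<and> fDN \<in> y
        else fST \<notin> y \<and> fDN \<notin> y \<and> (if fRW \<in> x then rowend x y else stepok k x y x1 y1 x2)))"

definition flags :: "fld set" where
  "flags = {fIM, fOM, fMK, fRW, fOK, fFN, fST, fDN}"

fun tok :: "fml \<Rightarrow> nat" where
  "tok (Var n) = 7" | "tok (Neg a) = 1" | "tok (Next1 a) = 2" | "tok (NextW a) = 3"
| "tok (Conj a b) = 4" | "tok (Until_u a b) = 5" | "tok (Until_U a b) = 6"

definition child1 :: "(nat \<Rightarrow> fld set) \<Rightarrow> nat \<Rightarrow> fml \<Rightarrow> fld set" where
  "child1 U p \<psi> = (case \<psi> of Var n \<Rightarrow> {} | _ \<Rightarrow> U (Suc p))"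

definition child2 :: "(nat \<Rightarrow> fld set) \<Rightarrow> nat \<Rightarrow> fml \<Rightarrow> fld set" where
  "child2 U p \<psi> = (case \<psi> of Conj a b \<Rightarrow> U (Suc (p + length (enc a)))
     | Until_u a b \<Rightarrow> U (Suc (p + length (enc a))) | Until_U a b \<Rightarrow> U (Suc (p + length (enc a))) | _ \<Rightarrow> {})"

text \<open>The walk along a lasso of total length \<open>l\<close> that returns to
  \<open>a\<close>: it visits the loop positions infinitely often and turns a finite path into an
  infinite sequence.\<close>

lemma unroll_index:
  assumes "a < (l :: nat)"
  obtains idx where "idx 0 = 0" "\<And>j. idx j < l" "\<And>j. idx (Suc j) = Suc (idx j) \<or> (Suc (idx j) = l \<and> idx (Suc j) = a)"
    "\<And>i N. a \<le> i \<Longrightarrow> i < l \<Longrightarrow> \<exists>j\<ge>N. idx j = i" "\<And>i. i < l \<Longrightarrow> \<exists>j. idx j = (i :: nat)"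
proof -
  define d where "d = l - a"
  define idx where "idx j = (if j < a then j else a + (j - a) mod d)" for j
  have d: "0 < d" using assms by (simp add: d_def)
  have md: "(j - a) mod d < d" for j using d by simp
  have lt: "idx j < l" for j
  proof (cases "j < a")
    case False
    have "l = a + d" using assms by (simp add: d_def)
    then show ?thesis using False md[of j] by (simp add: idx_def)
  qed (use assms in \<open>simp add: idx_def\<close>)
  have st: "idx (Suc j) = Suc (idx j) \<or> (Suc (idx j) = l \<and> idx (Suc j) = a)" for j
  proof (cases "j < a")
    case True
    then show ?thesis using d by (cases "Suc j = a") (auto simp: idx_def)
  next
    case False
    then have e: "Suc j - a = Suc (j - a)" by simp
    show ?thesis
    proof (cases "Suc ((j - a) mod d) = d")
      case True
      then show ?thesis using False e assms by (simp add: idx_def mod_Suc d_def)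
    next
      case F: False
      then show ?thesis using False e by (simp add: idx_def mod_Suc)
    qed
  qed
  have inf: "\<exists>j\<ge>N. idx j = i" if "a \<le> i" "i < l" for i N
  proof -
    have "idx (i + d * N) = i"
    proof -
      have e: "i + d * N - a = (i - a) + d * N" using that by simp
      have "i - a < d" using that by (simp add: d_def)
      then have "(i + d * N - a) mod d = i - a" unfolding e mod_mult_self2 by (rule mod_less)
      then show ?thesis using that by (simp add: idx_def)
    qed
    moreover have "N \<le> i + d * N" using d by (cases d) auto
    ultimately show ?thesis by blast
  qed
  have all: "\<exists>j. idx j = i" if "i < l" for i
  proof (cases "i < a")
    case True then show ?thesis by (intro exI[of _ i]) (simp add: idx_def)
  next
    case False then show ?thesis using inf[of i 0] that by auto
  qed
  have "idx 0 = 0" by (simp add: idx_def)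
  then show thesis using lt st inf all that by blast
qed

text \<open>Some value recurs infinitely often. The loop starts at one of its occurrences and is
  closed at a later one, after every property in \<open>X\<close> has been seen.
  \<open>1 \<le> a\<close> leaves a predecessor that can announce the entry, and \<open>M\<close>
  delays the closing beyond prescribed positions.\<close>

lemma lasso_find:
  fixes \<sigma> :: "nat \<Rightarrow> 'a"
  assumes fin: "finite (range \<sigma>)" "finite X" and inf: "\<And>x N. x \<in> X \<Longrightarrow> \<exists>j\<ge>N. P x j"
  shows "\<exists>a l. 1 \<le> a \<and> a < l \<and> M \<le> l \<and> \<sigma> a = \<sigma> l \<and> (\<forall>x\<in>X. \<exists>j. a \<le> j \<and> j < l \<and> P x j)"
proof -
  have "\<exists>y\<in>range \<sigma>. infinite {j \<in> UNIV. \<sigma> j = y}"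
    using pigeonhole_infinite[of UNIV \<sigma>] fin(1) by auto
  then obtain y where y: "infinite {j. \<sigma> j = y}" by auto
  have unb: "\<exists>j\<ge>N. \<sigma> j = y" for N
  proof (rule ccontr)
    assume "\<not> ?thesis"
    then have "{j. \<sigma> j = y} \<subseteq> {..<N}" by (auto simp: not_le)
    then show False using y finite_subset by blast
  qed
  obtain a where a: "1 \<le> a" "\<sigma> a = y" using unb by blast
  define J where "J x = (SOME j. a \<le> j \<and> P x j)" for x
  have J: "a \<le> J x \<and> P x (J x)" if "x \<in> X" for x
    unfolding J_def by (rule someI_ex) (use inf[OF that, of a] in blast)
  obtain b where b: "\<forall>x\<in>X. J x \<le> b" using finite_nat_set_iff_bounded_le[of "J ` X"] fin(2) by auto
  obtain l where l: "Suc (a + b + M) \<le> l" "\<sigma> l = y"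
    using unb by blast
  have "\<exists>j. a \<le> j \<and> j < l \<and> P x j" if "x \<in> X" for x
    using J[OF that] b that l(1) by (intro exI[of _ "J x"]) fastforce
  then show ?thesis using a l by (intro exI[of _ a] exI[of _ l]) auto
qed

context formula
begin

text \<open>The kind of an edge is recorded at every offset, so that each offset can be checked
  without looking elsewhere; the records then have to coincide.\<close>

definition uniform :: "(nat \<Rightarrow> fld set) \<Rightarrow> bool" where
  "uniform U \<longleftrightarrow> (\<forall>x\<in>Occ. U (fst x) \<inter> flags = U 0 \<inter> flags)"

definition varok :: "(nat \<Rightarrow> fld set) \<Rightarrow> bool" where
  "varok U \<longleftrightarrow> (\<forall>n p q. (p, Var n) \<in> Occ \<longrightarrow> (q, Var n) \<in> Occ \<longrightarrow> (fT \<in> U p \<longleftrightarrow> fT \<in> U q))"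

definition locally :: "(nat \<Rightarrow> fld set) \<Rightarrow> (nat \<Rightarrow> fld set) \<Rightarrow> nat \<times> fml \<Rightarrow> bool" where
  "locally U V x = (case x of (p, \<psi>) \<Rightarrow>
     lok (tok \<psi>) (U p) (V p) (child1 U p \<psi>) (child1 V p \<psi>) (child2 U p \<psi>))"

definition edge :: "(nat \<Rightarrow> fld set) \<Rightarrow> (nat \<Rightarrow> fld set) \<Rightarrow> bool" where
  "edge U V \<longleftrightarrow> (\<forall>x\<in>Occ. locally U V x) \<and> uniform U \<and> varok U \<and> (fST \<in> U 0 \<longrightarrow> fST \<in> V 0 \<or> fT \<in> V 0)"

definition TS :: "fld \<Rightarrow> (nat \<Rightarrow> fld set) \<Rightarrow> nat set" where
  "TS f U = {p \<in> fst ` Occ. f \<in> U p}"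

lemma TS_iff: "(p, \<psi>) \<in> Occ \<Longrightarrow> p \<in> TS f U \<longleftrightarrow> f \<in> U p"
  unfolding TS_def by force

lemma TS_cong: "(\<And>p \<psi>. (p, \<psi>) \<in> Occ \<Longrightarrow> f \<in> U p \<longleftrightarrow> g \<in> V p) \<Longrightarrow> TS f U = TS g V"
  unfolding TS_def by force

lemma root_Occ: "(0, \<phi>) \<in> Occ" by (rule occs_self)

lemma uniform_flag: "uniform U \<Longrightarrow> (p, \<psi>) \<in> Occ \<Longrightarrow> f \<in> flags \<Longrightarrow> f \<in> U p \<longleftrightarrow> f \<in> U 0"
  unfolding uniform_def by fastforce

lemma flags_simps: "fIM \<in> flags" "fOM \<in> flags" "fMK \<in> flags" "fRW \<in> flags" "fOK \<in> flags" "fFN \<in> flags" "fST \<in> flags" "fDN \<in> flags"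
  by (simp_all add: flags_def)

section \<open>From paths to labellings\<close>

lemma edge_normal:
  assumes "edge U V" "fST \<notin> U 0" "(p, \<psi>) \<in> Occ"
  shows "tyok (tok \<psi>) (U p) (child1 U p \<psi>) (child2 U p \<psi>)"
    "fFN \<in> U 0 \<Longrightarrow> finok (U p)"
    "fFN \<notin> U 0 \<Longrightarrow> fST \<notin> V p \<and> fDN \<notin> V p"
    "fFN \<notin> U 0 \<Longrightarrow> fRW \<in> U 0 \<Longrightarrow> rowend (U p) (V p)"
    "fFN \<notin> U 0 \<Longrightarrow> fRW \<notin> U 0 \<Longrightarrow> stepok (tok \<psi>) (U p) (V p) (child1 U p \<psi>) (child1 V p \<psi>) (child2 U p \<psi>)"
proof -
  have u: "uniform U" using assms(1) by (simp add: edge_def)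
  have f: "fST \<notin> U p" "fFN \<in> U p \<longleftrightarrow> fFN \<in> U 0" "fRW \<in> U p \<longleftrightarrow> fRW \<in> U 0"
    using uniform_flag[OF u assms(3)] flags_simps assms(2) by blast+
  have "locally U V (p, \<psi>)" using assms(1,3) unfolding edge_def by blast
  then have *: "lok (tok \<psi>) (U p) (V p) (child1 U p \<psi>) (child1 V p \<psi>) (child2 U p \<psi>)" by (simp add: locally_def)
  show "tyok (tok \<psi>) (U p) (child1 U p \<psi>) (child2 U p \<psi>)"
    "fFN \<in> U 0 \<Longrightarrow> finok (U p)"
    "fFN \<notin> U 0 \<Longrightarrow> fST \<notin> V p \<and> fDN \<notin> V p"
    "fFN \<notin> U 0 \<Longrightarrow> fRW \<in> U 0 \<Longrightarrow> rowend (U p) (V p)"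
    "fFN \<notin> U 0 \<Longrightarrow> fRW \<notin> U 0 \<Longrightarrow> stepok (tok \<psi>) (U p) (V p) (child1 U p \<psi>) (child1 V p \<psi>) (child2 U p \<psi>)"
    using * f by (simp_all add: lok_def)
qed

lemma static_of_edge:
  assumes "edge U V" "fST \<notin> U 0"
  shows "static (TS fB U) (TS fT U)"
  unfolding static_def
proof (intro conjI ballI allI impI)
  fix x assume x: "x \<in> Occ"
  obtain p \<psi> where xp: "x = (p, \<psi>)" by (cases x)
  then have O: "(p, \<psi>) \<in> Occ" using x by simp
  note ty = edge_normal(1)[OF assms O]
  have "case \<psi> of Neg a \<Rightarrow> p \<in> TS fT U \<longleftrightarrow> Suc p \<notin> TS fT U
      | Conj a b \<Rightarrow> p \<in> TS fT U \<longleftrightarrow> Suc p \<in> TS fT U \<and> Suc (p + length (enc a)) \<in> TS fT U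
      | NextW a \<Rightarrow> p \<in> TS fT U \<longleftrightarrow> Suc p \<in> TS fB U | _ \<Rightarrow> True"
  proof (cases \<psi>)
    case (Neg a)
    then show ?thesis using O TS_iff[OF O] TS_iff[OF children(1)[of p a]] ty by (simp add: tyok_def child1_def)
  next
    case (NextW a)
    then show ?thesis using O TS_iff[OF O] TS_iff[OF children(3)[of p a]] ty by (simp add: tyok_def child1_def)
  next
    case (Conj a b)
    then show ?thesis using O TS_iff[OF O] TS_iff[of "Suc p" a] TS_iff[of "Suc (p + length (enc a))" b] children(4)[of p a b] ty
      by (simp add: tyok_def child1_def child2_def)
  qed auto
  then show "case x of (p, \<psi>) \<Rightarrow> case \<psi> of Neg a \<Rightarrow> p \<in> TS fT U \<longleftrightarrow> Suc p \<notin> TS fT U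
      | Conj a b \<Rightarrow> p \<in> TS fT U \<longleftrightarrow> Suc p \<in> TS fT U \<and> Suc (p + length (enc a)) \<in> TS fT U
      | NextW a \<Rightarrow> p \<in> TS fT U \<longleftrightarrow> Suc p \<in> TS fB U | _ \<Rightarrow> True" by (simp add: xp)
next
  fix p q n assume "(p, Var n) \<in> Occ" "(q, Var n) \<in> Occ"
  moreover have "varok U" using assms(1) by (simp add: edge_def)
  ultimately show "p \<in> TS fT U \<longleftrightarrow> q \<in> TS fT U" unfolding varok_def using TS_iff by blast
qed

lemma succ_of_edge:
  assumes "edge U V" "fST \<notin> U 0" "fFN \<notin> U 0" "fRW \<notin> U 0"
  shows "succ (TS fT U) (TS fT V)"
  unfolding succ_def
proof
  fix x assume x: "x \<in> Occ"
  obtain p \<psi> where xp: "x = (p, \<psi>)" by (cases x)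
  then have O: "(p, \<psi>) \<in> Occ" using x by simp
  note st = edge_normal(5)[OF assms(1,2) O assms(3,4)]
  have "case \<psi> of Next1 a \<Rightarrow> p \<in> TS fT U \<longleftrightarrow> Suc p \<in> TS fT V
    | Until_u a b \<Rightarrow> p \<in> TS fT U \<longleftrightarrow> Suc (p + length (enc a)) \<in> TS fT U \<or> (Suc p \<in> TS fT U \<and> p \<in> TS fT V)
    | Until_U a b \<Rightarrow> p \<in> TS fT U \<longleftrightarrow> Suc (p + length (enc a)) \<in> TS fT U \<or> (Suc p \<in> TS fT U \<and> p \<in> TS fT V)
    | _ \<Rightarrow> True"
  proof (cases \<psi>)
    case (Next1 a)
    then show ?thesis using O TS_iff[OF O] TS_iff[OF children(2)[of p a]] st by (simp add: stepok_def child1_def)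
  next
    case (Until_u a b)
    then show ?thesis using O TS_iff[OF O] TS_iff[of "Suc p" a] TS_iff[of "Suc (p + length (enc a))" b] children(5)[of p a b] st
      by (simp add: stepok_def child1_def child2_def)
  next
    case (Until_U a b)
    then show ?thesis using O TS_iff[OF O] TS_iff[of "Suc p" a] TS_iff[of "Suc (p + length (enc a))" b] children(6)[of p a b] st
      by (simp add: stepok_def child1_def child2_def)
  qed auto
  then show "case x of (p, \<psi>) \<Rightarrow> case \<psi> of Next1 a \<Rightarrow> p \<in> TS fT U \<longleftrightarrow> Suc p \<in> TS fT V
    | Until_u a b \<Rightarrow> p \<in> TS fT U \<longleftrightarrow> Suc (p + length (enc a)) \<in> TS fT U \<or> (Suc p \<in> TS fT U \<and> p \<in> TS fT V)
    | Until_U a b \<Rightarrow> p \<in> TS fT U \<longleftrightarrow> Suc (p + length (enc a)) \<in> TS fT U \<or> (Suc p \<in> TS fT U \<and> p \<in> TS fT V)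
    | _ \<Rightarrow> True" by (simp add: xp)
qed

lemma ffk_ful:
  assumes O: "(p, \<psi>) \<in> Occ"
  shows "ffk (tok \<psi>) (U p) (child1 U p \<psi>) (child2 U p \<psi>) \<longleftrightarrow> ful (TS fB U) (TS fT U) (p, \<psi>)"
proof (cases \<psi>)
  case (Until_u a b)
  then show ?thesis using O TS_iff[OF O] TS_iff[of "Suc (p + length (enc a))" b] children(5)[of p a b]
    by (simp add: ffk_def child2_def ful_def)
next
  case (Until_U a b)
  then show ?thesis using O TS_iff[OF O] TS_iff[of "Suc p" a] TS_iff[of "Suc (p + length (enc a))" b] children(6)[of p a b]
    by (simp add: ffk_def child1_def child2_def ful_def)
qed (simp_all add: ffk_def ful_def)

lemma gfk_gful:
  assumes O: "(p, \<psi>) \<in> Occ"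
  shows "gfk (tok \<psi>) (U p) (child2 U p \<psi>) \<longleftrightarrow> gful (TS fT U) (p, \<psi>)"
proof (cases \<psi>)
  case (Until_U a b)
  then show ?thesis using O TS_iff[OF O] TS_iff[of "Suc (p + length (enc a))" b] children(6)[of p a b]
    by (simp add: gfk_def child2_def gful_def)
qed (simp_all add: gfk_def gful_def)

text \<open>All that other rows need to know of a completed row: its first label, the first label of
  its successor, and the outer obligations \<open>L\<close> met in it.\<close>

definition row :: "nat set \<Rightarrow> (nat \<times> fml) set \<Rightarrow> nat set \<Rightarrow> bool" where
  "row a L b \<longleftrightarrow> (\<exists>\<sigma>. \<sigma> 0 = a \<and> (\<forall>j. static b (\<sigma> j) \<and> succ (\<sigma> j) (\<sigma> (Suc j))) \<and>
     (\<forall>x\<in>Occ. \<forall>N. \<exists>j\<ge>N. ful b (\<sigma> j) x) \<and> (\<forall>x\<in>L. \<exists>j. gful (\<sigma> j) x))"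

lemma row_of_lasso:
  assumes st: "\<And>j. j < l \<Longrightarrow> static b (\<tau> j) \<and> succ (\<tau> j) (\<tau> (Suc j))"
    and a: "a \<le> l" "\<tau> a = \<tau> l" and f: "\<And>x. x \<in> Occ \<Longrightarrow> \<exists>j. a \<le> j \<and> j < l \<and> ful b (\<tau> j) x"
  shows "row (\<tau> 0) {x. \<exists>j<l. gful (\<tau> j) x} b"
proof -
  have "a < l" using f[OF root_Occ] by auto
  then obtain idx where i: "idx 0 = 0" "\<And>j. idx j < l" "\<And>j. idx (Suc j) = Suc (idx j) \<or> (Suc (idx j) = l \<and> idx (Suc j) = a)"
    "\<And>i N. a \<le> i \<Longrightarrow> i < l \<Longrightarrow> \<exists>j\<ge>N. idx j = i" "\<And>i. i < l \<Longrightarrow> \<exists>j. idx j = i"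
    by (rule unroll_index) blast
  have nx: "\<tau> (idx (Suc j)) = \<tau> (Suc (idx j))" for j using i(3)[of j] a(2) by metis
  show ?thesis unfolding row_def
  proof (intro exI[of _ "\<lambda>j. \<tau> (idx j)"] conjI allI ballI)
    fix x N assume "x \<in> Occ"
    then obtain k where "a \<le> k" "k < l" "ful b (\<tau> k) x" using f by blast
    then show "\<exists>j\<ge>N. ful b (\<tau> (idx j)) x" using i(4)[of k N] by blast
  next
    fix x assume "x \<in> {x. \<exists>j<l. gful (\<tau> j) x}"
    then show "\<exists>j. gful (\<tau> (idx j)) x" using i(5) by blast
  qed (use i(1) st[OF i(2)] nx in auto)
qed

text \<open>What a path to \<open>U\<close> has produced so far: \<open>r\<close> completed rows
  with first labels \<open>A\<close> and met obligations \<open>Lab\<close>, and a prefix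
  \<open>\<tau>\<close> of the current row with \<open>l\<close> steps. A claim in \<open>fF\<close>
  or \<open>fG\<close> is backed by an instant since the entry of the loop concerned.\<close>

definition history :: "(nat \<Rightarrow> fld set) \<Rightarrow> nat \<Rightarrow> (nat \<Rightarrow> nat set) \<Rightarrow> (nat \<Rightarrow> (nat \<times> fml) set) \<Rightarrow> nat
    \<Rightarrow> (nat \<Rightarrow> nat set) \<Rightarrow> bool" where
  "history U r A Lab l \<tau> \<longleftrightarrow> 0 \<in> A 0 \<and> A r = \<tau> 0 \<and>
     (\<forall>i<r. row (A i) (Lab i) (A (Suc i))) \<and>
     (\<forall>j<l. static (TS fB U) (\<tau> j) \<and> succ (\<tau> j) (\<tau> (Suc j))) \<and> \<tau> l = TS fT U \<and>
     (fIM \<in> U 0 \<longrightarrow> (\<exists>a\<le>l. \<tau> a = TS fS U \<and>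
        (\<forall>x\<in>Occ. fF \<in> U (fst x) \<longrightarrow> (\<exists>j. a \<le> j \<and> j < l \<and> ful (TS fB U) (\<tau> j) x)))) \<and>
     (fOM \<in> U 0 \<longrightarrow> (\<exists>c\<le>r. A c = TS fO U \<and>
        (\<forall>x\<in>Occ. fG \<in> U (fst x) \<longrightarrow> (\<exists>i. c \<le> i \<and> i < r \<and> x \<in> Lab i) \<or> (\<exists>j<l. gful (\<tau> j) x))))"

definition invar :: "(nat \<Rightarrow> fld set) \<Rightarrow> bool" where
  "invar U \<longleftrightarrow> fST \<notin> U 0 \<and> fDN \<notin> U 0 \<and> (\<exists>r A Lab l \<tau>. history U r A Lab l \<tau>)"

text \<open>An edge prolongs the current row, completes it, or closes both loops; in the last case
  the history unrolls to a full labelling.\<close>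

lemma inv_edge:
  assumes inv: "invar U" and e: "edge U V"
  shows "invar V \<or> (\<exists>T. labelling T \<and> 0 \<in> T 0 0)"
proof -
  have nst: "fST \<notin> U 0" and ndn: "fDN \<notin> U 0" using inv by (auto simp: invar_def)
  from inv obtain r A Lab l \<tau> where D: "history U r A Lab l \<tau>" unfolding invar_def by blast
  note D = D[unfolded history_def]
  note root = D[THEN conjunct1] and Ar = D[THEN conjunct2, THEN conjunct1]
    and rows = D[THEN conjunct2, THEN conjunct2, THEN conjunct1, rule_format]
    and tau = D[THEN conjunct2, THEN conjunct2, THEN conjunct2, THEN conjunct1, THEN spec, THEN mp]
    and tl = D[THEN conjunct2, THEN conjunct2, THEN conjunct2, THEN conjunct2, THEN conjunct1]
    and im = D[THEN conjunct2, THEN conjunct2, THEN conjunct2, THEN conjunct2, THEN conjunct2, THEN conjunct1, THEN mp]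
    and om = D[THEN conjunct2, THEN conjunct2, THEN conjunct2, THEN conjunct2, THEN conjunct2, THEN conjunct2, THEN mp]
  note stat = static_of_edge[OF e nst]
  have uni: "uniform U" using e by (simp add: edge_def)
  \<comment> \<open>Closing the inner loop turns the finite prefix into an infinite row; this is
    shared by row ends and by the final edge.\<close>
  have closed: "row (A r) {x. \<exists>j<l. gful (\<tau> j) x} (TS fB U)"
    if c: "fIM \<in> U 0" "\<And>p \<psi>. (p, \<psi>) \<in> Occ \<Longrightarrow> (fT \<in> U p \<longleftrightarrow> fS \<in> U p) \<and> fF \<in> U p"
  proof -
    obtain a where a: "a \<le> l" "\<tau> a = TS fS U"
      "\<And>x. x \<in> Occ \<Longrightarrow> fF \<in> U (fst x) \<Longrightarrow> \<exists>j. a \<le> j \<and> j < l \<and> ful (TS fB U) (\<tau> j) x" using im[OF c(1)] by blast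
    have "TS fT U = TS fS U" by (rule TS_cong) (use c(2) in blast)
    then have "\<tau> a = \<tau> l" using a(2) tl by simp
    moreover have "\<exists>j. a \<le> j \<and> j < l \<and> ful (TS fB U) (\<tau> j) x" if "x \<in> Occ" for x
      using a(3)[OF that] c(2)[of "fst x" "snd x"] that by simp
    ultimately show ?thesis unfolding Ar using row_of_lasso[where \<tau> = \<tau>, OF tau a(1)] by blast
  qed
  show ?thesis
  proof (cases "fFN \<in> U 0")
    case True
    have fin: "finok (U p)" if "(p, \<psi>) \<in> Occ" for p \<psi> using edge_normal(2)[OF e nst that True] .
    have f0: "fIM \<in> U 0" "fOM \<in> U 0" using fin[OF root_Occ] by (auto simp: finok_def)
    have row: "row (A r) {x. \<exists>j<l. gful (\<tau> j) x} (TS fB U)"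
      by (rule closed[OF f0(1)]) (use fin in \<open>auto simp: finok_def\<close>)
    have BO: "TS fB U = TS fO U" by (rule TS_cong) (use fin in \<open>auto simp: finok_def\<close>)
    obtain c where c: "c \<le> r" "A c = TS fO U"
      "\<And>x. x \<in> Occ \<Longrightarrow> fG \<in> U (fst x) \<Longrightarrow> (\<exists>i. c \<le> i \<and> i < r \<and> x \<in> Lab i) \<or> (\<exists>j<l. gful (\<tau> j) x)"
      using om[OF f0(2)] by blast
    \<comment> \<open>The row just closed is appended as row \<open>r\<close>. Its successor label
      is that of row \<open>c\<close>, so the rows from \<open>c\<close> to \<open>r\<close> can be
      repeated forever.\<close>
    define A' where "A' = A(Suc r := TS fB U)"
    define Lab' where "Lab' = Lab(r := {x. \<exists>j<l. gful (\<tau> j) x})"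
    have rows': "row (A' i) (Lab' i) (A' (Suc i))" if "i < Suc r" for i
      using that rows[of i] row by (auto simp: A'_def Lab'_def less_Suc_eq)
    have Ac: "A' c = A' (Suc r)" using c(1,2) BO by (simp add: A'_def)
    have "c < Suc r" using c(1) by simp
    then obtain idx where i: "idx 0 = 0" "\<And>j. idx j < Suc r" "\<And>j. idx (Suc j) = Suc (idx j) \<or> (Suc (idx j) = Suc r \<and> idx (Suc j) = c)"
      "\<And>i N. c \<le> i \<Longrightarrow> i < Suc r \<Longrightarrow> \<exists>j\<ge>N. idx j = i"
      by (rule unroll_index) blast
    have nx: "A' (idx (Suc j)) = A' (Suc (idx j))" for j using i(3)[of j] Ac by metis
    have "\<forall>i. \<exists>\<sigma>. \<sigma> 0 = A' (idx i) \<and> (\<forall>j. static (A' (idx (Suc i))) (\<sigma> j) \<and> succ (\<sigma> j) (\<sigma> (Suc j))) \<and>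
       (\<forall>x\<in>Occ. \<forall>N. \<exists>j\<ge>N. ful (A' (idx (Suc i))) (\<sigma> j) x) \<and> (\<forall>x\<in>Lab' (idx i). \<exists>j. gful (\<sigma> j) x)"
      using rows'[OF i(2)] unfolding row_def nx by blast
    then obtain T where T: "\<And>i. T i 0 = A' (idx i) \<and> (\<forall>j. static (A' (idx (Suc i))) (T i j) \<and> succ (T i j) (T i (Suc j))) \<and>
       (\<forall>x\<in>Occ. \<forall>N. \<exists>j\<ge>N. ful (A' (idx (Suc i))) (T i j) x) \<and> (\<forall>x\<in>Lab' (idx i). \<exists>j. gful (T i j) x)"
      by metis
    have T0: "T i 0 = A' (idx i)" for i using T by blast
    have "\<exists>i\<ge>N. \<exists>j. gful (T i j) x" if x: "x \<in> Occ" for x N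
    proof -
      have "fG \<in> U (fst x)" using fin[of "fst x" "snd x"] x by (simp add: finok_def)
      then have "\<exists>k. c \<le> k \<and> k < Suc r \<and> x \<in> Lab' k"
      proof (rule disjE[OF c(3)[OF x]])
        assume "\<exists>i. c \<le> i \<and> i < r \<and> x \<in> Lab i"
        then obtain k where "c \<le> k" "k < r" "x \<in> Lab k" by blast
        then show ?thesis by (intro exI[of _ k]) (simp add: Lab'_def)
      next
        assume "\<exists>j<l. gful (\<tau> j) x"
        then show ?thesis using c(1) by (intro exI[of _ r]) (simp add: Lab'_def)
      qed
      then obtain k where k: "c \<le> k" "k < Suc r" "x \<in> Lab' k" by blast
      obtain m where m: "N \<le> m" "idx m = k" using i(4)[OF k(1,2)] by blast
      have "\<exists>j. gful (T m j) x" using T[of m] k(3) m(2) by blast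
      then show ?thesis using m(1) by blast
    qed
    moreover have "static (T (Suc i) 0) (T i j) \<and> succ (T i j) (T i (Suc j))" for i j using T[of i] T0 by simp
    moreover have "\<exists>j\<ge>N. ful (T (Suc i) 0) (T i j) x" if "x \<in> Occ" for x i N using T[of i] T0 that by simp
    ultimately have "labelling T" unfolding labelling_def by blast
    moreover have "0 \<in> T 0 0" using T0 i(1) root by (simp add: A'_def)
    ultimately show ?thesis by blast
  next
    case nfn: False
    note nV = edge_normal(3)[OF e nst root_Occ nfn]
    show ?thesis
    proof (cases "fRW \<in> U 0")
      case True
      have re: "rowend (U p) (V p)" if "(p, \<psi>) \<in> Occ" for p \<psi> using edge_normal(4)[OF e nst that nfn True] .
      have row: "row (A r) {x. \<exists>j<l. gful (\<tau> j) x} (TS fB U)"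
        by (rule closed) (use re root_Occ in \<open>auto simp: rowend_def\<close>)
      have TV: "TS fT V = TS fB U" by (rule TS_cong) (use re in \<open>auto simp: rowend_def\<close>)
      have nim: "fIM \<notin> V 0" using re[OF root_Occ] by (simp add: rowend_def)
      define A' where "A' = A(Suc r := TS fB U)"
      define Lab' where "Lab' = Lab(r := {x. \<exists>j<l. gful (\<tau> j) x})"
      have rows': "row (A' i) (Lab' i) (A' (Suc i))" if "i < Suc r" for i
        using that rows[of i] row by (auto simp: A'_def Lab'_def less_Suc_eq)
      have okU: "fOK \<in> U p \<longleftrightarrow> fOK \<in> U 0" if "(p, \<psi>) \<in> Occ" for p \<psi> using uniform_flag[OF uni that] flags_simps by blast
      have om': "\<exists>c\<le>Suc r. A' c = TS fO V \<and> (\<forall>x\<in>Occ. fG \<in> V (fst x) \<longrightarrow> (\<exists>i. c \<le> i \<and> i < Suc r \<and> x \<in> Lab' i))"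
        if oV: "fOM \<in> V 0"
      proof (cases "fOK \<in> U 0")
        case True
        have "TS fO V = TS fB U" by (rule TS_cong) (use re okU True in \<open>auto simp: rowend_def\<close>)
        moreover have "fG \<notin> V (fst x)" if "x \<in> Occ" for x
          using re[of "fst x" "snd x"] okU[of "fst x" "snd x"] True that by (simp add: rowend_def)
        ultimately show ?thesis by (intro exI[of _ "Suc r"]) (simp add: A'_def)
      next
        case False
        then have "fOM \<in> U 0" using re[OF root_Occ] oV by (simp add: rowend_def)
        then obtain c where c: "c \<le> r" "A c = TS fO U"
          "\<And>x. x \<in> Occ \<Longrightarrow> fG \<in> U (fst x) \<Longrightarrow> (\<exists>i. c \<le> i \<and> i < r \<and> x \<in> Lab i) \<or> (\<exists>j<l. gful (\<tau> j) x)"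
          using om by blast
        have "TS fO V = TS fO U" by (rule TS_cong) (use re okU False in \<open>auto simp: rowend_def\<close>)
        then have "A' c = TS fO V" using c(1,2) by (simp add: A'_def)
        moreover have "\<exists>i. c \<le> i \<and> i < Suc r \<and> x \<in> Lab' i" if x: "x \<in> Occ" "fG \<in> V (fst x)" for x
        proof -
          have "fG \<in> U (fst x)" using re[of "fst x" "snd x"] okU[of "fst x" "snd x"] False x by (simp add: rowend_def)
          from c(3)[OF x(1) this] show ?thesis
          proof
            assume "\<exists>i. c \<le> i \<and> i < r \<and> x \<in> Lab i"
            then obtain k where "c \<le> k" "k < r" "x \<in> Lab k" by blast
            then show ?thesis by (intro exI[of _ k]) (simp add: Lab'_def)
          next
            assume "\<exists>j<l. gful (\<tau> j) x"
            then show ?thesis using c(1) by (intro exI[of _ r]) (simp add: Lab'_def)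
          qed
        qed
        ultimately show ?thesis using c(1) by (intro exI[of _ c]) auto
      qed
      have "history V (Suc r) A' Lab' 0 (\<lambda>_. TS fT V)" unfolding history_def
      proof (intro conjI)
        show "fOM \<in> V 0 \<longrightarrow> (\<exists>c\<le>Suc r. A' c = TS fO V \<and> (\<forall>x\<in>Occ. fG \<in> V (fst x) \<longrightarrow>
           (\<exists>i. c \<le> i \<and> i < Suc r \<and> x \<in> Lab' i) \<or> (\<exists>j<0. gful (TS fT V) x)))"
          using om' by blast
        show "\<forall>i<Suc r. row (A' i) (Lab' i) (A' (Suc i))" using rows' by blast
        show "0 \<in> A' 0" using root by (simp add: A'_def)
        show "A' (Suc r) = TS fT V" using TV by (simp add: A'_def)
      qed (use nim in auto)
      then show ?thesis using nV unfolding invar_def by blast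
    next
      case nrw: False
      have so: "stepok (tok \<psi>) (U p) (V p) (child1 U p \<psi>) (child1 V p \<psi>) (child2 U p \<psi>)" if "(p, \<psi>) \<in> Occ" for p \<psi>
        using edge_normal(5)[OF e nst that nfn nrw] .
      have BV: "TS fB V = TS fB U" by (rule TS_cong) (use so in \<open>auto simp: stepok_def\<close>)
      have OV: "TS fO V = TS fO U" by (rule TS_cong) (use so in \<open>auto simp: stepok_def\<close>)
      have mkU: "fMK \<in> U p \<longleftrightarrow> fMK \<in> U 0" if "(p, \<psi>) \<in> Occ" for p \<psi> using uniform_flag[OF uni that] flags_simps by blast
      define \<tau>' where "\<tau>' = \<tau>(Suc l := TS fT V)"
      have tau': "static (TS fB V) (\<tau>' j) \<and> succ (\<tau>' j) (\<tau>' (Suc j))" if "j < Suc l" for j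
        using that tau[of j] stat succ_of_edge[OF e nst nfn nrw] tl unfolding BV
        by (cases "j = l") (simp_all add: \<tau>'_def)
      have same: "\<tau>' j = \<tau> j" if "j \<le> l" for j using that by (simp add: \<tau>'_def)
      have im': "\<exists>a\<le>Suc l. \<tau>' a = TS fS V \<and>
        (\<forall>x\<in>Occ. fF \<in> V (fst x) \<longrightarrow> (\<exists>j. a \<le> j \<and> j < Suc l \<and> ful (TS fB V) (\<tau>' j) x))" if iV: "fIM \<in> V 0"
      proof (cases "fMK \<in> U 0")
        case True
        have "TS fS V = TS fT V" by (rule TS_cong) (use so mkU True in \<open>auto simp: stepok_def\<close>)
        moreover have "fF \<notin> V (fst x)" if "x \<in> Occ" for x
          using so[of "fst x" "snd x"] mkU[of "fst x" "snd x"] True that by (simp add: stepok_def)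
        ultimately show ?thesis by (intro exI[of _ "Suc l"]) (simp add: \<tau>'_def)
      next
        case False
        then have "fIM \<in> U 0" using so[OF root_Occ] iV by (simp add: stepok_def)
        then obtain a where a: "a \<le> l" "\<tau> a = TS fS U"
          "\<And>x. x \<in> Occ \<Longrightarrow> fF \<in> U (fst x) \<Longrightarrow> \<exists>j. a \<le> j \<and> j < l \<and> ful (TS fB U) (\<tau> j) x" using im by blast
        have "TS fS V = TS fS U" by (rule TS_cong) (use so mkU False in \<open>auto simp: stepok_def\<close>)
        then have "\<tau>' a = TS fS V" using a(1,2) same by simp
        moreover have "\<exists>j. a \<le> j \<and> j < Suc l \<and> ful (TS fB V) (\<tau>' j) x" if x: "x \<in> Occ" "fF \<in> V (fst x)" for x
        proof -
          obtain p \<psi> where xp: "x = (p, \<psi>)" by (cases x)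
          have O: "(p, \<psi>) \<in> Occ" using x xp by simp
          have "fF \<in> U p \<or> ffk (tok \<psi>) (U p) (child1 U p \<psi>) (child2 U p \<psi>)"
            using so[OF O] mkU[OF O] False x(2) xp by (simp add: stepok_def)
          then show ?thesis
          proof
            assume "fF \<in> U p"
            then obtain j where "a \<le> j" "j < l" "ful (TS fB U) (\<tau> j) x" using a(3)[OF x(1)] xp by auto
            then show ?thesis using same[of j] BV by (intro exI[of _ j]) simp
          next
            assume "ffk (tok \<psi>) (U p) (child1 U p \<psi>) (child2 U p \<psi>)"
            then have "ful (TS fB U) (TS fT U) x" using ffk_ful[OF O] xp by simp
            then show ?thesis using a(1) same[of l] BV tl by (intro exI[of _ l]) simp
          qed
        qed
        ultimately show ?thesis using a(1) by (intro exI[of _ a]) auto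
      qed
      have om': "\<exists>c\<le>r. A c = TS fO V \<and> (\<forall>x\<in>Occ. fG \<in> V (fst x) \<longrightarrow>
          (\<exists>i. c \<le> i \<and> i < r \<and> x \<in> Lab i) \<or> (\<exists>j<Suc l. gful (\<tau>' j) x))" if oV: "fOM \<in> V 0"
      proof -
        have "fOM \<in> U 0" using so[OF root_Occ] oV by (simp add: stepok_def)
        then obtain c where c: "c \<le> r" "A c = TS fO U"
          "\<And>x. x \<in> Occ \<Longrightarrow> fG \<in> U (fst x) \<Longrightarrow> (\<exists>i. c \<le> i \<and> i < r \<and> x \<in> Lab i) \<or> (\<exists>j<l. gful (\<tau> j) x)"
          using om by blast
        have "(\<exists>i. c \<le> i \<and> i < r \<and> x \<in> Lab i) \<or> (\<exists>j<Suc l. gful (\<tau>' j) x)" if x: "x \<in> Occ" "fG \<in> V (fst x)" for x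
        proof -
          obtain p \<psi> where xp: "x = (p, \<psi>)" by (cases x)
          have O: "(p, \<psi>) \<in> Occ" using x xp by simp
          have "fG \<in> U p \<or> gfk (tok \<psi>) (U p) (child2 U p \<psi>)"
            using so[OF O] x(2) xp by (simp add: stepok_def)
          then show ?thesis
          proof
            assume "fG \<in> U p"
            then have "(\<exists>i. c \<le> i \<and> i < r \<and> x \<in> Lab i) \<or> (\<exists>j<l. gful (\<tau> j) x)" using c(3)[OF x(1)] xp by simp
            then show ?thesis using same by (metis less_SucI less_imp_le_nat)
          next
            assume "gfk (tok \<psi>) (U p) (child2 U p \<psi>)"
            then have "gful (\<tau>' l) x" using gfk_gful[OF O] xp tl same[of l] by simp
            then show ?thesis by blast
          qed
        qed
        then show ?thesis using c(1,2) OV by (intro exI[of _ c]) auto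
      qed
      have "history V r A Lab (Suc l) \<tau>'" unfolding history_def
      proof (intro conjI)
        show "\<forall>j<Suc l. static (TS fB V) (\<tau>' j) \<and> succ (\<tau>' j) (\<tau>' (Suc j))" using tau' by blast
        show "A r = \<tau>' 0" using Ar same by simp
        show "\<tau>' (Suc l) = TS fT V" by (simp add: \<tau>'_def)
        show "\<forall>i<r. row (A i) (Lab i) (A (Suc i))" using rows by blast
        show "fIM \<in> V 0 \<longrightarrow> (\<exists>a\<le>Suc l. \<tau>' a = TS fS V \<and>
          (\<forall>x\<in>Occ. fF \<in> V (fst x) \<longrightarrow> (\<exists>j. a \<le> j \<and> j < Suc l \<and> ful (TS fB V) (\<tau>' j) x)))" using im' by blast
        show "fOM \<in> V 0 \<longrightarrow> (\<exists>c\<le>r. A c = TS fO V \<and> (\<forall>x\<in>Occ. fG \<in> V (fst x) \<longrightarrow>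
          (\<exists>i. c \<le> i \<and> i < r \<and> x \<in> Lab i) \<or> (\<exists>j<Suc l. gful (\<tau>' j) x)))" using om' by blast
      qed (rule root)
      then show ?thesis using nV unfolding invar_def by blast
    qed
  qed
qed

lemma inv_start:
  assumes e: "edge U V" and U: "fST \<in> U 0" and V: "fST \<notin> V 0"
  shows "invar V"
proof -
  have "locally U V (0, \<phi>)" using e root_Occ unfolding edge_def by blast
  then have "fIM \<notin> V 0 \<and> fOM \<notin> V 0 \<and> fDN \<notin> V 0" using U V by (simp add: locally_def lok_def)
  moreover have "fT \<in> V 0" using e U V by (simp add: edge_def)
  then have "0 \<in> TS fT V" using TS_iff[OF root_Occ] by simp
  ultimately have "history V 0 (\<lambda>_. TS fT V) (\<lambda>_. {}) 0 (\<lambda>_. TS fT V)" unfolding history_def by simp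
  then show ?thesis unfolding invar_def using V \<open>fIM \<notin> V 0 \<and> fOM \<notin> V 0 \<and> fDN \<notin> V 0\<close> by blast
qed

text \<open>The sink is neither a source nor allowed by \<open>invar\<close>, so for a path that
  ends there only the last alternative is left.\<close>

lemma path_labelling:
  assumes "edge\<^sup>*\<^sup>* U W" "fST \<in> U 0"
  shows "fST \<in> W 0 \<or> invar W \<or> (\<exists>T. labelling T \<and> 0 \<in> T 0 0)"
  using assms
proof (induction rule: rtranclp_induct)
  case (step V W)
  then show ?case using inv_start[of V W] inv_edge[of V W] by blast
qed simp

section \<open>From labellings to paths\<close>

lemma tyok_of_static:
  assumes "static (TS fB U) (TS fT U)" and O: "(p, \<psi>) \<in> Occ"
  shows "tyok (tok \<psi>) (U p) (child1 U p \<psi>) (child2 U p \<psi>)"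
proof (cases \<psi>)
  case (Neg a)
  then show ?thesis using O TS_iff[OF O] TS_iff[OF children(1)[of p a]] staticD(1)[OF assms(1), of p a]
    by (simp add: tyok_def child1_def)
next
  case (NextW a)
  then show ?thesis using O TS_iff[OF O] TS_iff[OF children(3)[of p a]] staticD(3)[OF assms(1), of p a]
    by (simp add: tyok_def child1_def)
next
  case (Conj a b)
  then show ?thesis using O TS_iff[OF O] TS_iff[of "Suc p" a] TS_iff[of "Suc (p + length (enc a))" b] children(4)[of p a b]
      staticD(2)[OF assms(1), of p a b]
    by (simp add: tyok_def child1_def child2_def)
qed (simp_all add: tyok_def)

lemma stepok_of_succ:
  assumes "succ (TS fT U) (TS fT V)" and O: "(p, \<psi>) \<in> Occ"
  shows "(tok \<psi> = 2 \<longrightarrow> (fT \<in> U p \<longleftrightarrow> fT \<in> child1 V p \<psi>)) \<and>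
     (tok \<psi> = 5 \<or> tok \<psi> = 6 \<longrightarrow> (fT \<in> U p \<longleftrightarrow> fT \<in> child2 U p \<psi> \<or> (fT \<in> child1 U p \<psi> \<and> fT \<in> V p)))"
proof (cases \<psi>)
  case (Next1 a)
  then show ?thesis using O TS_iff[OF O] TS_iff[OF children(2)[of p a]] succD(1)[OF assms(1), of p a]
    by (simp add: child1_def)
next
  case (Until_u a b)
  then show ?thesis using O TS_iff[OF O] TS_iff[of "Suc p" a] TS_iff[of "Suc (p + length (enc a))" b] children(5)[of p a b]
      succD(2)[OF assms(1), of p a b]
    by (simp add: child1_def child2_def)
next
  case (Until_U a b)
  then show ?thesis using O TS_iff[OF O] TS_iff[of "Suc p" a] TS_iff[of "Suc (p + length (enc a))" b] children(6)[of p a b]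
      succD(3)[OF assms(1), of p a b]
    by (simp add: child1_def child2_def)
qed simp_all

text \<open>Every row is cut to a lasso that meets all inner obligations in its loop and contains an
  instant for each outer obligation met anywhere in the row. Then the sequence of rows is itself cut
  to a lasso.\<close>

lemma labelling_path:
  assumes lab: "labelling T" and root: "0 \<in> T 0 0" and sub: "\<And>i j. T i j \<subseteq> fst ` Occ"
  shows "edge\<^sup>*\<^sup>* (\<lambda>_. {fST}) (\<lambda>_. {fDN})"
proof -
  have st: "static (T (Suc i) 0) (T i j)" and su: "succ (T i j) (T i (Suc j))" for i j
    using lab unfolding labelling_def by blast+
  have fu': "\<forall>x\<in>Occ. \<forall>i N. \<exists>j\<ge>N. ful (T (Suc i) 0) (T i j) x"
    and gf': "\<forall>x\<in>Occ. \<forall>N. \<exists>i\<ge>N. \<exists>j. gful (T i j) x"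
    by (rule conjunct1[OF conjunct2[OF lab[unfolded labelling_def]]],
        rule conjunct2[OF conjunct2[OF lab[unfolded labelling_def]]])
  have finO: "finite Occ" by (rule finite_occs)
  have finP: "finite (Pow (fst ` Occ))" using finO by simp
  have "\<exists>a l. 1 \<le> a \<and> a < l \<and> T i a = T i l \<and> (\<forall>x\<in>Occ. \<exists>j. a \<le> j \<and> j < l \<and> ful (T (Suc i) 0) (T i j) x) \<and>
     (\<forall>x\<in>Occ. (\<exists>j. gful (T i j) x) \<longrightarrow> (\<exists>j<l. gful (T i j) x))" for i
  proof -
    \<comment> \<open>\<open>J\<close> picks one instant for each outer obligation met in row
      \<open>i\<close>; the lasso is closed only beyond all of them, so cutting the row loses no
      obligation.\<close>
    define J where "J x = (SOME j. gful (T i j) x)" for x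
    have J: "gful (T i (J x)) x" if "\<exists>j. gful (T i j) x" for x
      unfolding J_def using that by (rule someI_ex)
    obtain M where M: "\<forall>n\<in>J ` Occ. n < M" using finite_nat_set_iff_bounded[of "J ` Occ"] finO by auto
    have fr: "finite (range (T i))" by (rule finite_subset[OF _ finP]) (use sub in auto)
    have "\<exists>j\<ge>N. ful (T (Suc i) 0) (T i j) x" if "x \<in> Occ" for x N
      by (rule bspec[OF fu' that, THEN spec, THEN spec])
    from lasso_find[where P = "\<lambda>x j. ful (T (Suc i) 0) (T i j) x" and M = M, OF fr finO this]
    obtain a l where al: "1 \<le> a" "a < l" "M \<le> l" "T i a = T i l"
      "\<forall>x\<in>Occ. \<exists>j. a \<le> j \<and> j < l \<and> ful (T (Suc i) 0) (T i j) x" by blast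
    have "\<exists>j<l. gful (T i j) x" if "x \<in> Occ" "\<exists>j. gful (T i j) x" for x
      using J[OF that(2)] M that(1) al(3) by (metis imageI less_le_trans)
    then show ?thesis using al by (intro exI[of _ a] exI[of _ l]) simp
  qed
  then obtain a l where al: "\<And>i. 1 \<le> a i \<and> a i < l i \<and> T i (a i) = T i (l i) \<and>
     (\<forall>x\<in>Occ. \<exists>j. a i \<le> j \<and> j < l i \<and> ful (T (Suc i) 0) (T i j) x) \<and>
     (\<forall>x\<in>Occ. (\<exists>j. gful (T i j) x) \<longrightarrow> (\<exists>j<l i. gful (T i j) x))" by metis
  have a1: "1 \<le> a i" "a i < l i" "T i (a i) = T i (l i)" for i using al[of i] by simp_all
  have af: "\<exists>j. a i \<le> j \<and> j < l i \<and> ful (T (Suc i) 0) (T i j) x" if "x \<in> Occ" for i x using al[of i] that by simp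
  have ag: "\<exists>j<l i. gful (T i j) x" if "x \<in> Occ" "\<exists>j. gful (T i j) x" for i x using al[of i] that by simp
  have fr: "finite (range (\<lambda>i. T i 0))" by (rule finite_subset[OF _ finP]) (use sub in auto)
  have "\<exists>i\<ge>N. \<exists>j. gful (T i j) x" if "x \<in> Occ" for x N by (rule bspec[OF gf' that, THEN spec])
  from lasso_find[where P = "\<lambda>x i. \<exists>j. gful (T i j) x" and M = 0, OF fr finO this]
  obtain c r where cr: "1 \<le> c" "c < r" "T c 0 = T r 0" "\<forall>x\<in>Occ. \<exists>i. c \<le> i \<and> i < r \<and> (\<exists>j. gful (T i j) x)"
    by blast
  \<comment> \<open>Instant \<open>(i, j)\<close> with the fields of its lassos. \<open>fMK\<close>
    and \<open>fOK\<close> stand one instant, respectively one row, before the loop entry, which is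
    why the entries \<open>a i\<close> and \<open>c\<close> had to be positive.\<close>
  define node :: "nat \<Rightarrow> nat \<Rightarrow> nat \<Rightarrow> fld set" where "node i j p = {f. case f of
      fT \<Rightarrow> p \<in> T i j | fB \<Rightarrow> p \<in> T (Suc i) 0 | fS \<Rightarrow> p \<in> T i (a i)
    | fF \<Rightarrow> (\<exists>\<psi>. (p, \<psi>) \<in> Occ \<and> (\<exists>m. a i \<le> m \<and> m < j \<and> ful (T (Suc i) 0) (T i m) (p, \<psi>)))
    | fO \<Rightarrow> p \<in> T c 0
    | fG \<Rightarrow> (\<exists>\<psi>. (p, \<psi>) \<in> Occ \<and> c \<le> i \<and> ((\<exists>i' j'. c \<le> i' \<and> i' < i \<and> j' < l i' \<and> gful (T i' j') (p, \<psi>)) \<or>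
         (\<exists>j'<j. gful (T i j') (p, \<psi>))))
    | fIM \<Rightarrow> a i \<le> j | fOM \<Rightarrow> c \<le> i | fMK \<Rightarrow> Suc j = a i
    | fRW \<Rightarrow> j = l i \<and> Suc i \<noteq> r | fOK \<Rightarrow> Suc i = c | fFN \<Rightarrow> j = l i \<and> Suc i = r | fST \<Rightarrow> False | fDN \<Rightarrow> False}" for i j p
  have nT: "TS fT (node i j) = T i j" and nB: "TS fB (node i j) = T (Suc i) 0" for i j
    using sub[of i j] sub[of "Suc i" 0] by (auto simp: TS_def node_def)
  have F_iff: "fF \<in> node i j p \<longleftrightarrow> (\<exists>m. a i \<le> m \<and> m < j \<and> ful (T (Suc i) 0) (T i m) (p, \<psi>))"
    if "(p, \<psi>) \<in> Occ" for p \<psi> i j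
  proof -
    have "(\<exists>\<psi>'. (p, \<psi>') \<in> Occ \<and> (\<exists>m. a i \<le> m \<and> m < j \<and> ful (T (Suc i) 0) (T i m) (p, \<psi>')))
      \<longleftrightarrow> (\<exists>m. a i \<le> m \<and> m < j \<and> ful (T (Suc i) 0) (T i m) (p, \<psi>))" using that occs_unique[OF that] by blast
    then show ?thesis by (simp add: node_def)
  qed
  have G_iff: "fG \<in> node i j p \<longleftrightarrow> c \<le> i \<and> ((\<exists>i' j'. c \<le> i' \<and> i' < i \<and> j' < l i' \<and> gful (T i' j') (p, \<psi>)) \<or>
         (\<exists>j'<j. gful (T i j') (p, \<psi>)))" if "(p, \<psi>) \<in> Occ" for p \<psi> i j
  proof -
    have "(\<exists>\<psi>'. (p, \<psi>') \<in> Occ \<and> c \<le> i \<and> ((\<exists>i' j'. c \<le> i' \<and> i' < i \<and> j' < l i' \<and> gful (T i' j') (p, \<psi>')) \<or>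
         (\<exists>j'<j. gful (T i j') (p, \<psi>'))))
      \<longleftrightarrow> c \<le> i \<and> ((\<exists>i' j'. c \<le> i' \<and> i' < i \<and> j' < l i' \<and> gful (T i' j') (p, \<psi>)) \<or>
         (\<exists>j'<j. gful (T i j') (p, \<psi>)))" using that occs_unique[OF that] by blast
    then show ?thesis by (simp add: node_def)
  qed
  have fl: "fT \<in> node i j p \<longleftrightarrow> p \<in> T i j" "fB \<in> node i j p \<longleftrightarrow> p \<in> T (Suc i) 0" "fS \<in> node i j p \<longleftrightarrow> p \<in> T i (a i)"
    "fO \<in> node i j p \<longleftrightarrow> p \<in> T c 0" "fIM \<in> node i j p \<longleftrightarrow> a i \<le> j" "fOM \<in> node i j p \<longleftrightarrow> c \<le> i"
    "fMK \<in> node i j p \<longleftrightarrow> Suc j = a i" "fRW \<in> node i j p \<longleftrightarrow> j = l i \<and> Suc i \<noteq> r" "fOK \<in> node i j p \<longleftrightarrow> Suc i = c"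
    "fFN \<in> node i j p \<longleftrightarrow> j = l i \<and> Suc i = r" "fST \<notin> node i j p" "fDN \<notin> node i j p" for i j p
    by (simp_all add: node_def)
  have uni: "uniform (node i j)" for i j
    unfolding uniform_def
  proof
    fix x
    show "node i j (fst x) \<inter> flags = node i j 0 \<inter> flags"
    proof (rule set_eqI)
      fix f show "f \<in> node i j (fst x) \<inter> flags \<longleftrightarrow> f \<in> node i j 0 \<inter> flags"
        by (cases f) (simp_all add: fl flags_def)
    qed
  qed
  have var: "varok (node i j)" for i j
    unfolding varok_def fl using staticD(4)[OF st] by blast
  have ty: "tyok (tok \<psi>) (node i j p) (child1 (node i j) p \<psi>) (child2 (node i j) p \<psi>)" if "(p, \<psi>) \<in> Occ" for i j p \<psi>
    by (rule tyok_of_static[OF _ that]) (simp add: nT nB st)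
  have edge_step: "edge (node i j) (node i (Suc j))" if j: "j < l i" for i j
  proof -
    have "locally (node i j) (node i (Suc j)) x" if x: "x \<in> Occ" for x
    proof -
      obtain p \<psi> where xp: "x = (p, \<psi>)" by (cases x)
      have O: "(p, \<psi>) \<in> Occ" using x xp by simp
      have s: "(tok \<psi> = 2 \<longrightarrow> (fT \<in> node i j p \<longleftrightarrow> fT \<in> child1 (node i (Suc j)) p \<psi>)) \<and>
        (tok \<psi> = 5 \<or> tok \<psi> = 6 \<longrightarrow> (fT \<in> node i j p \<longleftrightarrow> fT \<in> child2 (node i j) p \<psi> \<or> (fT \<in> child1 (node i j) p \<psi> \<and> fT \<in> node i (Suc j) p)))"
        by (rule stepok_of_succ[OF _ O]) (simp add: nT su)
      have g: "fG \<in> node i (Suc j) p \<longrightarrow> fG \<in> node i j p \<or> gfk (tok \<psi>) (node i j p) (child2 (node i j) p \<psi>)"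
        unfolding gfk_gful[OF O] nT G_iff[OF O] by (auto simp: less_Suc_eq)
      have f: "fF \<in> node i (Suc j) p \<longrightarrow> fF \<in> node i j p \<or> ffk (tok \<psi>) (node i j p) (child1 (node i j) p \<psi>) (child2 (node i j) p \<psi>)"
        unfolding ffk_ful[OF O] nT nB F_iff[OF O] by (auto simp: less_Suc_eq)
      have f2: "fF \<notin> node i (Suc j) p" if "Suc j = a i" unfolding F_iff[OF O] using that by auto
      have im: "a i \<le> Suc j \<longleftrightarrow> a i \<le> j" if "Suc j \<noteq> a i" using that by auto
      have "stepok (tok \<psi>) (node i j p) (node i (Suc j) p) (child1 (node i j) p \<psi>) (child1 (node i (Suc j)) p \<psi>) (child2 (node i j) p \<psi>)"
        unfolding stepok_def using s g f f2 im by (simp add: fl)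
      then show ?thesis using ty[OF O] j unfolding locally_def xp by (simp add: lok_def fl)
    qed
    then show ?thesis unfolding edge_def using uni var by (simp add: fl)
  qed
  have edge_row: "edge (node i (l i)) (node (Suc i) 0)" if i: "Suc i < r" for i
  proof -
    have "locally (node i (l i)) (node (Suc i) 0) x" if x: "x \<in> Occ" for x
    proof -
      obtain p \<psi> where xp: "x = (p, \<psi>)" by (cases x)
      have O: "(p, \<psi>) \<in> Occ" using x xp by simp
      have F: "fF \<in> node i (l i) p" unfolding F_iff[OF O] using af[OF O] by simp
      have G: "fG \<in> node i (l i) p" if g: "fG \<in> node (Suc i) 0 p" "Suc i \<noteq> c"
      proof -
        obtain i' j' where "c \<le> i'" "i' < Suc i" "j' < l i'" "gful (T i' j') (p, \<psi>)"
          using g(1) unfolding G_iff[OF O] by auto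
        then show ?thesis unfolding G_iff[OF O] by (cases "i' = i") auto
      qed
      have G2: "fG \<notin> node (Suc i) 0 p" if "Suc i = c" unfolding G_iff[OF O] using that by auto
      have om: "c \<le> Suc i \<longleftrightarrow> c \<le> i" if "Suc i \<noteq> c" using that by auto
      have aS: "\<not> a (Suc i) \<le> 0" using a1(1)[of "Suc i"] by simp
      have "rowend (node i (l i) p) (node (Suc i) 0 p)"
        unfolding rowend_def using F G G2 om a1[of i] aS by (simp add: fl)
      then show ?thesis using ty[OF O] i unfolding locally_def xp by (simp add: lok_def fl)
    qed
    then show ?thesis unfolding edge_def using uni var by (simp add: fl)
  qed
  obtain r' where r': "r = Suc r'" using cr(2) by (cases r) auto
  have edge_fin: "edge (node r' (l r')) (\<lambda>_. {fDN})"
  proof -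
    have "locally (node r' (l r')) (\<lambda>_. {fDN}) x" if x: "x \<in> Occ" for x
    proof -
      obtain p \<psi> where xp: "x = (p, \<psi>)" by (cases x)
      have O: "(p, \<psi>) \<in> Occ" using x xp by simp
      have F: "fF \<in> node r' (l r') p" unfolding F_iff[OF O] using af[OF O] by simp
      have G: "fG \<in> node r' (l r') p"
      proof -
        obtain i where i: "c \<le> i" "i < r" "\<exists>j. gful (T i j) (p, \<psi>)" using cr(4) O by blast
        obtain j where j: "j < l i" "gful (T i j) (p, \<psi>)" using ag[OF O i(3)] by blast
        have "c \<le> r'" using i(1,2) r' by simp
        then show ?thesis unfolding G_iff[OF O] using i(1,2) j r' by (cases "i = r'") auto
      qed
      have "finok (node r' (l r') p)"
        unfolding finok_def using F G a1[of r'] cr r' by (simp add: fl)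
      then show ?thesis using ty[OF O] r' unfolding locally_def xp by (simp add: lok_def fl)
    qed
    then show ?thesis unfolding edge_def using uni var by (simp add: fl)
  qed
  have edge_start: "edge (\<lambda>_. {fST}) (node 0 0)"
  proof -
    have "\<not> a 0 \<le> 0" "\<not> c \<le> 0" using a1(1)[of 0] cr(1) by simp_all
    then have "locally (\<lambda>_. {fST}) (node 0 0) x" for x
      by (cases x) (simp add: locally_def lok_def fl)
    then show ?thesis unfolding edge_def using root by (simp add: fl uniform_def varok_def)
  qed
  have inner: "j \<le> l i \<Longrightarrow> edge\<^sup>*\<^sup>* (node i 0) (node i j)" for i j
  proof (induction j)
    case (Suc j)
    then show ?case using edge_step[of j i] by (meson Suc_le_lessD Suc_leD rtranclp.rtrancl_into_rtrancl)
  qed simp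
  have outer: "i < r \<Longrightarrow> edge\<^sup>*\<^sup>* (\<lambda>_. {fST}) (node i 0)" for i
  proof (induction i)
    case 0 then show ?case using edge_start by blast
  next
    case (Suc i)
    then show ?case using inner[of "l i" i] edge_row[of i]
      by (meson Suc_lessD order_refl rtranclp.rtrancl_into_rtrancl rtranclp_trans)
  qed
  have "edge\<^sup>*\<^sup>* (\<lambda>_. {fST}) (node r' (l r'))"
    using outer[of r'] inner[of "l r'" r'] r' by (meson lessI order_refl rtranclp_trans)
  then show ?thesis using edge_fin by (simp only: rtranclp.rtrancl_into_rtrancl)
qed

theorem satisfiable_iff_path: "satisfiable \<phi> \<longleftrightarrow> edge\<^sup>*\<^sup>* (\<lambda>_. {fST}) (\<lambda>_. {fDN})"
proof
  assume "satisfiable \<phi>"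
  then obtain \<xi> where "sat \<xi> (0, 0) \<phi>" unfolding satisfiable_at_origin by blast
  then obtain T where "labelling T" "0 \<in> T 0 0" "\<forall>i j. T i j \<subseteq> fst ` Occ" using model_labelling by blast
  then show "edge\<^sup>*\<^sup>* (\<lambda>_. {fST}) (\<lambda>_. {fDN})" using labelling_path by blast
next
  assume "edge\<^sup>*\<^sup>* (\<lambda>_. {fST}) (\<lambda>_. {fDN})"
  then have "\<exists>T. labelling T \<and> 0 \<in> T 0 0" using path_labelling[of "\<lambda>_. {fST}" "\<lambda>_. {fDN}"] by (simp add: invar_def)
  then show "satisfiable \<phi>" using labelling_model by blast
qed

end

section \<open>The local check as a right-to-left scan\<close>

definition nsym :: nat where
  "nsym = card (UNIV :: fld set set)"

definition nbit :: nat where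
  "nbit = card (UNIV :: fld set)"

text \<open>Node symbols are numbered from 1, because 0 means an empty stack.\<close>

definition dec :: "nat \<Rightarrow> fld set" where
  "dec = (SOME h. bij_betw h {1..nsym} UNIV)"

lemma nsym_eq: "nsym = 2 ^ nbit"
proof -
  have "(UNIV :: fld set set) = Pow UNIV" by auto
  then show ?thesis using card_Pow[OF finite_fld] by (simp only: nsym_def nbit_def)
qed

lemma nsym_ge: "4 \<le> nsym"
proof -
  have "card {fT, fB} \<le> nbit" unfolding nbit_def by (rule card_mono[OF finite_fld]) simp
  then have "2 \<le> nbit" by simp
  then have "(2::nat) ^ 2 \<le> 2 ^ nbit" by (intro power_increasing) auto
  then show ?thesis by (simp add: nsym_eq)
qed

lemma bij_dec: "bij_betw dec {1..nsym} UNIV"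
proof -
  have "finite (UNIV :: fld set set)" using finite_fld by (simp add: Finite_Set.finite_set)
  then have "\<exists>h. bij_betw h {1..nsym} (UNIV :: fld set set)"
    unfolding nsym_def by (rule ex_bij_betw_nat_finite_1)
  then show ?thesis unfolding dec_def by (rule someI_ex)
qed

definition cod :: "fld set \<Rightarrow> nat" where
  "cod x = (SOME n. n \<in> {1..nsym} \<and> dec n = x)"

lemma cod: "cod x \<in> {1..nsym}" "dec (cod x) = x"
proof -
  have "x \<in> dec ` {1..nsym}" using bij_dec by (simp add: bij_betw_def)
  then have "\<exists>n. n \<in> {1..nsym} \<and> dec n = x" by auto
  then have "cod x \<in> {1..nsym} \<and> dec (cod x) = x" unfolding cod_def by (rule someI_ex)
  then show "cod x \<in> {1..nsym}" "dec (cod x) = x" by auto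
qed

text \<open>The scan uses \<open>rY\<close> and \<open>rY2\<close> for the candidate name and its
  matched part, and \<open>rCU\<close>, \<open>rCV\<close> for the symbols of both nodes at the
  roots of the formulas read so far. \<open>rPAR\<close> is 1 between formulas, 2 after the numeral
  of 0, 3 inside a numeral that began with 9; \<open>rEQ\<close> is 1 as long as the digits match
  the candidate; \<open>rVB\<close> holds the truth value seen for the candidate (2 or 3), or 1 if
  there is none yet; \<open>rFL\<close> holds the symbol with which flags are compared;
  \<open>rERR\<close> is 1 without error and 2 otherwise.\<close>

record dst =
  rW :: "nat list"
  rW2 :: "nat list"
  rPQ :: "nat list"
  rPX :: "nat list"
  rPA :: "nat list"
  rREST :: "nat list"
  rMODE :: "nat list"
  rX :: "nat list"
  rA :: "nat list"
  rY :: "nat list"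
  rY2 :: "nat list"
  rU :: "nat list"
  rV :: "nat list"
  rD :: "nat list"
  rCU :: "nat list"
  rCV :: "nat list"
  rDU :: "nat list"
  rDV :: "nat list"
  rPAR :: "nat list"
  rEQ :: "nat list"
  rVB :: "nat list"
  rFL :: "nat list"
  rERR :: "nat list"
  rLV :: "nat list"

text \<open>The symbols 1 and 2 of a candidate name stand for the digits 8 and 9, all other symbols end the name.\<close>

definition dgt :: "nat \<Rightarrow> nat" where
  "dgt x = (if x = 1 then 8 else if x = 2 then 9 else 0)"

definition tbit :: "nat \<Rightarrow> nat" where
  "tbit x = (if fT \<in> dec x then 3 else 2)"

text \<open>Flags are compared with the node symbol met last, which suffices since equality is
  transitive. \<open>Suc nsym\<close> is no node symbol and says that none has been met.\<close>

definition flag_ok :: "nat \<Rightarrow> nat \<Rightarrow> bool" where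
  "flag_ok f x \<longleftrightarrow> f = Suc nsym \<or> dec f \<inter> flags = dec x \<inter> flags"

definition matched :: "nat \<Rightarrow> nat \<Rightarrow> bool" where
  "matched e y \<longleftrightarrow> e = 1 \<and> dgt y = 0"

definition err7 :: "nat \<Rightarrow> nat \<Rightarrow> nat \<Rightarrow> nat \<Rightarrow> nat \<Rightarrow> nat \<Rightarrow> nat \<Rightarrow> bool" where
  "err7 par e y vb fl u v \<longleftrightarrow> par = 1 \<or> (matched e y \<and> vb \<noteq> 1 \<and> vb \<noteq> tbit u) \<or>
     \<not> lok 7 (dec u) (dec v) {} {} {} \<or> \<not> flag_ok fl u"

definition err1 :: "nat \<Rightarrow> nat \<Rightarrow> nat \<Rightarrow> nat \<Rightarrow> nat \<Rightarrow> nat \<Rightarrow> nat \<Rightarrow> bool" where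
  "err1 a par fl u v cu cv \<longleftrightarrow> par \<noteq> 1 \<or> cu = 0 \<or> \<not> lok a (dec u) (dec v) (dec cu) (dec cv) {} \<or> \<not> flag_ok fl u"

definition err2 :: "nat \<Rightarrow> nat \<Rightarrow> nat \<Rightarrow> nat \<Rightarrow> nat \<Rightarrow> nat \<Rightarrow> nat \<Rightarrow> nat \<Rightarrow> bool" where
  "err2 a par fl u v cu cv du \<longleftrightarrow> par \<noteq> 1 \<or> cu = 0 \<or> du = 0 \<or>
     \<not> lok a (dec u) (dec v) (dec cu) (dec cv) (dec du) \<or> \<not> flag_ok fl u"

definition set_top :: "nat \<Rightarrow> nat list \<Rightarrow> nat list" where
  "set_top a xs = (if xs = [] then [] else a # tl xs)"

text \<open>Read from right to left, prefix notation behaves like postfix notation: the operands are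
  on the stack before their connective arrives, the first operand on top. Digits arrive with the
  most significant one first.\<close>

definition stp :: "nat \<times> nat \<times> nat \<Rightarrow> dst \<Rightarrow> dst" where
  "stp z d = (case z of (a, u, v) \<Rightarrow>
    if a = 8 \<or> a = 9 then
      (let hit = (hd0 (rEQ d) = 1 \<and> dgt (hd0 (rY d)) = a) in
       d\<lparr> rY := (if hit then tl (rY d) else rY d), rY2 := (if hit then hd0 (rY d) # rY2 d else rY2 d),
          rEQ := (if hit then rEQ d else [2]),
          rPAR := (if hd0 (rPAR d) = 1 then [if a = 8 then 2 else 3] else rPAR d),
          rERR := (if hd0 (rPAR d) = 2 then [2] else rERR d) \<rparr>)
    else if a = 7 then
      d\<lparr> rY := rev (rY2 d) @ rY d, rY2 := [], rEQ := [1], rPAR := [1],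
         rVB := (if matched (hd0 (rEQ d)) (hd0 (rY d)) \<and> hd0 (rVB d) = 1 then [tbit u] else rVB d),
         rFL := [u], rCU := u # rCU d, rCV := v # rCV d,
         rERR := (if err7 (hd0 (rPAR d)) (hd0 (rEQ d)) (hd0 (rY d)) (hd0 (rVB d)) (hd0 (rFL d)) u v then [2] else rERR d) \<rparr>
    else if a = 1 \<or> a = 2 \<or> a = 3 then
      d\<lparr> rFL := [u], rCU := set_top u (rCU d), rCV := set_top v (rCV d),
         rERR := (if err1 a (hd0 (rPAR d)) (hd0 (rFL d)) u v (hd0 (rCU d)) (hd0 (rCV d)) then [2] else rERR d) \<rparr>
    else
      d\<lparr> rFL := [u], rCU := set_top u (tl (rCU d)), rCV := set_top v (tl (rCV d)),
         rERR := (if err2 a (hd0 (rPAR d)) (hd0 (rFL d)) u v (hd0 (rCU d)) (hd0 (rCV d)) (hd0 (tl (rCU d))) then [2] else rERR d) \<rparr>)"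

fun seg :: "(nat \<Rightarrow> nat) \<Rightarrow> (nat \<Rightarrow> nat) \<Rightarrow> nat \<Rightarrow> nat list \<Rightarrow> (nat \<times> nat \<times> nat) list" where
  "seg us vs k [] = []"
| "seg us vs k (a # w) = (a, us k, vs k) # seg us vs (Suc k) w"

lemma seg_append: "seg us vs k (w1 @ w2) = seg us vs k w1 @ seg us vs (k + length w1) w2"
  by (induction w1 arbitrary: k) auto

text \<open>The candidate lists the digits in scanning order and then needs a symbol that is no
  digit; the end of the word counts as such, since \<open>hd0 []\<close> is 0.\<close>

definition name_of :: "nat list \<Rightarrow> nat \<Rightarrow> bool" where
  "name_of y n \<longleftrightarrow> (let k = length (bin n) in map dgt (take k y) = rev (bin n) \<and> dgt (hd0 (drop k y)) = 0)"

lemma dgt_0 [simp]: "dgt 0 = 0" by (simp add: dgt_def)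

lemma take_Suc_hd0: "k < length y \<Longrightarrow> take (Suc k) y = take k y @ [hd0 (drop k y)]"
  by (simp add: take_Suc_conv_app_nth hd0_drop)

lemma scan_digit:
  assumes d: "rEQ d = [1] \<or> rEQ d = [2]" "a = 8 \<or> a = 9"
    and inv: "rev (rY2 d) @ rY d = y" "rEQ d = [1] \<longleftrightarrow> map dgt (take k y) = ds" "rEQ d = [1] \<longrightarrow> rY d = drop k y"
    and len: "length ds = k"
  shows "(rEQ (stp (a, u, v) d) = [1] \<or> rEQ (stp (a, u, v) d) = [2]) \<and>
     rev (rY2 (stp (a, u, v) d)) @ rY (stp (a, u, v) d) = y \<and>
     (rEQ (stp (a, u, v) d) = [1] \<longleftrightarrow> map dgt (take (Suc k) y) = ds @ [a]) \<and>
     (rEQ (stp (a, u, v) d) = [1] \<longrightarrow> rY (stp (a, u, v) d) = drop (Suc k) y)"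
proof -
  let ?hit = "rEQ d = [1] \<and> dgt (hd0 (rY d)) = a"
  have hd: "hd0 (rEQ d) = 1 \<longleftrightarrow> rEQ d = [1]" using d(1) by auto
  have st: "rEQ (stp (a, u, v) d) = (if ?hit then rEQ d else [2])"
    "rY (stp (a, u, v) d) = (if ?hit then tl (rY d) else rY d)"
    "rY2 (stp (a, u, v) d) = (if ?hit then hd0 (rY d) # rY2 d else rY2 d)"
    using d(2) hd by (auto simp: stp_def Let_def)
  have a0: "a \<noteq> 0" using d(2) by auto
  show ?thesis
  proof (cases ?hit)
    case True
    then have yd: "rY d = drop k y" using inv(3) by simp
    have "rY d \<noteq> []" using True a0 by auto
    then have k: "k < length y" using yd by (metis drop_all not_le)
    have "rY d = hd0 (rY d) # tl (rY d)" using \<open>rY d \<noteq> []\<close> by (cases "rY d") auto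
    then have "rev (rY2 d) @ [hd0 (rY d)] @ tl (rY d) = y" using inv(1) by simp
    moreover have "map dgt (take (Suc k) y) = ds @ [a]"
      using take_Suc_hd0[OF k] True inv(2) yd by simp
    moreover have "tl (rY d) = drop (Suc k) y" using yd by (simp add: drop_Suc tl_drop)
    ultimately show ?thesis using st True by simp
  next
    case False
    have "map dgt (take (Suc k) y) \<noteq> ds @ [a]"
    proof
      assume m: "map dgt (take (Suc k) y) = ds @ [a]"
      then have "length (take (Suc k) y) = Suc k" using len by (metis length_append_singleton length_map)
      then have k: "k < length y" by simp
      then have "map dgt (take k y) @ [dgt (hd0 (drop k y))] = ds @ [a]" using m take_Suc_hd0[OF k] by simp
      then have "map dgt (take k y) = ds" "dgt (hd0 (drop k y)) = a" by auto
      then show False using False inv(2,3) by auto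
    qed
    then show ?thesis using st False inv(1) d(1) by auto
  qed
qed

lemma stp_digit:
  assumes "a = 8 \<or> a = 9"
  shows "rPAR (stp (a, u, v) d) = (if hd0 (rPAR d) = 1 then [if a = 8 then 2 else 3] else rPAR d)"
    "rERR (stp (a, u, v) d) = (if hd0 (rPAR d) = 2 then [2] else rERR d)"
    "rVB (stp (a, u, v) d) = rVB d" "rFL (stp (a, u, v) d) = rFL d"
    "rCU (stp (a, u, v) d) = rCU d" "rCV (stp (a, u, v) d) = rCV d"
  using assms by (auto simp: stp_def Let_def)

text \<open>The scan meets the last digit of the numeral first. This digit is 8 only for the number
  0 and is 9 for all others, which is what the final parser state records.\<close>

lemma scan_bin:
  fixes us vs :: "nat \<Rightarrow> nat" and k n :: nat
  assumes d: "rPAR d = [1]" "rEQ d = [1]" "rY2 d = []"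
  defines "d' \<equiv> foldr stp (seg us vs k (bin n)) d"
  shows "(rEQ d' = [1] \<or> rEQ d' = [2]) \<and> rev (rY2 d') @ rY d' = rY d \<and>
    (rEQ d' = [1] \<longleftrightarrow> map dgt (take (length (bin n)) (rY d)) = rev (bin n)) \<and>
    (rEQ d' = [1] \<longrightarrow> rY d' = drop (length (bin n)) (rY d)) \<and>
    rPAR d' = [if n = 0 then 2 else 3] \<and> rERR d' = rERR d \<and> rVB d' = rVB d \<and> rFL d' = rFL d \<and>
    rCU d' = rCU d \<and> rCV d' = rCV d"
  unfolding d'_def
proof (induction n arbitrary: k rule: less_induct)
  case (less n)
  show ?case
  proof (cases "n < 2")
    case True
    then have b: "bin n = [8 + n]" by (subst bin.simps) simp
    have a: "8 + n = 8 \<or> 8 + n = 9" using True by auto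
    have "foldr stp (seg us vs k (bin n)) d = stp (8 + n, us k, vs k) d" by (simp add: b)
    moreover note scan_digit[of d "8 + n" "rY d" 0 "[]" "us k" "vs k"]
    ultimately show ?thesis using d b stp_digit[OF a, of "us k" "vs k" d] a by (simp, blast)
  next
    case False
    let ?m = "n div 2" and ?a = "8 + n mod 2"
    have b: "bin n = ?a # bin ?m" using False by (subst bin.simps) simp
    have a: "?a = 8 \<or> ?a = 9" by auto
    let ?d = "foldr stp (seg us vs (Suc k) (bin ?m)) d"
    have m: "?m < n" "?m \<noteq> 0" using False by auto
    have "foldr stp (seg us vs k (bin n)) d = stp (?a, us k, vs k) ?d" by (simp add: b)
    define e where "e = ?d"
    define c where "c = ?a"
    have c: "c = 8 \<or> c = 9" unfolding c_def by (rule a)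
    note IH = less.IH[OF m(1), of "Suc k", folded e_def]
    have "rPAR e = [3]" using IH m(2) by simp
    then have "rPAR (stp (c, us k, vs k) e) = [3]" "rERR (stp (c, us k, vs k) e) = rERR d"
      "rVB (stp (c, us k, vs k) e) = rVB d" "rFL (stp (c, us k, vs k) e) = rFL d"
      "rCU (stp (c, us k, vs k) e) = rCU d" "rCV (stp (c, us k, vs k) e) = rCV d"
      using IH by (simp_all add: stp_digit[OF c])
    moreover have "(rEQ (stp (c, us k, vs k) e) = [1] \<or> rEQ (stp (c, us k, vs k) e) = [2]) \<and>
       rev (rY2 (stp (c, us k, vs k) e)) @ rY (stp (c, us k, vs k) e) = rY d \<and>
       (rEQ (stp (c, us k, vs k) e) = [1] \<longleftrightarrow> map dgt (take (Suc (length (bin ?m))) (rY d)) = rev (bin ?m) @ [c]) \<and>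
       (rEQ (stp (c, us k, vs k) e) = [1] \<longrightarrow> rY (stp (c, us k, vs k) e) = drop (Suc (length (bin ?m))) (rY d))"
      by (rule scan_digit) (use IH c in \<open>blast | simp\<close>)+
    ultimately show ?thesis using False unfolding \<open>foldr stp (seg us vs k (bin n)) d = stp (?a, us k, vs k) ?d\<close> b
      by (simp add: e_def[symmetric] c_def[symmetric], (blast)?)
  qed
qed

lemma scan_Var:
  fixes us vs :: "nat \<Rightarrow> nat" and k n :: nat
  assumes d: "rPAR d = [1]" "rEQ d = [1]" "rY2 d = []" "rFL d = [f]" "rVB d = [b]"
  defines "d' \<equiv> foldr stp (seg us vs k (enc (Var n))) d"
  shows "rPAR d' = [1] \<and> rEQ d' = [1] \<and> rY2 d' = [] \<and> rY d' = rY d \<and> rCU d' = us k # rCU d \<and> rCV d' = vs k # rCV d \<and>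
     rFL d' = [us k] \<and> rVB d' = [if name_of (rY d) n \<and> b = 1 then tbit (us k) else b] \<and>
     rERR d' = (if (name_of (rY d) n \<and> b \<noteq> 1 \<and> b \<noteq> tbit (us k)) \<or> \<not> lok 7 (dec (us k)) (dec (vs k)) {} {} {} \<or> \<not> flag_ok f (us k)
       then [2] else rERR d)"
proof -
  let ?d = "foldr stp (seg us vs (Suc k) (bin n)) d"
  note B = scan_bin[OF d(1-3), where us = us and vs = vs and k = "Suc k" and n = n]
  have e: "d' = stp (7, us k, vs k) ?d" by (simp add: d'_def)
  have m: "matched (hd0 (rEQ ?d)) (hd0 (rY ?d)) \<longleftrightarrow> name_of (rY d) n"
    using B by (auto simp: matched_def name_of_def Let_def)
  have p: "hd0 (rPAR ?d) \<noteq> 1" using B by auto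
  show ?thesis unfolding e using B d(4,5) m p by (simp add: stp_def err7_def)
qed

section \<open>The conditions verified by a scan\<close>

definition LOC :: "(nat \<Rightarrow> nat) \<Rightarrow> (nat \<Rightarrow> nat) \<Rightarrow> nat \<Rightarrow> fml \<Rightarrow> bool" where
  "LOC us vs k \<phi> \<longleftrightarrow> (\<forall>x\<in>occs k \<phi>. formula.locally (\<lambda>p. dec (us p)) (\<lambda>p. dec (vs p)) x)"

definition FLG :: "(nat \<Rightarrow> nat) \<Rightarrow> nat \<Rightarrow> nat \<Rightarrow> fml \<Rightarrow> bool" where
  "FLG us f k \<phi> \<longleftrightarrow> flag_ok f (us k) \<and> (\<forall>x\<in>occs k \<phi>. dec (us (fst x)) \<inter> flags = dec (us k) \<inter> flags)"

definition bits :: "(nat \<Rightarrow> nat) \<Rightarrow> nat list \<Rightarrow> nat \<Rightarrow> fml \<Rightarrow> nat set" where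
  "bits us y k \<phi> = {tbit (us p) | p n. (p, Var n) \<in> occs k \<phi> \<and> name_of y n}"

text \<open>\<open>b\<close> is the content of the value register before a part is scanned, 1 if it
  holds no value, and \<open>Bs\<close> the set of values occurring in that part.\<close>

definition VOK :: "nat \<Rightarrow> nat set \<Rightarrow> bool" where
  "VOK b Bs \<longleftrightarrow> (\<forall>x\<in>Bs. b \<noteq> 1 \<longrightarrow> x = b) \<and> (\<forall>x\<in>Bs. \<forall>x'\<in>Bs. x = x')"

definition vnext :: "nat \<Rightarrow> nat set \<Rightarrow> nat \<Rightarrow> bool" where
  "vnext b Bs b' \<longleftrightarrow> (b \<noteq> 1 \<longrightarrow> b' = b) \<and> (Bs = {} \<longrightarrow> b' = b) \<and> (\<forall>x\<in>Bs. b' = x)"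

lemma tbit_neq: "tbit x \<noteq> 1" by (simp add: tbit_def)

lemma bits_neq: "x \<in> bits us y k \<phi> \<Longrightarrow> x \<noteq> 1" using tbit_neq by (auto simp: bits_def)

text \<open>Once a value is recorded, all later ones are compared with it. Handing the register from
  one part to the next therefore compares the values of both parts.\<close>

lemma VOK_union:
  assumes "VOK b X" "vnext b X b'" "\<forall>x\<in>X. x \<noteq> 1"
  shows "VOK b' Z \<longleftrightarrow> VOK b (X \<union> Z)"
proof (cases "X = {}")
  case True
  then show ?thesis using assms(2) by (simp add: vnext_def)
next
  case False
  then have X: "X = {b'}" using assms(2) unfolding vnext_def by auto
  have 1: "b' \<noteq> 1" using assms(3) X by blast
  have 2: "b \<noteq> 1 \<Longrightarrow> b' = b" using assms(2) unfolding vnext_def by blast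
  show ?thesis
  proof
    assume "VOK b' Z"
    then have "\<forall>x\<in>X \<union> Z. x = b'" using 1 X unfolding VOK_def by blast
    then show "VOK b (X \<union> Z)" using 2 unfolding VOK_def by metis
  next
    assume "VOK b (X \<union> Z)"
    then have "\<forall>x\<in>Z. x = b'" using X unfolding VOK_def by blast
    then show "VOK b' Z" unfolding VOK_def by metis
  qed
qed

lemma vnext_union:
  assumes "VOK b (X \<union> Z)" "vnext b X b'" "vnext b' Z b''" "\<forall>x\<in>X \<union> Z. x \<noteq> 1"
  shows "vnext b (X \<union> Z) b''"
  unfolding vnext_def
proof (intro conjI impI ballI)
  show "b'' = b" if "b \<noteq> 1" using assms(2,3) that unfolding vnext_def by metis
  show "b'' = b" if "X \<union> Z = {}" using assms(2,3) that unfolding vnext_def by simp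
  fix x assume "x \<in> X \<union> Z"
  then show "b'' = x"
  proof
    assume x: "x \<in> X"
    then have "b' = x" "x \<noteq> 1" using assms(2,4) unfolding vnext_def by blast+
    then show ?thesis using assms(3) unfolding vnext_def by metis
  next
    assume "x \<in> Z"
    then show ?thesis using assms(3) unfolding vnext_def by blast
  qed
qed

text \<open>Parser and comparison return to their resting states, so formulas can be scanned one
  after the other. The value register is specified only without error: no \<open>b'\<close>
  satisfies \<open>vnext\<close> for two conflicting values.\<close>

definition scanned :: "(nat \<Rightarrow> nat) \<Rightarrow> (nat \<Rightarrow> nat) \<Rightarrow> nat \<Rightarrow> fml \<Rightarrow> nat \<Rightarrow> nat \<Rightarrow> dst \<Rightarrow> dst \<Rightarrow> bool" where
  "scanned us vs k \<phi> f b d d' \<longleftrightarrow> rPAR d' = [1] \<and> rEQ d' = [1] \<and> rY2 d' = [] \<and> rY d' = rY d \<and>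
     rCU d' = us k # rCU d \<and> rCV d' = vs k # rCV d \<and> rFL d' = [us k] \<and>
     (\<exists>b'. rVB d' = [b'] \<and> (rERR d' = [1] \<longrightarrow> vnext b (bits us (rY d) k \<phi>) b')) \<and>
     (rERR d' = [1] \<longleftrightarrow> rERR d = [1] \<and> LOC us vs k \<phi> \<and> FLG us f k \<phi> \<and> VOK b (bits us (rY d) k \<phi>))"

lemma flag_ok_cong: "dec x \<inter> flags = dec x' \<inter> flags \<Longrightarrow> flag_ok f x \<longleftrightarrow> flag_ok f x'"
  by (simp add: flag_ok_def)

lemma FLG_unary:
  assumes "occs k \<phi> = insert (k, \<phi>) (occs (Suc k) a)"
  shows "FLG us f k \<phi> \<longleftrightarrow> dec (us (Suc k)) \<inter> flags = dec (us k) \<inter> flags \<and> FLG us f (Suc k) a"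
proof -
  have s: "(Suc k, a) \<in> occs (Suc k) a" by (rule occs_self)
  show ?thesis
  proof
    assume F: "FLG us f k \<phi>"
    then have all: "dec (us (fst x)) \<inter> flags = dec (us k) \<inter> flags" if "x \<in> occs (Suc k) a" for x
      using that unfolding FLG_def assms by blast
    have e: "dec (us (Suc k)) \<inter> flags = dec (us k) \<inter> flags" using all[OF s] by simp
    moreover have "flag_ok f (us (Suc k))" using F flag_ok_cong[OF e] unfolding FLG_def by simp
    ultimately show "dec (us (Suc k)) \<inter> flags = dec (us k) \<inter> flags \<and> FLG us f (Suc k) a"
      unfolding FLG_def using all by simp
  next
    assume F: "dec (us (Suc k)) \<inter> flags = dec (us k) \<inter> flags \<and> FLG us f (Suc k) a"
    then have "flag_ok f (us k)" using flag_ok_cong unfolding FLG_def by blast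
    then show "FLG us f k \<phi>" using F unfolding FLG_def assms by simp
  qed
qed

lemma FLG_binary:
  assumes "occs k \<phi> = insert (k, \<phi>) (occs (Suc k) a \<union> occs m c)"
  shows "FLG us f k \<phi> \<longleftrightarrow> dec (us (Suc k)) \<inter> flags = dec (us k) \<inter> flags \<and> dec (us m) \<inter> flags = dec (us (Suc k)) \<inter> flags \<and>
     (\<forall>x\<in>occs (Suc k) a. dec (us (fst x)) \<inter> flags = dec (us (Suc k)) \<inter> flags) \<and> FLG us f m c"
proof -
  have s: "(Suc k, a) \<in> occs (Suc k) a" "(m, c) \<in> occs m c" by (rule occs_self)+
  show ?thesis
  proof
    assume F: "FLG us f k \<phi>"
    then have all: "dec (us (fst x)) \<inter> flags = dec (us k) \<inter> flags" if "x \<in> occs (Suc k) a \<union> occs m c" for x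
      using that unfolding FLG_def assms by blast
    have e: "dec (us (Suc k)) \<inter> flags = dec (us k) \<inter> flags" "dec (us m) \<inter> flags = dec (us k) \<inter> flags"
      using all[of "(Suc k, a)"] all[of "(m, c)"] s by simp_all
    moreover have "flag_ok f (us m)" using F flag_ok_cong[OF e(2)] unfolding FLG_def by simp
    ultimately show "dec (us (Suc k)) \<inter> flags = dec (us k) \<inter> flags \<and> dec (us m) \<inter> flags = dec (us (Suc k)) \<inter> flags \<and>
     (\<forall>x\<in>occs (Suc k) a. dec (us (fst x)) \<inter> flags = dec (us (Suc k)) \<inter> flags) \<and> FLG us f m c"
      unfolding FLG_def using all by simp
  next
    assume F: "dec (us (Suc k)) \<inter> flags = dec (us k) \<inter> flags \<and> dec (us m) \<inter> flags = dec (us (Suc k)) \<inter> flags \<and>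
     (\<forall>x\<in>occs (Suc k) a. dec (us (fst x)) \<inter> flags = dec (us (Suc k)) \<inter> flags) \<and> FLG us f m c"
    then have e: "dec (us m) \<inter> flags = dec (us k) \<inter> flags" by simp
    have "flag_ok f (us k)" using F flag_ok_cong[OF e] unfolding FLG_def by blast
    moreover have "dec (us (fst x)) \<inter> flags = dec (us k) \<inter> flags" if x: "x \<in> occs k \<phi>" for x
    proof -
      consider "x = (k, \<phi>)" | "x \<in> occs (Suc k) a" | "x \<in> occs m c" using x unfolding assms by blast
      then show ?thesis
      proof cases
        case 2
        then have "dec (us (fst x)) \<inter> flags = dec (us (Suc k)) \<inter> flags" using F by blast
        then show ?thesis using F by (simp only:)
      next
        case 3
        then have "dec (us (fst x)) \<inter> flags = dec (us m) \<inter> flags" using F unfolding FLG_def by blast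
        then show ?thesis using e by (simp only:)
      qed simp
    qed
    ultimately show "FLG us f k \<phi>" unfolding FLG_def by blast
  qed
qed

lemma scan_unary:
  assumes d1: "scanned us vs (Suc k) a f b d d1"
    and t: "t = 1 \<or> t = 2 \<or> t = 3" and oc: "occs k \<phi> = insert (k, \<phi>) (occs (Suc k) a)" "\<forall>n. \<phi> \<noteq> Var n"
    and lc: "formula.locally (\<lambda>p. dec (us p)) (\<lambda>p. dec (vs p)) (k, \<phi>) \<longleftrightarrow>
       lok t (dec (us k)) (dec (vs k)) (dec (us (Suc k))) (dec (vs (Suc k))) {}"
    and us: "\<forall>p. us p \<in> {1..nsym}"
  shows "scanned us vs k \<phi> f b d (stp (t, us k, vs k) d1)"
proof -
  let ?d = "stp (t, us k, vs k) d1"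
  note S = d1[unfolded scanned_def]
  have u: "us (Suc k) \<noteq> 0" "us (Suc k) \<noteq> Suc nsym" using us[rule_format, of "Suc k"] by auto
  have t7: "t \<noteq> 7" "t \<noteq> 8" "t \<noteq> 9" using t by auto
  have bt: "bits us (rY d) k \<phi> = bits us (rY d) (Suc k) a" using oc by (auto simp: bits_def)
  have er: "rERR ?d = (if \<not> formula.locally (\<lambda>p. dec (us p)) (\<lambda>p. dec (vs p)) (k, \<phi>) \<or>
      dec (us (Suc k)) \<inter> flags \<noteq> dec (us k) \<inter> flags then [2] else rERR d1)"
    using S t t7 u unfolding lc by (simp add: stp_def err1_def flag_ok_def)
  have lo: "LOC us vs k \<phi> \<longleftrightarrow> formula.locally (\<lambda>p. dec (us p)) (\<lambda>p. dec (vs p)) (k, \<phi>) \<and> LOC us vs (Suc k) a"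
    unfolding LOC_def oc(1) by simp
  have E: "rERR ?d = [1] \<longleftrightarrow> rERR d = [1] \<and> LOC us vs k \<phi> \<and> FLG us f k \<phi> \<and> VOK b (bits us (rY d) k \<phi>)"
    unfolding er FLG_unary[OF oc(1)] lo bt using S by auto
  have E1: "rERR ?d = [1] \<longrightarrow> rERR d1 = [1]" unfolding er by simp
  have R: "rPAR ?d = [1] \<and> rEQ ?d = [1] \<and> rY2 ?d = [] \<and> rY ?d = rY d \<and>
     rCU ?d = us k # rCU d \<and> rCV ?d = vs k # rCV d \<and> rFL ?d = [us k] \<and> rVB ?d = rVB d1"
    using S t t7 by (simp add: stp_def set_top_def)
  have "\<exists>b'. rVB d1 = [b'] \<and> (rERR d1 = [1] \<longrightarrow> vnext b (bits us (rY d) (Suc k) a) b')" using S by blast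
  then have "\<exists>b'. rVB ?d = [b'] \<and> (rERR ?d = [1] \<longrightarrow> vnext b (bits us (rY d) k \<phi>) b')"
    using R E1 unfolding bt by metis
  then show ?thesis unfolding scanned_def using R E by blast
qed

text \<open>The second operand is scanned first. Its root symbol \<open>us m\<close> is the flag
  reference for the first operand, whose root symbol is in turn the reference for the
  connective.\<close>

lemma scan_binary:
  assumes d1: "scanned us vs m c f b d d1" and d2: "scanned us vs (Suc k) a (us m) b1 d1 d2" and b1: "rVB d1 = [b1]"
    and t: "t = 4 \<or> t = 5 \<or> t = 6" and oc: "occs k \<phi> = insert (k, \<phi>) (occs (Suc k) a \<union> occs m c)" "\<forall>n. \<phi> \<noteq> Var n"
    and lc: "formula.locally (\<lambda>p. dec (us p)) (\<lambda>p. dec (vs p)) (k, \<phi>) \<longleftrightarrow>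
       lok t (dec (us k)) (dec (vs k)) (dec (us (Suc k))) (dec (vs (Suc k))) (dec (us m))"
    and us: "\<forall>p. us p \<in> {1..nsym}"
  shows "scanned us vs k \<phi> f b d (stp (t, us k, vs k) d2)"
proof -
  let ?d = "stp (t, us k, vs k) d2"
  note S1 = d1[unfolded scanned_def] and S2 = d2[unfolded scanned_def]
  have u: "us (Suc k) \<noteq> 0" "us (Suc k) \<noteq> Suc nsym" "us m \<noteq> 0" "us m \<noteq> Suc nsym"
    using us[rule_format, of "Suc k"] us[rule_format, of m] by auto
  have t7: "t \<noteq> 7" "t \<noteq> 8" "t \<noteq> 9" "t \<noteq> 1" "t \<noteq> 2" "t \<noteq> 3" using t by auto
  let ?y = "rY d"
  have Y: "rY d1 = ?y" using S1 by simp
  have bt: "bits us ?y k \<phi> = bits us ?y m c \<union> bits us ?y (Suc k) a" using oc by (auto simp: bits_def)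
  have er: "rERR ?d = (if \<not> formula.locally (\<lambda>p. dec (us p)) (\<lambda>p. dec (vs p)) (k, \<phi>) \<or>
      dec (us (Suc k)) \<inter> flags \<noteq> dec (us k) \<inter> flags then [2] else rERR d2)"
    using S1 S2 t t7 u unfolding lc by (simp add: stp_def err2_def flag_ok_def)
  have lo: "LOC us vs k \<phi> \<longleftrightarrow> formula.locally (\<lambda>p. dec (us p)) (\<lambda>p. dec (vs p)) (k, \<phi>) \<and> LOC us vs (Suc k) a \<and> LOC us vs m c"
    unfolding LOC_def oc(1) by auto
  have fl: "FLG us (us m) (Suc k) a \<longleftrightarrow> dec (us m) \<inter> flags = dec (us (Suc k)) \<inter> flags \<and>
     (\<forall>x\<in>occs (Suc k) a. dec (us (fst x)) \<inter> flags = dec (us (Suc k)) \<inter> flags)"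
    unfolding FLG_def using u(4) by (simp add: flag_ok_def)
  have bn: "\<forall>x\<in>bits us ?y m c. x \<noteq> 1" "\<forall>x\<in>bits us ?y (Suc k) a. x \<noteq> 1" using bits_neq by blast+
  have vn: "vnext b (bits us ?y m c) b1" if "rERR d1 = [1]" using S1 b1 that by simp
  have VU: "VOK b1 (bits us ?y (Suc k) a) \<longleftrightarrow> VOK b (bits us ?y k \<phi>)" if "rERR d1 = [1]"
    unfolding bt by (rule VOK_union) (use vn[OF that] S1 that bn in auto)
  have VV: "VOK b (bits us ?y k \<phi>) \<Longrightarrow> VOK b (bits us ?y m c)" unfolding bt VOK_def by blast
  have E1: "rERR d1 = [1] \<longleftrightarrow> rERR d = [1] \<and> LOC us vs m c \<and> FLG us f m c \<and> VOK b (bits us ?y m c)" using S1 by simp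
  have E2: "rERR d2 = [1] \<longleftrightarrow> rERR d1 = [1] \<and> LOC us vs (Suc k) a \<and> FLG us (us m) (Suc k) a \<and> VOK b1 (bits us ?y (Suc k) a)"
    using S2 Y by simp
  have E3: "rERR ?d = [1] \<longleftrightarrow> formula.locally (\<lambda>p. dec (us p)) (\<lambda>p. dec (vs p)) (k, \<phi>) \<and>
      dec (us (Suc k)) \<inter> flags = dec (us k) \<inter> flags \<and> rERR d2 = [1]" unfolding er by (simp, blast)
  have E: "rERR ?d = [1] \<longleftrightarrow> rERR d = [1] \<and> LOC us vs k \<phi> \<and> FLG us f k \<phi> \<and> VOK b (bits us ?y k \<phi>)"
    unfolding E3 E2 FLG_binary[OF oc(1)] lo fl using E1 VU VV by blast
  obtain b2 where b2: "rVB d2 = [b2]" "rERR d2 = [1] \<longrightarrow> vnext b1 (bits us ?y (Suc k) a) b2" using S2 Y by auto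
  have v: "vnext b (bits us ?y k \<phi>) b2" if "rERR ?d = [1]"
  proof -
    have "rERR d2 = [1]" "rERR d1 = [1]" "VOK b (bits us ?y k \<phi>)" using that E3 E2 E by blast+
    then show ?thesis unfolding bt using vnext_union[of b "bits us ?y m c" "bits us ?y (Suc k) a" b1 b2] vn b2(2) bn
      by (auto simp: bt)
  qed
  have "rPAR ?d = [1] \<and> rEQ ?d = [1] \<and> rY2 ?d = [] \<and> rY ?d = rY d \<and>
     rCU ?d = us k # rCU d \<and> rCV ?d = vs k # rCV d \<and> rFL ?d = [us k] \<and> rVB ?d = [b2]"
    using S1 S2 t t7 b2(1) by (simp add: stp_def set_top_def)
  then show ?thesis unfolding scanned_def using v E by blast
qed

lemma scan_enc:
  assumes us: "\<forall>p. us p \<in> {1..nsym}"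
  shows "rPAR d = [1] \<Longrightarrow> rEQ d = [1] \<Longrightarrow> rY2 d = [] \<Longrightarrow> rFL d = [f] \<Longrightarrow> rVB d = [b] \<Longrightarrow>
    scanned us vs k \<phi> f b d (foldr stp (seg us vs k (enc \<phi>)) d)"
proof (induction \<phi> arbitrary: k d f b)
  case (Var n)
  let ?d = "foldr stp (seg us vs k (enc (Var n))) d"
  note V = scan_Var[OF Var.prems, of us vs k n]
  have bt: "bits us (rY d) k (Var n) = (if name_of (rY d) n then {tbit (us k)} else {})" by (auto simp: bits_def)
  have lo: "LOC us vs k (Var n) \<longleftrightarrow> lok 7 (dec (us k)) (dec (vs k)) {} {} {}"
    by (simp add: LOC_def formula.locally_def child1_def child2_def)
  have fl: "FLG us f k (Var n) \<longleftrightarrow> flag_ok f (us k)" by (simp add: FLG_def)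
  show ?case unfolding scanned_def bt lo fl using V tbit_neq[of "us k"] by (auto simp: VOK_def vnext_def)
next
  case (Neg a)
  have "scanned us vs k (Neg a) f b d (stp (1, us k, vs k) (foldr stp (seg us vs (Suc k) (enc a)) d))"
    by (rule scan_unary[OF Neg.IH[OF Neg.prems] _ _ _ _ us]) (simp_all add: formula.locally_def child1_def child2_def)
  then show ?case by simp
next
  case (Next1 a)
  have "scanned us vs k (Next1 a) f b d (stp (2, us k, vs k) (foldr stp (seg us vs (Suc k) (enc a)) d))"
    by (rule scan_unary[OF Next1.IH[OF Next1.prems] _ _ _ _ us]) (simp_all add: formula.locally_def child1_def child2_def)
  then show ?case by simp
next
  case (NextW a)
  have "scanned us vs k (NextW a) f b d (stp (3, us k, vs k) (foldr stp (seg us vs (Suc k) (enc a)) d))"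
    by (rule scan_unary[OF NextW.IH[OF NextW.prems] _ _ _ _ us]) (simp_all add: formula.locally_def child1_def child2_def)
  then show ?case by simp
next
  case (Conj a c)
  let ?m = "Suc (k + length (enc a))"
  let ?d1 = "foldr stp (seg us vs ?m (enc c)) d"
  note s1 = Conj.IH(2)[OF Conj.prems, of ?m]
  obtain b1 where b1: "rVB ?d1 = [b1]" using s1 by (auto simp: scanned_def)
  have s2: "scanned us vs (Suc k) a (us ?m) b1 ?d1 (foldr stp (seg us vs (Suc k) (enc a)) ?d1)"
    by (rule Conj.IH(1)) (use s1 b1 in \<open>auto simp: scanned_def\<close>)
  have "scanned us vs k (Conj a c) f b d (stp (4, us k, vs k) (foldr stp (seg us vs (Suc k) (enc a)) ?d1))"
    by (rule scan_binary[OF s1 s2 b1 _ _ _ _ us]) (simp_all add: formula.locally_def child1_def child2_def)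
  then show ?case by (simp add: seg_append)
next
  case (Until_u a c)
  let ?m = "Suc (k + length (enc a))"
  let ?d1 = "foldr stp (seg us vs ?m (enc c)) d"
  note s1 = Until_u.IH(2)[OF Until_u.prems, of ?m]
  obtain b1 where b1: "rVB ?d1 = [b1]" using s1 by (auto simp: scanned_def)
  have s2: "scanned us vs (Suc k) a (us ?m) b1 ?d1 (foldr stp (seg us vs (Suc k) (enc a)) ?d1)"
    by (rule Until_u.IH(1)) (use s1 b1 in \<open>auto simp: scanned_def\<close>)
  have "scanned us vs k (Until_u a c) f b d (stp (5, us k, vs k) (foldr stp (seg us vs (Suc k) (enc a)) ?d1))"
    by (rule scan_binary[OF s1 s2 b1 _ _ _ _ us]) (simp_all add: formula.locally_def child1_def child2_def)
  then show ?case by (simp add: seg_append)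
next
  case (Until_U a c)
  let ?m = "Suc (k + length (enc a))"
  let ?d1 = "foldr stp (seg us vs ?m (enc c)) d"
  note s1 = Until_U.IH(2)[OF Until_U.prems, of ?m]
  obtain b1 where b1: "rVB ?d1 = [b1]" using s1 by (auto simp: scanned_def)
  have s2: "scanned us vs (Suc k) a (us ?m) b1 ?d1 (foldr stp (seg us vs (Suc k) (enc a)) ?d1)"
    by (rule Until_U.IH(1)) (use s1 b1 in \<open>auto simp: scanned_def\<close>)
  have "scanned us vs k (Until_U a c) f b d (stp (6, us k, vs k) (foldr stp (seg us vs (Suc k) (enc a)) ?d1))"
    by (rule scan_binary[OF s1 s2 b1 _ _ _ _ us]) (simp_all add: formula.locally_def child1_def child2_def)
  then show ?case by (simp add: seg_append)
qed

text \<open>Without an error the scanned word is a forest of formulas, preceded by the digits of an unfinished variable.\<close>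

lemma scan_parse:
  fixes us vs :: "nat \<Rightarrow> nat" and k :: nat
  assumes "set w \<subseteq> {1..9}" "rPAR d = [1]" "rCU d = []"
  defines "d' \<equiv> foldr stp (seg us vs k w) d"
  shows "(rPAR d' = [1] \<or> rPAR d' = [2] \<or> rPAR d' = [3]) \<and> (rERR d' = [1] \<longrightarrow> rERR d = [1] \<and>
    (\<exists>ds \<phi>s. w = ds @ concat (map enc \<phi>s) \<and> length (rCU d') = length \<phi>s \<and>
      (rPAR d' = [1] \<longrightarrow> ds = []) \<and> (rPAR d' = [2] \<longrightarrow> ds = bin 0) \<and> (rPAR d' = [3] \<longrightarrow> (\<exists>n>0. ds = bin n))))"
  using assms(1) unfolding d'_def
proof (induction w arbitrary: k)
  case Nil
  then show ?case using assms(2,3) by (auto intro!: exI[of _ "[]"])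
next
  case (Cons a w)
  define D where "D = foldr stp (seg us vs (Suc k) w) d"
  let ?d = D and ?e = "stp (a, us k, vs k) D"
  note IH = Cons.IH[of "Suc k", folded D_def]
  have sw: "set w \<subseteq> {1..9}" using Cons.prems by simp
  note P = conjunct1[OF IH[OF sw]]
  have a: "a \<in> {1..9}" using Cons.prems by simp
  have e: "foldr stp (seg us vs k (a # w)) d = ?e" by (simp add: D_def)
  have P': "rPAR ?e = [1] \<or> rPAR ?e = [2] \<or> rPAR ?e = [3]" using P by (auto simp: stp_def Let_def)
  have bin0: "bin 0 = [8]" "bin 1 = [9]" by (subst bin.simps, simp)+
  have binS: "(8 + x) # bin n = bin (2 * n + x)" if "0 < n" "x < 2" for n x
    using that by (subst (2) bin.simps) simp
  show ?case unfolding e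
  proof (intro conjI impI)
    show "rPAR ?e = [1] \<or> rPAR ?e = [2] \<or> rPAR ?e = [3]" by (rule P')
    assume er: "rERR ?e = [1]"
    then have er': "rERR ?d = [1]" by (auto simp: stp_def Let_def split: if_splits)
    then show "rERR d = [1]" using IH[OF sw] by blast
    obtain ds \<phi>s where w: "w = ds @ concat (map enc \<phi>s)" "length (rCU ?d) = length \<phi>s"
      "rPAR ?d = [1] \<longrightarrow> ds = []" "rPAR ?d = [2] \<longrightarrow> ds = bin 0" "rPAR ?d = [3] \<longrightarrow> (\<exists>n>0. ds = bin n)"
      using IH[OF sw] er' by blast
    consider "a = 8 \<or> a = 9" | "a = 7" | "a = 1 \<or> a = 2 \<or> a = 3" | "a = 4 \<or> a = 5 \<or> a = 6"
      using a by fastforce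
    then show "\<exists>ds \<phi>s. a # w = ds @ concat (map enc \<phi>s) \<and> length (rCU ?e) = length \<phi>s \<and>
      (rPAR ?e = [1] \<longrightarrow> ds = []) \<and> (rPAR ?e = [2] \<longrightarrow> ds = bin 0) \<and> (rPAR ?e = [3] \<longrightarrow> (\<exists>n>0. ds = bin n))"
    proof cases
      case 1
      have cu: "rCU ?e = rCU ?d" using 1 by (auto simp: stp_def Let_def)
      from P show ?thesis
      proof (elim disjE)
        assume p: "rPAR ?d = [1]"
        then have "rPAR ?e = [if a = 8 then 2 else 3]" using 1 by (auto simp: stp_def Let_def)
        then show ?thesis using w p cu 1 bin0 by (intro exI[of _ "[a]"] exI[of _ \<phi>s]) (auto intro: exI[of _ 1])
      next
        \<comment> \<open>A further digit would give a longer numeral with most significant digit 8,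
          which \<open>bin\<close> never produces; the scan has flagged it.\<close>
        assume p: "rPAR ?d = [2]"
        then have "rERR ?e = [2]" using 1 by (auto simp: stp_def Let_def)
        then show ?thesis using er by simp
      next
        assume p: "rPAR ?d = [3]"
        then obtain n where n: "0 < n" "ds = bin n" using w by blast
        have "rPAR ?e = [3]" using 1 p by (auto simp: stp_def Let_def)
        moreover have "a # ds = bin (2 * n + (a - 8))" using binS[OF n(1), of "a - 8"] 1 n(2) by auto
        ultimately show ?thesis using w cu n(1) by (intro exI[of _ "a # ds"] exI[of _ \<phi>s]) (auto intro!: exI[of _ "2 * n + (a - 8)"])
      qed
    next
      case 2
      have "rPAR ?d \<noteq> [1]" using er 2 by (auto simp: stp_def err7_def split: if_splits)
      then obtain n where n: "ds = bin n" using P w by blast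
      have "rPAR ?e = [1]" "rCU ?e = us k # rCU ?d" using 2 by (auto simp: stp_def)
      then show ?thesis using w n 2 by (intro exI[of _ "[]"] exI[of _ "Var n # \<phi>s"]) auto
    next
      case 3
      then have *: "rPAR ?d = [1]" "rCU ?d \<noteq> []"
        using er P by (auto simp: stp_def err1_def split: if_splits)
      then obtain \<phi> \<phi>s' where f: "\<phi>s = \<phi> # \<phi>s'" using w(2) by (cases \<phi>s) auto
      define \<psi> where "\<psi> = (if a = 1 then Neg \<phi> else if a = 2 then Next1 \<phi> else NextW \<phi>)"
      have "enc \<psi> = a # enc \<phi>" using 3 by (auto simp: \<psi>_def)
      moreover have "rPAR ?e = [1]" "length (rCU ?e) = length (rCU ?d)" using 3 * by (auto simp: stp_def set_top_def)
      ultimately show ?thesis using w * f by (intro exI[of _ "[]"] exI[of _ "\<psi> # \<phi>s'"]) auto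
    next
      case 4
      have nt: "a \<noteq> 8" "a \<noteq> 9" "a \<noteq> 7" "a \<noteq> 1" "a \<noteq> 2" "a \<noteq> 3" using 4 by auto
      have "hd0 (rPAR ?d) = 1" "hd0 (tl (rCU ?d)) \<noteq> 0"
        using er nt by (auto simp: stp_def err2_def split: if_splits)
      then have *: "rPAR ?d = [1]" "tl (rCU ?d) \<noteq> []" using P by auto
      then obtain c1 c2 cs where cs: "rCU ?d = c1 # c2 # cs" by (metis list.exhaust list.sel(2,3))
      then obtain \<phi> \<phi>' \<phi>s' where f: "\<phi>s = \<phi> # \<phi>' # \<phi>s'" using w(2) by (cases \<phi>s; cases "tl \<phi>s") auto
      define \<psi> where "\<psi> = (if a = 4 then Conj \<phi> \<phi>' else if a = 5 then Until_u \<phi> \<phi>' else Until_U \<phi> \<phi>')"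
      have "enc \<psi> = a # enc \<phi> @ enc \<phi>'" using 4 by (auto simp: \<psi>_def)
      moreover have "rPAR ?e = [1]" "length (rCU ?e) = Suc (length cs)" using nt * cs by (auto simp: stp_def set_top_def)
      moreover have "length cs = length \<phi>s'" using w(2) cs f by simp
      ultimately show ?thesis using w * f by (intro exI[of _ "[]"] exI[of _ "\<psi> # \<phi>s'"]) auto
    qed
  qed
qed

section \<open>Savitch's recursion as a quantified formula\<close>

lemma length_seg [simp]: "length (seg us vs k w) = length w"
  by (induction w arbitrary: k) auto

lemma nth_seg: "i < length w \<Longrightarrow> seg us vs k w ! i = (w ! i, us (k + i), vs (k + i))"
proof (induction w arbitrary: k i)
  case (Cons a w)
  then show ?case by (cases i) auto
qed simp

text \<open>On its stack a node has the last offset on top, because the scan starts there. The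
  default 1 is a node symbol and keeps the range of \<open>fn\<close> within the coding.\<close>

definition fn :: "nat list \<Rightarrow> nat \<Rightarrow> nat" where
  "fn u p = (if p < length u then rev u ! p else 1)"

lemma fn_range: "set u \<subseteq> {1..nsym} \<Longrightarrow> fn u p \<in> {1..nsym}"
proof -
  assume a: "set u \<subseteq> {1..nsym}"
  show ?thesis
  proof (cases "p < length u")
    case True
    then have "rev u ! p \<in> set u" by (metis length_rev nth_mem set_rev)
    then show ?thesis using a True by (auto simp: fn_def)
  qed (use nsym_ge in \<open>simp add: fn_def\<close>)
qed

lemma seg_fn:
  assumes "length u = length w" "length v = length w"
  shows "rev (zip (rev w) (zip u v)) = seg (fn u) (fn v) 0 w"
proof (rule nth_equalityI)
  fix i assume "i < length (rev (zip (rev w) (zip u v)))"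
  then have i: "i < length w" using assms by simp
  then show "rev (zip (rev w) (zip u v)) ! i = seg (fn u) (fn v) 0 w ! i"
    using assms by (simp add: nth_seg rev_nth fn_def)
qed (use assms in simp)

definition root_ok :: "nat \<Rightarrow> nat \<Rightarrow> bool" where
  "root_ok u v \<longleftrightarrow> (fST \<in> dec u \<longrightarrow> fST \<in> dec v \<or> fT \<in> dec v)"

definition leaf_ok :: "nat list \<Rightarrow> nat list \<Rightarrow> nat list \<Rightarrow> nat list \<Rightarrow> bool" where
  "leaf_ok w u v y \<longleftrightarrow> (\<exists>\<phi>. w = enc \<phi> \<and> LOC (fn u) (fn v) 0 \<phi> \<and> FLG (fn u) (Suc nsym) 0 \<phi> \<and>
     VOK 1 (bits (fn u) y 0 \<phi>) \<and> root_ok (fn u 0) (fn v 0))"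

definition accepting :: "dst \<Rightarrow> bool" where
  "accepting d \<longleftrightarrow> rERR d = [1] \<and> rPAR d = [1] \<and> length (rCU d) = 1 \<and> root_ok (hd0 (rCU d)) (hd0 (rCV d))"

text \<open>The word is not assumed to encode a formula. Acceptance leaves one root symbol, so by
  \<open>scan_parse\<close> the word is a single formula, and from there \<open>scan_enc\<close>
  describes the run.\<close>

lemma scan_accepting:
  assumes w: "set w \<subseteq> {1..9}" and u: "length u = length w" "set u \<subseteq> {1..nsym}" and v: "length v = length w"
    and d: "rPAR d = [1]" "rEQ d = [1]" "rY2 d = []" "rFL d = [Suc nsym]" "rVB d = [1]" "rERR d = [1]" "rCU d = []" "rCV d = []"
  shows "accepting (fold stp (zip (rev w) (zip u v)) d) \<longleftrightarrow> leaf_ok w u v (rY d)"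
proof -
  have f: "fold stp (zip (rev w) (zip u v)) d = foldr stp (seg (fn u) (fn v) 0 w) d"
    using seg_fn[OF u(1) v] by (metis foldr_conv_fold rev_rev_ident)
  have sc: "scanned (fn u) (fn v) 0 \<phi> (Suc nsym) 1 d (foldr stp (seg (fn u) (fn v) 0 (enc \<phi>)) d)" for \<phi>
    by (rule scan_enc) (use fn_range[OF u(2)] d in auto)
  show ?thesis
  proof
    assume a: "accepting (fold stp (zip (rev w) (zip u v)) d)"
    let ?d = "foldr stp (seg (fn u) (fn v) 0 w) d"
    have e: "rERR ?d = [1]" "rPAR ?d = [1]" "length (rCU ?d) = 1" "root_ok (hd0 (rCU ?d)) (hd0 (rCV ?d))"
      using a by (simp_all add: accepting_def f)
    obtain ds \<phi>s where p: "w = ds @ concat (map enc \<phi>s)" "length (rCU ?d) = length \<phi>s" "ds = []"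
      using scan_parse[OF w d(1,7), of "fn u" "fn v" 0] e(1,2) by blast
    then obtain \<phi> where "\<phi>s = [\<phi>]" using e(3) by (metis One_nat_def length_0_conv length_Suc_conv)
    then have w': "w = enc \<phi>" using p by simp
    then have "rERR ?d = [1] \<longleftrightarrow> rERR d = [1] \<and> LOC (fn u) (fn v) 0 \<phi> \<and> FLG (fn u) (Suc nsym) 0 \<phi> \<and> VOK 1 (bits (fn u) (rY d) 0 \<phi>)"
      "rCU ?d = fn u 0 # rCU d" "rCV ?d = fn v 0 # rCV d"
      using sc[of \<phi>] unfolding scanned_def by blast+
    then show "leaf_ok w u v (rY d)" unfolding leaf_ok_def using e w' by auto
  next
    assume "leaf_ok w u v (rY d)"
    then obtain \<phi> where l: "w = enc \<phi>" "LOC (fn u) (fn v) 0 \<phi>" "FLG (fn u) (Suc nsym) 0 \<phi>"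
       "VOK 1 (bits (fn u) (rY d) 0 \<phi>)" "root_ok (fn u 0) (fn v 0)" unfolding leaf_ok_def by blast
    let ?d = "foldr stp (seg (fn u) (fn v) 0 w) d"
    have "rERR ?d = [1] \<longleftrightarrow> rERR d = [1] \<and> LOC (fn u) (fn v) 0 \<phi> \<and> FLG (fn u) (Suc nsym) 0 \<phi> \<and> VOK 1 (bits (fn u) (rY d) 0 \<phi>)"
      "rCU ?d = fn u 0 # rCU d" "rCV ?d = fn v 0 # rCV d" "rPAR ?d = [1]"
      using sc[of \<phi>] l(1) unfolding scanned_def by blast+
    then show "accepting (fold stp (zip (rev w) (zip u v)) d)" unfolding f accepting_def using l d by simp
  qed
qed

section \<open>The finite graph of words and its paths\<close>

definition nodes :: "nat \<Rightarrow> nat list set" where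
  "nodes n = {u. set u \<subseteq> {1..nsym} \<and> length u = n}"

lemma finite_nodes: "finite (nodes n)"
  unfolding nodes_def by (rule finite_lists_length_eq) simp

lemma card_nodes: "card (nodes n) = 2 ^ (nbit * n)"
  unfolding nodes_def by (simp add: card_lists_length_eq nsym_eq power_mult)

lemma occs_length: "(p, \<psi>) \<in> occs k \<phi> \<Longrightarrow> p + length (enc \<psi>) \<le> k + length (enc \<phi>)"
  by (induction \<phi> arbitrary: k) fastforce+

text \<open>The name is the longest prefix of the candidate that consists of digits.\<close>

lemma name_of_unique:
  assumes "name_of y n" "name_of y m"
  shows "n = m"
proof -
  have *: "rev (bin n) = takeWhile (\<lambda>x. x \<noteq> 0) (map dgt y)" if "name_of y n" for n
  proof -
    let ?k = "length (bin n)"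
    have 1: "map dgt (take ?k y) = rev (bin n)" and 2: "dgt (hd0 (drop ?k y)) = 0"
      using that by (auto simp: name_of_def Let_def)
    have nz: "x \<noteq> 0" if "x \<in> set (rev (bin n))" for x using that bin_alphabet[of n] by auto
    have "map dgt y = rev (bin n) @ map dgt (drop ?k y)"
      using 1 by (metis append_take_drop_id map_append)
    moreover have "takeWhile (\<lambda>x. x \<noteq> 0) (map dgt (drop ?k y)) = []" using 2 by (cases "drop ?k y") auto
    moreover have "takeWhile (\<lambda>x. x \<noteq> 0) (rev (bin n) @ map dgt (drop ?k y)) =
        rev (bin n) @ takeWhile (\<lambda>x. x \<noteq> 0) (map dgt (drop ?k y))"
      by (rule takeWhile_append2) (use nz in blast)
    ultimately show ?thesis by (simp only: append_Nil2)
  qed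
  have "bin n = bin m" using *[OF assms(1)] *[OF assms(2)] by (metis rev_rev_ident)
  then show ?thesis using bin_inj_prefix[of n "[]" m "[]"] by simp
qed

lemma name_of_exists:
  assumes "length (bin n) < N"
  shows "\<exists>y\<in>nodes N. name_of y n"
proof -
  \<comment> \<open>Subtracting 7 turns the digits 8 and 9 into 1 and 2, which \<open>dgt\<close>
    reads back; the filler 3 is no digit and ends the name.\<close>
  define y where "y = map (\<lambda>d. d - 7) (rev (bin n)) @ replicate (N - length (bin n)) 3"
  have d: "dgt (x - 7) = x" "x - 7 \<in> {1..nsym}" if "x \<in> set (bin n)" for x
    using that bin_alphabet[of n] nsym_ge by (auto simp: dgt_def)
  have "y \<in> nodes N" using assms d(2) nsym_ge by (auto simp: y_def nodes_def)
  moreover have "map dgt (map (\<lambda>d. d - 7) (rev (bin n))) = rev (bin n)"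
    using d(1) by (auto simp: comp_def intro: map_idI)
  then have "name_of y n" using assms
    by (simp add: name_of_def y_def Let_def) (cases "N - length (bin n)"; simp add: dgt_def)
  ultimately show ?thesis by blast
qed

text \<open>The token 7 in front of each numeral makes every name shorter than the encoding, so
  candidates as long as the encoding cover all variables that occur.\<close>

lemma all_names:
  "(\<forall>y\<in>nodes (length (enc \<phi>)). VOK 1 (bits us y 0 \<phi>)) \<longleftrightarrow> formula.varok \<phi> (\<lambda>p. dec (us p))"
proof
  assume a: "\<forall>y\<in>nodes (length (enc \<phi>)). VOK 1 (bits us y 0 \<phi>)"
  show "formula.varok \<phi> (\<lambda>p. dec (us p))" unfolding formula.varok_def
  proof (intro allI impI)
    fix n p q assume pq: "(p, Var n) \<in> occs 0 \<phi>" "(q, Var n) \<in> occs 0 \<phi>"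
    have "length (bin n) < length (enc \<phi>)" using occs_length[OF pq(1)] by simp
    then obtain y where y: "y \<in> nodes (length (enc \<phi>))" "name_of y n" using name_of_exists by blast
    have "tbit (us p) \<in> bits us y 0 \<phi>" "tbit (us q) \<in> bits us y 0 \<phi>" using pq y(2) unfolding bits_def by blast+
    then have "tbit (us p) = tbit (us q)" using a y(1) unfolding VOK_def by blast
    then show "fT \<in> dec (us p) \<longleftrightarrow> fT \<in> dec (us q)" by (simp add: tbit_def split: if_splits)
  qed
next
  assume v: "formula.varok \<phi> (\<lambda>p. dec (us p))"
  show "\<forall>y\<in>nodes (length (enc \<phi>)). VOK 1 (bits us y 0 \<phi>)"
  proof
    fix y
    have "x = x'" if x: "x \<in> bits us y 0 \<phi>" "x' \<in> bits us y 0 \<phi>" for x x'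
    proof -
      obtain p n q m where *: "x = tbit (us p)" "(p, Var n) \<in> occs 0 \<phi>" "name_of y n"
        "x' = tbit (us q)" "(q, Var m) \<in> occs 0 \<phi>" "name_of y m" using x unfolding bits_def by blast
      have "n = m" using name_of_unique[OF *(3,6)] .
      then have "fT \<in> dec (us p) \<longleftrightarrow> fT \<in> dec (us q)" using v *(2,5) unfolding formula.varok_def by blast
      then show ?thesis using *(1,4) by (simp add: tbit_def)
    qed
    then show "VOK 1 (bits us y 0 \<phi>)" unfolding VOK_def by blast
  qed
qed

lemma nodes_nonempty: "nodes n \<noteq> {}"
proof -
  have "replicate n 1 \<in> nodes n" using nsym_ge by (auto simp: nodes_def)
  then show ?thesis by blast
qed

text \<open>Only \<open>VOK\<close> depends on the candidate. Since candidates exist, quantifying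
  over all of them turns it into \<open>varok\<close> and leaves the other conditions
  unchanged.\<close>

lemma leaf_edge:
  "(\<forall>y\<in>nodes (length (enc \<phi>)). leaf_ok (enc \<phi>) u v y) \<longleftrightarrow> formula.edge \<phi> (\<lambda>p. dec (fn u p)) (\<lambda>p. dec (fn v p))"
proof -
  have l: "leaf_ok (enc \<phi>) u v y \<longleftrightarrow> LOC (fn u) (fn v) 0 \<phi> \<and> FLG (fn u) (Suc nsym) 0 \<phi> \<and>
     VOK 1 (bits (fn u) y 0 \<phi>) \<and> root_ok (fn u 0) (fn v 0)" for y
    unfolding leaf_ok_def enc_inj by auto
  have F: "FLG (fn u) (Suc nsym) 0 \<phi> \<longleftrightarrow> formula.uniform \<phi> (\<lambda>p. dec (fn u p))"
    by (simp add: FLG_def flag_ok_def formula.uniform_def)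
  have "(\<forall>y\<in>nodes (length (enc \<phi>)). leaf_ok (enc \<phi>) u v y) \<longleftrightarrow> LOC (fn u) (fn v) 0 \<phi> \<and> FLG (fn u) (Suc nsym) 0 \<phi> \<and>
     (\<forall>y\<in>nodes (length (enc \<phi>)). VOK 1 (bits (fn u) y 0 \<phi>)) \<and> root_ok (fn u 0) (fn v 0)"
    unfolding l using nodes_nonempty by blast
  then show ?thesis unfolding all_names F formula.edge_def LOC_def root_ok_def by blast
qed

definition steps :: "nat list \<Rightarrow> (nat list \<times> nat list) set" where
  "steps w = {(u, v). u \<in> nodes (length w) \<and> v \<in> nodes (length w) \<and> (\<forall>y\<in>nodes (length w). leaf_ok w u v y)}"

definition START :: nat where "START = cod {fST}"
definition DONE :: nat where "DONE = cod {fDN}"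

text \<open>Only offsets inside the encoding matter, so field assignments on all naturals can be
  exchanged for words.\<close>

lemma edge_cong:
  assumes "formula.edge \<phi> U V" "\<And>p. p < length (enc \<phi>) \<Longrightarrow> U p = U' p" "\<And>p. p < length (enc \<phi>) \<Longrightarrow> V p = V' p"
  shows "formula.edge \<phi> U' V'"
proof -
  have r: "p < length (enc \<phi>)" if "(p, \<psi>) \<in> occs 0 \<phi>" for p \<psi> using occs_range[OF that] by simp
  have z: "0 < length (enc \<phi>)" using r[OF occs_self] .
  have c: "formula.locally U' V' x = formula.locally U V x" if x: "x \<in> occs 0 \<phi>" for x
  proof -
    obtain p \<psi> where xp: "x = (p, \<psi>)" by (cases x)
    then have O: "(p, \<psi>) \<in> occs 0 \<phi>" using x by simp
    have c1: "child1 U' p \<psi> = child1 U p \<psi> \<and> child1 V' p \<psi> = child1 V p \<psi> \<and> child2 U' p \<psi> = child2 U p \<psi>"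
      using O formula.children[where \<phi> = \<phi> and p = p] r assms(2,3)
      by (cases \<psi>) (simp_all add: child1_def child2_def, blast+)
    show ?thesis using c1 assms(2,3)[OF r[OF O]] by (simp add: formula.locally_def xp)
  qed
  have u: "formula.uniform \<phi> U' = formula.uniform \<phi> U" "formula.varok \<phi> U' = formula.varok \<phi> U"
  proof -
    have "(\<forall>x\<in>occs 0 \<phi>. U' (fst x) \<inter> flags = U' 0 \<inter> flags) \<longleftrightarrow> (\<forall>x\<in>occs 0 \<phi>. U (fst x) \<inter> flags = U 0 \<inter> flags)"
      using r assms(2) z by (intro ball_cong refl) (metis prod.collapse)
    then show "formula.uniform \<phi> U' = formula.uniform \<phi> U" by (simp only: formula.uniform_def)
    show "formula.varok \<phi> U' = formula.varok \<phi> U" unfolding formula.varok_def using r assms(2) by metis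
  qed
  show ?thesis using assms(1) c u assms(2,3)[OF z] unfolding formula.edge_def by simp
qed

lemma steps_START_DONE:
  "(replicate (length (enc \<phi>)) START, replicate (length (enc \<phi>)) DONE) \<in> (steps (enc \<phi>))\<^sup>* \<longleftrightarrow> satisfiable \<phi>"
proof -
  let ?n = "length (enc \<phi>)"
  have z: "0 < ?n" using hd_enc(1) by simp
  have f0: "fn (replicate ?n a) 0 = a" for a using z by (simp add: fn_def)
  have sub: "formula.edge \<phi> (\<lambda>p. dec (fn u p)) (\<lambda>p. dec (fn v p))" if "(u, v) \<in> steps (enc \<phi>)" for u v
    using that leaf_edge unfolding steps_def by blast
  define ls where "ls U = rev (map (\<lambda>p. cod (U p)) [0..<?n])" for U
  have lsn: "ls U \<in> nodes ?n" for U using cod(1) by (auto simp: ls_def nodes_def)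
  have lsf: "dec (fn (ls U) p) = U p" if "p < ?n" for U p using that by (simp add: ls_def fn_def cod(2))
  have st: "(ls U, ls V) \<in> steps (enc \<phi>)" if "formula.edge \<phi> U V" for U V
  proof -
    have "formula.edge \<phi> (\<lambda>p. dec (fn (ls U) p)) (\<lambda>p. dec (fn (ls V) p))"
      by (rule edge_cong[OF that]) (simp_all add: lsf)
    then show ?thesis unfolding steps_def using leaf_edge lsn by blast
  qed
  have up: "(ls U, ls V) \<in> (steps (enc \<phi>))\<^sup>*" if "(formula.edge \<phi>)\<^sup>*\<^sup>* U V" for U V
    using that by (induction rule: rtranclp_induct) (auto intro: rtrancl_into_rtrancl st)
  have down: "(formula.edge \<phi>)\<^sup>*\<^sup>* (\<lambda>p. dec (fn u p)) (\<lambda>p. dec (fn v p))" if "(u, v) \<in> (steps (enc \<phi>))\<^sup>*" for u v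
    using that by (induction rule: rtrancl_induct) (auto intro: rtranclp.rtrancl_into_rtrancl sub)
  have lsc: "ls (\<lambda>_. x) = replicate ?n (cod x)" for x by (simp add: ls_def map_replicate_const)
  show ?thesis
  proof
    assume "(replicate ?n START, replicate ?n DONE) \<in> (steps (enc \<phi>))\<^sup>*"
    from down[OF this] have "fST \<in> dec (fn (replicate ?n DONE) 0) \<or> formula.invar \<phi> (\<lambda>p. dec (fn (replicate ?n DONE) p)) \<or>
        (\<exists>T. formula.labelling \<phi> T \<and> 0 \<in> T 0 0)"
      by (rule formula.path_labelling) (simp add: f0 START_def cod(2))
    then have "\<exists>T. formula.labelling \<phi> T \<and> 0 \<in> T 0 0" by (simp add: formula.invar_def f0 DONE_def cod(2))
    then show "satisfiable \<phi>" using formula.labelling_model by blast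
  next
    assume "satisfiable \<phi>"
    then have "(formula.edge \<phi>)\<^sup>*\<^sup>* (\<lambda>_. {fST}) (\<lambda>_. {fDN})" using formula.satisfiable_iff_path by blast
    from up[OF this] show "(replicate ?n START, replicate ?n DONE) \<in> (steps (enc \<phi>))\<^sup>*"
      by (simp add: lsc START_def DONE_def)
  qed
qed

lemma START_loop: "(replicate (length (enc \<phi>)) START, replicate (length (enc \<phi>)) START) \<in> steps (enc \<phi>)"
proof -
  let ?n = "length (enc \<phi>)"
  have n: "replicate ?n START \<in> nodes ?n" using cod(1) by (auto simp: nodes_def START_def)
  have "formula.edge \<phi> (\<lambda>_. {fST}) (\<lambda>_. {fST})"
    unfolding formula.edge_def formula.uniform_def formula.varok_def formula.locally_def lok_def by auto
  then have "formula.edge \<phi> (\<lambda>p. dec (fn (replicate ?n START) p)) (\<lambda>p. dec (fn (replicate ?n START) p))"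
    by (rule edge_cong) (simp_all add: fn_def START_def cod(2))
  then show ?thesis unfolding steps_def using leaf_edge n by blast
qed

lemma relpow_self: "(a, a) \<in> R \<Longrightarrow> (a, a) \<in> R ^^ k"
  by (induction k) auto

text \<open>Reachability in a finite relation needs no more steps than the relation has pairs; the
  missing steps are spent in the loop at the source.\<close>

lemma steps_pow:
  assumes "L = 2 * nbit * length (enc \<phi>)"
  shows "(replicate (length (enc \<phi>)) START, replicate (length (enc \<phi>)) DONE) \<in> steps (enc \<phi>) ^^ (2 ^ L) \<longleftrightarrow> satisfiable \<phi>"
proof -
  let ?n = "length (enc \<phi>)" and ?R = "steps (enc \<phi>)"
  have sub: "?R \<subseteq> nodes ?n \<times> nodes ?n" by (auto simp: steps_def)
  have fin: "finite ?R" using finite_subset[OF sub] finite_nodes by auto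
  have "card ?R \<le> card (nodes ?n \<times> nodes ?n)" using card_mono[OF _ sub] finite_nodes by blast
  also have "\<dots> = 2 ^ L" by (simp add: card_cartesian_product card_nodes assms power_add[symmetric] mult_2 algebra_simps)
  finally have c: "card ?R \<le> 2 ^ L" .
  show ?thesis unfolding steps_START_DONE[symmetric]
  proof
    assume "(replicate ?n START, replicate ?n DONE) \<in> ?R ^^ (2 ^ L)"
    then show "(replicate ?n START, replicate ?n DONE) \<in> ?R\<^sup>*" by (rule relpow_imp_rtrancl)
  next
    assume "(replicate ?n START, replicate ?n DONE) \<in> ?R\<^sup>*"
    then obtain k where k: "k \<le> card ?R" "(replicate ?n START, replicate ?n DONE) \<in> ?R ^^ k"
      unfolding rtrancl_finite_eq_relpow[OF fin] by auto
    have "(replicate ?n START, replicate ?n DONE) \<in> ?R ^^ (2 ^ L - k) O ?R ^^ k"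
      using relpow_self[OF START_loop] k(2) by (rule relcompI)
    then show "(replicate ?n START, replicate ?n DONE) \<in> ?R ^^ (2 ^ L)"
      using k(1) c by (simp flip: relpow_add)
  qed
qed

text \<open>Quantifier 1 is existential, every other one universal. The assignment is kept with the last variable first.\<close>

fun qev :: "(nat list \<Rightarrow> bool) \<Rightarrow> nat list \<Rightarrow> nat list \<Rightarrow> bool" where
  "qev f [] xs = f xs"
| "qev f (q # qs) xs = (if q = 1 then \<exists>x\<in>{1..nsym}. qev f qs (x # xs) else \<forall>x\<in>{1..nsym}. qev f qs (x # xs))"

text \<open>A level guesses a midpoint with \<open>n\<close> existential quantifiers, followed by
  one universal selector: value 1 asks for the left half, every other value for the right half. The
  last \<open>n\<close> universal quantifiers run over candidate names.\<close>

definition pattern :: "nat \<Rightarrow> nat \<Rightarrow> nat list" where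
  "pattern n L = concat (replicate L (replicate n 1 @ [2])) @ replicate n 2"

definition flat :: "(nat \<times> nat list) list \<Rightarrow> nat list" where
  "flat bs = concat (map (\<lambda>(s, b). s # b) bs)"

text \<open>The pair of nodes that is left to connect after the choices made so far, innermost level
  first in the list. Values are stored last variable first, hence the \<open>rev\<close>.\<close>

fun cur :: "nat \<Rightarrow> (nat \<times> nat list) list \<Rightarrow> nat list \<times> nat list" where
  "cur n [] = (replicate n START, replicate n DONE)"
| "cur n ((s, b) # bs) = (if s = 1 then (fst (cur n bs), rev b) else (rev b, snd (cur n bs)))"

function blocks :: "nat \<Rightarrow> nat list \<Rightarrow> (nat \<times> nat list) list" where
  "blocks n [] = []"
| "blocks n (s # xs) = (s, take n xs) # blocks n (drop n xs)"
  by pat_completeness auto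
termination by (relation "measure (\<lambda>(n, xs). length xs)") auto

lemma blocks_flat: "\<forall>(s, b)\<in>set bs. length b = n \<Longrightarrow> blocks n (flat bs) = bs"
  by (induction bs) (auto simp: flat_def)

definition leaf :: "nat list \<Rightarrow> nat list \<Rightarrow> bool" where
  "leaf w xs = (let n = length w; uv = cur n (blocks n (drop n xs)) in leaf_ok w (fst uv) (snd uv) (rev (take n xs)))"

lemma leaf_flat:
  "length y = length w \<Longrightarrow> \<forall>(s, b)\<in>set bs. length b = length w \<Longrightarrow>
   leaf w (y @ flat bs) = leaf_ok w (fst (cur (length w) bs)) (snd (cur (length w) bs)) (rev y)"
  by (simp add: leaf_def Let_def blocks_flat)

lemma nodes_Suc: "b \<in> nodes (Suc n) \<longleftrightarrow> (\<exists>b' x. b = b' @ [x] \<and> b' \<in> nodes n \<and> x \<in> {1..nsym})"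
proof (cases b rule: rev_cases)
  case (snoc ys y)
  then show ?thesis by (auto simp: nodes_def)
qed (auto simp: nodes_def)

lemma qev_ex: "qev f (replicate n 1 @ qs) xs \<longleftrightarrow> (\<exists>b\<in>nodes n. qev f qs (b @ xs))"
proof (induction n arbitrary: xs)
  case (Suc n)
  have "qev f (replicate (Suc n) 1 @ qs) xs \<longleftrightarrow> (\<exists>x\<in>{1..nsym}. \<exists>b\<in>nodes n. qev f qs (b @ x # xs))" using Suc by simp
  also have "\<dots> \<longleftrightarrow> (\<exists>b\<in>nodes (Suc n). qev f qs (b @ xs))" unfolding nodes_Suc Bex_def by force
  finally show ?case .
qed (simp add: nodes_def)

lemma qev_all: "qev f (replicate n 2 @ qs) xs \<longleftrightarrow> (\<forall>b\<in>nodes n. qev f qs (b @ xs))"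
proof (induction n arbitrary: xs)
  case (Suc n)
  have "qev f (replicate (Suc n) 2 @ qs) xs \<longleftrightarrow> (\<forall>x\<in>{1..nsym}. \<forall>b\<in>nodes n. qev f qs (b @ x # xs))" using Suc by simp
  also have "\<dots> \<longleftrightarrow> (\<forall>b\<in>nodes (Suc n). qev f qs (b @ xs))" unfolding nodes_Suc Ball_def by force
  finally show ?case .
qed (simp add: nodes_def)

lemma rev_nodes: "rev b \<in> nodes n \<longleftrightarrow> b \<in> nodes n" by (simp add: nodes_def)

lemma qev_levels:
  assumes w: "n = length w" and bs: "\<forall>(s, b)\<in>set bs. length b = n" and uv: "fst (cur n bs) \<in> nodes n" "snd (cur n bs) \<in> nodes n"
  shows "qev (leaf w) (pattern n j) (flat bs) \<longleftrightarrow> cur n bs \<in> steps w ^^ (2 ^ j)"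
  using bs uv
proof (induction j arbitrary: bs)
  case 0
  have "qev (leaf w) (pattern n 0) (flat bs) \<longleftrightarrow> (\<forall>y\<in>nodes n. leaf w (y @ flat bs))"
    using qev_all[of "leaf w" n "[]" "flat bs"] by (simp add: pattern_def)
  also have "\<dots> \<longleftrightarrow> (\<forall>y\<in>nodes n. leaf_ok w (fst (cur n bs)) (snd (cur n bs)) (rev y))"
    using leaf_flat[of _ w bs] 0(1) w by (intro ball_cong refl) (simp add: nodes_def)
  also have "\<dots> \<longleftrightarrow> (\<forall>y\<in>nodes n. leaf_ok w (fst (cur n bs)) (snd (cur n bs)) y)"
    using rev_nodes by (metis rev_rev_ident)
  also have "\<dots> \<longleftrightarrow> cur n bs \<in> steps w" using 0(2,3) w by (simp add: steps_def case_prod_beta)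
  finally show ?case by simp
next
  case (Suc j)
  have p: "pattern n (Suc j) = replicate n 1 @ 2 # pattern n j" by (simp add: pattern_def)
  have "qev (leaf w) (pattern n (Suc j)) (flat bs) \<longleftrightarrow> (\<exists>b\<in>nodes n. \<forall>s\<in>{1..nsym}. qev (leaf w) (pattern n j) (s # b @ flat bs))"
    unfolding p qev_ex by simp
  also have "\<dots> \<longleftrightarrow> (\<exists>b\<in>nodes n. \<forall>s\<in>{1..nsym}. cur n ((s, b) # bs) \<in> steps w ^^ (2 ^ j))"
  proof (intro bex_cong ball_cong refl)
    fix b s assume b: "b \<in> nodes n"
    have "s # b @ flat bs = flat ((s, b) # bs)" by (simp add: flat_def)
    then show "qev (leaf w) (pattern n j) (s # b @ flat bs) \<longleftrightarrow> cur n ((s, b) # bs) \<in> steps w ^^ (2 ^ j)"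
      using Suc.IH[of "(s, b) # bs"] Suc.prems b rev_nodes by (simp add: nodes_def split: if_splits)
  qed
  also have "\<dots> \<longleftrightarrow> (\<exists>b\<in>nodes n. (fst (cur n bs), rev b) \<in> steps w ^^ (2 ^ j) \<and> (rev b, snd (cur n bs)) \<in> steps w ^^ (2 ^ j))"
  proof (intro bex_cong refl)
    fix b
    have r: "1 \<in> {1..nsym}" "2 \<in> {1..nsym}" using nsym_ge by auto
    show "(\<forall>s\<in>{1..nsym}. cur n ((s, b) # bs) \<in> steps w ^^ (2 ^ j)) \<longleftrightarrow>
      (fst (cur n bs), rev b) \<in> steps w ^^ (2 ^ j) \<and> (rev b, snd (cur n bs)) \<in> steps w ^^ (2 ^ j)" (is "?l \<longleftrightarrow> ?r")
    proof
      assume l: ?l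
      have "cur n ((1, b) # bs) \<in> steps w ^^ (2 ^ j)" by (rule bspec[OF l r(1)])
      moreover have "cur n ((2, b) # bs) \<in> steps w ^^ (2 ^ j)" by (rule bspec[OF l r(2)])
      ultimately show ?r by simp
    next
      assume r: ?r
      show ?l
      proof
        fix s
        show "cur n ((s, b) # bs) \<in> steps w ^^ (2 ^ j)" using r by (cases "s = 1") simp_all
      qed
    qed
  qed
  also have "\<dots> \<longleftrightarrow> (\<exists>b\<in>nodes n. (fst (cur n bs), b) \<in> steps w ^^ (2 ^ j) \<and> (b, snd (cur n bs)) \<in> steps w ^^ (2 ^ j))"
    using rev_nodes by (metis rev_rev_ident)
  also have "\<dots> \<longleftrightarrow> cur n bs \<in> steps w ^^ (2 ^ j) O steps w ^^ (2 ^ j)"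
  proof -
    \<comment> \<open>The existential block ranges over nodes only. A midpoint is a node because it
      ends a path of positive length \<open>2 ^ j\<close>.\<close>
    have "b \<in> nodes n" if "(a, b) \<in> steps w ^^ (2 ^ j)" for a b
    proof -
      have "(a, b) \<in> steps w ^^ Suc (2 ^ j - 1)" using that by simp
      then obtain c where "(c, b) \<in> steps w" unfolding relpow.simps by blast
      then show ?thesis using w by (simp add: steps_def)
    qed
    then show ?thesis by (cases "cur n bs") (auto simp: relcomp_unfold)
  qed
  also have "\<dots> \<longleftrightarrow> cur n bs \<in> steps w ^^ (2 ^ Suc j)" by (simp add: relpow_add[symmetric] mult_2)
  finally show ?case .
qed

theorem qev_SAT:
  assumes "set w \<subseteq> {1..9}"
  shows "qev (leaf w) (pattern (length w) (2 * nbit * length w)) [] \<longleftrightarrow> w \<in> SAT_lang"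
proof -
  let ?n = "length w" and ?L = "2 * nbit * length w"
  have c: "fst (cur ?n []) \<in> nodes ?n" "snd (cur ?n []) \<in> nodes ?n"
    using cod(1) by (auto simp: nodes_def START_def DONE_def)
  have *: "qev (leaf w) (pattern ?n ?L) [] \<longleftrightarrow> (replicate ?n START, replicate ?n DONE) \<in> steps w ^^ (2 ^ ?L)"
    using qev_levels[OF refl _ c, of ?L] by (simp add: flat_def)
  show ?thesis
  proof (cases "\<exists>\<phi>. w = enc \<phi>")
    case True
    then obtain \<phi> where w: "w = enc \<phi>" by blast
    show ?thesis unfolding * unfolding w steps_pow[OF refl] by (auto simp: SAT_lang_def enc_inj)
  next
    case False
    then have "steps w = {}" using nodes_nonempty by (auto simp: steps_def leaf_ok_def)
    then have "steps w ^^ Suc k = {}" for k by simp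
    then have "steps w ^^ (2 ^ ?L) = {}" by (metis Suc_pred' zero_less_numeral zero_less_power)
    then show ?thesis unfolding * using False by (auto simp: SAT_lang_def)
  qed
qed

section \<open>The decision procedure as a stack program\<close>

definition reg :: "dst \<Rightarrow> regs" where
  "reg d = (\<lambda>_. [])(0 := rW d, 2 := rW2 d, 3 := rPQ d, 4 := rPX d, 5 := rPA d, 6 := rREST d, 7 := rMODE d, 8 := rX d, 9 := rA d, 10 := rY d, 11 := rY2 d, 12 := rU d, 13 := rV d, 14 := rD d, 15 := rCU d, 16 := rCV d, 17 := rDU d, 18 := rDV d, 19 := rPAR d, 20 := rEQ d, 21 := rVB d, 22 := rFL d, 23 := rERR d, 24 := rLV d)"

lemma reg_read [simp]:
  "reg d 0 = rW d"
  "reg d 2 = rW2 d"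
  "reg d 3 = rPQ d"
  "reg d 4 = rPX d"
  "reg d 5 = rPA d"
  "reg d 6 = rREST d"
  "reg d 7 = rMODE d"
  "reg d 8 = rX d"
  "reg d 9 = rA d"
  "reg d 10 = rY d"
  "reg d 11 = rY2 d"
  "reg d 12 = rU d"
  "reg d 13 = rV d"
  "reg d 14 = rD d"
  "reg d 15 = rCU d"
  "reg d 16 = rCV d"
  "reg d 17 = rDU d"
  "reg d 18 = rDV d"
  "reg d 19 = rPAR d"
  "reg d 20 = rEQ d"
  "reg d 21 = rVB d"
  "reg d 22 = rFL d"
  "reg d 23 = rERR d"
  "reg d 24 = rLV d"
  by (simp_all add: reg_def)

lemma reg_upd [simp]:
  "(reg d)(0 := xs) = reg (d\<lparr>rW := xs\<rparr>)"
  "(reg d)(2 := xs) = reg (d\<lparr>rW2 := xs\<rparr>)"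
  "(reg d)(3 := xs) = reg (d\<lparr>rPQ := xs\<rparr>)"
  "(reg d)(4 := xs) = reg (d\<lparr>rPX := xs\<rparr>)"
  "(reg d)(5 := xs) = reg (d\<lparr>rPA := xs\<rparr>)"
  "(reg d)(6 := xs) = reg (d\<lparr>rREST := xs\<rparr>)"
  "(reg d)(7 := xs) = reg (d\<lparr>rMODE := xs\<rparr>)"
  "(reg d)(8 := xs) = reg (d\<lparr>rX := xs\<rparr>)"
  "(reg d)(9 := xs) = reg (d\<lparr>rA := xs\<rparr>)"
  "(reg d)(10 := xs) = reg (d\<lparr>rY := xs\<rparr>)"
  "(reg d)(11 := xs) = reg (d\<lparr>rY2 := xs\<rparr>)"
  "(reg d)(12 := xs) = reg (d\<lparr>rU := xs\<rparr>)"
  "(reg d)(13 := xs) = reg (d\<lparr>rV := xs\<rparr>)"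
  "(reg d)(14 := xs) = reg (d\<lparr>rD := xs\<rparr>)"
  "(reg d)(15 := xs) = reg (d\<lparr>rCU := xs\<rparr>)"
  "(reg d)(16 := xs) = reg (d\<lparr>rCV := xs\<rparr>)"
  "(reg d)(17 := xs) = reg (d\<lparr>rDU := xs\<rparr>)"
  "(reg d)(18 := xs) = reg (d\<lparr>rDV := xs\<rparr>)"
  "(reg d)(19 := xs) = reg (d\<lparr>rPAR := xs\<rparr>)"
  "(reg d)(20 := xs) = reg (d\<lparr>rEQ := xs\<rparr>)"
  "(reg d)(21 := xs) = reg (d\<lparr>rVB := xs\<rparr>)"
  "(reg d)(22 := xs) = reg (d\<lparr>rFL := xs\<rparr>)"
  "(reg d)(23 := xs) = reg (d\<lparr>rERR := xs\<rparr>)"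
  "(reg d)(24 := xs) = reg (d\<lparr>rLV := xs\<rparr>)"
  by (rule ext, simp add: reg_def)+

lemma tops_reg [simp]:
  "tops (reg d) 0 = hd0 (rW d)"
  "tops (reg d) 2 = hd0 (rW2 d)"
  "tops (reg d) 3 = hd0 (rPQ d)"
  "tops (reg d) 4 = hd0 (rPX d)"
  "tops (reg d) 5 = hd0 (rPA d)"
  "tops (reg d) 6 = hd0 (rREST d)"
  "tops (reg d) 7 = hd0 (rMODE d)"
  "tops (reg d) 8 = hd0 (rX d)"
  "tops (reg d) 9 = hd0 (rA d)"
  "tops (reg d) 10 = hd0 (rY d)"
  "tops (reg d) 11 = hd0 (rY2 d)"
  "tops (reg d) 12 = hd0 (rU d)"
  "tops (reg d) 13 = hd0 (rV d)"
  "tops (reg d) 14 = hd0 (rD d)"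
  "tops (reg d) 15 = hd0 (rCU d)"
  "tops (reg d) 16 = hd0 (rCV d)"
  "tops (reg d) 17 = hd0 (rDU d)"
  "tops (reg d) 18 = hd0 (rDV d)"
  "tops (reg d) 19 = hd0 (rPAR d)"
  "tops (reg d) 20 = hd0 (rEQ d)"
  "tops (reg d) 21 = hd0 (rVB d)"
  "tops (reg d) 22 = hd0 (rFL d)"
  "tops (reg d) 23 = hd0 (rERR d)"
  "tops (reg d) 24 = hd0 (rLV d)"
  by (simp_all add: tops_def)

definition bnd :: "nat \<Rightarrow> dst \<Rightarrow> bool" where
  "bnd H d \<longleftrightarrow> length (rW d) \<le> H \<and> length (rW2 d) \<le> H \<and> length (rPQ d) \<le> H \<and> length (rPX d) \<le> H \<and> length (rPA d) \<le> H \<and> length (rREST d) \<le> H \<and> length (rMODE d) \<le> H \<and> length (rX d) \<le> H \<and> length (rA d) \<le> H \<and> length (rY d) \<le> H \<and> length (rY2 d) \<le> H \<and> length (rU d) \<le> H \<and> length (rV d) \<le> H \<and> length (rD d) \<le> H \<and> length (rCU d) \<le> H \<and> length (rCV d) \<le> H \<and> length (rDU d) \<le> H \<and> length (rDV d) \<le> H \<and> length (rPAR d) \<le> H \<and> length (rEQ d) \<le> H \<and> length (rVB d) \<le> H \<and> length (rFL d) \<le> H \<and> length (rERR d) \<le> H \<and> length (rLV d) \<le> H"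

lemma bounded_reg: "bounded H (reg d) \<longleftrightarrow> bnd H d"
proof
  assume b: "bounded H (reg d)"
  have "length (reg d r) \<le> H" for r using b by (simp add: bounded_def)
  from this[of 0] this[of 2] this[of 3] this[of 4] this[of 5] this[of 6] this[of 7] this[of 8] this[of 9] this[of 10] this[of 11] this[of 12] this[of 13] this[of 14] this[of 15] this[of 16] this[of 17] this[of 18] this[of 19] this[of 20] this[of 21] this[of 22] this[of 23] this[of 24]
  show "bnd H d" by (simp add: bnd_def)
next
  assume "bnd H d"
  then show "bounded H (reg d)" by (simp add: bnd_def bounded_def reg_def)
qed

section \<open>Loops over stacks and over the input word\<close>

lemma drain_reg:
  assumes "\<And>i. i < length xs \<Longrightarrow> runs P c (reg (g i)) (reg (g (Suc i)))" "\<And>i. i \<le> length xs \<Longrightarrow> reg (g i) r = drop i xs"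
    "\<forall>a\<in>set xs. 0 < a" "P (reg (g (length xs)))" "s = reg (g 0)" "s' = reg (g (length xs))"
  shows "runs P (WHILE (\<lambda>t. t r \<noteq> 0) c) s s'"
proof (rule runs_WHILE_iter[where f = "\<lambda>i. reg (g i)" and n = "length xs"])
  fix i assume i: "i < length xs"
  have "tops (reg (g i)) r = xs ! i" using tops_drop[of "reg (g i)" r i xs] assms(2) i by simp
  moreover have "0 < xs ! i" using assms(3) i by simp
  ultimately show "tops (reg (g i)) r \<noteq> 0 \<and> runs P c (reg (g i)) (reg (g (Suc i)))" using assms(1) i by simp
qed (use assms in \<open>simp_all add: tops_def\<close>)

lemma drain_Do:
  assumes "\<And>i. i \<le> length xs \<Longrightarrow> bnd H (g i)"
    "\<And>i. i < length xs \<Longrightarrow> do_acts (F (tops (reg (g i)))) (reg (g i)) = reg (g (Suc i))"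
    "\<And>i. i \<le> length xs \<Longrightarrow> reg (g i) r = drop i xs" "\<forall>a\<in>set xs. 0 < a" "s = reg (g 0)" "s' = reg (g (length xs))"
  shows "runs (bounded H) (WHILE (\<lambda>t. t r \<noteq> 0) (Do F)) s s'"
proof (rule drain_reg[where g = g and xs = xs])
  fix i assume i: "i < length xs"
  show "runs (bounded H) (Do F) (reg (g i)) (reg (g (Suc i)))"
    by (rule runs_Do) (use assms(1)[of i] assms(1)[of "Suc i"] assms(2)[OF i] i in \<open>simp_all add: bounded_reg\<close>)
qed (use assms in \<open>auto simp: bounded_reg\<close>)

lemma runs_Do_reg:
  "bnd H d \<Longrightarrow> bnd H d' \<Longrightarrow> do_acts (F (tops (reg d))) (reg d) = reg d' \<Longrightarrow> runs (bounded H) (Do F) (reg d) (reg d')"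
  by (rule runs_Do) (simp_all add: bounded_reg)

lemma runs_move:
  assumes "r \<noteq> r'" "\<forall>a\<in>set (s r). 0 < a" "bounded H s" "length (s r) + length (s r') \<le> H" "s' = s(r := [], r' := rev (s r) @ s r')"
  shows "runs (bounded H) (move_reg r r') s s'"
  unfolding move_reg_def
proof (rule runs_WHILE_iter[where n = "length (s r)" and f = "\<lambda>i. s(r := drop i (s r), r' := rev (take i (s r)) @ s r')"])
  let ?f = "\<lambda>i. s(r := drop i (s r), r' := rev (take i (s r)) @ s r')"
  have b: "bounded H (?f i)" for i
    unfolding bounded_def
  proof
    fix x
    have "length (s x) \<le> H" using assms(3) by (simp add: bounded_def)
    then show "length (?f i x) \<le> H" using assms(1,4) by (cases "x = r"; cases "x = r'") simp_all
  qed
  fix i assume i: "i < length (s r)"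
  have t: "tops (?f i) r = s r ! i" using tops_drop[of "?f i" r i "s r"] i assms(1) by simp
  have nz: "s r ! i \<noteq> 0" using assms(2) i by auto
  have e: "?f (Suc i) = do_acts (copy_act r' (tops (?f i) r) @ [Pop r]) (?f i)"
    using t nz assms(1) i by (auto simp: copy_act_def take_Suc_conv_app_nth drop_Suc tl_drop fun_eq_iff)
  show "tops (?f i) r \<noteq> 0 \<and> runs (bounded H) (Do (\<lambda>t. copy_act r' (t r) @ [Pop r])) (?f i) (?f (Suc i))"
    using t nz runs_Do[where F = "\<lambda>t. copy_act r' (t r) @ [Pop r]", OF b[of i] b[of "Suc i"] e] by simp
qed (use assms in \<open>auto simp: bounded_def tops_def\<close>)

text \<open>The input word doubles as a counter: its symbols travel to stack 2 and back, and
  \<open>F\<close> is performed once for each of them.\<close>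

definition for_word :: "((nat \<Rightarrow> nat) \<Rightarrow> act list) \<Rightarrow> com" where
  "for_word F = Seq (WHILE (\<lambda>t. t 0 \<noteq> 0) (Do (\<lambda>t. F t @ [Pop 0] @ copy_act 2 (t 0)))) (move_reg 2 0)"

lemma word_update_id: "rW d = W \<Longrightarrow> rW2 d = [] \<Longrightarrow> d\<lparr>rW := W, rW2 := []\<rparr> = d"
  by (cases d) auto

text \<open>\<open>h\<close> describes the states as if the word were in place. The actions must
  work for arbitrary contents \<open>X\<close>, \<open>Z\<close> of the word stacks, since these
  change while the loop runs.\<close>

lemma runs_for_word:
  assumes W: "\<And>i. i \<le> length W \<Longrightarrow> rW (h i) = W \<and> rW2 (h i) = [] \<and> bnd H (h i)" and pos: "\<forall>a\<in>set W. 0 < a"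
    and F: "\<And>i X Z. i < length W \<Longrightarrow> do_acts (F (tops (reg ((h i)\<lparr>rW := X, rW2 := Z\<rparr>)))) (reg ((h i)\<lparr>rW := X, rW2 := Z\<rparr>))
       = reg ((h (Suc i))\<lparr>rW := X, rW2 := Z\<rparr>)"
    and d: "d = h 0" "d' = h (length W)"
  shows "runs (bounded H) (for_word F) (reg d) (reg d')"
proof -
  define g where "g i = (h i)\<lparr>rW := drop i W, rW2 := rev (take i W)\<rparr>" for i
  have W': "length W \<le> H" using W[of 0] by (auto simp: bnd_def)
  have id0: "reg ((h 0)\<lparr>rW := W, rW2 := []\<rparr>) = reg (h 0)"
    by (rule arg_cong[where f = reg]) (use W[of 0] word_update_id in blast)
  have b: "bnd H (g i)" if "i \<le> length W" for i using W[OF that] W' by (auto simp: g_def bnd_def)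
  have "runs (bounded H) (WHILE (\<lambda>t. t 0 \<noteq> 0) (Do (\<lambda>t. F t @ [Pop 0] @ copy_act 2 (t 0)))) (reg d) (reg (g (length W)))"
  proof (rule drain_Do[where g = g and xs = W])
    fix i assume i: "i < length W"
    have nz: "W ! i \<noteq> 0" using pos i by auto
    have "do_acts (F (tops (reg (g i)))) (reg (g i)) = reg ((h (Suc i))\<lparr>rW := drop i W, rW2 := rev (take i W)\<rparr>)"
      using F[OF i, where X = "drop i W" and Z = "rev (take i W)"] by (simp add: g_def)
    then show "do_acts (F (tops (reg (g i))) @ [Pop 0] @ copy_act 2 (tops (reg (g i)) 0)) (reg (g i)) = reg (g (Suc i))"
      using i nz by (simp add: g_def hd0_drop copy_act_def take_Suc_conv_app_nth drop_Suc tl_drop)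
  qed (use b pos d id0 in \<open>simp_all add: g_def\<close>)
  moreover have "runs (bounded H) (move_reg 2 0) (reg (g (length W))) (reg d')"
  proof (rule runs_move)
    show "bounded H (reg (g (length W)))" using b[of "length W"] by (simp add: bounded_reg)
    have "reg ((h (length W))\<lparr>rW2 := [], rW := W\<rparr>) = reg (h (length W))"
      by (rule arg_cong[where f = reg]) (use W[of "length W"] in \<open>cases "h (length W)"; simp\<close>)
    then show "reg d' = (reg (g (length W)))(2 := [], 0 := rev (reg (g (length W)) 2) @ reg (g (length W)) 0)"
      using d by (simp add: g_def)
  qed (use pos W' in \<open>simp_all add: g_def\<close>)
  ultimately show ?thesis unfolding for_word_def by (rule runs_Seq)
qed

definition rep_act :: "nat \<Rightarrow> nat \<Rightarrow> act list" where
  "rep_act r a = (if a = 0 then [] else [Repl r a])"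

definition scan_acts :: "(nat \<Rightarrow> nat) \<Rightarrow> act list" where
  "scan_acts t = (if t 0 = 8 \<or> t 0 = 9 then
      (if t 20 = 1 \<and> dgt (t 10) = t 0 then copy_act 11 (t 10) @ [Pop 10] else [Repl 20 2]) @
      (if t 19 = 1 then [Repl 19 (if t 0 = 8 then 2 else 3)] else []) @ (if t 19 = 2 then [Repl 23 2] else [])
    else if t 0 = 7 then
      (if matched (t 20) (t 10) \<and> t 21 = 1 then [Repl 21 (tbit (t 12))] else []) @ [Repl 20 1, Repl 19 1] @
      rep_act 22 (t 12) @ copy_act 15 (t 12) @ copy_act 16 (t 13) @
      (if err7 (t 19) (t 20) (t 10) (t 21) (t 22) (t 12) (t 13) then [Repl 23 2] else [])
    else if t 0 = 1 \<or> t 0 = 2 \<or> t 0 = 3 then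
      rep_act 22 (t 12) @ rep_act 15 (t 12) @ rep_act 16 (t 13) @
      (if err1 (t 0) (t 19) (t 22) (t 12) (t 13) (t 15) (t 16) then [Repl 23 2] else [])
    else rep_act 22 (t 12) @ rep_act 15 (t 12) @ rep_act 16 (t 13) @ [Pop 17, Pop 18] @
      (if err2 (t 0) (t 19) (t 22) (t 12) (t 13) (t 17) (t 18) (t 15) then [Repl 23 2] else []))"

definition binary :: "nat \<Rightarrow> bool" where
  "binary a \<longleftrightarrow> a \<notin> {1, 2, 3, 7, 8, 9}"

text \<open>For a binary connective the root symbol of the second operand lies below the top; moving
  the first aside to stacks 17 and 18 makes both readable in one step. At token 7 the restoration of
  the candidate takes a loop and therefore follows the main action.\<close>

definition scan_body :: com where
  "scan_body =
    Seq (IF (\<lambda>t. binary (t 0)) (Do (\<lambda>t. copy_act 17 (t 15) @ copy_act 18 (t 16) @ [Pop 15, Pop 16])) SKIP)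
   (Seq (Do scan_acts)
   (Seq (IF (\<lambda>t. t 0 = 7) (move_reg 11 10) SKIP)
        (Do (\<lambda>t. [Pop 0] @ copy_act 2 (t 0) @ [Pop 12, Pop 13]))))"

text \<open>One-symbol registers must be occupied because \<open>Repl\<close> does nothing on an
  empty stack; positive entries make the reading 0 equivalent to emptiness.\<close>

definition ready :: "dst \<Rightarrow> bool" where
  "ready d \<longleftrightarrow> length (rPAR d) = 1 \<and> length (rEQ d) = 1 \<and> length (rVB d) = 1 \<and> length (rFL d) = 1 \<and> length (rERR d) = 1 \<and>
     rDU d = [] \<and> rDV d = [] \<and> (\<forall>a\<in>set (rY2 d). 0 < a) \<and> (\<forall>a\<in>set (rCU d). 0 < a) \<and> (\<forall>a\<in>set (rCV d). 0 < a)"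

lemma singleton_iff: "length xs = 1 \<longleftrightarrow> (\<exists>x. xs = [x])"
  by (cases xs) auto

lemma hd0_pos: "\<forall>a\<in>set xs. 0 < a \<Longrightarrow> hd0 xs = 0 \<longleftrightarrow> xs = []"
  by (cases xs) auto

lemma ready_stp:
  assumes "ready d" "0 < u" "0 < v"
  shows "ready (stp (a, u, v) d)" "length (rY (stp (a, u, v) d)) + length (rY2 (stp (a, u, v) d)) = length (rY d) + length (rY2 d)"
    "length (rCU (stp (a, u, v) d)) \<le> Suc (length (rCU d))" "length (rCV (stp (a, u, v) d)) \<le> Suc (length (rCV d))"
proof -
  have pos: "\<forall>a\<in>set (set_top x xs). 0 < a" if "0 < x" "\<forall>a\<in>set xs. 0 < a" for x xs
    using that by (cases xs) (auto simp: set_top_def)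
  have tl: "\<forall>a\<in>set (tl xs). 0 < a" if "\<forall>a\<in>set xs. 0 < a" for xs :: "nat list"
    using that by (cases xs) auto
  have hit: "rY d \<noteq> [] \<and> 0 < hd0 (rY d)" if "dgt (hd0 (rY d)) = a" "a = 8 \<or> a = 9"
    using that by (cases "rY d") (auto simp: dgt_def split: if_splits)
  have cu: "\<forall>a\<in>set (rCU d). 0 < a" "\<forall>a\<in>set (rCV d). 0 < a" using assms by (simp_all add: ready_def)
  have c: "\<forall>a\<in>set (set_top u (rCU d)). 0 < a" "\<forall>a\<in>set (set_top u (tl (rCU d))). 0 < a"
    "\<forall>a\<in>set (set_top v (rCV d)). 0 < a" "\<forall>a\<in>set (set_top v (tl (rCV d))). 0 < a"
    by (rule pos; (rule assms cu tl)+)+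
  show "ready (stp (a, u, v) d)"
  proof (cases "a = 8 \<or> a = 9")
    case True
    then have "\<forall>a\<in>set (rY2 (stp (a, u, v) d)). 0 < a" "length (rEQ (stp (a, u, v) d)) = 1"
      "length (rPAR (stp (a, u, v) d)) = 1" "length (rERR (stp (a, u, v) d)) = 1"
      "rVB (stp (a, u, v) d) = rVB d" "rFL (stp (a, u, v) d) = rFL d" "rDU (stp (a, u, v) d) = rDU d"
      "rDV (stp (a, u, v) d) = rDV d" "rCU (stp (a, u, v) d) = rCU d" "rCV (stp (a, u, v) d) = rCV d"
      using assms(1) hit by (auto simp: stp_def Let_def ready_def)
    then show ?thesis using assms(1) by (simp add: ready_def)
  next
    case False
    then show ?thesis using assms c by (simp add: ready_def stp_def)
  qed
  show "length (rY (stp (a, u, v) d)) + length (rY2 (stp (a, u, v) d)) = length (rY d) + length (rY2 d)"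
    using hit by (auto simp: stp_def Let_def)
  show "length (rCU (stp (a, u, v) d)) \<le> Suc (length (rCU d))" "length (rCV (stp (a, u, v) d)) \<le> Suc (length (rCV d))"
    by (auto simp: stp_def Let_def set_top_def)
qed

lemma stp_same [simp]:
  "rW (stp z d) = rW d"
  "rW2 (stp z d) = rW2 d"
  "rPQ (stp z d) = rPQ d"
  "rPX (stp z d) = rPX d"
  "rPA (stp z d) = rPA d"
  "rREST (stp z d) = rREST d"
  "rMODE (stp z d) = rMODE d"
  "rX (stp z d) = rX d"
  "rA (stp z d) = rA d"
  "rU (stp z d) = rU d"
  "rV (stp z d) = rV d"
  "rD (stp z d) = rD d"
  "rDU (stp z d) = rDU d"
  "rDV (stp z d) = rDV d"
  "rLV (stp z d) = rLV d"
  by (simp_all add: stp_def Let_def split: prod.split)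

lemma bnd_stp:
  assumes "ready d" "0 < u" "0 < v" "bnd h d" "h < H" "length (rY d) + length (rY2 d) \<le> H"
  shows "bnd H (stp (a, u, v) d)"
proof -
  note rs = ready_stp[OF assms(1-3), of a]
  have 1: "length (rY (stp (a, u, v) d)) \<le> H" "length (rY2 (stp (a, u, v) d)) \<le> H" using rs(2) assms(6) by linarith+
  have 2: "length (rCU (stp (a, u, v) d)) \<le> H" "length (rCV (stp (a, u, v) d)) \<le> H"
    using rs(3,4) assms(4,5) unfolding bnd_def by linarith+
  have 3: "length (rPAR (stp (a, u, v) d)) \<le> H" "length (rEQ (stp (a, u, v) d)) \<le> H" "length (rVB (stp (a, u, v) d)) \<le> H"
    "length (rFL (stp (a, u, v) d)) \<le> H" "length (rERR (stp (a, u, v) d)) \<le> H"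
    using rs(1) assms(5) unfolding ready_def by linarith+
  have "bnd H d" using assms(4,5) by (auto simp: bnd_def)
  then show ?thesis using 1 2 3 by (simp add: bnd_def)
qed

lemma runs_scan_body:
  assumes rd: "ready d" and W: "rW d = a # W" and U: "rU d = u # U" and V: "rV d = v # V"
    and pos: "0 < a" "0 < u" "0 < v" and b: "bnd h d" "h < H" and y: "length (rY d) + length (rY2 d) \<le> H"
  shows "runs (bounded H) scan_body (reg d) (reg ((stp (a, u, v) d)\<lparr>rW := W, rW2 := a # rW2 d, rU := U, rV := V\<rparr>))"
proof -
  have bH: "bnd H d" using b by (auto simp: bnd_def)
  have len: "length (rPAR d) = 1" "length (rEQ d) = 1" "length (rVB d) = 1" "length (rFL d) = 1" "length (rERR d) = 1"
    using rd by (simp_all add: ready_def)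
  obtain p where p: "rPAR d = [p]" using len(1) unfolding singleton_iff ..
  obtain e where e: "rEQ d = [e]" using len(2) unfolding singleton_iff ..
  obtain vb where vb: "rVB d = [vb]" using len(3) unfolding singleton_iff ..
  obtain f where f: "rFL d = [f]" using len(4) unfolding singleton_iff ..
  obtain er where er: "rERR d = [er]" using len(5) unfolding singleton_iff ..
  note s = p e vb f er
  have D: "rDU d = []" "rDV d = []" using rd by (simp_all add: ready_def)
  have cu: "\<forall>a\<in>set (rCU d). 0 < a" "\<forall>a\<in>set (rCV d). 0 < a" using rd by (simp_all add: ready_def)
  define d1 where "d1 = (if binary a then d\<lparr>rDU := (if rCU d = [] then [] else [hd0 (rCU d)]),
     rDV := (if rCV d = [] then [] else [hd0 (rCV d)]), rCU := tl (rCU d), rCV := tl (rCV d)\<rparr> else d)"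
  define d2 where "d2 = (if a = 7 then (stp (a, u, v) d)\<lparr>rY := rY d, rY2 := rY2 d\<rparr> else stp (a, u, v) d)"
  have H1: "1 \<le> H" using b by simp
  have b1: "bnd H d1" using bH H1 by (auto simp: bnd_def d1_def)
  have b3: "bnd H (stp (a, u, v) d)" by (rule bnd_stp[OF rd pos(2,3) b y])
  have b2: "bnd H d2"
    using b3 bH unfolding d2_def by (cases "a = 7") (simp_all add: bnd_def)
  have 1: "runs (bounded H) (IF (\<lambda>t. binary (t 0)) (Do (\<lambda>t. copy_act 17 (t 15) @ copy_act 18 (t 16) @ [Pop 15, Pop 16])) SKIP) (reg d) (reg d1)"
  proof (rule runs_IF, cases "binary a")
    case True
    have "do_acts (copy_act 17 (tops (reg d) 15) @ copy_act 18 (tops (reg d) 16) @ [Pop 15, Pop 16]) (reg d) = reg d1"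
      using True D hd0_pos[OF cu(1)] hd0_pos[OF cu(2)] by (cases d) (auto simp: d1_def copy_act_def)
    then have "runs (bounded H) (Do (\<lambda>t. copy_act 17 (t 15) @ copy_act 18 (t 16) @ [Pop 15, Pop 16])) (reg d) (reg d1)"
      using bH b1 by (intro runs_Do_reg)
    then show "runs (bounded H) (if binary (tops (reg d) 0) then Do (\<lambda>t. copy_act 17 (t 15) @ copy_act 18 (t 16) @ [Pop 15, Pop 16]) else SKIP) (reg d) (reg d1)"
      using True W by simp
  next
    case False
    then show "runs (bounded H) (if binary (tops (reg d) 0) then Do (\<lambda>t. copy_act 17 (t 15) @ copy_act 18 (t 16) @ [Pop 15, Pop 16]) else SKIP) (reg d) (reg d1)"
      using W bH by (simp add: d1_def runs_SKIP bounded_reg)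
  qed
  have "do_acts (scan_acts (tops (reg d1))) (reg d1) = reg d2"
  proof -
    consider "a = 8 \<or> a = 9" | "a = 7" | "a = 1 \<or> a = 2 \<or> a = 3" | "binary a" unfolding binary_def by blast
    then show ?thesis
    proof cases
      case 1
      then have nb: "\<not> binary a" by (auto simp: binary_def)
      have nz: "hd0 (rY d) \<noteq> 0" if "dgt (hd0 (rY d)) = a" using that 1 by (auto simp: dgt_def split: if_splits)
      have a7: "a \<noteq> 7" using 1 by auto
      have d1: "d1 = d" using nb by (simp add: d1_def)
      define hit where "hit \<longleftrightarrow> e = 1 \<and> dgt (hd0 (rY d)) = a"
      have sa: "scan_acts (tops (reg d)) = (if hit then [Push 11 (hd0 (rY d)), Pop 10] else [Repl 20 2]) @
        (if p = 1 then [Repl 19 (if a = 8 then 2 else 3)] else []) @ (if p = 2 then [Repl 23 2] else [])"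
        using 1 nz s W pos(1) by (simp add: scan_acts_def copy_act_def hit_def)
      have sp: "d2 = d\<lparr> rY := (if hit then tl (rY d) else rY d),
          rY2 := (if hit then hd0 (rY d) # rY2 d else rY2 d),
          rEQ := (if hit then [e] else [2]),
          rPAR := (if p = 1 then [if a = 8 then 2 else 3] else [p]),
          rERR := (if p = 2 then [2] else [er]) \<rparr>"
        using 1 a7 s by (simp add: d2_def stp_def Let_def hit_def)
      show ?thesis unfolding d1 sa sp
        by (cases hit; cases "p = 1"; cases "p = 2"; (use s in \<open>cases d; simp\<close>))
    next
      case 2
      then have nb: "\<not> binary a" by (auto simp: binary_def)
      show ?thesis using 2 nb s W U V pos unfolding d1_def d2_def scan_acts_def stp_def
        by (cases d; simp add: copy_act_def rep_act_def)
    next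
      case 3
      then have nb: "\<not> binary a" "a \<noteq> 7" "a \<noteq> 8" "a \<noteq> 9" by (auto simp: binary_def)
      show ?thesis using 3 nb s W U V pos unfolding d1_def d2_def scan_acts_def stp_def
        by (cases d; simp add: rep_act_def set_top_def)
    next
      case 4
      then have nb: "a \<noteq> 1" "a \<noteq> 2" "a \<noteq> 3" "a \<noteq> 7" "a \<noteq> 8" "a \<noteq> 9" by (auto simp: binary_def)
      have t: "hd0 (rDU d1) = hd0 (rCU d)" "hd0 (rDV d1) = hd0 (rCV d)" using 4 by (simp_all add: d1_def)
      show ?thesis using 4 nb s W U V pos D t unfolding d2_def scan_acts_def stp_def
        by (cases d; simp add: rep_act_def set_top_def d1_def)
    qed
  qed
  then have 2: "runs (bounded H) (Do scan_acts) (reg d1) (reg d2)" using b1 b2 by (intro runs_Do_reg)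
  have W2: "rW d2 = a # W" "rU d2 = u # U" "rV d2 = v # V" using W U V by (simp_all add: d2_def)
  have 3: "runs (bounded H) (IF (\<lambda>t. t 0 = 7) (move_reg 11 10) SKIP) (reg d2) (reg (stp (a, u, v) d))"
  proof (rule runs_IF, cases "a = 7")
    case True
    have "runs (bounded H) (move_reg 11 10) (reg d2) (reg (stp (a, u, v) d))"
    proof (rule runs_move)
      show "\<forall>x\<in>set (reg d2 11). 0 < x" using rd True by (simp add: d2_def ready_def)
      show "length (reg d2 11) + length (reg d2 10) \<le> H" using y True by (simp add: d2_def)
      show "reg (stp (a, u, v) d) = (reg d2)(11 := [], 10 := rev (reg d2 11) @ reg d2 10)"
        using True by (cases d) (simp add: d2_def stp_def)
    qed (use b2 in \<open>simp_all add: bounded_reg\<close>)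
    then show "runs (bounded H) (if tops (reg d2) 0 = 7 then move_reg 11 10 else SKIP) (reg d2) (reg (stp (a, u, v) d))"
      using True W2 by simp
  next
    case False
    then show "runs (bounded H) (if tops (reg d2) 0 = 7 then move_reg 11 10 else SKIP) (reg d2) (reg (stp (a, u, v) d))"
      using W2 b2 by (simp add: d2_def runs_SKIP bounded_reg)
  qed
  have W3: "rW (stp (a, u, v) d) = a # W" "rU (stp (a, u, v) d) = u # U" "rV (stp (a, u, v) d) = v # V" "rW2 (stp (a, u, v) d) = rW2 d"
    using W U V by simp_all
  have b4: "bnd H ((stp (a, u, v) d)\<lparr>rW := W, rW2 := a # rW2 d, rU := U, rV := V\<rparr>)"
    using b3 b W U V by (auto simp: bnd_def)
  have 4: "runs (bounded H) (Do (\<lambda>t. [Pop 0] @ copy_act 2 (t 0) @ [Pop 12, Pop 13])) (reg (stp (a, u, v) d))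
     (reg ((stp (a, u, v) d)\<lparr>rW := W, rW2 := a # rW2 d, rU := U, rV := V\<rparr>))"
    using b3 b4 W3 pos(1) by (intro runs_Do_reg) (simp_all add: copy_act_def)
  show ?thesis unfolding scan_body_def by (rule runs_Seq[OF 1 runs_Seq[OF 2 runs_Seq[OF 3 4]]])
qed

lemma stp_comm: "stp z (d\<lparr>rW := p, rW2 := q, rU := x, rV := y\<rparr>) = (stp z d)\<lparr>rW := p, rW2 := q, rU := x, rV := y\<rparr>"
  by (cases z, cases d) (simp add: stp_def Let_def)

definition scan_prog :: com where
  "scan_prog = Seq (WHILE (\<lambda>t. t 0 \<noteq> 0) scan_body) (move_reg 2 0)"

text \<open>A symbol adds at most one entry to the root stacks, and the candidate only moves between
  its two stacks. So \<open>h\<close> bounds the states between symbols, and the larger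
  \<open>H\<close> covers those inside the body.\<close>

lemma runs_scan_prog:
  assumes rd: "ready d" and l: "length ru = length rw" "length rv = length rw" and d: "rW d = rw" "rW2 d = []" "rU d = ru" "rV d = rv"
    and pos: "\<forall>a\<in>set rw. 0 < a" "\<forall>a\<in>set ru. 0 < a" "\<forall>a\<in>set rv. 0 < a"
    and b: "bnd h d" "h < H" "length (rCU d) + length rw \<le> h" "length (rCV d) + length rw \<le> h" "length (rY d) + length (rY2 d) \<le> h"
  shows "runs (bounded H) scan_prog (reg d) (reg ((fold stp (zip rw (zip ru rv)) d)\<lparr>rU := [], rV := []\<rparr>))"
proof -
  let ?zs = "zip rw (zip ru rv)" and ?n = "length rw"
  define E where "E i = fold stp (take i ?zs) d" for i
  define g where "g i = (E i)\<lparr>rW := drop i rw, rW2 := rev (take i rw), rU := drop i ru, rV := drop i rv\<rparr>" for i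
  have zi: "?zs ! i = (rw ! i, ru ! i, rv ! i)" if "i < ?n" for i using that l by simp
  have ES: "E (Suc i) = stp (rw ! i, ru ! i, rv ! i) (E i)" if "i < ?n" for i
    using that l zi[OF that] by (simp add: E_def take_Suc_conv_app_nth)
  have u: "0 < ru ! i" "0 < rv ! i" "0 < rw ! i" if "i < ?n" for i using pos l that by simp_all
  have inv: "ready (E i) \<and> length (rY (E i)) + length (rY2 (E i)) \<le> h \<and> length (rCU (E i)) \<le> length (rCU d) + i \<and>
     length (rCV (E i)) \<le> length (rCV d) + i \<and> bnd h (E i)" if "i \<le> ?n" for i
    using that
  proof (induction i)
    case 0 then show ?case using rd b by (simp add: E_def)
  next
    case (Suc i)
    then have i: "i < ?n" and IH: "ready (E i)" "length (rY (E i)) + length (rY2 (E i)) \<le> h"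
      "length (rCU (E i)) \<le> length (rCU d) + i" "length (rCV (E i)) \<le> length (rCV d) + i" "bnd h (E i)" by auto
    note rs = ready_stp[OF IH(1) u(1,2)[OF i], of "rw ! i"]
    let ?e = "stp (rw ! i, ru ! i, rv ! i) (E i)"
    have 1: "length (rY ?e) + length (rY2 ?e) \<le> h" using rs(2) IH(2) by simp
    have 2: "length (rCU ?e) \<le> length (rCU d) + Suc i" "length (rCV ?e) \<le> length (rCV d) + Suc i" using rs(3,4) IH(3,4) by linarith+
    have 3: "length (rY ?e) \<le> h" "length (rY2 ?e) \<le> h" "length (rCU ?e) \<le> h" "length (rCV ?e) \<le> h" using 1 2 b(3,4) i by linarith+
    have h1: "1 \<le> h" using b(3) i by linarith
    have 4: "length (rPAR ?e) \<le> h" "length (rEQ ?e) \<le> h" "length (rVB ?e) \<le> h" "length (rFL ?e) \<le> h" "length (rERR ?e) \<le> h"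
      using rs(1) h1 unfolding ready_def by linarith+
    have "bnd h ?e" using IH(5) 3 4 by (simp add: bnd_def)
    then show ?case unfolding ES[OF i] using rs(1) 1 2 by simp
  qed
  have nh: "?n \<le> h" using b(3) by simp
  have gb: "bnd h (g i)" if "i \<le> ?n" for i using inv[OF that] nh l by (auto simp: g_def bnd_def)
  have loop: "runs (bounded H) (WHILE (\<lambda>t. t 0 \<noteq> 0) scan_body) (reg d) (reg (g ?n))"
  proof (rule drain_reg[where g = g and xs = rw])
    fix i assume i: "i < ?n"
    have dr: "drop i xs = xs ! i # drop (Suc i) xs" if "length xs = ?n" for xs :: "nat list"
      using that i by (simp add: Cons_nth_drop_Suc)
    have ready: "ready (g i)" using inv[of i] i by (simp add: g_def ready_def)
    have "runs (bounded H) scan_body (reg (g i)) (reg ((stp (rw ! i, ru ! i, rv ! i) (g i))\<lparr>rW := drop (Suc i) rw,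
       rW2 := rw ! i # rW2 (g i), rU := drop (Suc i) ru, rV := drop (Suc i) rv\<rparr>))"
    proof (rule runs_scan_body[OF ready])
      show "rW (g i) = rw ! i # drop (Suc i) rw" "rU (g i) = ru ! i # drop (Suc i) ru" "rV (g i) = rv ! i # drop (Suc i) rv"
        using dr l by (simp_all add: g_def)
      show "bnd h (g i)" using gb i by simp
      show "length (rY (g i)) + length (rY2 (g i)) \<le> H" using inv[of i] i b(2) by (simp add: g_def)
    qed (use u[OF i] b(2) in simp_all)
    moreover have "(stp (rw ! i, ru ! i, rv ! i) (g i))\<lparr>rW := drop (Suc i) rw,
       rW2 := rw ! i # rW2 (g i), rU := drop (Suc i) ru, rV := drop (Suc i) rv\<rparr> = g (Suc i)"
      unfolding g_def stp_comm ES[OF i] using i by (simp add: take_Suc_conv_app_nth)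
    ultimately show "runs (bounded H) scan_body (reg (g i)) (reg (g (Suc i)))" by simp
  next
    show "bounded H (reg (g ?n))" using gb[of ?n] b(2) by (auto simp: bounded_reg bnd_def)
    have "g 0 = d" using d by (cases d) (simp add: g_def E_def)
    then show "reg d = reg (g 0)" by simp
  qed (use pos in \<open>simp_all add: g_def\<close>)
  have mv: "runs (bounded H) (move_reg 2 0) (reg (g ?n)) (reg ((fold stp ?zs d)\<lparr>rU := [], rV := []\<rparr>))"
  proof (rule runs_move)
    show "bounded H (reg (g ?n))" using gb[of ?n] b(2) by (auto simp: bounded_reg bnd_def)
    have e: "E ?n = fold stp ?zs d" using l by (simp add: E_def)
    have w: "rW (E ?n) = rw" "rW2 (E ?n) = []"
    proof -
      have "rW (fold stp zs d) = rW d \<and> rW2 (fold stp zs d) = rW2 d" for zs d by (induction zs arbitrary: d) auto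
      then show "rW (E ?n) = rw" "rW2 (E ?n) = []" using d by (simp_all add: E_def)
    qed
    show "reg ((fold stp ?zs d)\<lparr>rU := [], rV := []\<rparr>) = (reg (g ?n))(2 := [], 0 := rev (reg (g ?n) 2) @ reg (g ?n) 0)"
      unfolding e[symmetric] using w l by (cases "E ?n") (simp add: g_def)
  qed (use pos nh b(2) in \<open>simp_all add: g_def\<close>)
  show ?thesis unfolding scan_prog_def by (rule runs_Seq[OF loop mv])
qed

section \<open>Evaluation of one leaf of the quantified formula\<close>

definition dup_prog :: com where
  "dup_prog = Seq (move_reg 4 9) (WHILE (\<lambda>t. t 9 \<noteq> 0) (Do (\<lambda>t. copy_act 4 (t 9) @ copy_act 8 (t 9) @ [Pop 9])))"

lemma runs_dup_prog:
  assumes "rA d = []" "rX d = []" "rPX d = xs" "\<forall>a\<in>set xs. 0 < a" "bnd H d"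
  shows "runs (bounded H) dup_prog (reg d) (reg (d\<lparr>rX := xs\<rparr>))"
proof -
  have xH: "length xs \<le> H" using assms(3,5) by (auto simp: bnd_def)
  let ?d = "d\<lparr>rPX := [], rA := rev xs\<rparr>"
  have 1: "runs (bounded H) (move_reg 4 9) (reg d) (reg ?d)"
    by (rule runs_move) (use assms xH in \<open>simp_all add: bounded_reg\<close>)
  define g where "g i = d\<lparr>rPX := rev (take i (rev xs)), rX := rev (take i (rev xs)), rA := drop i (rev xs)\<rparr>" for i
  have 2: "runs (bounded H) (WHILE (\<lambda>t. t 9 \<noteq> 0) (Do (\<lambda>t. copy_act 4 (t 9) @ copy_act 8 (t 9) @ [Pop 9]))) (reg ?d) (reg (d\<lparr>rX := xs\<rparr>))"
  proof (rule drain_Do[where g = g and xs = "rev xs"])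
    show "bnd H (g i)" for i using assms(5) xH by (auto simp: g_def bnd_def)
    show "do_acts (copy_act 4 (tops (reg (g i)) 9) @ copy_act 8 (tops (reg (g i)) 9) @ [Pop 9]) (reg (g i)) = reg (g (Suc i))"
      if "i < length (rev xs)" for i
    proof -
      have "rev xs ! i \<noteq> 0" using assms(4) that by (metis nth_mem set_rev neq0_conv)
      then show ?thesis using that by (simp add: g_def hd0_drop copy_act_def take_Suc_conv_app_nth drop_Suc tl_drop)
    qed
    show "reg ?d = reg (g 0)" using assms by (cases d) (simp add: g_def)
    show "reg (d\<lparr>rX := xs\<rparr>) = reg (g (length (rev xs)))" using assms by (cases d) (simp add: g_def)
  qed (use assms in \<open>simp_all add: g_def\<close>)
  show ?thesis unfolding dup_prog_def by (rule runs_Seq[OF 1 2])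
qed

definition y_prog :: com where
  "y_prog = for_word (\<lambda>t. copy_act 10 (t 8) @ [Pop 8])"

lemma runs_y_prog:
  assumes d: "rW d = rw" "rW2 d = []" "rX d = xs" "rY d = []" and pos: "\<forall>a\<in>set rw. 0 < a" "\<forall>a\<in>set xs. 0 < a"
    and l: "length rw \<le> length xs" and b: "bnd H d"
  shows "runs (bounded H) y_prog (reg d) (reg (d\<lparr>rY := rev (take (length rw) xs), rX := drop (length rw) xs\<rparr>))"
  unfolding y_prog_def
proof (rule runs_for_word[where W = rw and h = "\<lambda>i. d\<lparr>rY := rev (take i xs), rX := drop i xs\<rparr>"])
  have xH: "length xs \<le> H" using d b by (auto simp: bnd_def)
  show "rW (d\<lparr>rY := rev (take i xs), rX := drop i xs\<rparr>) = rw \<and> rW2 (d\<lparr>rY := rev (take i xs), rX := drop i xs\<rparr>) = [] \<and>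
      bnd H (d\<lparr>rY := rev (take i xs), rX := drop i xs\<rparr>)" for i
    using d b xH by (auto simp: bnd_def)
  fix i X Z assume "i < length rw"
  then have i: "i < length xs" using l by simp
  then have "xs ! i \<noteq> 0" using pos(2) by auto
  then show "do_acts ((\<lambda>t. copy_act 10 (t 8) @ [Pop 8]) (tops (reg (d\<lparr>rY := rev (take i xs), rX := drop i xs, rW := X, rW2 := Z\<rparr>))))
      (reg (d\<lparr>rY := rev (take i xs), rX := drop i xs, rW := X, rW2 := Z\<rparr>)) =
     reg (d\<lparr>rY := rev (take (Suc i) xs), rX := drop (Suc i) xs, rW := X, rW2 := Z\<rparr>)"
    using i by (cases d) (simp add: hd0_drop copy_act_def take_Suc_conv_app_nth drop_Suc tl_drop)
qed (use d pos in \<open>cases d; simp\<close>)+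

text \<open>Stack 14 holds the destination of the midpoint: 1 for the left end, 2 for the right end,
  3 if that end is already fixed and the midpoint is discarded.\<close>

definition block_prog :: com where
  "block_prog = Seq (Do (\<lambda>t. [Push 14 (if t 8 = 1 then (if t 13 = 0 then 2 else 3) else (if t 12 = 0 then 1 else 3)), Pop 8]))
    (Seq (for_word (\<lambda>t. (if t 14 = 1 then copy_act 12 (t 8) else if t 14 = 2 then copy_act 13 (t 8) else []) @ [Pop 8]))
         (Do (\<lambda>_. [Pop 14])))"

text \<open>Blocks are met from the innermost level outwards. The first selector of each kind fixes
  one end of the pair, later ones of that kind are skipped; an empty list is an end still
  open.\<close>

definition sel :: "nat list \<times> nat list \<Rightarrow> nat \<times> nat list \<Rightarrow> nat list \<times> nat list" where
  "sel uv sb = (if fst sb = 1 then (fst uv, if snd uv = [] then rev (snd sb) else snd uv)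
     else (if fst uv = [] then rev (snd sb) else fst uv, snd uv))"

lemma runs_block_prog:
  assumes d: "rW d = rw" "rW2 d = []" "rX d = s # b @ xs" "rD d = []" and pos: "\<forall>a\<in>set rw. 0 < a" "0 < s" "\<forall>a\<in>set b. 0 < a"
      "\<forall>a\<in>set (rU d). 0 < a" "\<forall>a\<in>set (rV d). 0 < a"
    and l: "length b = length rw" and bn: "bnd H d" "1 \<le> H"
  shows "runs (bounded H) block_prog (reg d) (reg (d\<lparr>rU := fst (sel (rU d, rV d) (s, b)), rV := snd (sel (rU d, rV d) (s, b)), rX := xs\<rparr>))"
proof -
  define D where "D = (if s = 1 then (if rV d = [] then 2 else 3) else (if rU d = [] then 1 else (3::nat)))"
  have hU: "hd0 (rU d) = 0 \<longleftrightarrow> rU d = []" and hV: "hd0 (rV d) = 0 \<longleftrightarrow> rV d = []" using hd0_pos pos(4,5) by blast+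
  have lH: "length (s # b @ xs) \<le> H" "length (rU d) \<le> H" "length (rV d) \<le> H" using bn(1) d by (auto simp: bnd_def)
  let ?d1 = "d\<lparr>rD := [D], rX := b @ xs\<rparr>"
  have 1: "runs (bounded H) (Do (\<lambda>t. [Push 14 (if t 8 = 1 then (if t 13 = 0 then 2 else 3) else (if t 12 = 0 then 1 else 3)), Pop 8])) (reg d) (reg ?d1)"
  proof (rule runs_Do_reg)
    show "bnd H ?d1" using bn lH by (auto simp: bnd_def)
  qed (use bn d hU hV in \<open>simp_all add: D_def\<close>)
  define U where "U i = (if D = 1 then rev (take i b) else rU d)" for i
  define V where "V i = (if D = 2 then rev (take i b) else rV d)" for i
  define h where "h i = d\<lparr>rD := [D], rU := U i, rV := V i, rX := drop i b @ xs\<rparr>" for i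
  have D1: "D = 1 \<Longrightarrow> rU d = []" "D = 2 \<Longrightarrow> rV d = []"
    unfolding D_def by (cases "s = 1"; cases "rU d = []"; cases "rV d = []"; simp)+
  have h0: "h 0 = ?d1"
  proof -
    have "U 0 = rU d" "V 0 = rV d" using D1 by (simp_all add: U_def V_def)
    then show ?thesis by (cases d) (simp add: h_def)
  qed
  have bh: "bnd H (h i)" for i
  proof -
    have "length (U i) \<le> H" "length (V i) \<le> H" "length (drop i b @ xs) \<le> H" using lH by (auto simp: U_def V_def)
    then show ?thesis using bn by (simp add: h_def bnd_def)
  qed
  have 2: "runs (bounded H) (for_word (\<lambda>t. (if t 14 = 1 then copy_act 12 (t 8) else if t 14 = 2 then copy_act 13 (t 8) else []) @ [Pop 8]))
     (reg ?d1) (reg (h (length rw)))"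
  proof (rule runs_for_word[where W = rw and h = h])
    show "rW (h i) = rw \<and> rW2 (h i) = [] \<and> bnd H (h i)" for i using bh d by (simp add: h_def)
    fix i X Z assume "i < length rw"
    then have i: "i < length b" using l by simp
    have nz: "b ! i \<noteq> 0" using pos(3) i by auto
    have t: "hd0 (drop i b @ xs) = b ! i" "tl (drop i b @ xs) = drop (Suc i) b @ xs" using i by (simp_all add: Cons_nth_drop_Suc[symmetric])
    have UV: "U (Suc i) = (if D = 1 then b ! i # U i else U i)" "V (Suc i) = (if D = 2 then b ! i # V i else V i)"
      using i by (simp_all add: U_def V_def take_Suc_conv_app_nth)
    show "do_acts ((\<lambda>t. (if t 14 = 1 then copy_act 12 (t 8) else if t 14 = 2 then copy_act 13 (t 8) else []) @ [Pop 8]) (tops (reg ((h i)\<lparr>rW := X, rW2 := Z\<rparr>))))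
        (reg ((h i)\<lparr>rW := X, rW2 := Z\<rparr>)) = reg ((h (Suc i))\<lparr>rW := X, rW2 := Z\<rparr>)"
      using nz t UV by (cases d) (simp add: h_def copy_act_def)
  qed (use pos h0 in simp_all)
  have 3: "runs (bounded H) (Do (\<lambda>_. [Pop 14])) (reg (h (length rw))) (reg (d\<lparr>rU := fst (sel (rU d, rV d) (s, b)), rV := snd (sel (rU d, rV d) (s, b)), rX := xs\<rparr>))"
  proof (rule runs_Do_reg[OF bh])
    have e: "fst (sel (rU d, rV d) (s, b)) = U (length rw)" "snd (sel (rU d, rV d) (s, b)) = V (length rw)"
      using l by (auto simp: sel_def U_def V_def D_def)
    show "bnd H (d\<lparr>rU := fst (sel (rU d, rV d) (s, b)), rV := snd (sel (rU d, rV d) (s, b)), rX := xs\<rparr>)"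
      unfolding e using bh[of "length rw"] bn(1) lH by (auto simp: bnd_def h_def)
    show "do_acts [Pop 14] (reg (h (length rw))) = reg (d\<lparr>rU := fst (sel (rU d, rV d) (s, b)), rV := snd (sel (rU d, rV d) (s, b)), rX := xs\<rparr>)"
      unfolding e using d l by (cases d) (simp add: h_def)
  qed
  show ?thesis unfolding block_prog_def by (rule runs_Seq[OF 1 runs_Seq[OF 2 3]])
qed

definition sel_prog :: com where
  "sel_prog = WHILE (\<lambda>t. t 8 \<noteq> 0) block_prog"

lemma runs_sel_prog:
  assumes "rW d = rw" "rW2 d = []" "rX d = flat bs" "rD d = []" "\<forall>a\<in>set rw. 0 < a"
    "\<forall>(s, b)\<in>set bs. 0 < s \<and> (\<forall>a\<in>set b. 0 < a) \<and> length b = length rw"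
    "\<forall>a\<in>set (rU d). 0 < a" "\<forall>a\<in>set (rV d). 0 < a" "bnd H d" "1 \<le> H"
  shows "runs (bounded H) sel_prog (reg d) (reg (d\<lparr>rU := fst (foldl sel (rU d, rV d) bs), rV := snd (foldl sel (rU d, rV d) bs), rX := []\<rparr>))"
  using assms unfolding sel_prog_def
proof (induction bs arbitrary: d)
  case Nil
  have e: "reg (d\<lparr>rU := fst (foldl sel (rU d, rV d) []), rV := snd (foldl sel (rU d, rV d) []), rX := []\<rparr>) = reg d"
    using Nil.prems by (cases d) (simp add: flat_def)
  show ?case unfolding e by (rule runs_WHILE_False) (use Nil.prems in \<open>simp_all add: flat_def bounded_reg\<close>)
next
  case (Cons sb bs)
  obtain s b where sb: "sb = (s, b)" by (cases sb)
  have p: "0 < s" "\<forall>a\<in>set b. 0 < a" "length b = length rw" using Cons.prems(6) sb by auto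
  have x: "rX d = s # b @ flat bs" using Cons.prems(3) sb by (simp add: flat_def)
  let ?uv = "sel (rU d, rV d) (s, b)"
  let ?e = "d\<lparr>rU := fst ?uv, rV := snd ?uv, rX := flat bs\<rparr>"
  have 1: "runs (bounded H) block_prog (reg d) (reg ?e)"
    using Cons.prems p x by (intro runs_block_prog) simp_all
  have be: "bnd H ?e" using runs_post[OF 1] by (simp add: bounded_reg)
  have pu: "\<forall>a\<in>set (fst ?uv). 0 < a" "\<forall>a\<in>set (snd ?uv). 0 < a" using p(2) Cons.prems(7,8) by (simp_all add: sel_def)
  have "runs (bounded H) (WHILE (\<lambda>t. t 8 \<noteq> 0) block_prog) (reg ?e)
     (reg (?e\<lparr>rU := fst (foldl sel (rU ?e, rV ?e) bs), rV := snd (foldl sel (rU ?e, rV ?e) bs), rX := []\<rparr>))"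
    by (rule Cons.IH) (use Cons.prems be pu in simp_all)
  also have "reg (?e\<lparr>rU := fst (foldl sel (rU ?e, rV ?e) bs), rV := snd (foldl sel (rU ?e, rV ?e) bs), rX := []\<rparr>)
     = reg (d\<lparr>rU := fst (foldl sel (rU d, rV d) (sb # bs)), rV := snd (foldl sel (rU d, rV d) (sb # bs)), rX := []\<rparr>)"
    using sb by (cases d) simp
  finally show ?case using 1 x p(1) by (intro runs_WHILE_True[OF _ 1]) simp_all
qed

lemma cur_nodes: "\<forall>(s, b)\<in>set bs. b \<in> nodes n \<Longrightarrow> fst (cur n bs) \<in> nodes n \<and> snd (cur n bs) \<in> nodes n"
proof (induction bs)
  case Nil
  then show ?case using cod(1) by (auto simp: nodes_def START_def DONE_def)
next
  case (Cons sb bs)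
  then show ?case by (cases sb) (auto simp: nodes_def)
qed

text \<open>Links the outward pass of the program with \<open>cur\<close>, which determines the
  outer pair first; the statement is general in the ends \<open>uv\<close> found so far. An empty
  list could also be a genuine midpoint, but only for \<open>n = 0\<close>, when all nodes are
  empty.\<close>

lemma foldl_sel_cur:
  "\<forall>(s, b)\<in>set bs. b \<in> nodes n \<Longrightarrow> foldl sel uv bs = r \<Longrightarrow>
   (if fst r = [] then replicate n START else fst r) = (if fst uv = [] then fst (cur n bs) else fst uv) \<and>
   (if snd r = [] then replicate n DONE else snd r) = (if snd uv = [] then snd (cur n bs) else snd uv)"
proof (induction bs arbitrary: uv)
  case (Cons sb bs)
  obtain s b where sb: "sb = (s, b)" by (cases sb)
  have b: "b \<in> nodes n" "\<forall>(s, b)\<in>set bs. b \<in> nodes n" using Cons.prems(1) sb by auto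
  have e: "b = [] \<Longrightarrow> fst (cur n bs) = [] \<and> snd (cur n bs) = []"
    using cur_nodes[OF b(2)] b(1) by (simp add: nodes_def)
  have f: "foldl sel (sel uv (s, b)) bs = r" using Cons.prems(2) sb by simp
  show ?case using Cons.IH[OF b(2) f] e sb
    by (cases "s = 1"; cases "b = []"; cases "fst uv = []"; cases "snd uv = []") (simp_all add: sel_def)
qed auto

definition fill :: "nat \<Rightarrow> nat \<Rightarrow> com" where
  "fill r x = IF (\<lambda>t. t r = 0) (for_word (\<lambda>_. [Push r x])) SKIP"

lemma runs_fill_U:
  assumes d: "rW d = rw" "rW2 d = []" and pos: "\<forall>a\<in>set rw. 0 < a" "\<forall>a\<in>set (rU d). 0 < a" and b: "bnd H d"
  shows "runs (bounded H) (fill 12 x) (reg d) (reg (d\<lparr>rU := if rU d = [] then replicate (length rw) x else rU d\<rparr>))"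
proof (cases "rU d = []")
  case True
  have n: "length rw \<le> H" using b d by (auto simp: bnd_def)
  have "runs (bounded H) (for_word (\<lambda>_. [Push 12 x])) (reg d) (reg (d\<lparr>rU := replicate (length rw) x\<rparr>))"
  proof (rule runs_for_word[where W = rw and h = "\<lambda>i. d\<lparr>rU := replicate i x\<rparr>"])
    show "rW (d\<lparr>rU := replicate i x\<rparr>) = rw \<and> rW2 (d\<lparr>rU := replicate i x\<rparr>) = [] \<and> bnd H (d\<lparr>rU := replicate i x\<rparr>)"
      if "i \<le> length rw" for i using d b n that by (simp add: bnd_def)
    show "d = d\<lparr>rU := replicate 0 x\<rparr>" using True by (cases d) simp
  qed (use pos in \<open>cases d; simp\<close>)+
  then show ?thesis using True by (simp add: fill_def runs_IF)
next
  case False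
  then have "hd0 (rU d) \<noteq> 0" using hd0_pos pos(2) by blast
  then show ?thesis using False b by (simp add: fill_def runs_IF runs_SKIP bounded_reg)
qed

lemma runs_fill_V:
  assumes d: "rW d = rw" "rW2 d = []" and pos: "\<forall>a\<in>set rw. 0 < a" "\<forall>a\<in>set (rV d). 0 < a" and b: "bnd H d"
  shows "runs (bounded H) (fill 13 x) (reg d) (reg (d\<lparr>rV := if rV d = [] then replicate (length rw) x else rV d\<rparr>))"
proof (cases "rV d = []")
  case True
  have n: "length rw \<le> H" using b d by (auto simp: bnd_def)
  have "runs (bounded H) (for_word (\<lambda>_. [Push 13 x])) (reg d) (reg (d\<lparr>rV := replicate (length rw) x\<rparr>))"
  proof (rule runs_for_word[where W = rw and h = "\<lambda>i. d\<lparr>rV := replicate i x\<rparr>"])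
    show "rW (d\<lparr>rV := replicate i x\<rparr>) = rw \<and> rW2 (d\<lparr>rV := replicate i x\<rparr>) = [] \<and> bnd H (d\<lparr>rV := replicate i x\<rparr>)"
      if "i \<le> length rw" for i using d b n that by (simp add: bnd_def)
    show "d = d\<lparr>rV := replicate 0 x\<rparr>" using True by (cases d) simp
  qed (use pos in \<open>cases d; simp\<close>)+
  then show ?thesis using True by (simp add: fill_def runs_IF)
next
  case False
  then have "hd0 (rV d) \<noteq> 0" using hd0_pos pos(2) by blast
  then show ?thesis using False b by (simp add: fill_def runs_IF runs_SKIP bounded_reg)
qed

definition clear :: "nat \<Rightarrow> com" where
  "clear r = WHILE (\<lambda>t. t r \<noteq> 0) (Do (\<lambda>_. [Pop r]))"

lemma runs_clear:
  assumes "\<forall>a\<in>set (s r). 0 < a" "bounded H s"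
  shows "runs (bounded H) (clear r) s (s(r := []))"
  unfolding clear_def
proof (rule runs_WHILE_iter[where n = "length (s r)" and f = "\<lambda>i. s(r := drop i (s r))"])
  have b: "bounded H (s(r := drop i (s r)))" for i
    using assms(2) by (auto simp: bounded_def intro: le_trans[OF diff_le_self])
  fix i assume i: "i < length (s r)"
  have t: "tops (s(r := drop i (s r))) r = s r ! i" using i by (simp add: tops_def hd0_drop)
  have "s r ! i \<noteq> 0" using assms(1) i by auto
  moreover have "runs (bounded H) (Do (\<lambda>_. [Pop r])) (s(r := drop i (s r))) (s(r := drop (Suc i) (s r)))"
    by (rule runs_Do, rule b, rule b) (simp add: drop_Suc tl_drop)
  ultimately show "tops (s(r := drop i (s r))) r \<noteq> 0 \<and>
     runs (bounded H) (Do (\<lambda>_. [Pop r])) (s(r := drop i (s r))) (s(r := drop (Suc i) (s r)))"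
    using t by simp
qed (use assms in \<open>auto simp: bounded_def tops_def\<close>)

definition verdict :: "(nat \<Rightarrow> nat) \<Rightarrow> act list" where
  "verdict t = [Repl 7 (if t 23 = 1 \<and> t 19 = 1 \<and> t 15 \<noteq> 0 \<and> root_ok (t 15) (t 16) then 3 else 2),
     Pop 19, Pop 20, Pop 21, Pop 22, Pop 23, Pop 15, Pop 16]"

text \<open>Acceptance requires exactly one root symbol. The first action pops one and the second
  looks whether another remains.\<close>

definition finish_prog :: com where
  "finish_prog = Seq (Do verdict) (Seq (Do (\<lambda>t. if t 15 \<noteq> 0 then [Repl 7 2] else []))
    (Seq (clear 15) (Seq (clear 16) (Seq (clear 10) (clear 11)))))"

lemma runs_finish_prog:
  assumes rd: "ready e" and pos: "\<forall>a\<in>set (rY e). 0 < a" and m: "rMODE e = [m]" and b: "bnd H e"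
  shows "runs (bounded H) finish_prog (reg e) (reg (e\<lparr>rMODE := [if accepting e then 3 else 2], rPAR := [], rEQ := [], rVB := [],
    rFL := [], rERR := [], rCU := [], rCV := [], rY := [], rY2 := []\<rparr>))"
proof -
  have l: "length (rPAR e) = 1" "length (rEQ e) = 1" "length (rVB e) = 1" "length (rFL e) = 1" "length (rERR e) = 1"
    using rd by (simp_all add: ready_def)
  obtain p q v f x where s: "rPAR e = [p]" "rEQ e = [q]" "rVB e = [v]" "rFL e = [f]" "rERR e = [x]"
    using l unfolding singleton_iff by metis
  have H: "1 \<le> H" using b m by (auto simp: bnd_def)
  have pc: "\<forall>a\<in>set (rCU e). 0 < a" "\<forall>a\<in>set (rCV e). 0 < a" "\<forall>a\<in>set (rY2 e). 0 < a" using rd by (simp_all add: ready_def)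
  have tl: "\<forall>a\<in>set (tl xs). 0 < a" if "\<forall>a\<in>set xs. 0 < a" for xs :: "nat list" using that by (cases xs) auto
  define a where "a \<longleftrightarrow> x = 1 \<and> p = 1 \<and> hd0 (rCU e) \<noteq> 0 \<and> root_ok (hd0 (rCU e)) (hd0 (rCV e))"
  define k where "k = (if a then 3 else 2 :: nat)"
  define M where "M = (if accepting e then 3 else 2 :: nat)"
  let ?e1 = "e\<lparr>rMODE := [k], rPAR := [], rEQ := [], rVB := [], rFL := [], rERR := [], rCU := tl (rCU e), rCV := tl (rCV e)\<rparr>"
  let ?e2 = "e\<lparr>rMODE := [M], rPAR := [], rEQ := [], rVB := [], rFL := [], rERR := [], rCU := tl (rCU e), rCV := tl (rCV e)\<rparr>"
  have acc: "M = (if hd0 (tl (rCU e)) \<noteq> 0 then 2 else k)"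
  proof (cases "rCU e")
    case Nil
    then show ?thesis by (simp add: accepting_def a_def M_def k_def)
  next
    case (Cons y ys)
    then have "hd0 ys = 0 \<longleftrightarrow> ys = []" "y \<noteq> 0" using hd0_pos[of ys] pc(1) by auto
    then show ?thesis using Cons s by (simp add: accepting_def a_def M_def k_def)
  qed
  have b1: "bnd H ?e1" "bnd H ?e2" using b H by (auto simp: bnd_def)
  have v: "verdict (tops (reg e)) = [Repl 7 k, Pop 19, Pop 20, Pop 21, Pop 22, Pop 23, Pop 15, Pop 16]"
    using s by (simp add: verdict_def a_def k_def)
  have 1: "runs (bounded H) (Do verdict) (reg e) (reg ?e1)"
    by (rule runs_Do_reg[OF b b1(1)]) (simp add: v s m)
  have 2: "runs (bounded H) (Do (\<lambda>t. if t 15 \<noteq> 0 then [Repl 7 2] else [])) (reg ?e1) (reg ?e2)"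
  proof (rule runs_Do_reg[OF b1])
    have z: "?e1\<lparr>rMODE := [x]\<rparr> = e\<lparr>rMODE := [x], rPAR := [], rEQ := [], rVB := [], rFL := [], rERR := [], rCU := tl (rCU e), rCV := tl (rCV e)\<rparr>" for x
      by (cases e) simp
    show "do_acts ((\<lambda>t. if t 15 \<noteq> 0 then [Repl 7 2] else []) (tops (reg ?e1))) (reg ?e1) = reg ?e2"
    proof (cases "hd0 (tl (rCU e)) = 0")
      case True
      then show ?thesis using acc by simp
    next
      case False
      then have "do_acts ((\<lambda>t. if t 15 \<noteq> 0 then [Repl 7 2] else []) (tops (reg ?e1))) (reg ?e1) = reg (?e1\<lparr>rMODE := [2]\<rparr>)" by simp
      also have "\<dots> = reg ?e2" unfolding z using acc False by simp
      finally show ?thesis .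
    qed
  qed
  let ?e3 = "?e2\<lparr>rCU := []\<rparr>" let ?e4 = "?e3\<lparr>rCV := []\<rparr>" let ?e5 = "?e4\<lparr>rY := []\<rparr>" let ?e6 = "?e5\<lparr>rY2 := []\<rparr>"
  have 3: "runs (bounded H) (clear 15) (reg ?e2) (reg ?e3)"
    using runs_clear[of "reg ?e2" 15 H] b1(2) tl[OF pc(1)] by (simp add: bounded_reg)
  have b3: "bounded H (reg ?e3)" by (rule runs_post[OF 3])
  have 4: "runs (bounded H) (clear 16) (reg ?e3) (reg ?e4)"
    using runs_clear[of "reg ?e3" 16 H] b3 tl[OF pc(2)] by simp
  have b4: "bounded H (reg ?e4)" by (rule runs_post[OF 4])
  have 5: "runs (bounded H) (clear 10) (reg ?e4) (reg ?e5)"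
    using runs_clear[of "reg ?e4" 10 H] b4 pos by simp
  have b5: "bounded H (reg ?e5)" by (rule runs_post[OF 5])
  have 6: "runs (bounded H) (clear 11) (reg ?e5) (reg ?e6)"
    using runs_clear[of "reg ?e5" 11 H] b5 pc(3) by simp
  have e: "?e6 = e\<lparr>rMODE := [M], rPAR := [], rEQ := [], rVB := [],
    rFL := [], rERR := [], rCU := [], rCV := [], rY := [], rY2 := []\<rparr>" by (cases e) simp
  show ?thesis unfolding finish_prog_def M_def[symmetric] e[symmetric]
    by (rule runs_Seq[OF 1 runs_Seq[OF 2 runs_Seq[OF 3 runs_Seq[OF 4 runs_Seq[OF 5 6]]]]])
qed

lemma stp_Y: "set (rY (stp (a, u, v) d)) \<union> set (rY2 (stp (a, u, v) d)) \<subseteq> set (rY d) \<union> set (rY2 d)"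
proof -
  have t: "set (tl xs) \<subseteq> set xs" for xs :: "nat list" by (cases xs) auto
  have h: "hd0 (rY d) \<in> set (rY d)" if "dgt (hd0 (rY d)) = a" "a = 8 \<or> a = 9"
    using that by (cases "rY d") (auto simp: dgt_def split: if_splits)
  show ?thesis using t[of "rY d"] h by (auto simp: stp_def Let_def)
qed

lemma fold_stp_inv:
  assumes "ready d" "\<forall>(a, u, v)\<in>set zs. 0 < u \<and> 0 < v"
  shows "ready (fold stp zs d) \<and> set (rY (fold stp zs d)) \<union> set (rY2 (fold stp zs d)) \<subseteq> set (rY d) \<union> set (rY2 d)"
  using assms
proof (induction zs arbitrary: d)
  case (Cons z zs)
  obtain a u v where z: "z = (a, u, v)" by (cases z)
  have p: "0 < u" "0 < v" using Cons.prems(2) z by auto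
  have r: "ready (stp z d)" using ready_stp(1)[OF Cons.prems(1) p] z by simp
  show ?case using Cons.IH[OF r] Cons.prems(2) stp_Y[of a u v d] z by (simp, blast)
qed simp

lemma fold_stp_same:
  "rW (fold stp zs d) = rW d" "rW2 (fold stp zs d) = rW2 d" "rPQ (fold stp zs d) = rPQ d" "rPX (fold stp zs d) = rPX d"
  "rPA (fold stp zs d) = rPA d" "rREST (fold stp zs d) = rREST d" "rMODE (fold stp zs d) = rMODE d" "rX (fold stp zs d) = rX d"
  "rA (fold stp zs d) = rA d" "rD (fold stp zs d) = rD d" "rLV (fold stp zs d) = rLV d"
  by (induction zs arbitrary: d) auto

definition clean :: "dst \<Rightarrow> bool" where
  "clean d \<longleftrightarrow> rW2 d = [] \<and> rX d = [] \<and> rA d = [] \<and> rY d = [] \<and> rY2 d = [] \<and> rU d = [] \<and> rV d = [] \<and> rD d = [] \<and> rCU d = [] \<and>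
     rCV d = [] \<and> rDU d = [] \<and> rDV d = [] \<and> rPAR d = [] \<and> rEQ d = [] \<and> rVB d = [] \<and> rFL d = [] \<and> rERR d = [] \<and> rLV d = []"

definition leaf_prog :: com where
  "leaf_prog = Seq dup_prog (Seq y_prog (Seq sel_prog (Seq (fill 12 START) (Seq (fill 13 DONE)
    (Seq (Do (\<lambda>_. [Push 19 1, Push 20 1, Push 21 1, Push 22 (Suc nsym), Push 23 1])) (Seq scan_prog finish_prog))))))"

lemma flat_exhaust:
  "length xs = L * Suc n \<Longrightarrow> set xs \<subseteq> {1..nsym} \<Longrightarrow> \<exists>bs. xs = flat bs \<and> (\<forall>(s, b)\<in>set bs. 0 < s \<and> b \<in> nodes n)"
proof (induction L arbitrary: xs)
  case 0
  then show ?case by (intro exI[of _ "[]"]) (simp add: flat_def)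
next
  case (Suc L)
  obtain s ys where xs: "xs = s # ys" using Suc.prems(1) by (cases xs) auto
  have l: "length (drop n ys) = L * Suc n" "length (take n ys) = n" using Suc.prems(1) xs by auto
  have st: "set (drop n ys) \<subseteq> {1..nsym}" "set (take n ys) \<subseteq> {1..nsym}" "0 < s"
    using Suc.prems(2) xs set_drop_subset[of n ys] set_take_subset[of n ys] by auto
  obtain bs where bs: "drop n ys = flat bs" "\<forall>(s, b)\<in>set bs. 0 < s \<and> b \<in> nodes n" using Suc.IH[OF l(1) st(1)] by blast
  have "xs = flat ((s, take n ys) # bs)" using xs bs(1) append_take_drop_id[of n ys] by (simp add: flat_def)
  moreover have "\<forall>(s, b)\<in>set ((s, take n ys) # bs). 0 < s \<and> b \<in> nodes n" using bs(2) l(2) st by (simp add: nodes_def)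
  ultimately show ?case by blast
qed

lemma nodes_pos: "b \<in> nodes n \<Longrightarrow> \<forall>a\<in>set b. 0 < a"
  by (auto simp: nodes_def)

text \<open>Everything but the mode is restored, so all leaves are evaluated in the same
  space.\<close>

lemma runs_leaf_prog:
  assumes cl: "clean d" and w: "rW d = rev w" "set w \<subseteq> {1..9}" and m: "rMODE d = [m]"
    and xs: "rPX d = xs" "length xs = length w + L * Suc (length w)" "set xs \<subseteq> {1..nsym}" and b: "bnd h d" "h < H"
  shows "runs (bounded H) leaf_prog (reg d) (reg (d\<lparr>rMODE := [if leaf w xs then 3 else 2]\<rparr>))"
proof -
  let ?n = "length w"
  define y where "y = take ?n xs"
  have y: "y \<in> nodes ?n" using xs set_take_subset[of ?n xs] by (auto simp: y_def nodes_def)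
  have dl: "length (drop ?n xs) = L * Suc ?n" "set (drop ?n xs) \<subseteq> {1..nsym}" using xs set_drop_subset[of ?n xs] by auto
  obtain bs where bs: "drop ?n xs = flat bs" "\<forall>(s, b)\<in>set bs. 0 < s \<and> b \<in> nodes ?n" using flat_exhaust[OF dl] by blast
  have bn: "\<forall>(s, b)\<in>set bs. b \<in> nodes ?n" using bs(2) by blast
  have bl: "\<forall>(s, b)\<in>set bs. length b = ?n" using bn by (auto simp: nodes_def)
  have bp: "\<forall>(s, b)\<in>set bs. 0 < s \<and> (\<forall>a\<in>set b. 0 < a) \<and> length b = length (rev w)"
    using bs(2) nodes_pos bl by fastforce
  let ?u = "fst (cur ?n bs)" and ?v = "snd (cur ?n bs)"
  have u: "?u \<in> nodes ?n" "?v \<in> nodes ?n" using cur_nodes[OF bn] by auto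
  have ul: "length ?u = ?n" "length ?v = ?n" "length y = ?n" using u y by (auto simp: nodes_def)
  have lf: "leaf w xs \<longleftrightarrow> leaf_ok w ?u ?v (rev y)"
    using leaf_flat[OF ul(3) bl] bs(1) append_take_drop_id[of ?n xs] by (simp add: y_def)
  have pw: "\<forall>a\<in>set (rev w). 0 < a" using w(2) by auto
  have px: "\<forall>a\<in>set xs. 0 < a" using xs(3) by auto
  have bH: "bnd H d" using b by (auto simp: bnd_def)
  have h1: "1 \<le> h" "?n \<le> h" "1 \<le> H" using b m w(1) by (auto simp: bnd_def)
  have c: "rW2 d = []" "rX d = []" "rA d = []" "rY d = []" "rY2 d = []" "rU d = []" "rV d = []" "rD d = []" "rCU d = []"
     "rCV d = []" "rDU d = []" "rDV d = []" "rPAR d = []" "rEQ d = []" "rVB d = []" "rFL d = []" "rERR d = []" "rLV d = []"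
    using cl by (simp_all add: clean_def)
  let ?d1 = "d\<lparr>rX := xs\<rparr>"
  have 1: "runs (bounded H) dup_prog (reg d) (reg ?d1)" using c xs(1) px bH by (intro runs_dup_prog) simp_all
  have b1: "bnd H ?d1" using runs_post[OF 1] by (simp add: bounded_reg)
  let ?d2 = "d\<lparr>rY := rev y, rX := flat bs\<rparr>"
  have 2: "runs (bounded H) y_prog (reg ?d1) (reg ?d2)"
  proof -
    have "runs (bounded H) y_prog (reg ?d1) (reg (?d1\<lparr>rY := rev (take (length (rev w)) xs), rX := drop (length (rev w)) xs\<rparr>))"
      using c w xs px pw b1 by (intro runs_y_prog) simp_all
    moreover have "?d1\<lparr>rY := rev (take (length (rev w)) xs), rX := drop (length (rev w)) xs\<rparr> = ?d2"
      using bs(1) by (cases d) (simp add: y_def)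
    ultimately show ?thesis by simp
  qed
  have b2: "bnd H ?d2" using runs_post[OF 2] by (simp add: bounded_reg)
  obtain U V where UV: "foldl sel ([], []) bs = (U, V)" by (cases "foldl sel ([], []) bs")
  let ?d3 = "d\<lparr>rY := rev y, rU := U, rV := V\<rparr>"
  have 3: "runs (bounded H) sel_prog (reg ?d2) (reg ?d3)"
  proof -
    have "runs (bounded H) sel_prog (reg ?d2) (reg (?d2\<lparr>rU := fst (foldl sel (rU ?d2, rV ?d2) bs), rV := snd (foldl sel (rU ?d2, rV ?d2) bs), rX := []\<rparr>))"
      by (rule runs_sel_prog[where rw = "rev w"]) (use c w pw bp b2 h1 in simp_all)
    moreover have "?d2\<lparr>rU := fst (foldl sel (rU ?d2, rV ?d2) bs), rV := snd (foldl sel (rU ?d2, rV ?d2) bs), rX := []\<rparr> = ?d3"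
      using c UV by (cases d) simp
    ultimately show ?thesis by simp
  qed
  have b3: "bnd H ?d3" using runs_post[OF 3] by (simp add: bounded_reg)
  have UVc: "(if U = [] then replicate ?n START else U) = ?u" "(if V = [] then replicate ?n DONE else V) = ?v"
    using foldl_sel_cur[OF bn UV, unfolded fst_conv snd_conv] by simp_all
  have pU: "\<forall>a\<in>set U. 0 < a" "\<forall>a\<in>set V. 0 < a"
    using UVc nodes_pos[OF u(1)] nodes_pos[OF u(2)] by (cases "U = []"; cases "V = []"; simp)+
  let ?d4 = "d\<lparr>rY := rev y, rU := ?u, rV := V\<rparr>"
  have 4: "runs (bounded H) (fill 12 START) (reg ?d3) (reg ?d4)"
  proof -
    have "runs (bounded H) (fill 12 START) (reg ?d3) (reg (?d3\<lparr>rU := if rU ?d3 = [] then replicate (length (rev w)) START else rU ?d3\<rparr>))"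
      by (rule runs_fill_U) (use c w pw pU b3 in simp_all)
    moreover have "?d3\<lparr>rU := if rU ?d3 = [] then replicate (length (rev w)) START else rU ?d3\<rparr> = ?d4"
      unfolding UVc(1)[symmetric] by (cases d) simp
    ultimately show ?thesis by simp
  qed
  have b4: "bnd H ?d4" using runs_post[OF 4] by (simp add: bounded_reg)
  let ?d5 = "d\<lparr>rY := rev y, rU := ?u, rV := ?v\<rparr>"
  have 5: "runs (bounded H) (fill 13 DONE) (reg ?d4) (reg ?d5)"
  proof -
    have "runs (bounded H) (fill 13 DONE) (reg ?d4) (reg (?d4\<lparr>rV := if rV ?d4 = [] then replicate (length (rev w)) DONE else rV ?d4\<rparr>))"
      by (rule runs_fill_V) (use c w pw pU b4 in simp_all)
    moreover have "?d4\<lparr>rV := if rV ?d4 = [] then replicate (length (rev w)) DONE else rV ?d4\<rparr> = ?d5"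
      unfolding UVc(2)[symmetric] by (cases d) simp
    ultimately show ?thesis by simp
  qed
  have b5: "bnd H ?d5" using runs_post[OF 5] by (simp add: bounded_reg)
  define e where "e = d\<lparr>rY := rev y, rU := ?u, rV := ?v, rPAR := [1], rEQ := [1], rVB := [1], rFL := [Suc nsym], rERR := [1]\<rparr>"
  have be: "bnd h e" using b(1) h1 ul by (simp add: e_def bnd_def)
  have beH: "bnd H e" using b5 h1 by (simp add: e_def bnd_def)
  have 6: "runs (bounded H) (Do (\<lambda>_. [Push 19 1, Push 20 1, Push 21 1, Push 22 (Suc nsym), Push 23 1])) (reg ?d5) (reg e)"
    by (rule runs_Do_reg[OF b5 beH]) (use c in \<open>simp add: e_def\<close>)
  let ?zs = "zip (rev w) (zip ?u ?v)"
  let ?f = "fold stp ?zs e"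
  have re: "ready e" using c by (simp add: e_def ready_def)
  have 7: "runs (bounded H) scan_prog (reg e) (reg (?f\<lparr>rU := [], rV := []\<rparr>))"
    by (rule runs_scan_prog[OF re]) (use c w pw ul u b be h1 nodes_pos in \<open>simp_all add: e_def\<close>)
  let ?g = "?f\<lparr>rU := [], rV := []\<rparr>"
  have zp: "\<forall>(a, u, v)\<in>set ?zs. 0 < u \<and> 0 < v"
  proof clarify
    fix a p q assume "(a, p, q) \<in> set ?zs"
    then have "(p, q) \<in> set (zip ?u ?v)" by (rule set_zip_rightD)
    then have "p \<in> set ?u" "q \<in> set ?v" by (rule set_zip_leftD, rule set_zip_rightD)
    then show "0 < p \<and> 0 < q" using nodes_pos[OF u(1)] nodes_pos[OF u(2)] by blast
  qed
  have fi: "ready ?f" "set (rY ?f) \<union> set (rY2 ?f) \<subseteq> set (rev y)"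
    using fold_stp_inv[OF re zp] c by (auto simp: e_def)
  have acc: "accepting ?g \<longleftrightarrow> leaf w xs"
  proof -
    have "accepting ?g \<longleftrightarrow> accepting ?f" by (simp add: accepting_def)
    also have "\<dots> \<longleftrightarrow> leaf_ok w ?u ?v (rY e)"
      by (rule scan_accepting) (use w c ul u in \<open>simp_all add: e_def nodes_def\<close>)
    finally show ?thesis using lf by (simp add: e_def)
  qed
  have "runs (bounded H) finish_prog (reg ?g) (reg (?g\<lparr>rMODE := [if accepting ?g then 3 else 2], rPAR := [], rEQ := [], rVB := [],
    rFL := [], rERR := [], rCU := [], rCV := [], rY := [], rY2 := []\<rparr>))"
  proof (rule runs_finish_prog)
    show "ready ?g" using fi(1) by (simp add: ready_def)
    show "\<forall>a\<in>set (rY ?g). 0 < a" using fi(2) nodes_pos[OF y] by auto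
    show "rMODE ?g = [m]" using m by (simp add: fold_stp_same e_def)
    show "bnd H ?g" using runs_post[OF 7] by (simp add: bounded_reg)
  qed
  moreover have "?g\<lparr>rMODE := [if accepting ?g then 3 else 2], rPAR := [], rEQ := [], rVB := [],
    rFL := [], rERR := [], rCU := [], rCV := [], rY := [], rY2 := []\<rparr> = d\<lparr>rMODE := [if leaf w xs then 3 else 2]\<rparr>"
    unfolding acc by (rule dst.equality) (use c fi(1) in \<open>simp_all add: fold_stp_same e_def ready_def\<close>)
  ultimately have 8: "runs (bounded H) finish_prog (reg ?g) (reg (d\<lparr>rMODE := [if leaf w xs then 3 else 2]\<rparr>))" by simp
  show ?thesis unfolding leaf_prog_def
    by (rule runs_Seq[OF 1 runs_Seq[OF 2 runs_Seq[OF 3 runs_Seq[OF 4 runs_Seq[OF 5 runs_Seq[OF 6 runs_Seq[OF 7 8]]]]]]])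
qed

section \<open>The odometer over quantifier prefixes\<close>

definition advance :: "(nat \<Rightarrow> nat) \<Rightarrow> act list" where
  "advance t = (let new = (if t 3 = 1 then t 5 = 2 \<or> t 7 = 3 else t 5 = 2 \<and> t 7 = 3) in
     if t 4 < nsym then [Repl 4 (Suc (t 4)), Repl 5 (if new then 2 else 1), Repl 7 1]
     else [Pop 3, Pop 4, Pop 5] @ copy_act 6 (t 3) @ [Repl 7 (if new then 3 else 2)])"

text \<open>Mode 1 descends: the next quantifier is opened with value 1 and a neutral accumulator, 1
  (false) for an existential and 2 (true) for a universal one; when none is left, the leaf is
  evaluated. Modes 2 and 3 carry the value false or true upwards: \<open>advance\<close> merges it
  into the innermost accumulator and either tries the next symbol or closes the quantifier and
  passes the result on. Only one assignment and one accumulator per quantifier are stored.\<close>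

definition odo_body :: com where
  "odo_body = IF (\<lambda>t. t 7 = 1)
     (IF (\<lambda>t. t 6 \<noteq> 0) (Do (\<lambda>t. [Pop 6] @ copy_act 3 (t 6) @ [Push 4 1, Push 5 (if t 6 = 1 then 1 else 2)])) leaf_prog)
     (Do advance)"

locale odometer =
  fixes d :: dst and w :: "nat list" and L h H :: nat
  assumes clean: "clean d" and w: "rW d = rev w" "set w \<subseteq> {1..9}"
    and h: "length w + L * Suc (length w) \<le> h" "0 < h" "h < H"
begin

definition N :: nat where "N = length w + L * Suc (length w)"

definition conf :: "nat \<Rightarrow> nat list \<Rightarrow> nat list \<Rightarrow> nat list \<Rightarrow> nat list \<Rightarrow> dst" where
  "conf m qs pq px pa = d\<lparr>rPQ := pq, rPX := px, rPA := pa, rREST := qs, rMODE := [m]\<rparr>"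

definition fits :: "nat list \<Rightarrow> nat list \<Rightarrow> nat list \<Rightarrow> nat list \<Rightarrow> bool" where
  "fits qs pq px pa \<longleftrightarrow> length qs + length px = N \<and> length pq = length px \<and> length pa = length px"

lemma bnd_conf: "fits qs pq px pa \<Longrightarrow> bnd h (conf m qs pq px pa)"
  using clean w h by (auto simp: clean_def conf_def bnd_def fits_def N_def)

lemma bnd_conf': "fits qs pq px pa \<Longrightarrow> bnd H (conf m qs pq px pa)"
  using bnd_conf[of qs pq px pa m] h(3) by (auto simp: bnd_def)

definition odo_step :: "regs \<Rightarrow> regs \<Rightarrow> bool" where
  "odo_step s s' \<longleftrightarrow> (tops s 7 = 1 \<or> tops s 4 \<noteq> 0) \<and> runs (bounded H) odo_body s s'"

lemma conf_read [simp]: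
  "rPQ (conf m qs pq px pa) = pq" "rPX (conf m qs pq px pa) = px" "rPA (conf m qs pq px pa) = pa"
  "rREST (conf m qs pq px pa) = qs" "rMODE (conf m qs pq px pa) = [m]"
  by (simp_all add: conf_def)

lemma step_down:
  assumes "q \<in> {1, 2}" "fits (q # qs) pq px pa"
  shows "odo_step (reg (conf 1 (q # qs) pq px pa)) (reg (conf 1 qs (q # pq) (1 # px) ((if q = 1 then 1 else 2) # pa)))"
proof -
  let ?c = "conf 1 (q # qs) pq px pa" and ?c' = "conf 1 qs (q # pq) (1 # px) ((if q = 1 then 1 else 2) # pa)"
  have f: "fits qs (q # pq) (1 # px) ((if q = 1 then 1 else 2) # pa)" using assms(2) by (simp add: fits_def)
  have "runs (bounded H) (Do (\<lambda>t. [Pop 6] @ copy_act 3 (t 6) @ [Push 4 1, Push 5 (if t 6 = 1 then 1 else 2)])) (reg ?c) (reg ?c')"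
    by (rule runs_Do_reg[OF bnd_conf'[OF assms(2)] bnd_conf'[OF f]])
      (use assms(1) in \<open>unfold conf_def, (cases d; auto simp: copy_act_def)\<close>)
  then show ?thesis using assms(1) unfolding odo_step_def odo_body_def by (auto intro!: runs_IF)
qed

lemma step_leaf:
  assumes "fits [] pq px pa" "set px \<subseteq> {1..nsym}"
  shows "odo_step (reg (conf 1 [] pq px pa)) (reg (conf (if leaf w px then 3 else 2) [] pq px pa))"
proof -
  let ?c = "conf 1 [] pq px pa"
  have "runs (bounded H) leaf_prog (reg ?c) (reg (?c\<lparr>rMODE := [if leaf w px then 3 else 2]\<rparr>))"
  proof (rule runs_leaf_prog)
    show "clean ?c" "rW ?c = rev w" using clean w by (simp_all add: clean_def conf_def)
    show "length px = length w + L * Suc (length w)" using assms(1) by (simp add: fits_def N_def)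
  qed (use w assms h bnd_conf in simp_all)
  moreover have "?c\<lparr>rMODE := [if leaf w px then 3 else 2]\<rparr> = conf (if leaf w px then 3 else 2) [] pq px pa"
    by (simp add: conf_def)
  ultimately show ?thesis unfolding odo_step_def odo_body_def by (auto intro!: runs_IF)
qed

definition merge :: "nat \<Rightarrow> nat \<Rightarrow> bool \<Rightarrow> bool" where
  "merge q a v \<longleftrightarrow> (if q = 1 then a = 2 \<or> v else a = 2 \<and> v)"

lemma step_next:
  assumes "fits qs (q # pq) (x # px) (a # pa)" "0 < x" "x < nsym"
  shows "odo_step (reg (conf (if v then 3 else 2) qs (q # pq) (x # px) (a # pa)))
    (reg (conf 1 qs (q # pq) (Suc x # px) ((if merge q a v then 2 else 1) # pa)))"
proof -
  let ?c = "conf (if v then 3 else 2) qs (q # pq) (x # px) (a # pa)"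
  have f: "fits qs (q # pq) (Suc x # px) ((if merge q a v then 2 else 1) # pa)" using assms(1) by (simp add: fits_def)
  have "runs (bounded H) (Do advance) (reg ?c) (reg (conf 1 qs (q # pq) (Suc x # px) ((if merge q a v then 2 else 1) # pa)))"
    by (rule runs_Do_reg[OF bnd_conf'[OF assms(1)] bnd_conf'[OF f]])
      (use assms(3) in \<open>unfold conf_def, (cases d; auto simp: advance_def merge_def Let_def)\<close>)
  then show ?thesis using assms(2) unfolding odo_step_def odo_body_def by (auto intro!: runs_IF)
qed

lemma step_up:
  assumes "fits qs (q # pq) (nsym # px) (a # pa)" "q \<in> {1, 2}"
  shows "odo_step (reg (conf (if v then 3 else 2) qs (q # pq) (nsym # px) (a # pa)))
    (reg (conf (if merge q a v then 3 else 2) (q # qs) pq px pa))"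
proof -
  let ?c = "conf (if v then 3 else 2) qs (q # pq) (nsym # px) (a # pa)"
  have f: "fits (q # qs) pq px pa" using assms(1) by (simp add: fits_def)
  have q0: "q \<noteq> 0" using assms(2) by auto
  have "runs (bounded H) (Do advance) (reg ?c) (reg (conf (if merge q a v then 3 else 2) (q # qs) pq px pa))"
    by (rule runs_Do_reg[OF bnd_conf'[OF assms(1)] bnd_conf'[OF f]])
      (use q0 in \<open>unfold conf_def, (cases d; auto simp: advance_def merge_def Let_def copy_act_def)\<close>)
  then show ?thesis using nsym_ge unfolding odo_step_def odo_body_def by (auto intro!: runs_IF)
qed

lemma odometer_evaluates:
  "fits qs pq px pa \<Longrightarrow> set px \<subseteq> {1..nsym} \<Longrightarrow> set qs \<subseteq> {1, 2} \<Longrightarrow>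
   odo_step\<^sup>*\<^sup>* (reg (conf 1 qs pq px pa)) (reg (conf (if qev (leaf w) qs px then 3 else 2) qs pq px pa))"
proof (induction qs arbitrary: pq px pa)
  case Nil
  then show ?case using step_leaf[of pq px pa] by (simp add: r_into_rtranclp)
next
  case (Cons q qs)
  have q: "q \<in> {1, 2}" "set qs \<subseteq> {1, 2}" using Cons.prems(3) by auto
  define Q where "Q x = qev (leaf w) qs (x # px)" for x
  \<comment> \<open>The final value of the quantifier when the symbols from \<open>x\<close> on are
    still to be tried and \<open>a\<close> is the accumulator. The inner induction runs over the
    number of remaining symbols, the outer one over the remaining quantifiers.\<close>
  define R where "R x a \<longleftrightarrow> (if q = 1 then a = 2 \<or> (\<exists>y\<in>{x..nsym}. Q y) else a = 2 \<and> (\<forall>y\<in>{x..nsym}. Q y))" for x and a :: nat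
  have sweep: "odo_step\<^sup>*\<^sup>* (reg (conf 1 qs (q # pq) (x # px) (a # pa))) (reg (conf (if R x a then 3 else 2) (q # qs) pq px pa))"
    if "nsym - x = j" "0 < x" "x \<le> nsym" for j x a
    using that
  proof (induction j arbitrary: x a)
    case 0
    then have x: "x = nsym" by simp
    have f: "fits qs (q # pq) (nsym # px) (a # pa)" using Cons.prems(1) by (simp add: fits_def)
    have R: "R x a \<longleftrightarrow> merge q a (Q x)" using x by (auto simp: R_def merge_def)
    have A: "odo_step\<^sup>*\<^sup>* (reg (conf 1 qs (q # pq) (x # px) (a # pa))) (reg (conf (if Q x then 3 else 2) qs (q # pq) (x # px) (a # pa)))"
      unfolding Q_def by (rule Cons.IH) (use f q Cons.prems(2) 0 x in auto)
    have B: "odo_step (reg (conf (if Q x then 3 else 2) qs (q # pq) (x # px) (a # pa))) (reg (conf (if R x a then 3 else 2) (q # qs) pq px pa))"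
      unfolding R unfolding x by (rule step_up[OF f q(1)])
    show ?case by (rule rtranclp_trans[OF A r_into_rtranclp[where r = odo_step, OF B]])
  next
    case (Suc j)
    then have x: "x < nsym" by simp
    have f: "fits qs (q # pq) (x # px) (a # pa)" using Cons.prems(1) by (simp add: fits_def)
    let ?a = "if merge q a (Q x) then 2 else 1 :: nat"
    have "{x..nsym} = insert x {Suc x..nsym}" using x by auto
    then have R: "R x a \<longleftrightarrow> R (Suc x) ?a" by (auto simp: R_def merge_def)
    have A: "odo_step\<^sup>*\<^sup>* (reg (conf 1 qs (q # pq) (x # px) (a # pa))) (reg (conf (if Q x then 3 else 2) qs (q # pq) (x # px) (a # pa)))"
      unfolding Q_def by (rule Cons.IH) (use f q Cons.prems(2) Suc.prems in auto)
    have B: "odo_step (reg (conf (if Q x then 3 else 2) qs (q # pq) (x # px) (a # pa))) (reg (conf 1 qs (q # pq) (Suc x # px) (?a # pa)))"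
      by (rule step_next[OF f Suc.prems(2) x])
    have C: "odo_step\<^sup>*\<^sup>* (reg (conf 1 qs (q # pq) (Suc x # px) (?a # pa))) (reg (conf (if R x a then 3 else 2) (q # qs) pq px pa))"
      unfolding R by (rule Suc.IH) (use Suc.prems x in auto)
    show ?case by (rule rtranclp_trans[OF A converse_rtranclp_into_rtranclp[where r = odo_step, OF B C]])
  qed
  have R1: "R 1 (if q = 1 then 1 else 2) \<longleftrightarrow> qev (leaf w) (q # qs) px" by (auto simp: R_def Q_def)
  have A: "odo_step\<^sup>*\<^sup>* (reg (conf 1 qs (q # pq) (1 # px) ((if q = 1 then 1 else 2) # pa))) (reg (conf (if R 1 (if q = 1 then 1 else 2) then 3 else 2) (q # qs) pq px pa))"
    by (rule sweep[OF refl]) (use nsym_ge in simp_all)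
  show ?case using converse_rtranclp_into_rtranclp[where r = odo_step, OF step_down[OF q(1) Cons.prems(1)] A] unfolding R1 .
qed

text \<open>The guard fails exactly when a truth value has been obtained and no quantifier is open,
  that is, when the value of the whole prefix is known.\<close>

lemma runs_odometer:
  assumes "length qs = N" "set qs \<subseteq> {1, 2}"
  shows "runs (bounded H) (WHILE (\<lambda>t. t 7 = 1 \<or> t 4 \<noteq> 0) odo_body) (reg (conf 1 qs [] [] []))
    (reg (conf (if qev (leaf w) qs [] then 3 else 2) qs [] [] []))"
proof (rule runs_WHILE_star)
  have f: "fits qs [] [] []" using assms by (simp add: fits_def)
  have "odo_step\<^sup>*\<^sup>* (reg (conf 1 qs [] [] [])) (reg (conf (if qev (leaf w) qs [] then 3 else 2) qs [] [] []))"
    by (rule odometer_evaluates) (use f assms in simp_all)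
  then show "(\<lambda>s s'. (tops s 7 = 1 \<or> tops s 4 \<noteq> 0) \<and> runs (bounded H) odo_body s s')\<^sup>*\<^sup>* (reg (conf 1 qs [] [] []))
     (reg (conf (if qev (leaf w) qs [] then 3 else 2) qs [] [] []))"
    unfolding odo_step_def[abs_def] .
  show "bounded H (reg (conf (if qev (leaf w) qs [] then 3 else 2) qs [] [] []))" using bnd_conf'[OF f] by (simp add: bounded_reg)
qed simp

end

text \<open>The levels, \<open>2 * nbit\<close> for each input symbol, are counted on stack 24. The
  prefix is built from its end, the universal block for names first, since its first quantifier must
  come to lie on top.\<close>

definition setup_prog :: com where
  "setup_prog = Seq (for_word (\<lambda>_. replicate (2 * nbit) (Push 24 1))) (Seq (for_word (\<lambda>_. [Push 6 2]))
    (Seq (WHILE (\<lambda>t. t 24 \<noteq> 0) (Seq (Do (\<lambda>_. [Pop 24, Push 6 2])) (for_word (\<lambda>_. [Push 6 1]))))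
      (Do (\<lambda>_. [Push 7 1]))))"

definition sat_prog :: com where
  "sat_prog = Seq setup_prog (WHILE (\<lambda>t. t 7 = 1 \<or> t 4 \<noteq> 0) odo_body)"

definition start :: "nat list \<Rightarrow> dst" where
  "start w = \<lparr>rW = rev w, rW2 = [], rPQ = [], rPX = [], rPA = [], rREST = [], rMODE = [], rX = [], rA = [], rY = [], rY2 = [],
     rU = [], rV = [], rD = [], rCU = [], rCV = [], rDU = [], rDV = [], rPAR = [], rEQ = [], rVB = [], rFL = [], rERR = [], rLV = []\<rparr>"

lemma init_regs_start: "init_regs w = reg (start w)"
  by (rule ext) (simp add: init_regs_def reg_def start_def)

lemma do_acts_push_levels: "do_acts (replicate k (Push 24 1)) (reg d) = reg (d\<lparr>rLV := replicate k 1 @ rLV d\<rparr>)"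
  by (induction k arbitrary: d) (simp_all add: replicate_app_Cons_same)

lemma length_pattern: "length (pattern n L) = n + L * Suc n"
  by (induction L) (simp_all add: pattern_def)

lemma pattern_Suc: "pattern n (Suc L) = replicate n 1 @ 2 # pattern n L"
  by (simp add: pattern_def)

lemma set_pattern: "set (pattern n L) \<subseteq> {1, 2}"
  by (induction L) (auto simp: pattern_Suc pattern_def)

lemma runs_setup_prog:
  assumes w: "set w \<subseteq> {1..9}" and L: "L = 2 * nbit * length w" and H: "length w + L * Suc (length w) < H"
  shows "runs (bounded H) setup_prog (reg (start w)) (reg ((start w)\<lparr>rREST := pattern (length w) L, rMODE := [1]\<rparr>))"
proof -
  let ?n = "length w"
  have pw: "\<forall>a\<in>set (rev w). 0 < a" using w by auto
  have LH: "L \<le> H" "?n \<le> H" "1 \<le> H" using H by auto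
  let ?d1 = "(start w)\<lparr>rLV := replicate L 1\<rparr>"
  have 1: "runs (bounded H) (for_word (\<lambda>_. replicate (2 * nbit) (Push 24 1))) (reg (start w)) (reg ?d1)"
  proof (rule runs_for_word[where W = "rev w" and h = "\<lambda>i. (start w)\<lparr>rLV := replicate (2 * nbit * i) 1\<rparr>"])
    fix i
    show "rW ((start w)\<lparr>rLV := replicate (2 * nbit * i) 1\<rparr>) = rev w \<and> rW2 ((start w)\<lparr>rLV := replicate (2 * nbit * i) 1\<rparr>) = [] \<and>
      bnd H ((start w)\<lparr>rLV := replicate (2 * nbit * i) 1\<rparr>)" if "i \<le> length (rev w)"
    proof -
      have "2 * nbit * i \<le> L" unfolding L using that by simp
      then have "2 * nbit * i \<le> H" using LH by simp
      then show ?thesis using LH by (simp add: start_def bnd_def)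
    qed
    show "do_acts (replicate (2 * nbit) (Push 24 1)) (reg ((start w)\<lparr>rLV := replicate (2 * nbit * i) 1, rW := X, rW2 := Z\<rparr>))
       = reg ((start w)\<lparr>rLV := replicate (2 * nbit * Suc i) 1, rW := X, rW2 := Z\<rparr>)" for X Z
      unfolding do_acts_push_levels by (simp add: start_def replicate_add[symmetric])
  qed (use pw L in \<open>simp_all add: start_def\<close>)
  let ?f = "\<lambda>i. (start w)\<lparr>rREST := pattern ?n i, rLV := replicate (L - i) 1\<rparr>"
  have pl: "length (pattern ?n i) \<le> H" if "i \<le> L" for i
  proof -
    have "i * Suc ?n \<le> L * Suc ?n" using that by (intro mult_le_mono1)
    then show ?thesis using H unfolding length_pattern by simp
  qed
  have bf: "bnd H (?f i)" if "i \<le> L" for i using LH pl[OF that] by (simp add: start_def bnd_def)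
  have 2: "runs (bounded H) (for_word (\<lambda>_. [Push 6 2])) (reg ?d1) (reg (?f 0))"
  proof (rule runs_for_word[where W = "rev w" and h = "\<lambda>i. (start w)\<lparr>rREST := replicate i 2, rLV := replicate L 1\<rparr>"])
    fix i assume "i \<le> length (rev w)"
    then show "rW ((start w)\<lparr>rREST := replicate i 2, rLV := replicate L 1\<rparr>) = rev w \<and>
       rW2 ((start w)\<lparr>rREST := replicate i 2, rLV := replicate L 1\<rparr>) = [] \<and> bnd H ((start w)\<lparr>rREST := replicate i 2, rLV := replicate L 1\<rparr>)"
      using LH by (simp add: start_def bnd_def)
  qed (use pw in \<open>simp_all add: start_def pattern_def\<close>)
  have 3: "runs (bounded H) (WHILE (\<lambda>t. t 24 \<noteq> 0) (Seq (Do (\<lambda>_. [Pop 24, Push 6 2])) (for_word (\<lambda>_. [Push 6 1])))) (reg (?f 0)) (reg (?f L))"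
  proof (rule runs_WHILE_iter[where n = L and f = "\<lambda>i. reg (?f i)"])
    fix i assume i: "i < L"
    have r: "replicate (L - i) (1::nat) = 1 # replicate (L - Suc i) 1" using i by (simp add: Suc_diff_Suc replicate_Suc[symmetric] del: replicate_Suc)
    let ?k = "\<lambda>j. (start w)\<lparr>rREST := replicate j 1 @ 2 # pattern ?n i, rLV := replicate (L - Suc i) 1\<rparr>"
    have bk: "bnd H (?k j)" if "j \<le> ?n" for j
      using pl[of "Suc i"] i that LH by (simp add: pattern_Suc start_def bnd_def)
    have a: "runs (bounded H) (Do (\<lambda>_. [Pop 24, Push 6 2])) (reg (?f i)) (reg (?k 0))"
      by (rule runs_Do_reg) (use bf[of i] bk[of 0] i r in \<open>simp_all add: start_def\<close>)
    have b: "runs (bounded H) (for_word (\<lambda>_. [Push 6 1])) (reg (?k 0)) (reg (?f (Suc i)))"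
      by (rule runs_for_word[where W = "rev w" and h = ?k]) (use bk pw in \<open>simp_all add: start_def pattern_Suc\<close>)
    show "tops (reg (?f i)) 24 \<noteq> 0 \<and> runs (bounded H) (Seq (Do (\<lambda>_. [Pop 24, Push 6 2])) (for_word (\<lambda>_. [Push 6 1]))) (reg (?f i)) (reg (?f (Suc i)))"
      using runs_Seq[OF a b] r by simp
  qed (use bf[of L] in \<open>simp_all add: bounded_reg\<close>)
  have 4: "runs (bounded H) (Do (\<lambda>_. [Push 7 1])) (reg (?f L)) (reg ((start w)\<lparr>rREST := pattern ?n L, rMODE := [1]\<rparr>))"
    by (rule runs_Do_reg) (use bf[of L] LH in \<open>simp_all add: start_def bnd_def\<close>)
  show ?thesis unfolding setup_prog_def by (rule runs_Seq[OF 1 runs_Seq[OF 2 runs_Seq[OF 3 4]]])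
qed

lemma runs_sat_prog:
  assumes word: "set w \<subseteq> {1..9}" and H: "H = length w + 2 * nbit * length w * Suc (length w) + 2"
  shows "\<exists>s'. runs (bounded H) sat_prog (init_regs w) s' \<and> (tops s' 7 = 3 \<longleftrightarrow> w \<in> SAT_lang)"
proof -
  let ?L = "2 * nbit * length w"
  interpret odometer "start w" w ?L "H - 1" H
    by unfold_locales (use word H in \<open>simp_all add: start_def clean_def\<close>)
  let ?q = "pattern (length w) ?L"
  have c: "conf 1 ?q [] [] [] = (start w)\<lparr>rREST := ?q, rMODE := [1]\<rparr>" unfolding conf_def by (simp add: start_def)
  have 1: "runs (bounded H) setup_prog (reg (start w)) (reg (conf 1 ?q [] [] []))"
    unfolding c by (rule runs_setup_prog[OF word refl]) (use H in simp)
  have 2: "runs (bounded H) (WHILE (\<lambda>t. t 7 = 1 \<or> t 4 \<noteq> 0) odo_body) (reg (conf 1 ?q [] [] []))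
    (reg (conf (if qev (leaf w) ?q [] then 3 else 2) ?q [] [] []))"
    by (rule runs_odometer) (use set_pattern in \<open>simp_all add: length_pattern N_def\<close>)
  show ?thesis unfolding sat_prog_def init_regs_start
    by (rule exI, rule conjI, rule runs_Seq[OF 1 2]) (use qev_SAT[OF word] in simp)
qed

lemma wf_sat_prog: "wf_com 25 (nsym + 10) sat_prog"
proof -
  let ?B = "nsym + 10"
  have m: "f r < ?B" if "f \<in> mems 25 ?B" "r < 25" for f r using that by (simp add: mems_def)
  have cp: "ok_act 25 ?B a" if "a \<in> set (copy_act r (f r'))" "f \<in> mems 25 ?B" "r < 25" "r' < 25" for a r f r'
    using that m[of f r'] by (auto simp: copy_act_def split: if_splits)
  have rp: "ok_act 25 ?B a" if "a \<in> set (rep_act r (f r'))" "f \<in> mems 25 ?B" "r < 25" "r' < 25" for a r f r'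
    using that m[of f r'] by (auto simp: rep_act_def split: if_splits)
  have mv: "wf_com 25 ?B (move_reg r r')" if "r < 25" "r' < 25" for r r'
    using that cp by (auto simp: move_reg_def)
  have fw: "wf_com 25 ?B (for_word F)" if "\<forall>m\<in>mems 25 ?B. \<forall>a\<in>set (F m). ok_act 25 ?B a" for F
    using that cp[of _ 2 _ 0] mv by (auto simp: for_word_def)
  have clr: "wf_com 25 ?B (clear r)" if "r < 25" for r using that by (simp add: clear_def)
  have sc: "\<forall>f\<in>mems 25 ?B. \<forall>a\<in>set (scan_acts f). ok_act 25 ?B a"
    using cp rp nsym_ge by (auto simp: scan_acts_def tbit_def split: if_splits)
  have scan: "wf_com 25 ?B scan_prog"
    using sc mv cp by (auto simp: scan_prog_def scan_body_def)
  have dup: "wf_com 25 ?B dup_prog" using mv cp by (auto simp: dup_prog_def)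
  have y: "wf_com 25 ?B y_prog" unfolding y_prog_def by (rule fw) (use cp in auto)
  have blk: "wf_com 25 ?B sel_prog" unfolding sel_prog_def block_prog_def
    using cp by (auto intro!: fw split: if_splits)
  have fl: "wf_com 25 ?B (fill 12 START)" "wf_com 25 ?B (fill 13 DONE)"
    using cod(1)[of "{fST}"] cod(1)[of "{fDN}"] by (auto simp: fill_def START_def DONE_def intro!: fw)
  have fin: "wf_com 25 ?B finish_prog" using clr by (auto simp: finish_prog_def verdict_def split: if_splits)
  have lf: "wf_com 25 ?B leaf_prog" using dup y blk fl scan fin by (simp add: leaf_prog_def)
  have adv: "\<forall>f\<in>mems 25 ?B. \<forall>a\<in>set (advance f). ok_act 25 ?B a"
    using cp by (auto simp: advance_def Let_def split: if_splits)
  have odo: "wf_com 25 ?B odo_body" using lf adv cp by (auto simp: odo_body_def split: if_splits)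
  have "wf_com 25 ?B setup_prog" by (auto simp: setup_prog_def intro!: fw)
  then show ?thesis using odo by (simp add: sat_prog_def)
qed

lemma SAT_in_PSPACE: "PSPACE fml_alphabet SAT_lang"
proof (rule PSPACE_by_program[where ans = "\<lambda>t. t 7 = 3", OF wf_sat_prog])
  show "alphabet fml_alphabet" "fml_alphabet \<subseteq> {0<..<nsym + 10}" by (auto simp: alphabet_def fml_alphabet_def)
  show "SAT_lang \<subseteq> lists fml_alphabet" by (auto simp: SAT_lang_def fml_alphabet_def dest: subsetD[OF enc_alphabet])
  show "polyb (\<lambda>n. n + 2 * nbit * n * Suc n + 2)"
    unfolding Suc_eq_plus1 by (intro polyb_add polyb_mult polyb_const polyb_id)
  fix w assume "w \<in> lists fml_alphabet"
  then have "set w \<subseteq> {1..9}" by (auto simp: fml_alphabet_def)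
  then show "\<exists>s'. runs (bounded (length w + 2 * nbit * length w * Suc (length w) + 2)) sat_prog (init_regs w) s' \<and> (tops s' 7 = 3 \<longleftrightarrow> w \<in> SAT_lang)"
    by (rule runs_sat_prog) simp
qed simp_all

theorem mainTheorem17:
  shows "PSPACE_complete fml_alphabet SAT_lang"
  unfolding PSPACE_complete_def PSPACE_hard_def
proof (intro conjI allI impI)
  show "PSPACE fml_alphabet SAT_lang" by (rule SAT_in_PSPACE)
  fix S L assume P: "PSPACE S L"
  then obtain M k where M: "wf_tm M" "S \<subseteq> {..<tm_nsyms M}" "alphabet S" "decides_in_space M S L (\<lambda>n. k * (n + 1) ^ k)"
    unfolding PSPACE_def by blast
  then interpret space_machine M k S L by unfold_locales
  show "poly_reduces S L fml_alphabet SAT_lang" by (rule reduction)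
qed

end
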